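(* Let $G$ be a compact Lie group, let $\lambda\colon G\to O(1)=\{\pm1\}$ be a surjective (continuous) homomorphism, and let $H$ be the kernel of $\lambda$. If there exists an element of $G\setminus H$ commuting with all elements of $H$ (for example, if $G$ is abelian), then $\widetilde K_G(S^{1\oplus\lambda})$ is trivial, i.e. $\widetilde K_G(S^{1\oplus\lambda})=0$.
   Context: The homomorphism $\lambda$ is regarded as a one-dimensional real representation of $G$, and $1$ denotes the trivial one-dimensional real representation of $G$. $S^{1\oplus\lambda}$ is the one-point compactification of the real representation $1\oplus\lambda$ (a two-dimensional sphere with $G$-action), based at the point $*$ at infinity, which is fixed by $G$. For a compact $G$-space $X$, $K_G(X)$ is the Grothendieck group of complex $G$-vector bundles over $X$; if $X$ has a base point $*$ fixed by $G$, $\widetilde K_G(X)$ is the kernel of the restriction homomorphism $K_G(X)\to K_G( * )$. *)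

theory Defs
  imports "HOL-Analysis.Analysis" "HOL-Algebra.Elementary_Groups"
begin

section \<open>Smooth manifolds and Lie groups\<close>

text \<open>
  \<open>R^n\<close> is the library's \<open>Euclidean_space n\<close>: the sequences vanishing from index \<open>n\<close> on.
  This includes \<open>n = 0\<close>, so that finite groups are Lie groups.
  A function on an open subset of \<open>R^n\<close> is of class \<open>C^(k+1)\<close> iff it is continuous and all its
  partial derivatives exist and are of class \<open>C^k\<close>.
\<close>

fun Ck_on :: "nat \<Rightarrow> nat \<Rightarrow> (nat \<Rightarrow> real) set \<Rightarrow> ((nat \<Rightarrow> real) \<Rightarrow> real) \<Rightarrow> bool" where
  "Ck_on n 0 U f \<longleftrightarrow>
     continuous_map (subtopology (Euclidean_space n) U) euclideanreal f"
| "Ck_on n (Suc k) U f \<longleftrightarrow>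
     continuous_map (subtopology (Euclidean_space n) U) euclideanreal f \<and>
     (\<exists>D. \<forall>i<n. (\<forall>x\<in>U. ((\<lambda>t. f (x(i := t))) has_real_derivative D i x) (at (x i))) \<and>
                Ck_on n k U (D i))"

definition smooth_between ::
    "nat \<Rightarrow> nat \<Rightarrow> (nat \<Rightarrow> real) set \<Rightarrow> ((nat \<Rightarrow> real) \<Rightarrow> nat \<Rightarrow> real) \<Rightarrow> bool" where
  "smooth_between n m U F \<longleftrightarrow> (\<forall>j<m. \<forall>k. Ck_on n k U (\<lambda>x. F x j))"

type_synonym 'p chart = "'p set \<times> ('p \<Rightarrow> nat \<Rightarrow> real)"

definition smooth_manifold :: "'p topology \<Rightarrow> nat \<Rightarrow> 'p chart set \<Rightarrow> bool" where
  "smooth_manifold T n A \<longleftrightarrow>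
     Hausdorff_space T \<and> second_countable T \<and>
     (\<Union>(U, \<phi>)\<in>A. U) = topspace T \<and>
     (\<forall>(U, \<phi>)\<in>A. openin T U \<and> openin (Euclidean_space n) (\<phi> ` U) \<and>
        homeomorphic_map (subtopology T U) (subtopology (Euclidean_space n) (\<phi> ` U)) \<phi>) \<and>
     (\<forall>(U, \<phi>)\<in>A. \<forall>(V, \<psi>)\<in>A.
        smooth_between n n (\<phi> ` (U \<inter> V)) (\<lambda>x. \<psi> (inv_into U \<phi> x)))"

definition smooth_map ::
    "'p topology \<Rightarrow> nat \<Rightarrow> 'p chart set \<Rightarrow> 'q topology \<Rightarrow> nat \<Rightarrow> 'q chart set \<Rightarrow> ('p \<Rightarrow> 'q) \<Rightarrow> bool"
  where
  "smooth_map T n A T' m B f \<longleftrightarrow>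
     continuous_map T T' f \<and>
     (\<forall>(U, \<phi>)\<in>A. \<forall>(V, \<psi>)\<in>B.
        smooth_between n m (\<phi> ` {p \<in> U. f p \<in> V}) (\<lambda>x. \<psi> (f (inv_into U \<phi> x))))"

definition prod_atlas :: "nat \<Rightarrow> 'p chart set \<Rightarrow> 'q chart set \<Rightarrow> ('p \<times> 'q) chart set" where
  "prod_atlas n A B =
     {(U \<times> V, \<lambda>(p, q) i. if i < n then \<phi> p i else \<psi> q (i - n)) | U \<phi> V \<psi>.
        (U, \<phi>) \<in> A \<and> (V, \<psi>) \<in> B}"

definition lie_group ::
    "('g, 'r) monoid_scheme \<Rightarrow> 'g topology \<Rightarrow> nat \<Rightarrow> 'g chart set \<Rightarrow> bool" where
  "lie_group G T n A \<longleftrightarrow>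
     group G \<and> topspace T = carrier G \<and> smooth_manifold T n A \<and>
     smooth_map (prod_topology T T) (n + n) (prod_atlas n A A) T n A (\<lambda>(g, h). g \<otimes>\<^bsub>G\<^esub> h) \<and>
     smooth_map T n A T n A (\<lambda>g. inv\<^bsub>G\<^esub> g)"

section \<open>Equivariant complex vector bundles\<close>

definition G_space ::
    "('g, 'r) monoid_scheme \<Rightarrow> 'g topology \<Rightarrow> 'x topology \<Rightarrow> ('g \<Rightarrow> 'x \<Rightarrow> 'x) \<Rightarrow> bool" where
  "G_space G T X \<alpha> \<longleftrightarrow>
     continuous_map (prod_topology T X) X (\<lambda>(g, x). \<alpha> g x) \<and>
     (\<forall>x\<in>topspace X. \<alpha> \<one>\<^bsub>G\<^esub> x = x) \<and>
     (\<forall>g\<in>carrier G. \<forall>h\<in>carrier G. \<forall>x\<in>topspace X. \<alpha> (g \<otimes>\<^bsub>G\<^esub> h) x = \<alpha> g (\<alpha> h x))"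

text \<open>\<open>C^n\<close>, encoded in the same way as \<open>Euclidean_space n\<close>.\<close>

definition complex_space :: "nat \<Rightarrow> (nat \<Rightarrow> complex) topology" where
  "complex_space n =
     subtopology (product_topology (\<lambda>_. euclidean) UNIV) {v. \<forall>i\<ge>n. v i = 0}"

text \<open>Fibrewise addition is only meaningful on pairs of points in the same fibre.\<close>

record ('g, 'x, 'e) gbundle =
  total_space :: "'e topology"
  bundle_proj :: "'e \<Rightarrow> 'x"
  fibre_add :: "'e \<Rightarrow> 'e \<Rightarrow> 'e"
  fibre_scale :: "complex \<Rightarrow> 'e \<Rightarrow> 'e"
  bundle_act :: "'g \<Rightarrow> 'e \<Rightarrow> 'e"

definition part_over :: "('g, 'x, 'e) gbundle \<Rightarrow> 'x set \<Rightarrow> 'e set" where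
  "part_over E U = {e \<in> topspace (total_space E). bundle_proj E e \<in> U}"

text \<open>
  The local trivializations are fibrewise bijections with some \<open>C^n\<close> that preserve addition and
  scalar multiplication, so they force each fibre to be a finite-dimensional complex vector space.
  The rank may vary between connected components of the base.
\<close>

definition complex_vector_bundle :: "'x topology \<Rightarrow> ('g, 'x, 'e) gbundle \<Rightarrow> bool" where
  "complex_vector_bundle X E \<longleftrightarrow>
     continuous_map (total_space E) X (bundle_proj E) \<and>
     (\<forall>x\<in>topspace X. \<exists>U n \<tau>. openin X U \<and> x \<in> U \<and>
        homeomorphic_map (prod_topology (subtopology X U) (complex_space n))
                         (subtopology (total_space E) (part_over E U)) \<tau> \<and>
        (\<forall>y\<in>U. \<forall>v\<in>topspace (complex_space n).
           bundle_proj E (\<tau> (y, v)) = y \<and>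
           (\<forall>w\<in>topspace (complex_space n).
              fibre_add E (\<tau> (y, v)) (\<tau> (y, w)) = \<tau> (y, \<lambda>i. v i + w i)) \<and>
           (\<forall>c. fibre_scale E c (\<tau> (y, v)) = \<tau> (y, \<lambda>i. c * v i))))"

definition G_vector_bundle ::
    "('g, 'r) monoid_scheme \<Rightarrow> 'g topology \<Rightarrow> 'x topology \<Rightarrow> ('g \<Rightarrow> 'x \<Rightarrow> 'x)
      \<Rightarrow> ('g, 'x, 'e) gbundle \<Rightarrow> bool" where
  "G_vector_bundle G T X \<alpha> E \<longleftrightarrow>
     complex_vector_bundle X E \<and>
     G_space G T (total_space E) (bundle_act E) \<and>
     (\<forall>g\<in>carrier G. \<forall>e\<in>topspace (total_space E).
        bundle_proj E (bundle_act E g e) = \<alpha> g (bundle_proj E e) \<and>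
        (\<forall>e'\<in>topspace (total_space E). bundle_proj E e' = bundle_proj E e \<longrightarrow>
           bundle_act E g (fibre_add E e e') =
             fibre_add E (bundle_act E g e) (bundle_act E g e')) \<and>
        (\<forall>c. bundle_act E g (fibre_scale E c e) = fibre_scale E c (bundle_act E g e)))"

definition bundle_isomorphic ::
    "('g, 'r) monoid_scheme \<Rightarrow> ('g, 'x, 'e) gbundle \<Rightarrow> ('g, 'x, 'f) gbundle \<Rightarrow> bool" where
  "bundle_isomorphic G E F \<longleftrightarrow>
     (\<exists>\<theta>. homeomorphic_map (total_space E) (total_space F) \<theta> \<and>
        (\<forall>e\<in>topspace (total_space E).
           bundle_proj F (\<theta> e) = bundle_proj E e \<and>
           (\<forall>e'\<in>topspace (total_space E). bundle_proj E e' = bundle_proj E e \<longrightarrow>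
              \<theta> (fibre_add E e e') = fibre_add F (\<theta> e) (\<theta> e')) \<and>
           (\<forall>c. \<theta> (fibre_scale E c e) = fibre_scale F c (\<theta> e)) \<and>
           (\<forall>g\<in>carrier G. \<theta> (bundle_act E g e) = bundle_act F g (\<theta> e))))"

definition whitney_sum ::
    "('g, 'x, 'e) gbundle \<Rightarrow> ('g, 'x, 'f) gbundle \<Rightarrow> ('g, 'x, 'e \<times> 'f) gbundle" where
  "whitney_sum E F =
     \<lparr>total_space = subtopology (prod_topology (total_space E) (total_space F))
                      {(e, f). bundle_proj E e = bundle_proj F f},
      bundle_proj = (\<lambda>(e, f). bundle_proj E e),
      fibre_add = (\<lambda>(e, f) (e', f'). (fibre_add E e e', fibre_add F f f')),
      fibre_scale = (\<lambda>c (e, f). (fibre_scale E c e, fibre_scale F c f)),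
      bundle_act = (\<lambda>g (e, f). (bundle_act E g e, bundle_act F g f))\<rparr>"

definition bundle_restrict :: "('g, 'x, 'e) gbundle \<Rightarrow> 'x set \<Rightarrow> ('g, 'x, 'e) gbundle" where
  "bundle_restrict E A = E\<lparr>total_space := subtopology (total_space E) (part_over E A)\<rparr>"

definition zero_bundle ::
    "'x topology \<Rightarrow> ('g \<Rightarrow> 'x \<Rightarrow> 'x) \<Rightarrow> ('g, 'x, 'x \<times> (nat \<Rightarrow> complex)) gbundle" where
  "zero_bundle X \<alpha> =
     \<lparr>total_space = prod_topology X (complex_space 0),
      bundle_proj = fst,
      fibre_add = (\<lambda>e e'. e),
      fibre_scale = (\<lambda>c e. e),
      bundle_act = (\<lambda>g (x, v). (\<alpha> g x, v))\<rparr>"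

section \<open>Equivariant K-theory\<close>

text \<open>
  To speak of all isomorphism classes of bundles over a space with points of type \<open>'x\<close>, one type
  of points for the total spaces has to be fixed. The type \<open>'x \<times> (nat \<Rightarrow> complex)\<close> is large
  enough: choosing a linear bijection of each fibre onto some \<open>C^n\<close> identifies the total space of
  any bundle with a subset of this type, along which the topology and all operations can be
  transported. No topology is prescribed on the type itself.
\<close>

type_synonym ('g, 'x) std_bundle = "('g, 'x, 'x \<times> (nat \<Rightarrow> complex)) gbundle"

definition bundle_iso_rel ::
    "('g, 'r) monoid_scheme \<Rightarrow> 'g topology \<Rightarrow> 'x topology \<Rightarrow> ('g \<Rightarrow> 'x \<Rightarrow> 'x)
      \<Rightarrow> (('g, 'x) std_bundle \<times> ('g, 'x) std_bundle) set" where
  "bundle_iso_rel G T X \<alpha> =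
     {(E, F). G_vector_bundle G T X \<alpha> E \<and> G_vector_bundle G T X \<alpha> F \<and> bundle_isomorphic G E F}"

text \<open>
  \<open>E \<oplus> F\<close> lives over a larger type, so the product of two classes is the class of those
  bundles of the fixed type that are isomorphic to it.
\<close>

definition vect_monoid ::
    "('g, 'r) monoid_scheme \<Rightarrow> 'g topology \<Rightarrow> 'x topology \<Rightarrow> ('g \<Rightarrow> 'x \<Rightarrow> 'x)
      \<Rightarrow> ('g, 'x) std_bundle set monoid" where
  "vect_monoid G T X \<alpha> =
     \<lparr>carrier = {E. G_vector_bundle G T X \<alpha> E} // bundle_iso_rel G T X \<alpha>,
      mult = (\<lambda>P Q. {D. G_vector_bundle G T X \<alpha> D \<and>
                        (\<exists>E\<in>P. \<exists>F\<in>Q. bundle_isomorphic G (whitney_sum E F) D)}),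
      one = bundle_iso_rel G T X \<alpha> `` {zero_bundle X \<alpha>}\<rparr>"

text \<open>The pair \<open>(a, b)\<close> stands for the formal difference \<open>a - b\<close>.\<close>

definition grothendieck_rel :: "('m, 'r) monoid_scheme \<Rightarrow> (('m \<times> 'm) \<times> ('m \<times> 'm)) set" where
  "grothendieck_rel M =
     {((a, b), (c, d)) | a b c d.
        a \<in> carrier M \<and> b \<in> carrier M \<and> c \<in> carrier M \<and> d \<in> carrier M \<and>
        (\<exists>k\<in>carrier M. a \<otimes>\<^bsub>M\<^esub> d \<otimes>\<^bsub>M\<^esub> k = c \<otimes>\<^bsub>M\<^esub> b \<otimes>\<^bsub>M\<^esub> k)}"

definition grothendieck_group :: "('m, 'r) monoid_scheme \<Rightarrow> ('m \<times> 'm) set monoid" where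
  "grothendieck_group M =
     \<lparr>carrier = (carrier M \<times> carrier M) // grothendieck_rel M,
      mult = (\<lambda>P Q. \<Union>(a, b)\<in>P. \<Union>(c, d)\<in>Q.
                      grothendieck_rel M `` {(a \<otimes>\<^bsub>M\<^esub> c, b \<otimes>\<^bsub>M\<^esub> d)}),
      one = grothendieck_rel M `` {(\<one>\<^bsub>M\<^esub>, \<one>\<^bsub>M\<^esub>)}\<rparr>"

definition grothendieck_map ::
    "('n, 'r) monoid_scheme \<Rightarrow> ('m \<Rightarrow> 'n) \<Rightarrow> ('m \<times> 'm) set \<Rightarrow> ('n \<times> 'n) set" where
  "grothendieck_map N f P = (\<Union>(a, b)\<in>P. grothendieck_rel N `` {(f a, f b)})"

definition K_group ::
    "('g, 'r) monoid_scheme \<Rightarrow> 'g topology \<Rightarrow> 'x topology \<Rightarrow> ('g \<Rightarrow> 'x \<Rightarrow> 'x)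
      \<Rightarrow> (('g, 'x) std_bundle set \<times> ('g, 'x) std_bundle set) set monoid" where
  "K_group G T X \<alpha> = grothendieck_group (vect_monoid G T X \<alpha>)"

definition class_restrict ::
    "('g, 'r) monoid_scheme \<Rightarrow> 'g topology \<Rightarrow> 'x topology \<Rightarrow> ('g \<Rightarrow> 'x \<Rightarrow> 'x) \<Rightarrow> 'x set
      \<Rightarrow> ('g, 'x) std_bundle set \<Rightarrow> ('g, 'x) std_bundle set" where
  "class_restrict G T X \<alpha> A P =
     {D. G_vector_bundle G T (subtopology X A) \<alpha> D \<and>
         (\<exists>E\<in>P. bundle_isomorphic G (bundle_restrict E A) D)}"

definition K_restrict ::
    "('g, 'r) monoid_scheme \<Rightarrow> 'g topology \<Rightarrow> 'x topology \<Rightarrow> ('g \<Rightarrow> 'x \<Rightarrow> 'x) \<Rightarrow> 'x set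
      \<Rightarrow> (('g, 'x) std_bundle set \<times> ('g, 'x) std_bundle set) set
      \<Rightarrow> (('g, 'x) std_bundle set \<times> ('g, 'x) std_bundle set) set" where
  "K_restrict G T X \<alpha> A =
     grothendieck_map (vect_monoid G T (subtopology X A) \<alpha>) (class_restrict G T X \<alpha> A)"

definition reduced_K_group ::
    "('g, 'r) monoid_scheme \<Rightarrow> 'g topology \<Rightarrow> 'x topology \<Rightarrow> ('g \<Rightarrow> 'x \<Rightarrow> 'x) \<Rightarrow> 'x
      \<Rightarrow> (('g, 'x) std_bundle set \<times> ('g, 'x) std_bundle set) set monoid" where
  "reduced_K_group G T X \<alpha> b =
     (K_group G T X \<alpha>)
       \<lparr>carrier := kernel (K_group G T X \<alpha>) (K_group G T (subtopology X {b}) \<alpha>)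
                         (K_restrict G T X \<alpha> {b})\<rparr>"

section \<open>The representation sphere\<close>

definition O1 :: "real monoid" where
  "O1 = \<lparr>carrier = {1, -1}, mult = (*), one = 1\<rparr>"

text \<open>One-dimensional real representations are given by characters with values in \<open>O(1)\<close>.\<close>

definition character_rep :: "('g \<Rightarrow> real) \<Rightarrow> 'g \<Rightarrow> real \<Rightarrow> real" where
  "character_rep \<epsilon> g t = \<epsilon> g * t"

definition rep_sum :: "('g \<Rightarrow> 'v \<Rightarrow> 'v) \<Rightarrow> ('g \<Rightarrow> 'w \<Rightarrow> 'w) \<Rightarrow> 'g \<Rightarrow> 'v \<times> 'w \<Rightarrow> 'v \<times> 'w" where
  "rep_sum \<rho> \<sigma> g = map_prod (\<rho> g) (\<sigma> g)"

definition one_plus :: "('g \<Rightarrow> real) \<Rightarrow> 'g \<Rightarrow> real \<times> real \<Rightarrow> real \<times> real" where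
  "one_plus \<epsilon> = rep_sum (character_rep (\<lambda>_. 1)) (character_rep \<epsilon>)"

text \<open>
  The sphere of a representation on \<open>'v\<close> is the one-point compactification of \<open>'v\<close>,
  whose point at infinity is \<open>None\<close>.
\<close>

definition sphere_space :: "'v::euclidean_space option topology" where
  "sphere_space = Alexandroff_compactification euclidean"

definition sphere_act :: "('g \<Rightarrow> 'v \<Rightarrow> 'v) \<Rightarrow> 'g \<Rightarrow> 'v option \<Rightarrow> 'v option" where
  "sphere_act \<rho> g = map_option (\<rho> g)"

end

theory Submission
  imports Defs "Jordan_Normal_Form.Determinant" "HOL-Computational_Algebra.Fundamental_Theorem_Algebra"
begin

text \<open>
  The element \<open>c\<close> commutes with \<open>H\<close> and swaps the two hemispheres of the sphere, whose common boundary
  it fixes, while \<open>H\<close> acts trivially. So a bundle \<open>E\<close> is an \<open>H\<close>-bundle on the contractible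
  hemisphere together with an action of \<open>c\<close> over the equator. Averaging over the compact group gives
  an \<open>H\<close>-frame on the hemisphere and a \<open>G\<close>-frame on the equator, both equal to a fixed frame at
  infinity, and their difference is a loop \<open>\<psi>\<close> in the \<open>H\<close>-automorphisms of the fibre \<open>V\<close> at infinity.
  Let \<open>V'\<close> be \<open>V\<close> with \<open>c\<close> acting by a square root of \<open>c\<^sup>2\<close> that is a polynomial in \<open>c\<^sup>2\<close>. Then \<open>\<psi>\<close>
  is \<open>G\<close>-equivariant on \<open>V'\<close>, hence on the equator \<open>\<psi> \<oplus> 1\<close> may be replaced by
  \<open>\<psi> \<oplus> \<psi>\<^bsup>-1\<^esup>\<close>, which extends over the hemisphere by a rotation of \<open>V \<oplus> V'\<close>. This gives
  \<open>E \<oplus> V' \<cong> V \<oplus> V'\<close>: stably, a bundle is determined by its fibre at infinity.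
\<close>

section \<open>Linear maps of the spaces \<open>C^n\<close>\<close>

text \<open>The obstacle is that \<psi> commutes with \<open>H\<close> only: on \<open>V\<close>
  itself it need not commute with \<open>c\<close>, so changing a \<open>G\<close>-frame of the
  equator by it would break the action of \<open>c\<close>. On \<open>V'\<close> the element
  \<open>c\<close> acts by a polynomial in the action of \<open>c\<^sup>2\<close>, and
  \<open>c\<^sup>2\<close> lies in \<open>H\<close>, so whatever commutes with \<open>H\<close>
  commutes with \<open>G\<close>. The polynomial exists because the scalars are complex and the
  action of \<open>c\<^sup>2\<close> is invertible; \<open>V'\<close> is a representation of
  \<open>G\<close> because \<open>c\<close> is central, \<open>G\<close> being the union of
  \<open>H\<close> and \<open>c H\<close>. Adding summands is harmless, since a formal difference
  vanishes exactly if its two terms are stably equal. Frames can be normalized at infinity for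
  topological reasons. The hemisphere is a rectangle with three sides collapsed to infinity, and
  these sides are a retract of it. The equator is an interval with both ends at infinity; the
  monodromy of a frame on it is joined to the identity by a path of invertible complex combinations
  of the two.\<close>

lemma continuous_map_binop:
  assumes "continuous_on UNIV (\<lambda>p. h (fst p) (snd p))"
    and "continuous_map X euclidean f" "continuous_map X euclidean g"
  shows "continuous_map X euclidean (\<lambda>x. h (f x) (g x))"
proof -
  have "continuous_map X (prod_topology euclidean euclidean) (\<lambda>x. (f x, g x))"
    using assms(2,3) by (rule continuous_map_pairedI)
  then have "continuous_map X euclidean ((\<lambda>p. h (fst p) (snd p)) \<circ> (\<lambda>x. (f x, g x)))"
    by (rule continuous_map_compose) (use assms(1) in \<open>simp add: euclidean_product_topology\<close>)
  then show ?thesis by (simp add: o_def)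
qed

lemma continuous_map_unop:
  assumes "continuous_on UNIV h" and "continuous_map X euclidean f"
  shows "continuous_map X euclidean (\<lambda>x. h (f x))"
  using continuous_map_compose[OF assms(2), of euclidean h] assms(1) by (simp add: o_def)

lemma continuous_map_mult_algebra:
  fixes f g :: "'a \<Rightarrow> 'b::real_normed_algebra"
  assumes "continuous_map X euclidean f" "continuous_map X euclidean g"
  shows "continuous_map X euclidean (\<lambda>x. f x * g x)"
  by (rule continuous_map_binop[OF _ assms]) (intro continuous_intros)

lemma continuous_map_prod_algebra:
  fixes f :: "'a \<Rightarrow> 'i \<Rightarrow> 'b::{real_normed_algebra, comm_ring_1}"
  assumes "finite I" "\<And>i. i \<in> I \<Longrightarrow> continuous_map X euclidean (\<lambda>x. f x i)"
  shows "continuous_map X euclidean (\<lambda>x. \<Prod>i\<in>I. f x i)"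
  using assms by (induction I rule: finite_induct) (auto intro: continuous_map_mult_algebra)

lemma continuous_map_divide_field:
  fixes f g :: "'a \<Rightarrow> 'b::real_normed_field"
  assumes f: "continuous_map X euclidean f" and g: "continuous_map X euclidean g"
    and nz: "\<And>x. x \<in> topspace X \<Longrightarrow> g x \<noteq> 0"
  shows "continuous_map X euclidean (\<lambda>x. f x / g x)"
proof -
  have "continuous_map X (top_of_set (- {0})) g"
    using g nz by (auto simp: continuous_map_in_subtopology)
  then have "continuous_map X euclidean (inverse \<circ> g)"
    by (rule continuous_map_compose) (auto intro!: continuous_intros)
  from continuous_map_mult_algebra[OF f this] show ?thesis
    by (simp add: o_def divide_inverse)
qed

definition vecs :: "nat \<Rightarrow> (nat \<Rightarrow> complex) set" where
  "vecs n = {v. \<forall>i\<ge>n. v i = 0}"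

definition basis_vec :: "nat \<Rightarrow> nat \<Rightarrow> complex" where
  "basis_vec j = (\<lambda>i. if i = j then 1 else 0)"

definition lin_map :: "nat \<Rightarrow> nat \<Rightarrow> ((nat \<Rightarrow> complex) \<Rightarrow> nat \<Rightarrow> complex) \<Rightarrow> bool" where
  "lin_map n m f \<longleftrightarrow> (\<forall>v\<in>vecs n. f v \<in> vecs m \<and>
     (\<forall>w\<in>vecs n. f (\<lambda>i. v i + w i) = (\<lambda>i. f v i + f w i)) \<and>
     (\<forall>c. f (\<lambda>i. c * v i) = (\<lambda>i. c * f v i)))"

lemma topspace_complex_space [simp]: "topspace (complex_space n) = vecs n"
  by (simp add: complex_space_def vecs_def)

lemma vecs_add [simp]: "v \<in> vecs n \<Longrightarrow> w \<in> vecs n \<Longrightarrow> (\<lambda>i. v i + w i) \<in> vecs n"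
  and vecs_diff [simp]: "v \<in> vecs n \<Longrightarrow> w \<in> vecs n \<Longrightarrow> (\<lambda>i. v i - w i) \<in> vecs n"
  and vecs_scale [simp]: "v \<in> vecs n \<Longrightarrow> (\<lambda>i. c * v i) \<in> vecs n"
  and vecs_zero [simp]: "(\<lambda>i. 0) \<in> vecs n"
  and vecs_basis [simp]: "j < n \<Longrightarrow> basis_vec j \<in> vecs n"
  by (auto simp: vecs_def basis_vec_def)

lemma vecs_eqI:
  assumes "v \<in> vecs n" "w \<in> vecs n" "\<And>i. i < n \<Longrightarrow> v i = w i"
  shows "v = w"
  using assms by (auto simp: vecs_def fun_eq_iff) (metis not_le)

lemma lin_mapI:
  assumes "\<And>v. v \<in> vecs n \<Longrightarrow> f v \<in> vecs m"
    and "\<And>v w. v \<in> vecs n \<Longrightarrow> w \<in> vecs n \<Longrightarrow> f (\<lambda>i. v i + w i) = (\<lambda>i. f v i + f w i)"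
    and "\<And>c v. v \<in> vecs n \<Longrightarrow> f (\<lambda>i. c * v i) = (\<lambda>i. c * f v i)"
  shows "lin_map n m f"
  using assms by (auto simp: lin_map_def)

lemma lin_map_in: "lin_map n m f \<Longrightarrow> v \<in> vecs n \<Longrightarrow> f v \<in> vecs m"
  and lin_map_add: "lin_map n m f \<Longrightarrow> v \<in> vecs n \<Longrightarrow> w \<in> vecs n \<Longrightarrow>
        f (\<lambda>i. v i + w i) = (\<lambda>i. f v i + f w i)"
  and lin_map_scale: "lin_map n m f \<Longrightarrow> v \<in> vecs n \<Longrightarrow> f (\<lambda>i. c * v i) = (\<lambda>i. c * f v i)"
  by (auto simp: lin_map_def)

lemma lin_map_zero: "lin_map n m f \<Longrightarrow> f (\<lambda>i. 0) = (\<lambda>i. 0)"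
  using lin_map_scale[of n m f "\<lambda>i. 0" 0] by simp

lemma lin_map_compose:
  "lin_map n m f \<Longrightarrow> lin_map m l g \<Longrightarrow> lin_map n l (\<lambda>v. g (f v))"
  by (auto simp: lin_map_def)

lemma lin_map_sum:
  assumes "lin_map n m f" "finite I" "\<And>k. k \<in> I \<Longrightarrow> v k \<in> vecs n"
  shows "(\<lambda>i. \<Sum>k\<in>I. v k i) \<in> vecs n \<and> f (\<lambda>i. \<Sum>k\<in>I. v k i) = (\<lambda>i. \<Sum>k\<in>I. f (v k) i)"
  using assms(2,3)
proof (induction I rule: finite_induct)
  case empty
  then show ?case using lin_map_zero[OF assms(1)] by simp
next
  case (insert x I)
  then show ?case using lin_map_add[OF assms(1), of "v x" "\<lambda>i. \<Sum>k\<in>I. v k i"] by simp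
qed

lemma vecs_expand:
  assumes "v \<in> vecs n"
  shows "v = (\<lambda>i. \<Sum>j<n. v j * basis_vec j i)"
proof
  fix i
  have "(\<Sum>j<n. v j * basis_vec j i) = (\<Sum>j<n. if j = i then v j else 0)"
    by (intro sum.cong) (auto simp: basis_vec_def)
  also have "\<dots> = v i" using assms by (auto simp: vecs_def)
  finally show "v i = (\<Sum>j<n. v j * basis_vec j i)" by simp
qed

lemma lin_map_expand:
  assumes "lin_map n m f" "v \<in> vecs n"
  shows "f v = (\<lambda>i. \<Sum>j<n. v j * f (basis_vec j) i)"
proof -
  have "f v = f (\<lambda>i. \<Sum>j<n. v j * basis_vec j i)"
    using vecs_expand[OF assms(2)] by simp
  also have "\<dots> = (\<lambda>i. \<Sum>j<n. f (\<lambda>i. v j * basis_vec j i) i)"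
    using lin_map_sum[OF assms(1), of "{..<n}" "\<lambda>j i. v j * basis_vec j i"] by simp
  also have "\<dots> = (\<lambda>i. \<Sum>j<n. v j * f (basis_vec j) i)"
    by (intro ext sum.cong refl) (simp add: lin_map_scale[OF assms(1)])
  finally show ?thesis .
qed

lemma continuous_map_complex_space_iff:
  "continuous_map X (complex_space n) f \<longleftrightarrow>
     (\<forall>i. continuous_map X euclidean (\<lambda>x. f x i)) \<and> (\<forall>x\<in>topspace X. f x \<in> vecs n)"
  by (auto simp: complex_space_def continuous_map_in_subtopology continuous_map_componentwise_UNIV
      vecs_def)

lemma continuous_map_complex_space_coord: "continuous_map (complex_space n) euclidean (\<lambda>v. v i)"
  using continuous_map_id[of "complex_space n"]
  unfolding continuous_map_complex_space_iff by simp

text \<open>Joint continuity reduces to matrix entries, because in finite dimension the value is a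
  finite sum of coordinates times entries. Families of inverses and of averages are later handled
  entry by entry through this.\<close>

lemma continuous_map_lin_family:
  assumes lin: "\<And>y. y \<in> topspace Y \<Longrightarrow> lin_map n m (t y)"
    and cont: "\<And>i j. i < m \<Longrightarrow> j < n \<Longrightarrow> continuous_map Y euclidean (\<lambda>y. t y (basis_vec j) i)"
  shows "continuous_map (prod_topology Y (complex_space n)) (complex_space m) (\<lambda>(y, v). t y v)"
proof -
  \<comment> \<open>Rows from \<open>m\<close> on vanish, which is why \<open>cont\<close> asks only
    for \<open>i < m\<close>.\<close>
  have cont': "continuous_map Y euclidean (\<lambda>y. t y (basis_vec j) i)" if "j < n" for i j
  proof (cases "i < m")
    case False
    then have "continuous_map Y euclidean (\<lambda>y. 0::complex)" by simp
    then show ?thesis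
      by (rule continuous_map_eq) (use lin_map_in[OF lin vecs_basis[OF that]] False in \<open>auto simp: vecs_def\<close>)
  qed (use cont that in blast)
  have "continuous_map (prod_topology Y (complex_space n)) euclidean (\<lambda>p. (case p of (y, v) \<Rightarrow> t y v) i)" for i
  proof (rule continuous_map_eq)
    show "continuous_map (prod_topology Y (complex_space n)) euclidean
        (\<lambda>p. \<Sum>j<n. snd p j * t (fst p) (basis_vec j) i)"
    proof (intro continuous_map_sum continuous_map_mult_algebra)
      fix j assume "j \<in> {..<n}"
      show "continuous_map (prod_topology Y (complex_space n)) euclidean (\<lambda>p. snd p j)"
        using continuous_map_compose[OF continuous_map_snd continuous_map_complex_space_coord]
        by (simp add: o_def)
      show "continuous_map (prod_topology Y (complex_space n)) euclidean (\<lambda>p. t (fst p) (basis_vec j) i)"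
        using continuous_map_compose[OF continuous_map_fst cont'] \<open>j \<in> {..<n}\<close>
        by (simp add: o_def)
    qed simp
  next
    fix p assume "p \<in> topspace (prod_topology Y (complex_space n))"
    then obtain y v where "p = (y, v)" "y \<in> topspace Y" "v \<in> vecs n" by auto
    then show "(\<Sum>j<n. snd p j * t (fst p) (basis_vec j) i) = (case p of (y, v) \<Rightarrow> t y v) i"
      using lin_map_expand[OF lin] by (metis fst_conv old.prod.case snd_conv)
  qed
  then show ?thesis
    using lin_map_in[OF lin] by (auto simp: continuous_map_complex_space_iff)
qed

lemma continuous_map_lin_family_entry:
  assumes "continuous_map (prod_topology Y (complex_space n)) (complex_space m) (\<lambda>(y, v). t y v)"
    and "w \<in> vecs n"
  shows "continuous_map Y euclidean (\<lambda>y. t y w i)"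
proof -
  have "continuous_map Y (prod_topology Y (complex_space n)) (\<lambda>y. (y, w))"
    using assms(2) by (intro continuous_map_pairedI) auto
  from continuous_map_compose[OF this assms(1)] show ?thesis
    by (simp add: o_def continuous_map_complex_space_iff)
qed

section \<open>Matrices, determinants and continuously varying inverses\<close>

definition lin_mat :: "nat \<Rightarrow> ((nat \<Rightarrow> complex) \<Rightarrow> nat \<Rightarrow> complex) \<Rightarrow> complex mat" where
  "lin_mat n f = Matrix.mat n n (\<lambda>(i, j). f (basis_vec j) i)"

lemma lin_mat_carrier [simp]: "lin_mat n f \<in> carrier_mat n n"
  by (simp add: lin_mat_def)

text \<open>The Leibniz formula makes the determinant a polynomial in the entries.\<close>

lemma continuous_map_det:
  assumes "\<And>i j. i < n \<Longrightarrow> j < n \<Longrightarrow> continuous_map Y euclidean (\<lambda>y. B y i j :: complex)"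
  shows "continuous_map Y euclidean (\<lambda>y. Determinant.det (Matrix.mat n n (\<lambda>(i, j). B y i j)))"
proof -
  have "continuous_map Y euclidean
      (\<lambda>y. \<Sum>p | p permutes {0..<n}. signof p * (\<Prod>i = 0..<n. B y i (p i)))"
    using assms
    by (intro continuous_map_sum continuous_map_mult_algebra continuous_map_prod_algebra)
       (auto simp: finite_permutations permutes_in_image)
  moreover have "Determinant.det (Matrix.mat n n (\<lambda>(i, j). B y i j)) =
      (\<Sum>p | p permutes {0..<n}. signof p * (\<Prod>i = 0..<n. B y i (p i)))" for y
    by (subst det_def'[of _ n]) (auto intro!: sum.cong prod.cong simp: permutes_in_image)
  ultimately show ?thesis by simp
qed

lemma continuous_map_adj:
  assumes "\<And>i j. i < n \<Longrightarrow> j < n \<Longrightarrow> continuous_map Y euclidean (\<lambda>y. B y i j :: complex)"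
    and "a < n" "b < n"
  shows "continuous_map Y euclidean (\<lambda>y. adj_mat (Matrix.mat n n (\<lambda>(i, j). B y i j)) $$ (a, b))"
proof -
  \<comment> \<open>The minor with row \<open>b\<close> and column \<open>a\<close> deleted: the
    indices jump over \<open>b\<close> and \<open>a\<close>. Rows and columns are exchanged as in
    the adjugate.\<close>
  define D where "D y = Determinant.det (Matrix.mat (n - 1) (n - 1) (\<lambda>(i, j).
      B y (if i < b then i else Suc i) (if j < a then j else Suc j)))" for y
  have "adj_mat (Matrix.mat n n (\<lambda>(i, j). B y i j)) $$ (a, b) = (-1)^(b+a) * D y" for y
    using assms(2,3)
    by (auto simp: adj_mat_def cofactor_def mat_delete_def D_def
        intro!: arg_cong[where f = Determinant.det] eq_matI)
  moreover have "continuous_map Y euclidean (\<lambda>y. D y)"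
    unfolding D_def using assms by (intro continuous_map_det assms(1)) auto
  ultimately show ?thesis
    by (simp add: continuous_map_mult_algebra)
qed

lemma lin_mat_mult:
  assumes "lin_map n n f" "lin_map n n g"
  shows "lin_mat n f * lin_mat n g = lin_mat n (\<lambda>v. f (g v))"
proof (rule eq_matI)
  fix i j assume "i < dim_row (lin_mat n (\<lambda>v. f (g v)))" "j < dim_col (lin_mat n (\<lambda>v. f (g v)))"
  then have ij: "i < n" "j < n" by (simp_all add: lin_mat_def)
  then show "(lin_mat n f * lin_mat n g) $$ (i, j) = lin_mat n (\<lambda>v. f (g v)) $$ (i, j)"
    using lin_map_expand[OF assms(1) lin_map_in[OF assms(2) vecs_basis[OF ij(2)]]]
    by (simp add: lin_mat_def scalar_prod_def mult.commute atLeast0LessThan)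
qed (simp_all add: lin_mat_def)

lemma lin_mat_id: "lin_mat n (\<lambda>v. v) = 1\<^sub>m n"
  by (auto simp: lin_mat_def basis_vec_def intro!: eq_matI)

lemma lin_mat_cong:
  "(\<And>v. v \<in> vecs n \<Longrightarrow> f v = g v) \<Longrightarrow> lin_mat n f = lin_mat n g"
  by (auto simp: lin_mat_def intro!: eq_matI)

lemma det_lin_mat_nonzero:
  assumes "lin_map n n f" "lin_map n n g" "\<And>v. v \<in> vecs n \<Longrightarrow> f (g v) = v"
  shows "Determinant.det (lin_mat n f) \<noteq> 0"
proof -
  have "lin_mat n f * lin_mat n g = 1\<^sub>m n"
    using assms by (simp add: lin_mat_mult lin_mat_id[symmetric] cong: lin_mat_cong)
  then have "Determinant.det (lin_mat n f) * Determinant.det (lin_mat n g) = 1"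
    by (metis det_mult det_one lin_mat_carrier)
  then show ?thesis by auto
qed

text \<open>Cramer's rule. The inverse is given by a formula instead of being chosen, so that it
  varies continuously with a parameter wherever the determinant does not vanish. Coordinates from
  \<open>n\<close> on are set to 0 to stay inside \<open>vecs n\<close>.\<close>

definition lin_inv :: "nat \<Rightarrow> ((nat \<Rightarrow> complex) \<Rightarrow> nat \<Rightarrow> complex) \<Rightarrow> (nat \<Rightarrow> complex) \<Rightarrow> nat \<Rightarrow> complex" where
  "lin_inv n f v = (\<lambda>i. if i < n then
     (\<Sum>j<n. v j * adj_mat (lin_mat n f) $$ (i, j)) / Determinant.det (lin_mat n f) else 0)"

lemma lin_map_lin_inv: "lin_map n n (lin_inv n f)"
  by (rule lin_mapI)
     (auto simp: lin_inv_def vecs_def fun_eq_iff distrib_right sum.distrib add_divide_distrib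
        sum_distrib_left mult.assoc)

lemma lin_mat_inj:
  assumes "lin_map n n f" "lin_map n n g" "lin_mat n f = lin_mat n g" "v \<in> vecs n"
  shows "f v = g v"
proof (rule vecs_eqI[OF lin_map_in[OF assms(1,4)] lin_map_in[OF assms(2,4)]])
  fix i assume "i < n"
  have "f (basis_vec j) i = g (basis_vec j) i" if "j < n" for j
    using arg_cong[OF assms(3), of "\<lambda>M. M $$ (i, j)"] \<open>i < n\<close> that by (simp add: lin_mat_def)
  then show "f v i = g v i"
    using lin_map_expand[OF assms(1,4)] lin_map_expand[OF assms(2,4)] by simp
qed

lemma lin_mat_lin_inv:
  "lin_mat n (lin_inv n f) = (1 / Determinant.det (lin_mat n f)) \<cdot>\<^sub>m adj_mat (lin_mat n f)"
proof -
  have "adj_mat (lin_mat n f) \<in> carrier_mat n n" by (rule adj_mat) simp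
  moreover have "(\<Sum>k<n. basis_vec j k * h k) = h j" if "j < n" for j and h :: "nat \<Rightarrow> complex"
  proof -
    have "(\<Sum>k<n. basis_vec j k * h k) = (\<Sum>k<n. if k = j then h k else 0)"
      by (intro sum.cong) (auto simp: basis_vec_def)
    then show ?thesis using that by simp
  qed
  ultimately show ?thesis
    by (auto simp: lin_mat_def[of n "lin_inv n f"] lin_inv_def intro!: eq_matI)
qed

lemma smult_inverse_smult: "d \<noteq> 0 \<Longrightarrow> (1 / d) \<cdot>\<^sub>m (d \<cdot>\<^sub>m 1\<^sub>m n) = (1\<^sub>m n :: complex mat)"
  by (auto intro!: eq_matI)

lemma lin_inv:
  assumes f: "lin_map n n f" and d: "Determinant.det (lin_mat n f) \<noteq> 0" and v: "v \<in> vecs n"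
  shows "lin_inv n f (f v) = v" "f (lin_inv n f v) = v"
proof -
  let ?d = "Determinant.det (lin_mat n f)"
  have adj: "adj_mat (lin_mat n f) \<in> carrier_mat n n"
    "lin_mat n f * adj_mat (lin_mat n f) = ?d \<cdot>\<^sub>m 1\<^sub>m n"
    "adj_mat (lin_mat n f) * lin_mat n f = ?d \<cdot>\<^sub>m 1\<^sub>m n"
    by (rule adj_mat; simp)+
  have id: "lin_map n n (\<lambda>v. v)" by (rule lin_mapI) auto
  have "lin_mat n (\<lambda>v. lin_inv n f (f v)) = lin_mat n (\<lambda>v. v)"
    using adj d
    by (simp add: lin_mat_mult[OF lin_map_lin_inv f, symmetric] lin_mat_lin_inv lin_mat_id smult_inverse_smult
        mult_smult_assoc_mat[OF adj(1) lin_mat_carrier])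
  from lin_mat_inj[OF lin_map_compose[OF f lin_map_lin_inv] id this v]
  show "lin_inv n f (f v) = v" .
  have "lin_mat n (\<lambda>v. f (lin_inv n f v)) = lin_mat n (\<lambda>v. v)"
    using adj d
    by (simp add: lin_mat_mult[OF f lin_map_lin_inv, symmetric] lin_mat_lin_inv lin_mat_id smult_inverse_smult
        mult_smult_distrib[OF lin_mat_carrier adj(1)])
  from lin_mat_inj[OF lin_map_compose[OF lin_map_lin_inv f] id this v]
  show "f (lin_inv n f v) = v" .
qed

lemma continuous_map_det_lin_family:
  assumes "continuous_map (prod_topology Y (complex_space n)) (complex_space n) (\<lambda>(y, v). t y v)"
  shows "continuous_map Y euclidean (\<lambda>y. Determinant.det (lin_mat n (t y)))"
  unfolding lin_mat_def
  by (intro continuous_map_det continuous_map_lin_family_entry[OF assms]) auto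

lemma continuous_map_lin_inv_family:
  assumes t: "continuous_map (prod_topology Y (complex_space n)) (complex_space n) (\<lambda>(y, v). t y v)"
    and nz: "\<And>y. y \<in> topspace Y \<Longrightarrow> Determinant.det (lin_mat n (t y)) \<noteq> 0"
  shows "continuous_map (prod_topology Y (complex_space n)) (complex_space n) (\<lambda>(y, v). lin_inv n (t y) v)"
proof (rule continuous_map_lin_family)
  fix i j assume ij: "i < n" "j < n"
  have "continuous_map Y euclidean (\<lambda>y. adj_mat (lin_mat n (t y)) $$ (i, j) / Determinant.det (lin_mat n (t y)))"
    using ij nz
    by (intro continuous_map_divide_field continuous_map_det_lin_family[OF t])
       (auto simp: lin_mat_def intro!: continuous_map_adj continuous_map_lin_family_entry[OF t])
  moreover have "lin_inv n (t y) (basis_vec j) i =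
      adj_mat (lin_mat n (t y)) $$ (i, j) / Determinant.det (lin_mat n (t y))" for y
    using arg_cong[OF lin_mat_lin_inv[of n "t y"], of "\<lambda>M. M $$ (i, j)"] ij adj_mat(1)[OF lin_mat_carrier[of n "t y"]]
    by (auto simp: lin_mat_def[of n "lin_inv n (t y)"])
  ultimately show "continuous_map Y euclidean (\<lambda>y. lin_inv n (t y) (basis_vec j) i)" by simp
qed (rule lin_map_lin_inv)

lemma lin_map_affine:
  "lin_map n m f \<Longrightarrow> lin_map n m g \<Longrightarrow> lin_map n m (\<lambda>v i. a * f v i + b * g v i)"
  by (rule lin_mapI)
     (auto simp: lin_map_add lin_map_scale algebra_simps vecs_def dest!: lin_map_in)

text \<open>The complex line through the identity and \<open>f\<close> meets the zero set of the determinant in finitely many points.\<close>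

lemma invertible_path:
  assumes f: "lin_map n n f" and g: "lin_map n n g" and fg: "\<And>v. v \<in> vecs n \<Longrightarrow> f (g v) = v"
  obtains z :: "real \<Rightarrow> complex" where "continuous_on {0..1} z" "z 0 = 0" "z 1 = 1"
    "\<forall>s\<in>{0..1}. Determinant.det (lin_mat n (\<lambda>v i. (1 - z s) * v i + z s * f v i)) \<noteq> 0"
proof -
  \<comment> \<open>The pencil \<open>(1 - X) + X f\<close>, with entries of degree at most 1 in
    \<open>X\<close>. Its determinant is a single polynomial, whose values at 0 and 1 are the
    determinants of the identity and of \<open>f\<close>.\<close>
  define P where "P = Matrix.mat n n (\<lambda>(i, j). [: basis_vec j i, f (basis_vec j) i - basis_vec j i :])"
  define p where "p = Determinant.det P"
  have eval: "poly p z = Determinant.det (lin_mat n (\<lambda>v i. (1 - z) * v i + z * f v i))" for z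
  proof -
    interpret comm_ring_hom "\<lambda>q::complex poly. poly q z" by unfold_locales auto
    have "map_mat (\<lambda>q. poly q z) P = lin_mat n (\<lambda>v i. (1 - z) * v i + z * f v i)"
      by (auto simp: P_def lin_mat_def algebra_simps intro!: eq_matI)
    then show ?thesis using hom_det[of P] by (simp add: p_def)
  qed
  have p0: "poly p 0 \<noteq> 0" by (simp add: eval lin_mat_id)
  have p1: "poly p 1 \<noteq> 0"
    using det_lin_mat_nonzero[OF f g fg] by (simp add: eval)
  have "finite {z. poly p z = 0}" using p0 by (intro poly_roots_finite) auto
  \<comment> \<open>The complex plane minus finitely many points is path connected. On the real
    segment from 0 to 1 a root could block the way.\<close>
  then have "path_connected (- {z. poly p z = 0})"
    by (intro path_connected_complement_countable) (auto intro: countable_finite)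
  then obtain z where "path z" "path_image z \<subseteq> - {z. poly p z = 0}"
    "pathstart z = 0" "pathfinish z = 1"
    using p0 p1 unfolding path_connected_def by blast
  then show thesis
    by (intro that[of z])
       (auto simp: path_def pathstart_def pathfinish_def path_image_def eval[symmetric] image_subset_iff)
qed

section \<open>Square roots of invertible endomorphisms\<close>

text \<open>The endomorphism \<open>p(f)\<close>, computed by Horner's rule: the constant
  coefficient, plus \<open>f\<close> applied to the value of the remaining polynomial.\<close>

definition poly_map :: "((nat \<Rightarrow> complex) \<Rightarrow> nat \<Rightarrow> complex) \<Rightarrow> complex poly \<Rightarrow> (nat \<Rightarrow> complex) \<Rightarrow> nat \<Rightarrow> complex" where
  "poly_map f p = fold_coeffs (\<lambda>a g v i. a * v i + f (g v) i) p (\<lambda>v i. 0)"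

context
  fixes n f assumes f: "lin_map n n f"
begin

lemma poly_map_0 [simp]: "poly_map f 0 v = (\<lambda>i. 0)"
  by (simp add: poly_map_def)

lemma poly_map_pCons [simp]: "poly_map f (pCons a p) v = (\<lambda>i. a * v i + f (poly_map f p v) i)"
  using lin_map_zero[OF f]
  by (cases "a = 0 \<and> p = 0") (auto simp: poly_map_def fold_coeffs_pCons_coeff_not_0_eq fold_coeffs_pCons_not_0_0_eq)

lemma lin_map_poly_map: "lin_map n n (poly_map f p)"
proof (induction p)
  case (pCons a p)
  show ?case
    using lin_map_affine[OF _ lin_map_compose[OF pCons.IH f], of "\<lambda>v. v" a 1]
    by (simp add: lin_map_def)
qed (simp add: lin_map_def)

lemmas poly_map_in = lin_map_in[OF lin_map_poly_map]

lemma poly_map_add: "v \<in> vecs n \<Longrightarrow> poly_map f (p + q) v = (\<lambda>i. poly_map f p v i + poly_map f q v i)"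
  by (induction p q rule: poly_induct2) (simp_all add: lin_map_add[OF f] poly_map_in algebra_simps)

lemma poly_map_smult: "v \<in> vecs n \<Longrightarrow> poly_map f (Polynomial.smult c p) v = (\<lambda>i. c * poly_map f p v i)"
  by (induction p) (simp_all add: lin_map_scale[OF f] poly_map_in algebra_simps)

lemma poly_map_mult: "v \<in> vecs n \<Longrightarrow> poly_map f (p * q) v = poly_map f p (poly_map f q v)"
  by (induction p) (simp_all add: poly_map_add poly_map_smult)

lemma poly_map_commute:
  assumes t: "lin_map n n t"
    and comm: "\<And>v. v \<in> vecs n \<Longrightarrow> t (f v) = f (t v)" and v: "v \<in> vecs n"
  shows "t (poly_map f p v) = poly_map f p (t v)"
proof (induction p)
  case 0
  then show ?case using lin_map_zero[OF t] by simp
next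
  case (pCons a p)
  have "t (\<lambda>i. a * v i + f (poly_map f p v) i) = (\<lambda>i. t (\<lambda>i. a * v i) i + t (f (poly_map f p v)) i)"
    using v by (intro lin_map_add[OF t]) (auto intro: lin_map_in[OF f] poly_map_in)
  then show ?case
    using pCons v by (simp add: lin_map_scale[OF t] comm poly_map_in)
qed

text \<open>The \<open>n + 1\<close> vectors obtained from \<open>v\<close> by the powers of
  \<open>f\<close> up to \<open>n\<close> are linearly dependent, and the coefficients of a
  dependency are those of \<open>p\<close>.\<close>

lemma annihilating_poly_vec:
  assumes v: "v \<in> vecs n"
  shows "\<exists>p. p \<noteq> 0 \<and> poly_map f p v = (\<lambda>i. 0)"
proof -
  have it: "(f ^^ k) v \<in> vecs n" for k by (induction k) (auto simp: v lin_map_in[OF f])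
  \<comment> \<open>The vectors are padded to a square matrix: row \<open>n\<close> holds their
    coordinates of index \<open>n\<close>, which are 0, so the determinant vanishes.\<close>
  define N where "N = Matrix.mat (Suc n) (Suc n) (\<lambda>(i, k). (f ^^ k) v i)"
  have N: "N \<in> carrier_mat (Suc n) (Suc n)" by (simp add: N_def)
  have "Determinant.det N = 0"
  proof -
    have "N = mat\<^sub>r (Suc n) (Suc n) (\<lambda>i. if i = n then 0\<^sub>v (Suc n) else Matrix.row N i)"
      using it by (auto simp: N_def vecs_def intro!: eq_matI)
    also have "Determinant.det \<dots> = 0"
      by (rule det_row_0) (auto simp: N_def)
    finally show ?thesis .
  qed
  then obtain c where c: "c \<in> carrier_vec (Suc n)" "c \<noteq> 0\<^sub>v (Suc n)" "N *\<^sub>v c = 0\<^sub>v (Suc n)"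
    using det_0_iff_vec_prod_zero[OF N] by auto
  define p where "p = (\<Sum>k<Suc n. monom (c $ k) k)"
  have mon: "poly_map f (monom a k) v = (\<lambda>i. a * (f ^^ k) v i)" for a k
    by (induction k) (simp_all add: monom_0 monom_Suc lin_map_zero[OF f] lin_map_scale[OF f] it)
  have sum: "poly_map f (\<Sum>k\<in>K. monom (c $ k) k) v = (\<lambda>i. \<Sum>k\<in>K. c $ k * (f ^^ k) v i)"
    if "finite K" for K
    using that by (induction K rule: finite_induct) (simp_all add: poly_map_add v mon)
  have "poly_map f p v i = 0" for i
  proof (cases "i < n")
    case True
    then have "0 = (N *\<^sub>v c) $ i" using c by simp
    also have "\<dots> = (\<Sum>k<Suc n. (f ^^ k) v i * c $ k)"
      using True c(1) by (simp add: N_def scalar_prod_def atLeast0LessThan del: sum.lessThan_Suc)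
    finally show ?thesis unfolding p_def sum[OF finite_lessThan] by (simp add: mult.commute)
  qed (use poly_map_in[OF v, of p] in \<open>auto simp: vecs_def\<close>)
  moreover have "p \<noteq> 0"
  proof
    assume "p = 0"
    have "c $ k = 0" if "k < Suc n" for k
    proof -
      have "coeff p k = (\<Sum>j<Suc n. if j = k then c $ j else 0)"
        unfolding p_def coeff_sum by (intro sum.cong) auto
      with that \<open>p = 0\<close> show ?thesis by (simp del: sum.lessThan_Suc)
    qed
    then have "c = 0\<^sub>v (Suc n)" using c(1) by (intro eq_vecI) auto
    with c(2) show False by simp
  qed
  ultimately show ?thesis by blast
qed

text \<open>Take the product of annihilators of the basis vectors. Multiplication of polynomials is
  commutative, so the factor that kills a given basis vector may be applied to it before the
  others.\<close>

lemma annihilating_poly: "\<exists>p. p \<noteq> 0 \<and> (\<forall>v\<in>vecs n. poly_map f p v = (\<lambda>i. 0))"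
proof -
  obtain q where q: "\<And>j. j < n \<Longrightarrow> q j \<noteq> 0 \<and> poly_map f (q j) (basis_vec j) = (\<lambda>i. 0)"
    using annihilating_poly_vec[OF vecs_basis] by metis
  define p where "p = (\<Prod>j<n. q j)"
  have "poly_map f p (basis_vec j) = (\<lambda>i. 0)" if "j < n" for j
  proof -
    have "p = (\<Prod>j\<in>{..<n} - {j}. q j) * q j"
      unfolding p_def using that by (subst prod.remove[of _ j]) (auto simp: mult.commute)
    then show ?thesis
      using that q lin_map_zero[OF lin_map_poly_map] by (simp add: poly_map_mult)
  qed
  then have "poly_map f p v = (\<lambda>i. 0)" if "v \<in> vecs n" for v
    using lin_map_expand[OF lin_map_poly_map that] by simp
  moreover have "p \<noteq> 0" using q by (simp add: p_def)
  ultimately show ?thesis by blast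
qed

end

text \<open>Induction on the degree of \<open>f\<close>. Split off a root \<open>a\<close>, so that
  \<open>f = (X - a) h\<close>, and correct a square root \<open>p\<close> of \<open>X\<close>
  modulo \<open>h\<close> to \<open>p + t h\<close>. Divisibility by the further factor
  \<open>X - a\<close> is one equation for the number \<open>t\<close>, solvable over the complex
  numbers: it is quadratic if \<open>h(a)\<close> is not 0, and otherwise linear with slope
  \<open>2 p(a)\<close>, which is not 0 because then \<open>p(a)\<^sup>2 = a\<close>.\<close>

lemma poly_sqrt_mod:
  assumes "poly f 0 \<noteq> (0::complex)"
  shows "\<exists>p. f dvd p * p - [:0, 1:]"
  using assms
proof (induction "degree f" arbitrary: f)
  case 0
  then have "f dvd 1" by (metis degree_eq_zeroE is_unit_triv poly_0 pCons_0_0)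
  then show ?case using dvd_trans one_dvd by blast
next
  case (Suc d)
  then have "\<not> constant (poly f)" by (simp add: constant_degree)
  then obtain a where "poly f a = 0" using fundamental_theorem_of_algebra by blast
  then obtain h where h: "f = [:-a, 1:] * h" by (auto simp: poly_eq_0_iff_dvd)
  have a: "a \<noteq> 0" and h0: "poly h 0 \<noteq> 0" using Suc.prems h by auto
  then have "degree f = Suc (degree h)" unfolding h by (subst degree_mult_eq) auto
  then obtain p g where g: "p * p - [:0, 1:] = h * g"
    using Suc.hyps(1)[of h] Suc.hyps(2) h0 by (auto simp: dvd_def)
  \<comment> \<open>The left-hand side is the value at \<open>a\<close> of the quotient of
    \<open>(p + t h)\<^sup>2 - X\<close> by \<open>h\<close>.\<close>
  have "\<exists>t. poly g a + 2 * t * poly p a + t * t * poly h a = 0"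
  proof (cases "poly h a = 0")
    case True
    then have "poly p a * poly p a = a" using arg_cong[OF g, of "\<lambda>q. poly q a"] by simp
    then have "poly p a \<noteq> 0" using a by auto
    then show ?thesis using True by (intro exI[of _ "- poly g a / (2 * poly p a)"]) simp
  next
    case False
    then have "degree [:poly g a, 2 * poly p a, poly h a:] = 2" by simp
    then have "\<not> constant (poly [:poly g a, 2 * poly p a, poly h a:])" by (simp add: constant_degree)
    then obtain t where "poly [:poly g a, 2 * poly p a, poly h a:] t = 0"
      using fundamental_theorem_of_algebra by blast
    then show ?thesis by (intro exI[of _ t]) (simp add: algebra_simps)
  qed
  then obtain t where t: "poly g a + 2 * t * poly p a + t * t * poly h a = 0" by blast
  then have "[:-a, 1:] dvd g + Polynomial.smult (2 * t) p + Polynomial.smult (t * t) h"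
    by (simp add: poly_eq_0_iff_dvd[symmetric])
  moreover have "(p + Polynomial.smult t h) * (p + Polynomial.smult t h) - [:0, 1:] = h * (g + Polynomial.smult (2 * t) p + Polynomial.smult (t * t) h)"
  proof -
    define u where "u = [:t:]"
    have u: "Polynomial.smult t q = u * q" "Polynomial.smult (2 * t) q = 2 * u * q"
      "Polynomial.smult (t * t) q = u * u * q" for q
      by (simp_all add: u_def numeral_poly mult.commute)
    have "(p + u * h) * (p + u * h) - [:0, 1:] = (p * p - [:0, 1:]) + h * (2 * u * p + u * u * h)"
      by (simp add: algebra_simps)
    then show ?thesis unfolding u g by (simp add: algebra_simps)
  qed
  ultimately show ?case
    unfolding h by (metis mult.commute mult_dvd_mono dvd_refl)
qed

text \<open>Injectivity lets the powers of \<open>X\<close> be stripped from an annihilating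
  polynomial, leaving \<open>r\<close> with \<open>r(f) = 0\<close> and \<open>r(0)\<close> not 0. A
  square root \<open>p\<close> of \<open>X\<close> modulo \<open>r\<close> then gives
  \<open>s = p(f)\<close>. Being a polynomial in \<open>f\<close> is what makes \<open>s\<close>
  commute with everything that commutes with \<open>f\<close>.\<close>

lemma lin_map_sqrt:
  assumes f: "lin_map n n f" and inj: "inj_on f (vecs n)"
  shows "\<exists>s. lin_map n n s \<and> (\<forall>v\<in>vecs n. s (s v) = f v) \<and>
    (\<forall>t. lin_map n n t \<longrightarrow> (\<forall>v\<in>vecs n. t (f v) = f (t v)) \<longrightarrow> (\<forall>v\<in>vecs n. t (s v) = s (t v)))"
proof -
  obtain q where q: "q \<noteq> 0" "\<And>v. v \<in> vecs n \<Longrightarrow> poly_map f q v = (\<lambda>i. 0)"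
    using annihilating_poly[OF f] by blast
  obtain r where r: "q = [:-0, 1:] ^ Polynomial.order 0 q * r" "\<not> [:-0, 1:] dvd r"
    using order_decomp[OF q(1)] by blast
  have cancel: "(\<forall>v\<in>vecs n. poly_map f r v = (\<lambda>i. 0))"
    if "\<forall>v\<in>vecs n. poly_map f ([:-0, 1:] ^ k * r) v = (\<lambda>i. 0)" for k
    using that
  proof (induction k)
    case (Suc k)
    have "poly_map f ([:-0, 1:] ^ k * r) v = (\<lambda>i. 0)" if v: "v \<in> vecs n" for v
    proof -
      have "f (poly_map f ([:-0, 1:] ^ k * r) v) = poly_map f ([:-0, 1:] ^ Suc k * r) v"
        using v by (simp add: poly_map_mult[OF f] poly_map_in[OF f] poly_map_pCons[OF f] poly_map_0[OF f] lin_map_zero[OF f] mult.assoc)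
      also have "\<dots> = f (\<lambda>i. 0)" using Suc.prems v by (simp add: lin_map_zero[OF f])
      finally show ?thesis
        using inj v poly_map_in[OF f v] by (auto dest!: inj_onD)
    qed
    then show ?case using Suc.IH by blast
  qed simp
  have r0: "poly_map f r v = (\<lambda>i. 0)" if "v \<in> vecs n" for v
    using cancel[of "Polynomial.order 0 q"] r(1) q(2) that by metis
  have "poly r 0 \<noteq> 0" using r(2) by (simp add: poly_eq_0_iff_dvd)
  then obtain p g where p: "p * p - [:0, 1:] = r * g" using poly_sqrt_mod by (metis dvdE)
  have ss: "poly_map f p (poly_map f p v) = f v" if v: "v \<in> vecs n" for v
  proof -
    have "poly_map f p (poly_map f p v) = poly_map f (p * p) v" using v by (simp add: poly_map_mult[OF f])
    also have "p * p = [:0, 1:] + r * g" using p by (simp add: algebra_simps)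
    also have "poly_map f \<dots> v = f v"
      using v r0 by (simp add: poly_map_add[OF f] poly_map_mult[OF f] poly_map_in[OF f] poly_map_pCons[OF f]
          poly_map_0[OF f] lin_map_zero[OF f])
    finally show ?thesis .
  qed
  have "t (poly_map f p v) = poly_map f p (t v)"
    if "lin_map n n t" "\<forall>v\<in>vecs n. t (f v) = f (t v)" "v \<in> vecs n" for t v
    by (rule poly_map_commute[OF f that(1) _ that(3)]) (use that(2) in blast)
  then show ?thesis
    using ss lin_map_poly_map[OF f] by (intro exI[of _ "poly_map f p"]) blast
qed

section \<open>The invariant mean of a compact group\<close>

text \<open>Tube argument: the projection along a compact factor is closed, so the parameters
  \<open>y\<close> for which some \<open>k\<close> violates the bound form a closed set, and
  \<open>y0\<close> lies outside it.\<close>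

lemma compact_uniform_nbhd:
  fixes F :: "'k \<times> 'y \<Rightarrow> 'b::real_normed_vector"
  assumes F: "continuous_map (prod_topology K Y) euclidean F" and K: "compact_space K"
    and y0: "y0 \<in> topspace Y" and e: "e > 0"
  obtains W where "openin Y W" "y0 \<in> W"
    "\<And>k y. k \<in> topspace K \<Longrightarrow> y \<in> W \<Longrightarrow> norm (F (k, y) - F (k, y0)) < e"
proof -
  have "continuous_map (prod_topology K Y) (prod_topology K Y) (\<lambda>p. (fst p, y0))"
    using y0 by (intro continuous_map_pairedI continuous_map_fst) auto
  from continuous_map_compose[OF this F]
  have "continuous_map (prod_topology K Y) euclidean (\<lambda>p. F (fst p, y0))"
    by (simp add: o_def)
  then have c: "continuous_map (prod_topology K Y) euclideanreal (\<lambda>p. norm (F p - F (fst p, y0)))"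
    using F by (intro continuous_map_norm continuous_map_diff)
  define C where "C = {p \<in> topspace (prod_topology K Y). norm (F p - F (fst p, y0)) \<in> {e..}}"
  have "closedin (prod_topology K Y) C"
    unfolding C_def by (rule closedin_continuous_map_preimage[OF c]) auto
  then have "closedin Y (snd ` C)"
    using closed_map_snd[OF K, of Y] by (auto simp: closed_map_def)
  then have "openin Y (topspace Y - snd ` C)" by (rule openin_diff[OF openin_topspace])
  moreover have "y0 \<in> topspace Y - snd ` C" using y0 e by (auto simp: C_def)
  moreover have "norm (F (k, y) - F (k, y0)) < e" if "k \<in> topspace K" "y \<in> topspace Y - snd ` C" for k y
  proof (rule ccontr)
    assume "\<not> norm (F (k, y) - F (k, y0)) < e"
    then have "(k, y) \<in> C" using that by (auto simp: C_def)
    then show False using that by force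
  qed
  ultimately show thesis by (rule that)
qed

text \<open>Iterated averages over finite sets of translates, as in von Neumann's construction of
  the Haar mean. They are kept as operators, independent of the function, so that one average can be
  applied to several functions and composed with another. The parameter \<open>act\<close> covers
  left and right translations alike.\<close>

inductive averaging :: "('g \<Rightarrow> 'g \<Rightarrow> 'g) \<Rightarrow> 'g set \<Rightarrow> (('g \<Rightarrow> real) \<Rightarrow> 'g \<Rightarrow> real) \<Rightarrow> bool"
  for act C where
  averaging_id: "averaging act C (\<lambda>f. f)"
| averaging_step: "averaging act C M \<Longrightarrow> finite S \<Longrightarrow> S \<noteq> {} \<Longrightarrow> S \<subseteq> C \<Longrightarrow>
    averaging act C (\<lambda>f x. (\<Sum>a\<in>S. M f (act a x)) / card S)"

lemma averaging_compose:
  "averaging act C M \<Longrightarrow> averaging act C N \<Longrightarrow> averaging act C (\<lambda>f. M (N f))"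
  by (induction rule: averaging.induct) (auto intro: averaging_step)

lemma averaging_add: "averaging act C M \<Longrightarrow> M (\<lambda>x. f x + g x) = (\<lambda>x. M f x + M g x)"
  by (induction rule: averaging.induct) (auto simp: sum.distrib add_divide_distrib)

lemma averaging_scale: "averaging act C M \<Longrightarrow> M (\<lambda>x. c * f x) = (\<lambda>x. c * M f x)"
  by (induction rule: averaging.induct) (auto simp: sum_distrib_left)

lemma averaging_sum:
  assumes "averaging act C M" "finite S"
  shows "M (\<lambda>x. \<Sum>a\<in>S. h a x) = (\<lambda>x. \<Sum>a\<in>S. M (h a) x)"
  using assms(2)
proof (induction S rule: finite_induct)
  case empty
  then show ?case using averaging_scale[OF assms(1), of 0 "\<lambda>x. 0"] by simp
qed (simp add: averaging_add[OF assms(1)])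

lemma averaging_lower:
  assumes "averaging act C M" and act: "\<And>a x. a \<in> C \<Longrightarrow> x \<in> C \<Longrightarrow> act a x \<in> C"
    and "\<And>x. x \<in> C \<Longrightarrow> c \<le> f x" "x \<in> C"
  shows "c \<le> M f x"
  using assms(1,3,4)
proof (induction arbitrary: x rule: averaging.induct)
  case (averaging_step M S)
  have "card S * c = (\<Sum>a\<in>S. c)" by simp
  also have "\<dots> \<le> (\<Sum>a\<in>S. M f (act a x))"
    using averaging_step act by (intro sum_mono) blast
  finally show ?case using averaging_step by (simp add: field_simps card_gt_0_iff)
qed auto

lemma averaging_upper:
  assumes "averaging act C M" "\<And>a x. a \<in> C \<Longrightarrow> x \<in> C \<Longrightarrow> act a x \<in> C"
    and "\<And>x. x \<in> C \<Longrightarrow> f x \<le> c" "x \<in> C"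
  shows "M f x \<le> c"
proof -
  have "- c \<le> M (\<lambda>x. -1 * f x) x" by (rule averaging_lower[OF assms(1,2)]) (use assms in auto)
  then show ?thesis unfolding averaging_scale[OF assms(1)] by simp
qed

lemma averaging_near:
  assumes "averaging act C M" "\<And>a x. a \<in> C \<Longrightarrow> x \<in> C \<Longrightarrow> act a x \<in> C"
    and "\<And>x. x \<in> C \<Longrightarrow> \<bar>f x - c\<bar> \<le> e" "x \<in> C"
  shows "\<bar>M f x - c\<bar> \<le> e"
proof -
  have b: "c - e \<le> f y" "f y \<le> c + e" if "y \<in> C" for y
    using assms(3)[OF that] by linarith+
  have "c - e \<le> M f x" by (rule averaging_lower[OF assms(1,2) b(1) assms(4)])
  moreover have "M f x \<le> c + e" by (rule averaging_upper[OF assms(1,2) b(2) assms(4)])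
  ultimately show ?thesis by linarith
qed

section \<open>Flattening continuous functions on a compact group by averaging\<close>

locale group_with_topology = group G for G (structure) +
  fixes T :: "'a topology"
  assumes topspace_eq: "topspace T = carrier G"

locale compact_group = group_with_topology +
  assumes compact: "compact_space T"
    and cont_mult: "continuous_map (prod_topology T T) T (\<lambda>(x, y). x \<otimes> y)"
    and cont_inv: "continuous_map T T (\<lambda>x. inv x)"
begin

lemma continuous_map_mult:
  assumes "continuous_map X T f" "continuous_map X T g"
  shows "continuous_map X T (\<lambda>x. f x \<otimes> g x)"
  using continuous_map_compose[OF continuous_map_pairedI[OF assms] cont_mult] by (simp add: o_def)

text \<open>Compactness of the product of two copies of the group makes the neighbourhood uniform in
  both outer factors. The perturbation \<open>u\<close> stands in the middle so that a left
  translation can be absorbed into \<open>x\<close> while \<open>z\<close> remains free.\<close>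

lemma uniformly_continuous:
  assumes f: "continuous_map T euclideanreal f" and e: "e > 0"
  obtains U where "openin T U" "\<one> \<in> U"
    "\<And>u x z. u \<in> U \<Longrightarrow> x \<in> carrier G \<Longrightarrow> z \<in> carrier G \<Longrightarrow> \<bar>f (x \<otimes> u \<otimes> z) - f (x \<otimes> z)\<bar> < e"
proof -
  let ?K = "prod_topology T T"
  let ?F = "\<lambda>p. f (fst (fst p) \<otimes> snd p \<otimes> snd (fst p))"
  have "continuous_map (prod_topology ?K T) T (\<lambda>p. fst (fst p) \<otimes> snd p \<otimes> snd (fst p))"
    by (intro continuous_map_mult continuous_intros continuous_map_fst_of continuous_map_snd_of
          continuous_map_compose[OF continuous_map_fst, unfolded o_def])
  from continuous_map_compose[OF this f]
  have F: "continuous_map (prod_topology ?K T) euclideanreal ?F" by (simp add: o_def)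
  have "compact_space ?K" using compact by (simp add: compact_space_prod_topology)
  then obtain W where W: "openin T W" "\<one> \<in> W"
    "\<And>k y. k \<in> topspace ?K \<Longrightarrow> y \<in> W \<Longrightarrow> norm (?F (k, y) - ?F (k, \<one>)) < e"
    using compact_uniform_nbhd[OF F _ _ e, of \<one>] one_closed unfolding topspace_eq by blast
  show thesis
  proof (rule that[OF W(1,2)])
    fix u x z assume "u \<in> W" "x \<in> carrier G" "z \<in> carrier G"
    then show "\<bar>f (x \<otimes> u \<otimes> z) - f (x \<otimes> z)\<bar> < e"
      using W(3)[of "(x, z)" u] by (simp add: topspace_eq)
  qed
qed

text \<open>For each \<open>b\<close> the set of \<open>y\<close> with
  \<open>b \<otimes> inv y\<close> in \<open>U\<close> is open and contains \<open>b\<close>; by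
  compactness finitely many of these sets cover the group.\<close>

lemma finite_translates_cover:
  assumes U: "openin T U" "\<one> \<in> U"
  obtains S where "finite S" "S \<subseteq> carrier G" "S \<noteq> {}" "\<And>y. y \<in> carrier G \<Longrightarrow> \<exists>a\<in>S. a \<otimes> inv y \<in> U"
proof -
  define V where "V b = {y \<in> topspace T. b \<otimes> inv y \<in> U}" for b
  have "openin T (V b)" if "b \<in> carrier G" for b
    unfolding V_def using that
    by (intro openin_continuous_map_preimage[OF _ U(1)] continuous_map_mult cont_inv)
       (auto simp: topspace_eq)
  moreover have "b \<in> V b" if "b \<in> carrier G" for b
    using that U by (simp add: V_def topspace_eq)
  ultimately obtain \<F> where F: "finite \<F>" "\<F> \<subseteq> V ` carrier G" "topspace T \<subseteq> \<Union>\<F>"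
    using compact unfolding compact_space_alt
    by (elim allE[of _ "V ` carrier G"]) (force simp: topspace_eq)
  then obtain S where S: "finite S" "S \<subseteq> carrier G" "\<F> = V ` S"
    by (meson finite_subset_image)
  have cover: "\<exists>a\<in>S. a \<otimes> inv y \<in> U" if "y \<in> carrier G" for y
    using F(3) S(3) that by (auto simp: topspace_eq V_def)
  then have "S \<noteq> {}" by blast
  with S cover that show thesis by blast
qed

text \<open>Averaging does not spoil the modulus of continuity, because every translating element
  merges with \<open>x\<close>. Hence one neighbourhood \<open>U\<close> serves all rounds of an
  iteration.\<close>

lemma averaging_left_uniform:
  assumes "averaging (\<otimes>) (carrier G) M"
    and "\<And>u x z. u \<in> U \<Longrightarrow> x \<in> carrier G \<Longrightarrow> z \<in> carrier G \<Longrightarrow> \<bar>f (x \<otimes> u \<otimes> z) - f (x \<otimes> z)\<bar> \<le> e"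
    and "U \<subseteq> carrier G"
    and "u \<in> U" "x \<in> carrier G" "z \<in> carrier G"
  shows "\<bar>M f (x \<otimes> u \<otimes> z) - M f (x \<otimes> z)\<bar> \<le> e"
  using assms(1,5)
proof (induction arbitrary: x rule: averaging.induct)
  case averaging_id
  then show ?case using assms by blast
next
  case (averaging_step M S)
  have u: "u \<in> carrier G" using assms by blast
  have "\<bar>(\<Sum>a\<in>S. M f (a \<otimes> (x \<otimes> u \<otimes> z))) - (\<Sum>a\<in>S. M f (a \<otimes> (x \<otimes> z)))\<bar>
      \<le> (\<Sum>a\<in>S. \<bar>M f (a \<otimes> (x \<otimes> u \<otimes> z)) - M f (a \<otimes> (x \<otimes> z))\<bar>)"
    by (simp add: sum_subtractf[symmetric])
  also have "\<dots> \<le> (\<Sum>a\<in>S. e)"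
  proof (rule sum_mono)
    fix a assume "a \<in> S"
    then have a: "a \<in> carrier G" using averaging_step by blast
    show "\<bar>M f (a \<otimes> (x \<otimes> u \<otimes> z)) - M f (a \<otimes> (x \<otimes> z))\<bar> \<le> e"
      using averaging_step.IH[of "a \<otimes> x"] a u assms(6) averaging_step.prems by (simp add: m_assoc)
  qed
  finally show ?case
    using averaging_step.hyps by (simp add: diff_divide_distrib[symmetric] field_simps card_gt_0_iff)
qed

lemma continuous_averaging_left:
  assumes "averaging (\<otimes>) (carrier G) M" "continuous_map T euclideanreal f"
  shows "continuous_map T euclideanreal (M f)"
  using assms(1)
proof (induction rule: averaging.induct)
  case (averaging_step M S)
  have "continuous_map T euclideanreal (\<lambda>x. M f (a \<otimes> x))" if "a \<in> S" for a
  proof -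
    have "a \<in> topspace T" using that averaging_step topspace_eq by blast
    then have "continuous_map T T (\<lambda>x. a \<otimes> x)" by (intro continuous_map_mult) auto
    from continuous_map_compose[OF this averaging_step.IH] show ?thesis by (simp add: o_def)
  qed
  then show ?case
    using averaging_step.hyps by (intro continuous_map_real_divide continuous_map_sum) auto
qed (use assms in auto)

text \<open>One further average over \<open>S\<close> shrinks the oscillation: among the
  \<open>N\<close> translates of any \<open>x\<close> by \<open>S\<close>, one lies so near a
  minimum point \<open>x0\<close> that it contributes almost the minimum, while the others exceed it
  by at most the old oscillation. The oscillation is thus multiplied by \<open>1 - 1 / N\<close>, up
  to a fixed error, and iteration makes it small.\<close>

lemma averaging_left_small:
  assumes f: "continuous_map T euclideanreal f" and e: "e > 0"
  obtains M where "averaging (\<otimes>) (carrier G) M"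
    "\<And>x y. x \<in> carrier G \<Longrightarrow> y \<in> carrier G \<Longrightarrow> \<bar>M f x - M f y\<bar> \<le> e"
proof -
  have "compactin euclideanreal (f ` topspace T)"
    using compact f image_compactin unfolding compact_space_def by blast
  then have "bounded (f ` carrier G)" by (simp add: compact_imp_bounded topspace_eq)
  then obtain D where "\<And>x. x \<in> carrier G \<Longrightarrow> \<bar>f x\<bar> \<le> D" by (auto simp: bounded_iff)
  then have D: "\<bar>f x - f y\<bar> \<le> 2 * D" if "x \<in> carrier G" "y \<in> carrier G" for x y
    using \<open>\<And>x. x \<in> carrier G \<Longrightarrow> \<bar>f x\<bar> \<le> D\<close>[OF that(1)] \<open>\<And>x. x \<in> carrier G \<Longrightarrow> \<bar>f x\<bar> \<le> D\<close>[OF that(2)]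
    by linarith
  have D0: "D \<ge> 0" using D[OF one_closed one_closed] by simp
  obtain U where U: "openin T U" "\<one> \<in> U"
    "\<And>u x z. u \<in> U \<Longrightarrow> x \<in> carrier G \<Longrightarrow> z \<in> carrier G \<Longrightarrow> \<bar>f (x \<otimes> u \<otimes> z) - f (x \<otimes> z)\<bar> < e / 2"
    using uniformly_continuous[OF f, of "e / 2"] e by auto
  have UG: "U \<subseteq> carrier G" using openin_subset[OF U(1)] topspace_eq by simp
  obtain S where S: "finite S" "S \<subseteq> carrier G" "S \<noteq> {}"
    "\<And>y. y \<in> carrier G \<Longrightarrow> \<exists>a\<in>S. a \<otimes> inv y \<in> U"
    using finite_translates_cover[OF U(1,2)] by metis
  define N where "N = real (card S)"
  have N: "N \<ge> 1" using S by (simp add: N_def Suc_le_eq card_gt_0_iff)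
  \<comment> \<open>The contraction factor. The summand \<open>e / 2\<close> in the bound below is
    the fixed point of the recursion: \<open>c * (e / 2) + e / (2 * N) = e / 2\<close>.\<close>
  define c where "c = 1 - 1 / N"
  have c: "0 \<le> c" "c < 1" using N by (auto simp: c_def)
  have "\<exists>M. averaging (\<otimes>) (carrier G) M \<and>
      (\<forall>x\<in>carrier G. \<forall>y\<in>carrier G. \<bar>M f x - M f y\<bar> \<le> c ^ k * (2 * D) + e / 2)" for k
  proof (induction k)
    case 0
    have "\<forall>x\<in>carrier G. \<forall>y\<in>carrier G. \<bar>f x - f y\<bar> \<le> c ^ 0 * (2 * D) + e / 2"
      using D e by fastforce
    then show ?case using averaging_id by blast
  next
    case (Suc k)
    then obtain M where M: "averaging (\<otimes>) (carrier G) M"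
      and osc: "\<And>x y. x \<in> carrier G \<Longrightarrow> y \<in> carrier G \<Longrightarrow> \<bar>M f x - M f y\<bar> \<le> c ^ k * (2 * D) + e / 2"
      by blast
    let ?d = "c ^ k * (2 * D) + e / 2"
    have unif: "\<bar>M f (x \<otimes> u \<otimes> z) - M f (x \<otimes> z)\<bar> \<le> e / 2"
      if "u \<in> U" "x \<in> carrier G" "z \<in> carrier G" for u x z
      by (rule averaging_left_uniform[OF M _ UG that]) (use U(3) less_imp_le in blast)
    have "compactin euclideanreal (M f ` topspace T)"
      using compact continuous_averaging_left[OF M f] image_compactin unfolding compact_space_def by blast
    then have "compact (M f ` carrier G)" by (simp add: topspace_eq)
    then obtain x0 where x0: "x0 \<in> carrier G" "\<And>x. x \<in> carrier G \<Longrightarrow> M f x0 \<le> M f x"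
      using compact_attains_inf[of "M f ` carrier G"] one_closed by blast
    let ?M = "\<lambda>f x. (\<Sum>a\<in>S. M f (a \<otimes> x)) / card S"
    have hi: "(\<Sum>a\<in>S. M f (a \<otimes> x)) \<le> N * M f x0 + (N - 1) * ?d + e / 2" if x: "x \<in> carrier G" for x
    proof -
      \<comment> \<open>By the choice of \<open>b\<close>, the translate
        \<open>b \<otimes> x\<close> is an element of \<open>U\<close> times
        \<open>x0\<close>.\<close>
      obtain b where b: "b \<in> S" "b \<otimes> inv (x0 \<otimes> inv x) \<in> U"
        using S(4)[of "x0 \<otimes> inv x"] x x0(1) by auto
      have bG: "b \<in> carrier G" using b S by blast
      have bx: "b \<otimes> inv (x0 \<otimes> inv x) \<otimes> x0 = b \<otimes> x"
        using bG x x0(1) by (simp add: inv_mult_group m_assoc)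
      have "\<bar>M f (b \<otimes> x) - M f x0\<bar> \<le> e / 2"
        using unif[OF b(2) one_closed x0(1)] bx UG b(2) x0(1) by (simp add: subset_iff)
      then have "M f (b \<otimes> x) \<le> M f x0 + e / 2" by linarith
      moreover have "(\<Sum>a\<in>S - {b}. M f (a \<otimes> x)) \<le> (\<Sum>a\<in>S - {b}. M f x0 + ?d)"
      proof (rule sum_mono)
        fix a assume "a \<in> S - {b}"
        then have "a \<otimes> x \<in> carrier G" using S x by blast
        from osc[OF this x0(1)] show "M f (a \<otimes> x) \<le> M f x0 + ?d" by linarith
      qed
      ultimately have "(\<Sum>a\<in>S. M f (a \<otimes> x)) \<le> M f x0 + e / 2 + (N - 1) * (M f x0 + ?d)"
        using S(1) b(1) N by (simp add: sum.remove[of S b] N_def of_nat_diff)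
      then show ?thesis by (simp add: algebra_simps)
    qed
    have lo: "N * M f x0 \<le> (\<Sum>a\<in>S. M f (a \<otimes> x))" if x: "x \<in> carrier G" for x
    proof -
      have "(\<Sum>a\<in>S. M f x0) \<le> (\<Sum>a\<in>S. M f (a \<otimes> x))"
        using S x x0(2) by (intro sum_mono) blast
      then show ?thesis by (simp add: N_def)
    qed
    have "?M f x - ?M f y \<le> c ^ Suc k * (2 * D) + e / 2" if "x \<in> carrier G" "y \<in> carrier G" for x y
    proof -
      have "N * (?M f x - ?M f y) \<le> (N - 1) * ?d + e / 2"
        using hi[OF that(1)] lo[OF that(2)] N by (simp add: N_def algebra_simps)
      also have "\<dots> = N * (c * ?d + e / (2 * N))" using N by (simp add: c_def field_simps)
      finally have "?M f x - ?M f y \<le> c * ?d + e / (2 * N)" using N by simp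
      also have "\<dots> = c ^ Suc k * (2 * D) + e / 2" using N by (simp add: c_def field_simps)
      finally show ?thesis .
    qed
    then have "\<forall>x\<in>carrier G. \<forall>y\<in>carrier G. \<bar>?M f x - ?M f y\<bar> \<le> c ^ Suc k * (2 * D) + e / 2"
      by (simp add: abs_le_iff)
    moreover have "averaging (\<otimes>) (carrier G) ?M" using averaging_step[OF M S(1,3,2)] .
    ultimately show ?case by blast
  qed
  moreover obtain k where "c ^ k * (2 * D) \<le> e / 2"
  proof -
    have "(\<lambda>k. c ^ k * (2 * D)) \<longlonglongrightarrow> 0 * (2 * D)"
      using c by (intro tendsto_mult LIMSEQ_power_zero) auto
    then have "\<forall>\<^sub>F k in sequentially. c ^ k * (2 * D) < e / 2"
      using e by (intro order_tendstoD(2)) auto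
    then show thesis using that by (auto simp: eventually_sequentially intro: less_imp_le)
  qed
  ultimately obtain M where "averaging (\<otimes>) (carrier G) M"
    "\<forall>x\<in>carrier G. \<forall>y\<in>carrier G. \<bar>M f x - M f y\<bar> \<le> c ^ k * (2 * D) + e / 2"
    "c ^ k * (2 * D) + e / 2 \<le> e"
    by (metis add_right_mono field_sum_of_halves)
  then show thesis by (intro that[of M]) (auto intro: order_trans)
qed

abbreviation (input) rmult where "rmult \<equiv> \<lambda>a x. x \<otimes> a"

text \<open>This is the statement for left averages in the opposite group, whose inverses are those
  of \<open>G\<close>.\<close>

lemma averaging_right_small:
  assumes f: "continuous_map T euclideanreal f" and e: "e > 0"
  obtains M where "averaging rmult (carrier G) M"
    "\<And>x y. x \<in> carrier G \<Longrightarrow> y \<in> carrier G \<Longrightarrow> \<bar>M f x - M f y\<bar> \<le> e"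
proof -
  let ?G = "\<lparr>carrier = carrier G, mult = rmult, one = \<one>\<rparr>"
  have "group ?G"
    by (rule groupI) (auto simp: m_assoc intro: l_inv_ex r_inv_ex)
  then interpret op: group ?G .
  have "inv\<^bsub>?G\<^esub> x = inv x" if "x \<in> carrier G" for x
    using that by (intro op.inv_equality) auto
  then have "continuous_map T T (\<lambda>x. inv\<^bsub>?G\<^esub> x)"
    by (intro continuous_map_eq[OF cont_inv]) (auto simp: topspace_eq)
  moreover have "continuous_map (prod_topology T T) T (\<lambda>p. snd p \<otimes> fst p)"
    by (intro continuous_map_mult continuous_map_fst continuous_map_snd)
  ultimately interpret op: compact_group ?G T
    by unfold_locales (auto simp: topspace_eq compact case_prod_unfold)
  show thesis using op.averaging_left_small[OF f e] that by auto
qed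

lemma averaging_right_translate:
  assumes "averaging rmult (carrier G) R" "a \<in> carrier G" "x \<in> carrier G"
  shows "R (\<lambda>x. h (a \<otimes> x)) x = R h (a \<otimes> x)"
  using assms(1,3)
proof (induction arbitrary: x rule: averaging.induct)
  case (averaging_step M S)
  have "(\<Sum>b\<in>S. M (\<lambda>x. h (a \<otimes> x)) (x \<otimes> b)) = (\<Sum>b\<in>S. M h (a \<otimes> x \<otimes> b))"
    using averaging_step assms(2) by (intro sum.cong refl) (auto simp: m_assoc subset_iff)
  then show ?case by simp
qed simp

text \<open>By associativity, left translations commute with right ones. The comparisons of averages
  below rest on this.\<close>

lemma averaging_commute:
  assumes M: "averaging (\<otimes>) (carrier G) M" and R: "averaging rmult (carrier G) R"
    and x: "x \<in> carrier G"
  shows "M (R f) x = R (M f) x"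
  using M x
proof (induction arbitrary: x rule: averaging.induct)
  case (averaging_step M S)
  have "R (\<lambda>x. (\<Sum>a\<in>S. M f (a \<otimes> x)) / card S) x
      = R (\<lambda>x. (1 / card S) * (\<Sum>a\<in>S. M f (a \<otimes> x))) x" by simp
  also have "\<dots> = (1 / card S) * (\<Sum>a\<in>S. R (\<lambda>x. M f (a \<otimes> x)) x)"
    using averaging_step.hyps
    by (subst averaging_scale[OF R]) (simp add: averaging_sum[OF R])
  also have "(\<Sum>a\<in>S. R (\<lambda>x. M f (a \<otimes> x)) x) = (\<Sum>a\<in>S. M (R f) (a \<otimes> x))"
    using averaging_step by (intro sum.cong refl) (auto simp: averaging_right_translate[OF R] subset_iff)
  finally show ?case by simp
qed simp

text \<open>The candidate for the Haar integral: the best constant lower bound reached by left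
  averages of \<open>f\<close>. For continuous \<open>f\<close> it turns out to be the limit value
  of all nearly constant averages, left or right.\<close>

definition mean :: "('a \<Rightarrow> real) \<Rightarrow> real" where
  "mean f = Sup {c. \<exists>M. averaging (\<otimes>) (carrier G) M \<and> (\<forall>x\<in>carrier G. c \<le> M f x)}"

text \<open>A nearly constant right average \<open>R\<close> links \<open>M\<close> to any competing
  left average \<open>N\<close>. Since averages on opposite sides commute, \<open>R (N f)\<close>
  and \<open>R (M f)\<close> are both near the value of \<open>R f\<close>, so no lower bound
  reached through \<open>N\<close> can exceed \<open>M f\<close> by more than
  \<open>e\<close>.\<close>

lemma mean_near_left:
  assumes f: "continuous_map T euclideanreal f" and M: "averaging (\<otimes>) (carrier G) M"
    and osc: "\<And>x y. x \<in> carrier G \<Longrightarrow> y \<in> carrier G \<Longrightarrow> \<bar>M f x - M f y\<bar> \<le> e"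
    and x: "x \<in> carrier G"
  shows "\<bar>M f x - mean f\<bar> \<le> e"
proof -
  let ?S = "{c. \<exists>M. averaging (\<otimes>) (carrier G) M \<and> (\<forall>x\<in>carrier G. c \<le> M f x)}"
  have "M f x - e \<in> ?S" using M osc[OF x] by (auto intro!: exI[of _ M] simp: abs_le_iff algebra_simps)
  moreover have le: "c \<le> M f x + e" if "c \<in> ?S" for c
  proof (rule field_le_epsilon)
    fix d :: real assume d: "d > 0"
    obtain N where N: "averaging (\<otimes>) (carrier G) N" "\<And>y. y \<in> carrier G \<Longrightarrow> c \<le> N f y"
      using \<open>c \<in> ?S\<close> by blast
    obtain R where R: "averaging rmult (carrier G) R"
      "\<And>x y. x \<in> carrier G \<Longrightarrow> y \<in> carrier G \<Longrightarrow> \<bar>R f x - R f y\<bar> \<le> d / 2"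
      using averaging_right_small[OF f, of "d / 2"] d by auto
    have Rb: "R f \<one> - d / 2 \<le> R f y" "R f y \<le> R f \<one> + d / 2" if "y \<in> carrier G" for y
      using R(2)[OF that one_closed] by linarith+
    have Mb: "M f y \<le> M f x + e" if "y \<in> carrier G" for y
      using osc[OF that x] by linarith
    have "c \<le> R (N f) \<one>" by (rule averaging_lower[OF R(1)]) (use N(2) in auto)
    also have "\<dots> = N (R f) \<one>" using averaging_commute[OF N(1) R(1)] by simp
    also have "\<dots> \<le> R f \<one> + d / 2"
      by (rule averaging_upper[OF N(1)]) (use Rb in auto)
    finally have 1: "c \<le> R f \<one> + d / 2" .
    have "R f \<one> - d / 2 \<le> M (R f) \<one>"
      by (rule averaging_lower[OF M]) (use Rb in auto)
    also have "\<dots> = R (M f) \<one>" using averaging_commute[OF M R(1)] by simp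
    also have "\<dots> \<le> M f x + e"
      by (rule averaging_upper[OF R(1)]) (use Mb in auto)
    finally show "c \<le> M f x + e + d" using 1 by simp
  qed
  ultimately have "M f x - e \<le> mean f"
    unfolding mean_def by (intro cSup_upper bdd_aboveI) auto
  moreover have "mean f \<le> M f x + e"
    unfolding mean_def using \<open>M f x - e \<in> ?S\<close> le by (intro cSup_least) auto
  ultimately show ?thesis by linarith
qed

text \<open>Compare with a nearly constant left average \<open>M\<close>: the function
  \<open>M (R f) = R (M f)\<close> is close to the values of both.\<close>

lemma mean_near_right:
  assumes f: "continuous_map T euclideanreal f" and R: "averaging rmult (carrier G) R"
    and osc: "\<And>x y. x \<in> carrier G \<Longrightarrow> y \<in> carrier G \<Longrightarrow> \<bar>R f x - R f y\<bar> \<le> e"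
    and x: "x \<in> carrier G"
  shows "\<bar>R f x - mean f\<bar> \<le> e"
proof (rule field_le_epsilon)
  fix d :: real assume d: "d > 0"
  obtain M where M: "averaging (\<otimes>) (carrier G) M"
    "\<And>x y. x \<in> carrier G \<Longrightarrow> y \<in> carrier G \<Longrightarrow> \<bar>M f x - M f y\<bar> \<le> d / 2"
    using averaging_left_small[OF f, of "d / 2"] d by auto
  have "\<bar>M f \<one> - mean f\<bar> \<le> d / 2" by (rule mean_near_left[OF f M]) auto
  moreover have "\<bar>M (R f) \<one> - R f x\<bar> \<le> e"
    by (rule averaging_near[OF M(1)]) (use osc[OF _ x] in auto)
  moreover have "\<bar>R (M f) \<one> - M f \<one>\<bar> \<le> d / 2"
    by (rule averaging_near[OF R]) (use M(2)[OF _ one_closed] in auto)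
  ultimately show "\<bar>R f x - mean f\<bar> \<le> e + d"
    using averaging_commute[OF M(1) R one_closed, of f] by linarith
qed

lemma mean_right:
  assumes f: "continuous_map T euclideanreal f" and e: "e > 0"
  obtains R where "averaging rmult (carrier G) R" "\<And>x. x \<in> carrier G \<Longrightarrow> \<bar>R f x - mean f\<bar> \<le> e"
  using averaging_right_small[OF f e] mean_near_right[OF f] by metis

lemma mean_left:
  assumes f: "continuous_map T euclideanreal f" and e: "e > 0"
  obtains M where "averaging (\<otimes>) (carrier G) M" "\<And>x. x \<in> carrier G \<Longrightarrow> \<bar>M f x - mean f\<bar> \<le> e"
  using averaging_left_small[OF f e] mean_near_left[OF f] by metis

text \<open>The test uses right averages for two reasons: they commute with left translations, which
  makes invariance immediate, and they compose, which gives additivity.\<close>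

lemma mean_eqI:
  assumes f: "continuous_map T euclideanreal f"
    and c: "\<And>e. e > 0 \<Longrightarrow> \<exists>R. averaging rmult (carrier G) R \<and> (\<forall>x\<in>carrier G. \<bar>R f x - c\<bar> \<le> e)"
  shows "mean f = c"
proof -
  have le: "\<bar>c - mean f\<bar> \<le> 0 + e" if e: "e > 0" for e
  proof -
    obtain R where R: "averaging rmult (carrier G) R" "\<forall>x\<in>carrier G. \<bar>R f x - c\<bar> \<le> e / 3"
      using c[of "e / 3"] e by auto
    have "\<bar>R f x - R f y\<bar> \<le> 2 * e / 3" if "x \<in> carrier G" "y \<in> carrier G" for x y
      using R(2)[rule_format, OF that(1)] R(2)[rule_format, OF that(2)] by linarith
    then have "\<bar>R f \<one> - mean f\<bar> \<le> 2 * e / 3"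
      by (rule mean_near_right[OF f R(1) _ one_closed])
    moreover have "\<bar>R f \<one> - c\<bar> \<le> e / 3" using R(2) by simp
    ultimately show ?thesis by linarith
  qed
  have "\<bar>c - mean f\<bar> \<le> 0" by (rule field_le_epsilon[OF le])
  then show ?thesis by simp
qed

lemma mean_translate:
  assumes f: "continuous_map T euclideanreal f" and a: "a \<in> carrier G"
  shows "mean (\<lambda>x. f (a \<otimes> x)) = mean f"
proof (rule mean_eqI)
  have "continuous_map T T (\<lambda>x. a \<otimes> x)"
    using a by (intro continuous_map_mult) (auto simp: topspace_eq)
  from continuous_map_compose[OF this f] show "continuous_map T euclideanreal (\<lambda>x. f (a \<otimes> x))"
    by (simp add: o_def)
  fix e :: real assume "e > 0"
  then obtain R where R: "averaging rmult (carrier G) R" "\<And>x. x \<in> carrier G \<Longrightarrow> \<bar>R f x - mean f\<bar> \<le> e"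
    using mean_right[OF f] by blast
  then show "\<exists>R. averaging rmult (carrier G) R \<and> (\<forall>x\<in>carrier G. \<bar>R (\<lambda>x. f (a \<otimes> x)) x - mean f\<bar> \<le> e)"
    using a by (intro exI[of _ R]) (simp add: averaging_right_translate)
qed

lemma continuous_averaging_right:
  assumes "averaging rmult (carrier G) R" "continuous_map T euclideanreal f"
  shows "continuous_map T euclideanreal (R f)"
  using assms(1)
proof (induction rule: averaging.induct)
  case (averaging_step M S)
  have "continuous_map T euclideanreal (\<lambda>x. M f (x \<otimes> a))" if "a \<in> S" for a
  proof -
    have "a \<in> topspace T" using that averaging_step topspace_eq by blast
    then have "continuous_map T T (\<lambda>x. x \<otimes> a)" by (intro continuous_map_mult) auto
    from continuous_map_compose[OF this averaging_step.IH] show ?thesis by (simp add: o_def)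
  qed
  then show ?case
    using averaging_step.hyps by (intro continuous_map_real_divide continuous_map_sum) auto
qed (use assms in auto)

text \<open>A single right average has to flatten both functions: \<open>R\<close> flattens
  \<open>f\<close>, then \<open>R'\<close> flattens \<open>R g\<close>, and \<open>R'\<close> does
  not disturb the flatness of \<open>R f\<close>.\<close>

lemma mean_add:
  assumes f: "continuous_map T euclideanreal f" and g: "continuous_map T euclideanreal g"
  shows "mean (\<lambda>x. f x + g x) = mean f + mean g"
proof (rule mean_eqI)
  show "continuous_map T euclideanreal (\<lambda>x. f x + g x)" using f g by (rule continuous_map_add)
  fix e :: real assume "e > 0"
  then have e: "e / 2 > 0" by simp
  obtain R where R: "averaging rmult (carrier G) R" "\<And>x. x \<in> carrier G \<Longrightarrow> \<bar>R f x - mean f\<bar> \<le> e / 2"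
    using mean_right[OF f e] by blast
  have Rg: "continuous_map T euclideanreal (R g)" by (rule continuous_averaging_right[OF R(1) g])
  obtain R' where R': "averaging rmult (carrier G) R'"
    "\<And>x. x \<in> carrier G \<Longrightarrow> \<bar>R' (R g) x - mean (R g)\<bar> \<le> e / 2"
    using mean_right[OF Rg e] by blast
  \<comment> \<open>The mean of \<open>R g\<close> is that of \<open>g\<close>, because left averages of \<open>g\<close> commute with \<open>R\<close>.\<close>
  have "mean (R g) = mean g"
  proof -
    have le: "\<bar>mean (R g) - mean g\<bar> \<le> 0 + d" if "d > 0" for d
    proof -
      have d: "d / 3 > 0" using that by simp
      obtain M where M: "averaging (\<otimes>) (carrier G) M"
        "\<And>x. x \<in> carrier G \<Longrightarrow> \<bar>M g x - mean g\<bar> \<le> d / 3"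
        using mean_left[OF g d] by blast
      have near: "\<bar>M (R g) x - mean g\<bar> \<le> d / 3" if "x \<in> carrier G" for x
        unfolding averaging_commute[OF M(1) R(1) that]
        by (rule averaging_near[OF R(1)]) (use M(2) that in auto)
      have "\<bar>M (R g) x - M (R g) y\<bar> \<le> 2 * d / 3" if "x \<in> carrier G" "y \<in> carrier G" for x y
        using near[OF that(1)] near[OF that(2)] by linarith
      then have "\<bar>M (R g) \<one> - mean (R g)\<bar> \<le> 2 * d / 3"
        by (rule mean_near_left[OF Rg M(1) _ one_closed])
      with near[OF one_closed] show ?thesis by linarith
    qed
    have "\<bar>mean (R g) - mean g\<bar> \<le> 0" by (rule field_le_epsilon[OF le])
    then show ?thesis by simp
  qed
  have "\<bar>R' (R (\<lambda>x. f x + g x)) x - (mean f + mean g)\<bar> \<le> e" if "x \<in> carrier G" for x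
  proof -
    have "\<bar>R' (R f) x - mean f\<bar> \<le> e / 2"
      by (rule averaging_near[OF R'(1)]) (use R(2) that in auto)
    then show ?thesis
      using R'(2)[OF that] \<open>mean (R g) = mean g\<close>
      unfolding averaging_add[OF R(1)] averaging_add[OF R'(1)] by linarith
  qed
  then show "\<exists>R. averaging rmult (carrier G) R \<and>
      (\<forall>x\<in>carrier G. \<bar>R (\<lambda>x. f x + g x) x - (mean f + mean g)\<bar> \<le> e)"
    using averaging_compose[OF R'(1) R(1)] by (intro exI[of _ "\<lambda>f. R' (R f)"]) simp
qed

lemma mean_scale:
  assumes f: "continuous_map T euclideanreal f"
  shows "mean (\<lambda>x. c * f x) = c * mean f"
proof (rule mean_eqI)
  show "continuous_map T euclideanreal (\<lambda>x. c * f x)" using f by (rule continuous_map_real_mult_left)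
  fix e :: real assume e: "e > 0"
  then have "e / (\<bar>c\<bar> + 1) > 0" by simp
  then obtain R where R: "averaging rmult (carrier G) R"
    "\<And>x. x \<in> carrier G \<Longrightarrow> \<bar>R f x - mean f\<bar> \<le> e / (\<bar>c\<bar> + 1)"
    using mean_right[OF f] by blast
  have "\<bar>c * R f x - c * mean f\<bar> \<le> e" if "x \<in> carrier G" for x
  proof -
    have "\<bar>c * R f x - c * mean f\<bar> = \<bar>c\<bar> * \<bar>R f x - mean f\<bar>"
      by (simp add: abs_mult[symmetric] algebra_simps)
    also have "\<dots> \<le> \<bar>c\<bar> * (e / (\<bar>c\<bar> + 1))" using R(2)[OF that] by (intro mult_left_mono) auto
    also have "\<dots> \<le> e" using e by (simp add: field_simps)
    finally show ?thesis .
  qed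
  then show "\<exists>R. averaging rmult (carrier G) R \<and> (\<forall>x\<in>carrier G. \<bar>R (\<lambda>x. c * f x) x - c * mean f\<bar> \<le> e)"
    using R(1) by (intro exI[of _ R]) (simp add: averaging_scale)
qed

lemma mean_near:
  assumes f: "continuous_map T euclideanreal f" and "\<And>x. x \<in> carrier G \<Longrightarrow> \<bar>f x - c\<bar> \<le> e"
  shows "\<bar>mean f - c\<bar> \<le> e"
proof (rule field_le_epsilon)
  fix d :: real assume "d > 0"
  then obtain R where R: "averaging rmult (carrier G) R" "\<And>x. x \<in> carrier G \<Longrightarrow> \<bar>R f x - mean f\<bar> \<le> d"
    using mean_right[OF f] by blast
  have "\<bar>R f \<one> - c\<bar> \<le> e" by (rule averaging_near[OF R(1)]) (use assms(2) in auto)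
  with R(2)[OF one_closed] show "\<bar>mean f - c\<bar> \<le> e + d" by linarith
qed

end

section \<open>Charts of vector bundles\<close>

lemma continuous_map_in: "continuous_map X Y f \<Longrightarrow> x \<in> topspace X \<Longrightarrow> f x \<in> topspace Y"
  using continuous_map_image_subset_topspace by blast

text \<open>A local trivialization unpacked into \<tau> and the vector part \<phi> of its inverse,
  the base part of the inverse being the projection. Two continuous maps with pointwise identities
  are easier to restrict, combine and transport than a homeomorphism of subspaces.\<close>

definition vb_chart ::
    "'x topology \<Rightarrow> ('g, 'x, 'e) gbundle \<Rightarrow> 'x set \<Rightarrow> nat \<Rightarrow> ('x \<times> (nat \<Rightarrow> complex) \<Rightarrow> 'e)
      \<Rightarrow> ('e \<Rightarrow> nat \<Rightarrow> complex) \<Rightarrow> bool" where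
  "vb_chart X E U n \<tau> \<phi> \<longleftrightarrow> openin X U \<and>
     continuous_map (prod_topology (subtopology X U) (complex_space n)) (total_space E) \<tau> \<and>
     continuous_map (subtopology (total_space E) (part_over E U)) (complex_space n) \<phi> \<and>
     (\<forall>e\<in>part_over E U. \<tau> (bundle_proj E e, \<phi> e) = e) \<and>
     (\<forall>y\<in>U. \<forall>v\<in>vecs n.
        bundle_proj E (\<tau> (y, v)) = y \<and> \<phi> (\<tau> (y, v)) = v \<and>
        (\<forall>w\<in>vecs n. fibre_add E (\<tau> (y, v)) (\<tau> (y, w)) = \<tau> (y, \<lambda>i. v i + w i)) \<and>
        (\<forall>c. fibre_scale E c (\<tau> (y, v)) = \<tau> (y, \<lambda>i. c * v i)))"

lemma complex_vector_bundle_iff_charts: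
  "complex_vector_bundle X E \<longleftrightarrow> continuous_map (total_space E) X (bundle_proj E) \<and>
     (\<forall>x\<in>topspace X. \<exists>U n \<tau> \<phi>. x \<in> U \<and> vb_chart X E U n \<tau> \<phi>)"
  (is "?L \<longleftrightarrow> ?p \<and> ?R")
proof (intro iffI conjI ballI)
  assume L: ?L
  then show p: ?p by (simp add: complex_vector_bundle_def)
  fix x assume "x \<in> topspace X"
  then obtain U n \<tau> where U: "openin X U" "x \<in> U"
    and h: "homeomorphic_map (prod_topology (subtopology X U) (complex_space n))
       (subtopology (total_space E) (part_over E U)) \<tau>"
    and lin: "\<forall>y\<in>U. \<forall>v\<in>vecs n. bundle_proj E (\<tau> (y, v)) = y \<and>
        (\<forall>w\<in>vecs n. fibre_add E (\<tau> (y, v)) (\<tau> (y, w)) = \<tau> (y, \<lambda>i. v i + w i)) \<and>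
        (\<forall>c. fibre_scale E c (\<tau> (y, v)) = \<tau> (y, \<lambda>i. c * v i))"
    using L[unfolded complex_vector_bundle_def topspace_complex_space, THEN conjunct2, THEN bspec,
      OF \<open>x \<in> topspace X\<close>]
    by (elim exE conjE) (rule that; assumption)
  have US: "U \<subseteq> topspace X" using U(1) by (rule openin_subset)
  obtain \<sigma> where s: "homeomorphic_maps (prod_topology (subtopology X U) (complex_space n))
       (subtopology (total_space E) (part_over E U)) \<tau> \<sigma>"
    using h by (auto simp: homeomorphic_map_maps)
  have s1: "continuous_map (prod_topology (subtopology X U) (complex_space n))
       (subtopology (total_space E) (part_over E U)) \<tau>"
    and s2: "continuous_map (subtopology (total_space E) (part_over E U))
       (prod_topology (subtopology X U) (complex_space n)) \<sigma>"
    and 3: "\<And>y v. y \<in> U \<Longrightarrow> v \<in> vecs n \<Longrightarrow> \<sigma> (\<tau> (y, v)) = (y, v)"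
    and s4: "\<And>e. e \<in> part_over E U \<Longrightarrow> \<tau> (\<sigma> e) = e"
    using s US by (auto simp: homeomorphic_maps_def part_over_def)
  have 4: "\<sigma> e \<in> U \<times> vecs n" if "e \<in> part_over E U" for e
    using continuous_map_in[OF s2, of e] that by (auto simp: part_over_def)
  have 1: "continuous_map (prod_topology (subtopology X U) (complex_space n)) (total_space E) \<tau>"
    using s1 by (simp add: continuous_map_in_subtopology)
  have 2: "continuous_map (subtopology (total_space E) (part_over E U)) (complex_space n) (snd \<circ> \<sigma>)"
    by (rule continuous_map_compose[OF s2 continuous_map_snd])
  have "\<tau> (bundle_proj E e, (snd \<circ> \<sigma>) e) = e" if "e \<in> part_over E U" for e
  proof -
    obtain y v where yv: "\<sigma> e = (y, v)" by fastforce
    then have "e = \<tau> (y, v)" "y \<in> U" "v \<in> vecs n" using 4[OF that] s4[OF that] by auto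
    then show ?thesis using lin yv by auto
  qed
  then have "vb_chart X E U n \<tau> (snd \<circ> \<sigma>)"
    using U(1) 1 2 3 lin unfolding vb_chart_def by simp
  then show "\<exists>U n \<tau> \<phi>. x \<in> U \<and> vb_chart X E U n \<tau> \<phi>" using U(2) by blast
next
  assume pR: "?p \<and> ?R"
  show ?L unfolding complex_vector_bundle_def
  proof (intro conjI ballI)
    show "continuous_map (total_space E) X (bundle_proj E)" using pR by blast
    fix x assume "x \<in> topspace X"
    then obtain U n \<tau> \<phi> where x: "x \<in> U" and c: "vb_chart X E U n \<tau> \<phi>" using pR by blast
    have US: "U \<subseteq> topspace X" using c openin_subset unfolding vb_chart_def by blast
    have "homeomorphic_maps (prod_topology (subtopology X U) (complex_space n))
       (subtopology (total_space E) (part_over E U)) \<tau> (\<lambda>e. (bundle_proj E e, \<phi> e))"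
      unfolding homeomorphic_maps_def
    proof (intro conjI)
      show "continuous_map (prod_topology (subtopology X U) (complex_space n))
         (subtopology (total_space E) (part_over E U)) \<tau>"
        using c US continuous_map_in[of _ "total_space E" \<tau>] unfolding vb_chart_def
        by (auto simp: continuous_map_in_subtopology part_over_def)
      show "continuous_map (subtopology (total_space E) (part_over E U))
          (prod_topology (subtopology X U) (complex_space n)) (\<lambda>e. (bundle_proj E e, \<phi> e))"
        using c pR unfolding vb_chart_def
        by (intro continuous_map_pairedI)
           (auto simp: continuous_map_in_subtopology part_over_def continuous_map_from_subtopology)
    qed (use c US in \<open>auto simp: vb_chart_def part_over_def\<close>)
    then show "\<exists>U n \<tau>. openin X U \<and> x \<in> U \<and> homeomorphic_map
         (prod_topology (subtopology X U) (complex_space n))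
         (subtopology (total_space E) (part_over E U)) \<tau> \<and>
        (\<forall>y\<in>U. \<forall>v\<in>topspace (complex_space n). bundle_proj E (\<tau> (y, v)) = y \<and>
           (\<forall>w\<in>topspace (complex_space n).
              fibre_add E (\<tau> (y, v)) (\<tau> (y, w)) = \<tau> (y, \<lambda>i. v i + w i)) \<and>
           (\<forall>c. fibre_scale E c (\<tau> (y, v)) = \<tau> (y, \<lambda>i. c * v i)))"
      using x c unfolding vb_chart_def
      by (intro exI[of _ U] exI[of _ n] exI[of _ \<tau>]) (auto intro: homeomorphic_maps_imp_map)
  qed
qed

lemma vb_chartD:
  assumes "vb_chart X E U n \<tau> \<phi>"
  shows "openin X U" "U \<subseteq> topspace X"
    "continuous_map (prod_topology (subtopology X U) (complex_space n)) (total_space E) \<tau>"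
    "continuous_map (subtopology (total_space E) (part_over E U)) (complex_space n) \<phi>"
    "\<And>e. e \<in> topspace (total_space E) \<Longrightarrow> bundle_proj E e \<in> U \<Longrightarrow> \<tau> (bundle_proj E e, \<phi> e) = e"
    "\<And>e. e \<in> topspace (total_space E) \<Longrightarrow> bundle_proj E e \<in> U \<Longrightarrow> \<phi> e \<in> vecs n"
    "\<And>y v. y \<in> U \<Longrightarrow> v \<in> vecs n \<Longrightarrow> \<tau> (y, v) \<in> topspace (total_space E)"
    "\<And>y v. y \<in> U \<Longrightarrow> v \<in> vecs n \<Longrightarrow> bundle_proj E (\<tau> (y, v)) = y"
    "\<And>y v. y \<in> U \<Longrightarrow> v \<in> vecs n \<Longrightarrow> \<phi> (\<tau> (y, v)) = v"
    "\<And>y v w. y \<in> U \<Longrightarrow> v \<in> vecs n \<Longrightarrow> w \<in> vecs n \<Longrightarrow>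
        fibre_add E (\<tau> (y, v)) (\<tau> (y, w)) = \<tau> (y, \<lambda>i. v i + w i)"
    "\<And>y v c. y \<in> U \<Longrightarrow> v \<in> vecs n \<Longrightarrow> fibre_scale E c (\<tau> (y, v)) = \<tau> (y, \<lambda>i. c * v i)"
proof -
  show S: "U \<subseteq> topspace X" using assms openin_subset unfolding vb_chart_def by blast
  show "\<tau> (y, v) \<in> topspace (total_space E)" if "y \<in> U" "v \<in> vecs n" for y v
    using assms S that continuous_map_in[of "prod_topology (subtopology X U) (complex_space n)" "total_space E" \<tau> "(y, v)"]
    unfolding vb_chart_def by auto
  show "\<phi> e \<in> vecs n" if "e \<in> topspace (total_space E)" "bundle_proj E e \<in> U" for e
    using assms that continuous_map_in[of "subtopology (total_space E) (part_over E U)" "complex_space n" \<phi> e]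
    unfolding vb_chart_def by (auto simp: part_over_def)
qed (use assms in \<open>auto simp: vb_chart_def part_over_def\<close>)

lemma complex_vector_bundleD:
  assumes "complex_vector_bundle X E"
  shows "continuous_map (total_space E) X (bundle_proj E)"
    and "\<And>e. e \<in> topspace (total_space E) \<Longrightarrow> bundle_proj E e \<in> topspace X"
    and "\<And>x. x \<in> topspace X \<Longrightarrow> \<exists>U n \<tau> \<phi>. x \<in> U \<and> vb_chart X E U n \<tau> \<phi>"
  using assms unfolding complex_vector_bundle_iff_charts by (blast dest: continuous_map_in)+

text \<open>The record puts no condition on the fibre operations. In a chart they are the
  coordinatewise ones, and this forces them to stay in the fibre.\<close>

lemma fibre_ops_closed:
  assumes E: "complex_vector_bundle X E" and e: "e \<in> topspace (total_space E)"
  shows "e' \<in> topspace (total_space E) \<Longrightarrow> bundle_proj E e' = bundle_proj E e \<Longrightarrow>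
      fibre_add E e e' \<in> topspace (total_space E) \<and> bundle_proj E (fibre_add E e e') = bundle_proj E e"
    and "fibre_scale E c e \<in> topspace (total_space E) \<and> bundle_proj E (fibre_scale E c e) = bundle_proj E e"
proof -
  obtain U n \<tau> \<phi> where x: "bundle_proj E e \<in> U" and ch: "vb_chart X E U n \<tau> \<phi>"
    using complex_vector_bundleD[OF E] e by blast
  note D = vb_chartD[OF ch]
  have e_eq: "e = \<tau> (bundle_proj E e, \<phi> e)" "\<phi> e \<in> vecs n" using D(5,6) e x by auto
  have "fibre_scale E c e = \<tau> (bundle_proj E e, \<lambda>i. c * \<phi> e i)"
    by (subst e_eq(1)) (rule D(11)[OF x e_eq(2)])
  then show "fibre_scale E c e \<in> topspace (total_space E) \<and> bundle_proj E (fibre_scale E c e) = bundle_proj E e"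
    using D(7,8) x e_eq(2) by simp
  assume e': "e' \<in> topspace (total_space E)" "bundle_proj E e' = bundle_proj E e"
  have e'_eq: "e' = \<tau> (bundle_proj E e, \<phi> e')" "\<phi> e' \<in> vecs n" using D(5,6) e' x by metis+
  have "fibre_add E e e' = fibre_add E (\<tau> (bundle_proj E e, \<phi> e)) (\<tau> (bundle_proj E e, \<phi> e'))"
    using e_eq e'_eq by simp
  also have "\<dots> = \<tau> (bundle_proj E e, \<lambda>i. \<phi> e i + \<phi> e' i)"
    by (rule D(10)[OF x e_eq(2) e'_eq(2)])
  finally show "fibre_add E e e' \<in> topspace (total_space E) \<and> bundle_proj E (fibre_add E e e') = bundle_proj E e"
    using D(7,8) x e_eq(2) e'_eq(2) by simp
qed

lemma G_spaceD:
  assumes "G_space G T X \<alpha>"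
  shows "continuous_map (prod_topology T X) X (\<lambda>(g, x). \<alpha> g x)"
    and "\<And>x. x \<in> topspace X \<Longrightarrow> \<alpha> \<one>\<^bsub>G\<^esub> x = x"
    and "\<And>g h x. g \<in> carrier G \<Longrightarrow> h \<in> carrier G \<Longrightarrow> x \<in> topspace X \<Longrightarrow> \<alpha> (g \<otimes>\<^bsub>G\<^esub> h) x = \<alpha> g (\<alpha> h x)"
    and "\<And>g x. g \<in> topspace T \<Longrightarrow> x \<in> topspace X \<Longrightarrow> \<alpha> g x \<in> topspace X"
proof -
  show "continuous_map (prod_topology T X) X (\<lambda>(g, x). \<alpha> g x)" using assms by (simp add: G_space_def)
  from continuous_map_in[OF this]
  show "\<alpha> g x \<in> topspace X" if "g \<in> topspace T" "x \<in> topspace X" for g x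
    using that by fastforce
qed (use assms in \<open>auto simp: G_space_def\<close>)

lemma continuous_map_action:
  assumes "G_space G T X \<alpha>" "continuous_map Z T f" "continuous_map Z X g"
  shows "continuous_map Z X (\<lambda>z. \<alpha> (f z) (g z))"
  using continuous_map_compose[OF continuous_map_pairedI[OF assms(2,3)] G_spaceD(1)[OF assms(1)]]
  by (simp add: o_def)

lemma G_vector_bundleD:
  assumes "G_vector_bundle G T X \<alpha> E"
  shows "complex_vector_bundle X E" "G_space G T (total_space E) (bundle_act E)"
    and "\<And>g e. g \<in> carrier G \<Longrightarrow> e \<in> topspace (total_space E) \<Longrightarrow>
        bundle_proj E (bundle_act E g e) = \<alpha> g (bundle_proj E e)"
    and "\<And>g e e'. g \<in> carrier G \<Longrightarrow> e \<in> topspace (total_space E) \<Longrightarrow>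
        e' \<in> topspace (total_space E) \<Longrightarrow> bundle_proj E e' = bundle_proj E e \<Longrightarrow>
        bundle_act E g (fibre_add E e e') = fibre_add E (bundle_act E g e) (bundle_act E g e')"
    and "\<And>g e c. g \<in> carrier G \<Longrightarrow> e \<in> topspace (total_space E) \<Longrightarrow>
        bundle_act E g (fibre_scale E c e) = fibre_scale E c (bundle_act E g e)"
  using assms unfolding G_vector_bundle_def by blast+

section \<open>Isomorphisms, sums and restrictions of bundles\<close>

definition bundle_iso ::
    "('g, 'r) monoid_scheme \<Rightarrow> ('g, 'x, 'e) gbundle \<Rightarrow> ('g, 'x, 'f) gbundle \<Rightarrow> ('e \<Rightarrow> 'f) \<Rightarrow> ('f \<Rightarrow> 'e) \<Rightarrow> bool"
  where
  "bundle_iso G E F \<theta> \<theta>' \<longleftrightarrow> homeomorphic_maps (total_space E) (total_space F) \<theta> \<theta>' \<and>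
     (\<forall>e\<in>topspace (total_space E). bundle_proj F (\<theta> e) = bundle_proj E e \<and>
        (\<forall>e'\<in>topspace (total_space E). bundle_proj E e' = bundle_proj E e \<longrightarrow>
           \<theta> (fibre_add E e e') = fibre_add F (\<theta> e) (\<theta> e')) \<and>
        (\<forall>c. \<theta> (fibre_scale E c e) = fibre_scale F c (\<theta> e)) \<and>
        (\<forall>g\<in>carrier G. \<theta> (bundle_act E g e) = bundle_act F g (\<theta> e)))"

lemma bundle_isomorphic_iff: "bundle_isomorphic G E F \<longleftrightarrow> (\<exists>\<theta> \<theta>'. bundle_iso G E F \<theta> \<theta>')"
  unfolding bundle_isomorphic_def bundle_iso_def homeomorphic_map_maps by simp

lemma bundle_isoI:
  assumes "continuous_map (total_space E) (total_space F) \<theta>"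
    and "continuous_map (total_space F) (total_space E) \<theta>'"
    and "\<And>e. e \<in> topspace (total_space E) \<Longrightarrow> \<theta>' (\<theta> e) = e"
    and "\<And>f. f \<in> topspace (total_space F) \<Longrightarrow> \<theta> (\<theta>' f) = f"
    and "\<And>e. e \<in> topspace (total_space E) \<Longrightarrow> bundle_proj F (\<theta> e) = bundle_proj E e"
    and "\<And>e e'. e \<in> topspace (total_space E) \<Longrightarrow> e' \<in> topspace (total_space E) \<Longrightarrow>
        bundle_proj E e' = bundle_proj E e \<Longrightarrow> \<theta> (fibre_add E e e') = fibre_add F (\<theta> e) (\<theta> e')"
    and "\<And>e c. e \<in> topspace (total_space E) \<Longrightarrow> \<theta> (fibre_scale E c e) = fibre_scale F c (\<theta> e)"
    and "\<And>e g. e \<in> topspace (total_space E) \<Longrightarrow> g \<in> carrier G \<Longrightarrow>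
        \<theta> (bundle_act E g e) = bundle_act F g (\<theta> e)"
  shows "bundle_iso G E F \<theta> \<theta>'"
  using assms by (simp add: bundle_iso_def homeomorphic_maps_def)

lemma bundle_isoD:
  assumes "bundle_iso G E F \<theta> \<theta>'"
  shows "continuous_map (total_space E) (total_space F) \<theta>"
    "continuous_map (total_space F) (total_space E) \<theta>'"
    "\<And>e. e \<in> topspace (total_space E) \<Longrightarrow> \<theta>' (\<theta> e) = e"
    "\<And>f. f \<in> topspace (total_space F) \<Longrightarrow> \<theta> (\<theta>' f) = f"
    "\<And>e. e \<in> topspace (total_space E) \<Longrightarrow> \<theta> e \<in> topspace (total_space F)"
    "\<And>f. f \<in> topspace (total_space F) \<Longrightarrow> \<theta>' f \<in> topspace (total_space E)"
    "\<And>e. e \<in> topspace (total_space E) \<Longrightarrow> bundle_proj F (\<theta> e) = bundle_proj E e"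
    "\<And>f. f \<in> topspace (total_space F) \<Longrightarrow> bundle_proj E (\<theta>' f) = bundle_proj F f"
    "\<And>e e'. e \<in> topspace (total_space E) \<Longrightarrow> e' \<in> topspace (total_space E) \<Longrightarrow>
        bundle_proj E e' = bundle_proj E e \<Longrightarrow> \<theta> (fibre_add E e e') = fibre_add F (\<theta> e) (\<theta> e')"
    "\<And>e c. e \<in> topspace (total_space E) \<Longrightarrow> \<theta> (fibre_scale E c e) = fibre_scale F c (\<theta> e)"
    "\<And>e g. e \<in> topspace (total_space E) \<Longrightarrow> g \<in> carrier G \<Longrightarrow>
        \<theta> (bundle_act E g e) = bundle_act F g (\<theta> e)"
proof -
  show c: "continuous_map (total_space E) (total_space F) \<theta>"
    "continuous_map (total_space F) (total_space E) \<theta>'"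
    and "\<And>e. e \<in> topspace (total_space E) \<Longrightarrow> \<theta>' (\<theta> e) = e"
    and i: "\<And>f. f \<in> topspace (total_space F) \<Longrightarrow> \<theta> (\<theta>' f) = f"
    and p: "\<And>e. e \<in> topspace (total_space E) \<Longrightarrow> bundle_proj F (\<theta> e) = bundle_proj E e"
    using assms by (simp_all add: bundle_iso_def homeomorphic_maps_def)
  show "\<theta> e \<in> topspace (total_space F)" if "e \<in> topspace (total_space E)" for e
    using continuous_map_in[OF c(1) that] .
  show r: "\<theta>' f \<in> topspace (total_space E)" if "f \<in> topspace (total_space F)" for f
    using continuous_map_in[OF c(2) that] .
  show "bundle_proj E (\<theta>' f) = bundle_proj F f" if "f \<in> topspace (total_space F)" for f
    using p[OF r[OF that]] i[OF that] by simp
qed (use assms in \<open>simp_all add: bundle_iso_def\<close>)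

lemma bundle_isomorphicI: "bundle_iso G E F \<theta> \<theta>' \<Longrightarrow> bundle_isomorphic G E F"
  using bundle_isomorphic_iff by blast

lemma bundle_isomorphic_refl: "bundle_isomorphic G E E"
  unfolding bundle_isomorphic_def by (intro exI[of _ id]) auto

lemma bundle_isomorphic_trans:
  assumes "bundle_isomorphic G E F" "bundle_isomorphic G F D"
  shows "bundle_isomorphic G E D"
proof -
  obtain \<theta> \<theta>' \<eta> \<eta>' where "bundle_iso G E F \<theta> \<theta>'" "bundle_iso G F D \<eta> \<eta>'"
    using assms unfolding bundle_isomorphic_iff by blast
  note t = bundle_isoD[OF this(1)] and h = bundle_isoD[OF this(2)]
  have "bundle_iso G E D (\<eta> \<circ> \<theta>) (\<theta>' \<circ> \<eta>')"
    by (rule bundle_isoI) (use continuous_map_compose[OF t(1) h(1)] continuous_map_compose[OF h(2) t(2)]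
        t(3-11) h(3-11) in simp_all)
  then show ?thesis by (rule bundle_isomorphicI)
qed

context group_with_topology
begin

text \<open>Only \<open>E\<close> is assumed to be a bundle. Its operations stay in its total space,
  so \<theta>' undoes \<theta> on their results.\<close>

lemma bundle_isomorphic_sym:
  assumes iso: "bundle_isomorphic G E F" and E: "G_vector_bundle G T X \<alpha> E"
  shows "bundle_isomorphic G F E"
proof -
  note E' = G_vector_bundleD[OF E]
  note cl = fibre_ops_closed[OF E'(1)]
  obtain \<theta> \<theta>' where "bundle_iso G E F \<theta> \<theta>'"
    using iso unfolding bundle_isomorphic_iff by blast
  note t = bundle_isoD[OF this]
  show ?thesis
  proof (rule bundle_isomorphicI, rule bundle_isoI[OF t(2,1,4,3,8)])
    fix f f' assume f: "f \<in> topspace (total_space F)" "f' \<in> topspace (total_space F)"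
      "bundle_proj F f' = bundle_proj F f"
    then have eq: "fibre_add F f f' = \<theta> (fibre_add E (\<theta>' f) (\<theta>' f'))" using t by simp
    have "fibre_add E (\<theta>' f) (\<theta>' f') \<in> topspace (total_space E)"
      using cl(1)[of "\<theta>' f" "\<theta>' f'"] t(6,8) f by simp
    then show "\<theta>' (fibre_add F f f') = fibre_add E (\<theta>' f) (\<theta>' f')"
      unfolding eq by (rule t(3))
  next
    fix f c assume f: "f \<in> topspace (total_space F)"
    then have eq: "fibre_scale F c f = \<theta> (fibre_scale E c (\<theta>' f))" using t by simp
    have "fibre_scale E c (\<theta>' f) \<in> topspace (total_space E)"
      using cl(2)[of "\<theta>' f"] t(6) f by simp
    then show "\<theta>' (fibre_scale F c f) = fibre_scale E c (\<theta>' f)"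
      unfolding eq by (rule t(3))
  next
    fix f g assume f: "f \<in> topspace (total_space F)" and g: "g \<in> carrier G"
    then have eq: "bundle_act F g f = \<theta> (bundle_act E g (\<theta>' f))" using t by simp
    have "bundle_act E g (\<theta>' f) \<in> topspace (total_space E)"
      using G_spaceD(4)[OF E'(2)] t(6) f g topspace_eq by simp
    then show "\<theta>' (bundle_act F g f) = bundle_act E g (\<theta>' f)"
      unfolding eq by (rule t(3))
  qed auto
qed

text \<open>Transport of structure: on the total space of \<open>F\<close> every operation is the
  conjugate by \<theta> of that of \<open>E\<close>. It is used to recognize copies over another
  type as bundles.\<close>

lemma G_vector_bundle_isomorphic:
  assumes iso: "bundle_isomorphic G E F" and E: "G_vector_bundle G T X \<alpha> E"
  shows "G_vector_bundle G T X \<alpha> F"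
proof -
  note E' = G_vector_bundleD[OF E]
  note cl = fibre_ops_closed[OF E'(1)]
  note act = G_spaceD[OF E'(2)]
  obtain \<theta> \<theta>' where "bundle_iso G E F \<theta> \<theta>'"
    using iso unfolding bundle_isomorphic_iff by blast
  note t = bundle_isoD[OF this]
  have add: "fibre_add F f f' = \<theta> (fibre_add E (\<theta>' f) (\<theta>' f'))"
    if "f \<in> topspace (total_space F)" "f' \<in> topspace (total_space F)" "bundle_proj F f' = bundle_proj F f" for f f'
    using t that by simp
  have scale: "fibre_scale F c f = \<theta> (fibre_scale E c (\<theta>' f))" if "f \<in> topspace (total_space F)" for f c
    using t that by simp
  have actF: "bundle_act F g f = \<theta> (bundle_act E g (\<theta>' f))"
    if "g \<in> carrier G" "f \<in> topspace (total_space F)" for f g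
    using t that by simp
  have "complex_vector_bundle X F"
    unfolding complex_vector_bundle_iff_charts
  proof (intro conjI ballI)
    have "continuous_map (total_space F) X (bundle_proj E \<circ> \<theta>')"
      by (rule continuous_map_compose[OF t(2) complex_vector_bundleD(1)[OF E'(1)]])
    then show "continuous_map (total_space F) X (bundle_proj F)"
      by (rule continuous_map_eq) (simp add: t(8))
    fix x assume "x \<in> topspace X"
    then obtain U n \<tau> \<phi> where x: "x \<in> U" and ch: "vb_chart X E U n \<tau> \<phi>"
      using complex_vector_bundleD(3)[OF E'(1)] by blast
    note D = vb_chartD[OF ch]
    have "vb_chart X F U n (\<theta> \<circ> \<tau>) (\<phi> \<circ> \<theta>')"
      unfolding vb_chart_def
    proof (intro conjI ballI allI)
      show "continuous_map (prod_topology (subtopology X U) (complex_space n)) (total_space F) (\<theta> \<circ> \<tau>)"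
        by (rule continuous_map_compose[OF D(3) t(1)])
      show "continuous_map (subtopology (total_space F) (part_over F U)) (complex_space n) (\<phi> \<circ> \<theta>')"
        by (rule continuous_map_compose[OF _ D(4)])
           (use t(2,6,8) in \<open>auto simp: continuous_map_in_subtopology continuous_map_from_subtopology part_over_def\<close>)
      show "(\<theta> \<circ> \<tau>) (bundle_proj F e, (\<phi> \<circ> \<theta>') e) = e" if "e \<in> part_over F U" for e
        using that D(5)[of "\<theta>' e"] t by (auto simp: part_over_def)
    qed (use D(1,2,7-11) t(3,7) in \<open>simp_all add: t(9)[symmetric] t(10)[symmetric]\<close>)
    then show "\<exists>U n \<tau> \<phi>. x \<in> U \<and> vb_chart X F U n \<tau> \<phi>" using x by blast
  qed
  moreover have "G_space G T (total_space F) (bundle_act F)"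
    unfolding G_space_def
  proof (intro conjI ballI)
    have "continuous_map (prod_topology T (total_space F)) (total_space F)
        (\<theta> \<circ> (\<lambda>p. bundle_act E (fst p) (\<theta>' (snd p))))"
      by (intro continuous_map_compose[OF continuous_map_action[OF E'(2)] t(1)] continuous_map_fst
          continuous_map_compose[OF continuous_map_snd t(2), unfolded o_def])
    then show "continuous_map (prod_topology T (total_space F)) (total_space F) (\<lambda>(g, x). bundle_act F g x)"
      by (rule continuous_map_eq) (auto simp: actF topspace_eq)
    fix f assume f: "f \<in> topspace (total_space F)"
    have i: "\<theta>' f \<in> topspace (total_space E)" using t f by simp
    show "bundle_act F \<one> f = f"
      using actF[OF one_closed f] act(2)[OF i] t(4)[OF f] by simp
    fix g h assume g: "g \<in> carrier G" and h: "h \<in> carrier G"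
    have hi: "bundle_act E h (\<theta>' f) \<in> topspace (total_space E)" using act(4) h i topspace_eq by simp
    show "bundle_act F (g \<otimes> h) f = bundle_act F g (bundle_act F h f)"
      using actF[OF m_closed[OF g h] f] actF[OF h f] act(3)[OF g h i] t(11)[OF hi g] by simp
  qed
  moreover have "bundle_proj F (bundle_act F g f) = \<alpha> g (bundle_proj F f) \<and>
      (\<forall>f'\<in>topspace (total_space F). bundle_proj F f' = bundle_proj F f \<longrightarrow>
         bundle_act F g (fibre_add F f f') = fibre_add F (bundle_act F g f) (bundle_act F g f')) \<and>
      (\<forall>c. bundle_act F g (fibre_scale F c f) = fibre_scale F c (bundle_act F g f))"
    if g: "g \<in> carrier G" and f: "f \<in> topspace (total_space F)" for g f
  proof (intro conjI ballI impI allI)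
    have i: "\<theta>' f \<in> topspace (total_space E)" using t f by simp
    have gi: "bundle_act E g (\<theta>' f) \<in> topspace (total_space E)" using act(4) g i topspace_eq by simp
    show "bundle_proj F (bundle_act F g f) = \<alpha> g (bundle_proj F f)"
      using actF[OF g f] t(7)[OF gi] E'(3)[OF g i] t(8)[OF f] by simp
    show "bundle_act F g (fibre_scale F c f) = fibre_scale F c (bundle_act F g f)" for c
      using actF[OF g f] scale[OF f] t(11)[OF conjunct1[OF cl(2)[OF i]] g, symmetric] E'(5)[OF g i] t(10)[OF gi]
      by simp
    fix f' assume f': "f' \<in> topspace (total_space F)" "bundle_proj F f' = bundle_proj F f"
    have i': "\<theta>' f' \<in> topspace (total_space E)" "bundle_proj E (\<theta>' f') = bundle_proj E (\<theta>' f)"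
      using t f f' by simp_all
    have gi': "bundle_act E g (\<theta>' f') \<in> topspace (total_space E)" using act(4) g i' topspace_eq by simp
    have p: "bundle_proj E (bundle_act E g (\<theta>' f')) = bundle_proj E (bundle_act E g (\<theta>' f))"
      using E'(3)[OF g i] E'(3)[OF g i'(1)] i'(2) by simp
    show "bundle_act F g (fibre_add F f f') = fibre_add F (bundle_act F g f) (bundle_act F g f')"
      using actF[OF g f] actF[OF g f'(1)] add[OF f f'] t(11)[OF conjunct1[OF cl(1)[OF i i']] g, symmetric]
        E'(4)[OF g i i'] t(9)[OF gi gi' p] by simp
  qed
  ultimately show ?thesis
    unfolding G_vector_bundle_def by blast
qed

end

subsection \<open>Whitney sums\<close>

lemma continuous_map_into_whitney:
  assumes "continuous_map Z (total_space E) f" "continuous_map Z (total_space F) g"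
    and "\<And>z. z \<in> topspace Z \<Longrightarrow> bundle_proj E (f z) = bundle_proj F (g z)"
  shows "continuous_map Z (total_space (whitney_sum E F)) (\<lambda>z. (f z, g z))"
  using assms by (auto simp: whitney_sum_def continuous_map_in_subtopology intro: continuous_map_pairedI)

lemma topspace_whitney:
  "topspace (total_space (whitney_sum E F)) =
     {(e, f). e \<in> topspace (total_space E) \<and> f \<in> topspace (total_space F) \<and> bundle_proj E e = bundle_proj F f}"
  by (auto simp: whitney_sum_def)

lemma continuous_map_whitney_fst: "continuous_map (total_space (whitney_sum E F)) (total_space E) fst"
  and continuous_map_whitney_snd: "continuous_map (total_space (whitney_sum E F)) (total_space F) snd"
  by (auto simp: whitney_sum_def intro: continuous_map_from_subtopology continuous_map_fst continuous_map_snd)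

lemma whitney_simps [simp]:
  "bundle_proj (whitney_sum E F) (e, f) = bundle_proj E e"
  "fibre_add (whitney_sum E F) (e, f) (e', f') = (fibre_add E e e', fibre_add F f f')"
  "fibre_scale (whitney_sum E F) c (e, f) = (fibre_scale E c e, fibre_scale F c f)"
  "bundle_act (whitney_sum E F) g (e, f) = (bundle_act E g e, bundle_act F g f)"
  by (simp_all add: whitney_sum_def)

lemma vb_chart_subset:
  assumes "vb_chart X E U n \<tau> \<phi>" "openin X V" "V \<subseteq> U"
  shows "vb_chart X E V n \<tau> \<phi>"
proof -
  have "continuous_map (prod_topology (subtopology X V) (complex_space n)) (total_space E) \<tau>"
  proof -
    have "prod_topology (subtopology X V) (complex_space n) =
        subtopology (prod_topology (subtopology X U) (complex_space n)) (V \<times> vecs n)"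
      using assms(3) by (simp add: prod_topology_subtopology(1) subtopology_subtopology Times_Int_Times inf.absorb2)
    then show ?thesis using vb_chartD(3)[OF assms(1)] by (simp add: continuous_map_from_subtopology)
  qed
  moreover have "continuous_map (subtopology (total_space E) (part_over E V)) (complex_space n) \<phi>"
    by (rule continuous_map_from_subtopology_mono[OF vb_chartD(4)[OF assms(1)]])
       (use assms(3) in \<open>auto simp: part_over_def\<close>)
  ultimately show ?thesis
    using assms unfolding vb_chart_def part_over_def by (auto simp: subset_iff)
qed

lemma whitney_charts:
  assumes "vb_chart X E U n1 \<tau> \<phi>" "vb_chart X F U n2 \<sigma> \<psi>"
  shows "vb_chart X (whitney_sum E F) U (n1 + n2)
     (\<lambda>(y, v). (\<tau> (y, \<lambda>i. if i < n1 then v i else 0), \<sigma> (y, \<lambda>i. v (i + n1))))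
     (\<lambda>(e, f) i. if i < n1 then \<phi> e i else \<psi> f (i - n1))"
proof -
  note D = vb_chartD[OF assms(1)] and D' = vb_chartD[OF assms(2)]
  let ?Z = "prod_topology (subtopology X U) (complex_space (n1 + n2))"
  let ?P = "subtopology (total_space (whitney_sum E F)) (part_over (whitney_sum E F) U)"
  have v1: "(\<lambda>i. if i < n1 then v i else 0) \<in> vecs n1" for v :: "nat \<Rightarrow> complex"
    by (auto simp: vecs_def)
  have v2: "(\<lambda>i. v (i + n1)) \<in> vecs n2" if "v \<in> vecs (n1 + n2)" for v :: "nat \<Rightarrow> complex"
    using that by (auto simp: vecs_def)
  have coord: "continuous_map ?Z euclidean (\<lambda>p. snd p i)" for i
    using continuous_map_compose[OF continuous_map_snd continuous_map_complex_space_coord] by (simp add: o_def)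
  have "continuous_map ?Z (complex_space n1) (\<lambda>p i. if i < n1 then snd p i else 0)"
    using coord v1 by (auto simp: continuous_map_complex_space_iff)
  then have c1: "continuous_map ?Z (total_space E) (\<lambda>p. \<tau> (fst p, \<lambda>i. if i < n1 then snd p i else 0))"
    using continuous_map_compose[OF continuous_map_pairedI[OF continuous_map_fst] D(3)] by (simp add: o_def)
  have "continuous_map ?Z (complex_space n2) (\<lambda>p i. snd p (i + n1))"
    using coord v2 by (auto simp: continuous_map_complex_space_iff)
  then have c2: "continuous_map ?Z (total_space F) (\<lambda>p. \<sigma> (fst p, \<lambda>i. snd p (i + n1)))"
    using continuous_map_compose[OF continuous_map_pairedI[OF continuous_map_fst] D'(3)] by (simp add: o_def)
  have "continuous_map ?Z (total_space (whitney_sum E F))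
      (\<lambda>p. (\<tau> (fst p, \<lambda>i. if i < n1 then snd p i else 0), \<sigma> (fst p, \<lambda>i. snd p (i + n1))))"
    by (rule continuous_map_into_whitney[OF c1 c2]) (use D(8) D'(8) v1 v2 in auto)
  then have 1: "continuous_map ?Z (total_space (whitney_sum E F))
     (\<lambda>(y, v). (\<tau> (y, \<lambda>i. if i < n1 then v i else 0), \<sigma> (y, \<lambda>i. v (i + n1))))"
    by (simp add: case_prod_unfold)
  have "continuous_map ?P (subtopology (total_space E) (part_over E U)) fst"
    using continuous_map_from_subtopology[OF continuous_map_whitney_fst]
    by (auto simp: continuous_map_in_subtopology part_over_def topspace_whitney)
  from continuous_map_compose[OF this D(4)]
  have p1: "continuous_map ?P euclidean (\<lambda>p. \<phi> (fst p) i)" for i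
    by (simp add: o_def continuous_map_complex_space_iff)
  have "continuous_map ?P (subtopology (total_space F) (part_over F U)) snd"
    using continuous_map_from_subtopology[OF continuous_map_whitney_snd]
    by (auto simp: continuous_map_in_subtopology part_over_def topspace_whitney)
  from continuous_map_compose[OF this D'(4)]
  have p2: "continuous_map ?P euclidean (\<lambda>p. \<psi> (snd p) i)" for i
    by (simp add: o_def continuous_map_complex_space_iff)
  have "(\<lambda>i. if i < n1 then \<phi> e i else \<psi> f (i - n1)) \<in> vecs (n1 + n2)"
    if "(e, f) \<in> topspace ?P" for e f
    using that D'(6)[of f] by (auto simp: vecs_def part_over_def topspace_whitney)
  then have 2: "continuous_map ?P (complex_space (n1 + n2)) (\<lambda>(e, f) i. if i < n1 then \<phi> e i else \<psi> f (i - n1))"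
    using p1 p2 by (auto simp: continuous_map_complex_space_iff case_prod_unfold)
  have 3: "(\<lambda>i. if i < n1 then if i < n1 then \<phi> e i else \<psi> f (i - n1) else 0) = \<phi> e"
    if "e \<in> topspace (total_space E)" "bundle_proj E e \<in> U" for e f
    using D(6)[OF that] by (auto simp: vecs_def)
  have 4: "(\<lambda>i. if i < n1 then if i < n1 then v i else 0 else v (i - n1 + n1)) = v" for v :: "nat \<Rightarrow> complex"
    by auto
  have 5: "(\<lambda>i. if i < n1 then v i + w i else 0) = (\<lambda>i. (if i < n1 then v i else 0) + (if i < n1 then w i else 0))"
    for v w :: "nat \<Rightarrow> complex" by auto
  have 6: "(\<lambda>i. if i < n1 then c * v i else 0) = (\<lambda>i. c * (if i < n1 then v i else 0))"
    for c and v :: "nat \<Rightarrow> complex" by auto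
  show ?thesis
    unfolding vb_chart_def
  proof (intro conjI ballI allI)
    fix e assume "e \<in> part_over (whitney_sum E F) U"
    then obtain a b where ab: "e = (a, b)" "a \<in> topspace (total_space E)" "b \<in> topspace (total_space F)"
      "bundle_proj E a = bundle_proj F b" "bundle_proj E a \<in> U"
      by (auto simp: part_over_def topspace_whitney)
    then show "(case (bundle_proj (whitney_sum E F) e, case e of (e, f) \<Rightarrow> \<lambda>i. if i < n1 then \<phi> e i else \<psi> f (i - n1)) of
        (y, v) \<Rightarrow> (\<tau> (y, \<lambda>i. if i < n1 then v i else 0), \<sigma> (y, \<lambda>i. v (i + n1)))) = e"
      using D(5)[of a] D'(5)[of b] by (simp add: 3)
  next
    fix y v assume y: "y \<in> U" and v: "v \<in> vecs (n1 + n2)"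
    show "(case (case (y, v) of (y, v) \<Rightarrow> (\<tau> (y, \<lambda>i. if i < n1 then v i else 0), \<sigma> (y, \<lambda>i. v (i + n1))))
        of (e, f) \<Rightarrow> \<lambda>i. if i < n1 then \<phi> e i else \<psi> f (i - n1)) = v"
      using D(9)[OF y v1] D'(9)[OF y v2[OF v]] by (auto simp: fun_eq_iff)
  qed (use 1 2 D D' v1 v2 in \<open>simp_all add: 5 6\<close>)
qed

context group_with_topology
begin

lemma G_vector_bundle_whitney:
  assumes E: "G_vector_bundle G T X \<alpha> E" and F: "G_vector_bundle G T X \<alpha> F"
  shows "G_vector_bundle G T X \<alpha> (whitney_sum E F)"
proof -
  note E' = G_vector_bundleD[OF E] and F' = G_vector_bundleD[OF F]
  note aE = G_spaceD[OF E'(2)] and aF = G_spaceD[OF F'(2)]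
  have "complex_vector_bundle X (whitney_sum E F)"
    unfolding complex_vector_bundle_iff_charts
  proof (intro conjI ballI)
    show "continuous_map (total_space (whitney_sum E F)) X (bundle_proj (whitney_sum E F))"
      using continuous_map_compose[OF continuous_map_whitney_fst complex_vector_bundleD(1)[OF E'(1)]]
      by (rule continuous_map_eq) (auto simp: topspace_whitney)
    fix x assume x: "x \<in> topspace X"
    obtain U n \<tau> \<phi> where U: "x \<in> U" "vb_chart X E U n \<tau> \<phi>"
      using complex_vector_bundleD(3)[OF E'(1) x] by blast
    obtain V m \<sigma> \<psi> where V: "x \<in> V" "vb_chart X F V m \<sigma> \<psi>"
      using complex_vector_bundleD(3)[OF F'(1) x] by blast
    have "openin X (U \<inter> V)" using vb_chartD(1)[OF U(2)] vb_chartD(1)[OF V(2)] by blast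
    then have "vb_chart X E (U \<inter> V) n \<tau> \<phi>" "vb_chart X F (U \<inter> V) m \<sigma> \<psi>"
      using vb_chart_subset[OF U(2)] vb_chart_subset[OF V(2)] by auto
    from whitney_charts[OF this] show "\<exists>U n \<tau> \<phi>. x \<in> U \<and> vb_chart X (whitney_sum E F) U n \<tau> \<phi>"
      using U(1) V(1) by blast
  qed
  moreover have "G_space G T (total_space (whitney_sum E F)) (bundle_act (whitney_sum E F))"
    unfolding G_space_def
  proof (intro conjI ballI)
    let ?Z = "prod_topology T (total_space (whitney_sum E F))"
    have "continuous_map ?Z (total_space (whitney_sum E F))
       (\<lambda>p. (bundle_act E (fst p) (fst (snd p)), bundle_act F (fst p) (snd (snd p))))"
      by (rule continuous_map_into_whitney)
         (use E'(3) F'(3) in \<open>auto intro!: continuous_map_action[OF E'(2)] continuous_map_action[OF F'(2)]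
           continuous_map_fst continuous_map_compose[OF continuous_map_snd continuous_map_whitney_fst, unfolded o_def]
           continuous_map_compose[OF continuous_map_snd continuous_map_whitney_snd, unfolded o_def]
           simp: topspace_whitney topspace_eq\<close>)
    then show "continuous_map ?Z (total_space (whitney_sum E F)) (\<lambda>(g, x). bundle_act (whitney_sum E F) g x)"
      by (rule continuous_map_eq) auto
  qed (auto simp: topspace_whitney aE aF)
  ultimately show ?thesis
    unfolding G_vector_bundle_def
    by (auto simp: topspace_whitney E'(3-5) F'(3-5))
qed

end

lemma vecs_0 [simp]: "v \<in> vecs 0 \<longleftrightarrow> v = (\<lambda>i. 0)"
  by (auto simp: vecs_def)

lemma bundle_iso_whitney:
  assumes "bundle_iso G E E' \<theta> \<theta>'" "bundle_iso G F F' \<eta> \<eta>'"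
  shows "bundle_iso G (whitney_sum E F) (whitney_sum E' F') (\<lambda>p. (\<theta> (fst p), \<eta> (snd p))) (\<lambda>p. (\<theta>' (fst p), \<eta>' (snd p)))"
proof -
  note t = bundle_isoD[OF assms(1)] and h = bundle_isoD[OF assms(2)]
  show ?thesis
  proof (rule bundle_isoI)
    show "continuous_map (total_space (whitney_sum E F)) (total_space (whitney_sum E' F')) (\<lambda>p. (\<theta> (fst p), \<eta> (snd p)))"
      using continuous_map_compose[OF continuous_map_whitney_fst t(1)] continuous_map_compose[OF continuous_map_whitney_snd h(1)]
      by (intro continuous_map_into_whitney) (auto simp: o_def topspace_whitney t(7) h(7))
    show "continuous_map (total_space (whitney_sum E' F')) (total_space (whitney_sum E F)) (\<lambda>p. (\<theta>' (fst p), \<eta>' (snd p)))"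
      using continuous_map_compose[OF continuous_map_whitney_fst t(2)] continuous_map_compose[OF continuous_map_whitney_snd h(2)]
      by (intro continuous_map_into_whitney) (auto simp: o_def topspace_whitney t(8) h(8))
  qed (auto simp: topspace_whitney t(3-11) h(3-11))
qed

lemma whitney_cong:
  "bundle_isomorphic G E E' \<Longrightarrow> bundle_isomorphic G F F' \<Longrightarrow>
     bundle_isomorphic G (whitney_sum E F) (whitney_sum E' F')"
  unfolding bundle_isomorphic_iff using bundle_iso_whitney by blast

lemma whitney_comm: "bundle_isomorphic G (whitney_sum E F) (whitney_sum F E)"
proof (rule bundle_isomorphicI, rule bundle_isoI)
  show "continuous_map (total_space (whitney_sum E F)) (total_space (whitney_sum F E)) (\<lambda>p. (snd p, fst p))"
    "continuous_map (total_space (whitney_sum F E)) (total_space (whitney_sum E F)) (\<lambda>p. (snd p, fst p))"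
    by (rule continuous_map_into_whitney[OF continuous_map_whitney_snd continuous_map_whitney_fst],
        auto simp: topspace_whitney)+
qed (auto simp: topspace_whitney)

lemma whitney_assoc:
  "bundle_isomorphic G (whitney_sum (whitney_sum E F) D) (whitney_sum E (whitney_sum F D))"
proof (rule bundle_isomorphicI, rule bundle_isoI)
  let ?L = "whitney_sum (whitney_sum E F) D" and ?R = "whitney_sum E (whitney_sum F D)"
  have 1: "continuous_map (total_space ?L) (total_space E) (\<lambda>p. fst (fst p))"
    and 2: "continuous_map (total_space ?L) (total_space F) (\<lambda>p. snd (fst p))"
    using continuous_map_compose[OF continuous_map_whitney_fst continuous_map_whitney_fst]
      continuous_map_compose[OF continuous_map_whitney_fst continuous_map_whitney_snd]
    by (simp_all add: o_def)
  show "continuous_map (total_space ?L) (total_space ?R) (\<lambda>p. (fst (fst p), (snd (fst p), snd p)))"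
    by (intro continuous_map_into_whitney 1 2 continuous_map_whitney_snd) (auto simp: topspace_whitney)
  have 1: "continuous_map (total_space ?R) (total_space F) (\<lambda>p. fst (snd p))"
    and 2: "continuous_map (total_space ?R) (total_space D) (\<lambda>p. snd (snd p))"
    using continuous_map_compose[OF continuous_map_whitney_snd continuous_map_whitney_fst]
      continuous_map_compose[OF continuous_map_whitney_snd continuous_map_whitney_snd]
    by (simp_all add: o_def)
  show "continuous_map (total_space ?R) (total_space ?L) (\<lambda>p. ((fst p, fst (snd p)), snd (snd p)))"
    by (intro continuous_map_into_whitney 1 2 continuous_map_whitney_fst) (auto simp: topspace_whitney)
qed (auto simp: topspace_whitney)

lemma whitney_zero:
  assumes "complex_vector_bundle X E"
  shows "bundle_isomorphic G (whitney_sum (zero_bundle X \<alpha>) E) E"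
proof (rule bundle_isomorphicI, rule bundle_isoI)
  note E = complex_vector_bundleD[OF assms]
  show "continuous_map (total_space (whitney_sum (zero_bundle X \<alpha>) E)) (total_space E) snd"
    by (rule continuous_map_whitney_snd)
  show "continuous_map (total_space E) (total_space (whitney_sum (zero_bundle X \<alpha>) E))
      (\<lambda>e. ((bundle_proj E e, \<lambda>i. 0), e))"
    using E(1) by (intro continuous_map_into_whitney) (auto simp: zero_bundle_def intro!: continuous_map_pairedI)
qed (auto simp: topspace_whitney zero_bundle_def dest: complex_vector_bundleD(2)[OF assms])

subsection \<open>Product bundles\<close>

definition product_bundle ::
    "'x topology \<Rightarrow> ('g \<Rightarrow> 'x \<Rightarrow> 'x) \<Rightarrow> nat \<Rightarrow> ('g \<Rightarrow> (nat \<Rightarrow> complex) \<Rightarrow> nat \<Rightarrow> complex)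
      \<Rightarrow> ('g, 'x) std_bundle" where
  "product_bundle X \<alpha> n r =
     \<lparr>total_space = prod_topology X (complex_space n),
      bundle_proj = fst,
      fibre_add = (\<lambda>(x, v) (y, w). (x, \<lambda>i. v i + w i)),
      fibre_scale = (\<lambda>c (x, v). (x, \<lambda>i. c * v i)),
      bundle_act = (\<lambda>g (x, v). (\<alpha> g x, r g v))\<rparr>"

lemma product_bundle_simps [simp]:
  "total_space (product_bundle X \<alpha> n r) = prod_topology X (complex_space n)"
  "bundle_proj (product_bundle X \<alpha> n r) = fst"
  "fibre_add (product_bundle X \<alpha> n r) (x, v) (y, w) = (x, \<lambda>i. v i + w i)"
  "fibre_scale (product_bundle X \<alpha> n r) c (x, v) = (x, \<lambda>i. c * v i)"
  "bundle_act (product_bundle X \<alpha> n r) g (x, v) = (\<alpha> g x, r g v)"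
  by (simp_all add: product_bundle_def)

definition lin_rep ::
    "('g, 'r) monoid_scheme \<Rightarrow> 'g topology \<Rightarrow> nat \<Rightarrow> ('g \<Rightarrow> (nat \<Rightarrow> complex) \<Rightarrow> nat \<Rightarrow> complex) \<Rightarrow> bool" where
  "lin_rep G T n r \<longleftrightarrow> G_space G T (complex_space n) r \<and> (\<forall>g\<in>carrier G. lin_map n n (r g))"

lemma lin_repD:
  assumes "lin_rep G T n r"
  shows "G_space G T (complex_space n) r" "\<And>g. g \<in> carrier G \<Longrightarrow> lin_map n n (r g)"
    "\<And>g v. g \<in> carrier G \<Longrightarrow> v \<in> vecs n \<Longrightarrow> r g v \<in> vecs n"
    "\<And>v. v \<in> vecs n \<Longrightarrow> r \<one>\<^bsub>G\<^esub> v = v"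
    "\<And>g h v. g \<in> carrier G \<Longrightarrow> h \<in> carrier G \<Longrightarrow> v \<in> vecs n \<Longrightarrow> r (g \<otimes>\<^bsub>G\<^esub> h) v = r g (r h v)"
proof -
  show "lin_map n n (r g)" if "g \<in> carrier G" for g using assms that by (simp add: lin_rep_def)
  then show "r g v \<in> vecs n" if "g \<in> carrier G" "v \<in> vecs n" for g v using lin_map_in that by blast
qed (use assms in \<open>auto simp: lin_rep_def G_space_def\<close>)

context group_with_topology
begin

lemma G_vector_bundle_product:
  assumes X: "G_space G T X \<alpha>" and r: "lin_rep G T n r"
  shows "G_vector_bundle G T X \<alpha> (product_bundle X \<alpha> n r)"
proof -
  note r' = lin_repD[OF r] and a = G_spaceD[OF X]
  let ?P = "product_bundle X \<alpha> n r"
  have "vb_chart X ?P (topspace X) n (\<lambda>p. p) snd"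
    unfolding vb_chart_def
    by (auto simp: part_over_def continuous_map_snd intro: continuous_map_from_subtopology continuous_map_id[unfolded id_def])
  then have "complex_vector_bundle X ?P"
    unfolding complex_vector_bundle_iff_charts using continuous_map_fst by fastforce
  moreover have "G_space G T (total_space ?P) (bundle_act ?P)"
    unfolding G_space_def
  proof (intro conjI ballI)
    let ?Z = "prod_topology T (prod_topology X (complex_space n))"
    have 1: "continuous_map ?Z X (\<lambda>p. fst (snd p))" and 2: "continuous_map ?Z (complex_space n) (\<lambda>p. snd (snd p))"
      using continuous_map_compose[OF continuous_map_snd continuous_map_fst]
        continuous_map_compose[OF continuous_map_snd continuous_map_snd] by (simp_all add: o_def)
    have "continuous_map ?Z (prod_topology X (complex_space n))
       (\<lambda>p. (\<alpha> (fst p) (fst (snd p)), r (fst p) (snd (snd p))))"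
      by (intro continuous_map_pairedI continuous_map_action[OF X continuous_map_fst 1]
          continuous_map_action[OF r'(1) continuous_map_fst 2])
    then show "continuous_map (prod_topology T (total_space ?P)) (total_space ?P) (\<lambda>(g, x). bundle_act ?P g x)"
      unfolding product_bundle_simps by (rule continuous_map_eq) auto
  qed (auto simp: a r')
  ultimately show ?thesis
    unfolding G_vector_bundle_def
    by (auto simp: lin_map_add[OF r'(2)] lin_map_scale[OF r'(2)])
qed

lemma lin_rep_trivial: "lin_rep G T n (\<lambda>g v. v)"
  by (auto simp: lin_rep_def G_space_def lin_map_def case_prod_unfold continuous_map_snd)

lemma G_vector_bundle_zero:
  assumes "G_space G T X \<alpha>"
  shows "G_vector_bundle G T X \<alpha> (zero_bundle X \<alpha>)"
proof (rule G_vector_bundle_isomorphic[OF _ G_vector_bundle_product[OF assms lin_rep_trivial]])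
  show "bundle_isomorphic G (product_bundle X \<alpha> 0 (\<lambda>g v. v)) (zero_bundle X \<alpha>)"
    by (rule bundle_isomorphicI, rule bundle_isoI[where \<theta> = id and \<theta>' = id])
       (auto simp: zero_bundle_def)
qed

end

subsection \<open>Restrictions\<close>

lemma restrict_simps [simp]:
  "total_space (bundle_restrict E A) = subtopology (total_space E) (part_over E A)"
  "bundle_proj (bundle_restrict E A) = bundle_proj E"
  "fibre_add (bundle_restrict E A) = fibre_add E"
  "fibre_scale (bundle_restrict E A) = fibre_scale E"
  "bundle_act (bundle_restrict E A) = bundle_act E"
  by (simp_all add: bundle_restrict_def)

context group_with_topology
begin

lemma G_space_subtopology:
  assumes X: "G_space G T X \<alpha>" and A: "\<And>g x. g \<in> carrier G \<Longrightarrow> x \<in> topspace X \<Longrightarrow> x \<in> A \<Longrightarrow> \<alpha> g x \<in> A"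
  shows "G_space G T (subtopology X A) \<alpha>"
proof -
  have "continuous_map (prod_topology T (subtopology X A)) X (\<lambda>(g, x). \<alpha> g x)"
    unfolding prod_topology_subtopology(2) by (rule continuous_map_from_subtopology[OF G_spaceD(1)[OF X]])
  then have "continuous_map (prod_topology T (subtopology X A)) (subtopology X A) (\<lambda>(g, x). \<alpha> g x)"
    using A by (auto simp: continuous_map_in_subtopology topspace_eq)
  then show ?thesis using X by (simp add: G_space_def)
qed

lemma G_vector_bundle_restrict:
  assumes E: "G_vector_bundle G T X \<alpha> E" and A: "\<And>g x. g \<in> carrier G \<Longrightarrow> x \<in> A \<Longrightarrow> \<alpha> g x \<in> A"
  shows "G_vector_bundle G T (subtopology X A) \<alpha> (bundle_restrict E A)"
proof -
  note E' = G_vector_bundleD[OF E]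
  have "complex_vector_bundle (subtopology X A) (bundle_restrict E A)"
    unfolding complex_vector_bundle_iff_charts
  proof (intro conjI ballI)
    show "continuous_map (total_space (bundle_restrict E A)) (subtopology X A) (bundle_proj (bundle_restrict E A))"
      using continuous_map_from_subtopology[OF complex_vector_bundleD(1)[OF E'(1)]]
      by (auto simp: continuous_map_in_subtopology part_over_def)
    fix x assume "x \<in> topspace (subtopology X A)"
    then have x: "x \<in> topspace X" "x \<in> A" by auto
    obtain U n \<tau> \<phi> where U: "x \<in> U" and ch: "vb_chart X E U n \<tau> \<phi>"
      using complex_vector_bundleD(3)[OF E'(1) x(1)] by blast
    note D = vb_chartD[OF ch]
    have "vb_chart (subtopology X A) (bundle_restrict E A) (U \<inter> A) n \<tau> \<phi>"
      unfolding vb_chart_def restrict_simps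
    proof (intro conjI ballI allI)
      show "openin (subtopology X A) (U \<inter> A)" using D(1) by (auto simp: openin_subtopology)
      have eq: "subtopology (subtopology X A) (U \<inter> A) = subtopology (subtopology X U) (U \<inter> A)"
        by (simp add: subtopology_subtopology Int_ac)
      have "continuous_map (prod_topology (subtopology (subtopology X A) (U \<inter> A)) (complex_space n)) (total_space E) \<tau>"
        unfolding eq prod_topology_subtopology(1)[of "subtopology X U"]
        by (rule continuous_map_from_subtopology[OF D(3)])
      then show "continuous_map (prod_topology (subtopology (subtopology X A) (U \<inter> A)) (complex_space n))
          (subtopology (total_space E) (part_over E A)) \<tau>"
        using D(7,8) by (auto simp: continuous_map_in_subtopology part_over_def)
      show "continuous_map (subtopology (subtopology (total_space E) (part_over E A)) (part_over (bundle_restrict E A) (U \<inter> A)))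
          (complex_space n) \<phi>"
        unfolding subtopology_subtopology
        by (rule continuous_map_from_subtopology_mono[OF D(4)]) (auto simp: part_over_def)
    qed (use D in \<open>auto simp: part_over_def\<close>)
    then show "\<exists>U n \<tau> \<phi>. x \<in> U \<and> vb_chart (subtopology X A) (bundle_restrict E A) U n \<tau> \<phi>"
      using U x by blast
  qed
  moreover have "G_space G T (total_space (bundle_restrict E A)) (bundle_act (bundle_restrict E A))"
    unfolding restrict_simps
    by (rule G_space_subtopology[OF E'(2)]) (use A E'(3) G_spaceD(4)[OF E'(2)] topspace_eq in \<open>auto simp: part_over_def\<close>)
  ultimately show ?thesis
    unfolding G_vector_bundle_def using E'(3-5) by simp
qed

end

lemma restrict_cong:
  assumes "bundle_isomorphic G E F"
  shows "bundle_isomorphic G (bundle_restrict E A) (bundle_restrict F A)"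
proof -
  obtain \<theta> \<theta>' where "bundle_iso G E F \<theta> \<theta>'" using assms unfolding bundle_isomorphic_iff by blast
  note t = bundle_isoD[OF this]
  show ?thesis
    by (rule bundle_isomorphicI, rule bundle_isoI[where \<theta> = \<theta> and \<theta>' = \<theta>'])
       (use t(3-11) continuous_map_from_subtopology[OF t(1)] continuous_map_from_subtopology[OF t(2)]
        in \<open>auto simp: continuous_map_in_subtopology part_over_def\<close>)
qed

lemma restrict_whitney:
  "bundle_isomorphic G (bundle_restrict (whitney_sum E F) A) (whitney_sum (bundle_restrict E A) (bundle_restrict F A))"
proof (rule bundle_isomorphicI, rule bundle_isoI[where \<theta> = id and \<theta>' = id])
  show "continuous_map (total_space (bundle_restrict (whitney_sum E F) A))
      (total_space (whitney_sum (bundle_restrict E A) (bundle_restrict F A))) id"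
    using continuous_map_into_whitney[of "total_space (bundle_restrict (whitney_sum E F) A)" "bundle_restrict E A" fst
        "bundle_restrict F A" snd]
      continuous_map_from_subtopology[OF continuous_map_whitney_fst[of E F]]
      continuous_map_from_subtopology[OF continuous_map_whitney_snd[of E F]]
    by (force simp: continuous_map_in_subtopology part_over_def topspace_whitney id_def)
  show "continuous_map (total_space (whitney_sum (bundle_restrict E A) (bundle_restrict F A)))
      (total_space (bundle_restrict (whitney_sum E F) A)) id"
    using continuous_map_into_whitney[of "total_space (whitney_sum (bundle_restrict E A) (bundle_restrict F A))" E fst F snd]
      continuous_map_whitney_fst[of "bundle_restrict E A" "bundle_restrict F A"]
      continuous_map_whitney_snd[of "bundle_restrict E A" "bundle_restrict F A"]
    by (force simp: continuous_map_in_subtopology part_over_def topspace_whitney id_def)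
qed (auto simp: topspace_whitney part_over_def)

lemma restrict_zero: "bundle_restrict (zero_bundle X \<alpha>) A = zero_bundle (subtopology X A) \<alpha>"
proof -
  let ?P = "prod_topology X (complex_space 0)"
  have "topspace ?P \<inter> A \<times> vecs 0 = (topspace X \<inter> A) \<times> vecs 0" by auto
  then have "subtopology ?P ((topspace X \<inter> A) \<times> vecs 0) = subtopology ?P (A \<times> vecs 0)"
    by (metis subtopology_restrict)
  moreover have "part_over (zero_bundle X \<alpha>) A = (topspace X \<inter> A) \<times> vecs 0"
    by (auto simp: part_over_def zero_bundle_def)
  ultimately show ?thesis
    unfolding bundle_restrict_def prod_topology_subtopology(1) zero_bundle_def by simp
qed

section \<open>The monoid of bundles\<close>

text \<open>A chart is chosen for every point separately, so that each fibre is labelled by vectors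
  and \<Phi> is injective. Nothing makes the labels vary continuously from fibre to fibre; the
  topology and the operations are carried over along \<Phi>.\<close>

lemma standard_model_exists:
  fixes E :: "('g, 'x, 'e) gbundle"
  assumes E: "complex_vector_bundle X E"
  shows "\<exists>D :: ('g, 'x) std_bundle. bundle_isomorphic G E D"
proof -
  let ?S = "topspace (total_space E)"
  have "\<forall>x\<in>topspace X. \<exists>c. \<exists>U n \<tau>. x \<in> U \<and> vb_chart X E U n \<tau> c"
    using complex_vector_bundleD(3)[OF E] by blast
  from bchoice[OF this] obtain \<phi> where
    \<phi>: "\<And>x. x \<in> topspace X \<Longrightarrow> \<exists>U n \<tau>. x \<in> U \<and> vb_chart X E U n \<tau> (\<phi> x)"
    by blast
  define \<Phi> where "\<Phi> e = (bundle_proj E e, \<phi> (bundle_proj E e) e)" for e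
  define \<Psi> where "\<Psi> = inv_into ?S \<Phi>"
  have inj: "inj_on \<Phi> ?S"
  proof
    fix e e' assume e: "e \<in> ?S" and e': "e' \<in> ?S" and eq: "\<Phi> e = \<Phi> e'"
    obtain U n \<tau> where U: "bundle_proj E e \<in> U" "vb_chart X E U n \<tau> (\<phi> (bundle_proj E e))"
      using \<phi> complex_vector_bundleD(2)[OF E e] by blast
    have p: "bundle_proj E e' = bundle_proj E e" using eq by (simp add: \<Phi>_def)
    then have q: "\<phi> (bundle_proj E e) e' = \<phi> (bundle_proj E e) e" using eq by (simp add: \<Phi>_def)
    have "e = \<tau> (bundle_proj E e, \<phi> (bundle_proj E e) e)" by (rule vb_chartD(5)[OF U(2) e U(1), symmetric])
    also have "\<dots> = \<tau> (bundle_proj E e', \<phi> (bundle_proj E e) e')" by (simp only: p q)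
    also have "\<dots> = e'" by (rule vb_chartD(5)[OF U(2) e']) (simp only: p U(1))
    finally show "e = e'" .
  qed
  then have \<Psi>\<Phi>: "\<Psi> (\<Phi> e) = e" if "e \<in> ?S" for e using that by (simp add: \<Psi>_def)
  define D :: "('g, 'x) std_bundle" where
    "D = \<lparr>total_space = pullback_topology (\<Phi> ` ?S) \<Psi> (total_space E),
      bundle_proj = (\<lambda>d. bundle_proj E (\<Psi> d)),
      fibre_add = (\<lambda>d d'. \<Phi> (fibre_add E (\<Psi> d) (\<Psi> d'))),
      fibre_scale = (\<lambda>c d. \<Phi> (fibre_scale E c (\<Psi> d))),
      bundle_act = (\<lambda>g d. \<Phi> (bundle_act E g (\<Psi> d)))\<rparr>"
  have top: "topspace (total_space D) = \<Phi> ` ?S"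
    using \<Psi>\<Phi> by (auto simp: D_def topspace_pullback_topology)
  have "bundle_iso G E D \<Phi> \<Psi>"
  proof (rule bundle_isoI)
    have "{e \<in> ?S. \<Phi> e \<in> \<Psi> -` U \<inter> \<Phi> ` ?S} = U" if "openin (total_space E) U" for U
      using openin_subset[OF that] \<Psi>\<Phi> by (auto simp: inj_on_eq_iff[OF inj] subset_iff)
    then show "continuous_map (total_space E) (total_space D) \<Phi>"
      unfolding continuous_map_def top
      by (auto simp: D_def openin_pullback_topology simp del: vimage_eq IntI)
    have "openin (total_space D) {d \<in> topspace (total_space D). \<Psi> d \<in> U}" if "openin (total_space E) U" for U
      unfolding top using that by (auto simp: D_def openin_pullback_topology intro!: exI[of _ U])
    then show "continuous_map (total_space D) (total_space E) \<Psi>"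
      using \<Psi>\<Phi> by (auto simp: continuous_map_def top)
  qed (auto simp: top \<Psi>\<Phi>, auto simp: D_def \<Psi>\<Phi>)
  then show ?thesis using bundle_isomorphicI by blast
qed

context group_with_topology
begin

definition bundle_class ::
    "'x topology \<Rightarrow> ('a \<Rightarrow> 'x \<Rightarrow> 'x) \<Rightarrow> ('a, 'x) std_bundle \<Rightarrow> ('a, 'x) std_bundle set" where
  "bundle_class X \<alpha> E = {D. G_vector_bundle G T X \<alpha> D \<and> bundle_isomorphic G E D}"

lemma bundle_class_eq_iff:
  assumes "G_vector_bundle G T X \<alpha> E" "G_vector_bundle G T X \<alpha> F"
  shows "bundle_class X \<alpha> E = bundle_class X \<alpha> F \<longleftrightarrow> bundle_isomorphic G E F"
proof
  assume "bundle_class X \<alpha> E = bundle_class X \<alpha> F"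
  then have "F \<in> bundle_class X \<alpha> E" using assms(2) by (simp add: bundle_class_def bundle_isomorphic_refl)
  then show "bundle_isomorphic G E F" by (simp add: bundle_class_def)
next
  assume iso: "bundle_isomorphic G E F"
  then have "bundle_isomorphic G F E" using assms(1) by (rule bundle_isomorphic_sym)
  with iso show "bundle_class X \<alpha> E = bundle_class X \<alpha> F"
    unfolding bundle_class_def using bundle_isomorphic_trans by blast
qed

lemma bundle_iso_rel_image:
  "G_vector_bundle G T X \<alpha> E \<Longrightarrow> bundle_iso_rel G T X \<alpha> `` {E} = bundle_class X \<alpha> E"
  by (auto simp: bundle_iso_rel_def bundle_class_def)

lemma carrier_vect_monoid:
  "carrier (vect_monoid G T X \<alpha>) = bundle_class X \<alpha> ` {E. G_vector_bundle G T X \<alpha> E}"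
  by (auto simp: vect_monoid_def quotient_def bundle_iso_rel_image)

lemma one_vect_monoid:
  "G_space G T X \<alpha> \<Longrightarrow> \<one>\<^bsub>vect_monoid G T X \<alpha>\<^esub> = bundle_class X \<alpha> (zero_bundle X \<alpha>)"
  by (simp add: vect_monoid_def bundle_iso_rel_image G_vector_bundle_zero)

text \<open>Whitney sums respect isomorphism, so the bundles isomorphic to a sum of representatives
  form a single class.\<close>

lemma mult_vect_monoid:
  fixes X :: "'x topology"
  assumes E: "G_vector_bundle G T X \<alpha> E" and F: "G_vector_bundle G T X \<alpha> F"
    and D: "bundle_isomorphic G (whitney_sum E F) D"
  shows "bundle_class X \<alpha> E \<otimes>\<^bsub>vect_monoid G T X \<alpha>\<^esub> bundle_class X \<alpha> F = bundle_class X \<alpha> D"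
proof -
  have DW: "bundle_isomorphic G D (whitney_sum E F)"
    by (rule bundle_isomorphic_sym[OF D G_vector_bundle_whitney[OF E F]])
  show ?thesis
  proof (intro equalityI subsetI)
    fix B assume "B \<in> bundle_class X \<alpha> E \<otimes>\<^bsub>vect_monoid G T X \<alpha>\<^esub> bundle_class X \<alpha> F"
    then obtain E' F' :: "('a, 'x) std_bundle" where B: "G_vector_bundle G T X \<alpha> B" "bundle_isomorphic G (whitney_sum E' F') B"
      "bundle_isomorphic G E E'" "bundle_isomorphic G F F'"
      by (auto simp: vect_monoid_def bundle_class_def)
    then show "B \<in> bundle_class X \<alpha> D"
      using bundle_isomorphic_trans[OF DW bundle_isomorphic_trans[OF whitney_cong[OF B(3,4)] B(2)]]
      by (simp add: bundle_class_def)
  next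
    fix B assume "B \<in> bundle_class X \<alpha> D"
    then have "G_vector_bundle G T X \<alpha> B" "bundle_isomorphic G (whitney_sum E F) B"
      using bundle_isomorphic_trans[OF D] by (auto simp: bundle_class_def)
    then show "B \<in> bundle_class X \<alpha> E \<otimes>\<^bsub>vect_monoid G T X \<alpha>\<^esub> bundle_class X \<alpha> F"
      using E F bundle_isomorphic_refl by (auto simp: vect_monoid_def bundle_class_def)
  qed
qed

lemma sum_model_exists:
  fixes X :: "'x topology"
  assumes "G_vector_bundle G T X \<alpha> E" "G_vector_bundle G T X \<alpha> F"
  obtains D :: "('a, 'x) std_bundle" where "G_vector_bundle G T X \<alpha> D" "bundle_isomorphic G (whitney_sum E F) D"
proof -
  note W = G_vector_bundle_whitney[OF assms]
  obtain D :: "('a, 'x) std_bundle" where D: "bundle_isomorphic G (whitney_sum E F) D"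
    using standard_model_exists[OF G_vector_bundleD(1)[OF W]] by blast
  show thesis using that[OF G_vector_bundle_isomorphic[OF D W] D] .
qed

lemma comm_monoid_vect_monoid:
  fixes X :: "'x topology"
  assumes X: "G_space G T X \<alpha>"
  shows "comm_monoid (vect_monoid G T X \<alpha>)"
proof (rule comm_monoidI)
  let ?M = "vect_monoid G T X \<alpha>"
  note Z = G_vector_bundle_zero[OF X]
  show "\<one>\<^bsub>?M\<^esub> \<in> carrier ?M" using Z by (simp add: one_vect_monoid[OF X] carrier_vect_monoid)
  fix x assume "x \<in> carrier ?M"
  then obtain E where E: "G_vector_bundle G T X \<alpha> E" "x = bundle_class X \<alpha> E" by (auto simp: carrier_vect_monoid)
  show "\<one>\<^bsub>?M\<^esub> \<otimes>\<^bsub>?M\<^esub> x = x"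
    unfolding E(2) one_vect_monoid[OF X]
    by (rule mult_vect_monoid[OF Z E(1) whitney_zero[OF G_vector_bundleD(1)[OF E(1)]]])
  fix y assume "y \<in> carrier ?M"
  then obtain F where F: "G_vector_bundle G T X \<alpha> F" "y = bundle_class X \<alpha> F" by (auto simp: carrier_vect_monoid)
  obtain S :: "('a, 'x) std_bundle" where S: "G_vector_bundle G T X \<alpha> S" "bundle_isomorphic G (whitney_sum E F) S"
    using sum_model_exists[OF E(1) F(1)] .
  note xy = mult_vect_monoid[OF E(1) F(1) S(2)]
  show "x \<otimes>\<^bsub>?M\<^esub> y \<in> carrier ?M" using S(1) by (auto simp: E(2) F(2) xy carrier_vect_monoid)
  show "x \<otimes>\<^bsub>?M\<^esub> y = y \<otimes>\<^bsub>?M\<^esub> x"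
    unfolding E(2) F(2) xy
    by (rule mult_vect_monoid[OF F(1) E(1) bundle_isomorphic_trans[OF whitney_comm S(2)], symmetric])
  fix z assume "z \<in> carrier ?M"
  then obtain D where D: "G_vector_bundle G T X \<alpha> D" "z = bundle_class X \<alpha> D" by (auto simp: carrier_vect_monoid)
  obtain R :: "('a, 'x) std_bundle" where R: "G_vector_bundle G T X \<alpha> R" "bundle_isomorphic G (whitney_sum F D) R"
    using sum_model_exists[OF F(1) D(1)] .
  obtain Q :: "('a, 'x) std_bundle" where Q: "G_vector_bundle G T X \<alpha> Q" "bundle_isomorphic G (whitney_sum E R) Q"
    using sum_model_exists[OF E(1) R(1)] .
  note [trans] = bundle_isomorphic_trans
  have "bundle_isomorphic G S (whitney_sum E F)"
    by (rule bundle_isomorphic_sym[OF S(2) G_vector_bundle_whitney[OF E(1) F(1)]])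
  then have "bundle_isomorphic G (whitney_sum S D) (whitney_sum (whitney_sum E F) D)"
    by (rule whitney_cong[OF _ bundle_isomorphic_refl])
  also have "bundle_isomorphic G (whitney_sum (whitney_sum E F) D) (whitney_sum E (whitney_sum F D))"
    by (rule whitney_assoc)
  also have "bundle_isomorphic G (whitney_sum E (whitney_sum F D)) (whitney_sum E R)"
    by (rule whitney_cong[OF bundle_isomorphic_refl R(2)])
  also note Q(2)
  finally have SQ: "bundle_isomorphic G (whitney_sum S D) Q" .
  show "x \<otimes>\<^bsub>?M\<^esub> y \<otimes>\<^bsub>?M\<^esub> z = x \<otimes>\<^bsub>?M\<^esub> (y \<otimes>\<^bsub>?M\<^esub> z)"
    unfolding E(2) F(2) D(2) xy mult_vect_monoid[OF F(1) D(1) R(2)] mult_vect_monoid[OF E(1) R(1) Q(2)]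
    by (rule mult_vect_monoid[OF S(1) D(1) SQ])
qed

lemma class_restrict_eq:
  fixes X :: "'x topology"
  assumes E: "G_vector_bundle G T X \<alpha> E" and A: "\<And>g x. g \<in> carrier G \<Longrightarrow> x \<in> A \<Longrightarrow> \<alpha> g x \<in> A"
  shows "class_restrict G T X \<alpha> A (bundle_class X \<alpha> E) = bundle_class (subtopology X A) \<alpha> (bundle_restrict E A)"
proof (intro equalityI subsetI)
  fix D assume "D \<in> class_restrict G T X \<alpha> A (bundle_class X \<alpha> E)"
  then obtain F :: "('a, 'x) std_bundle" where F: "G_vector_bundle G T (subtopology X A) \<alpha> D" "bundle_isomorphic G E F"
    "bundle_isomorphic G (bundle_restrict F A) D"
    by (auto simp: class_restrict_def bundle_class_def)
  then show "D \<in> bundle_class (subtopology X A) \<alpha> (bundle_restrict E A)"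
    using bundle_isomorphic_trans[OF restrict_cong[OF F(2)] F(3)] by (simp add: bundle_class_def)
next
  fix D assume "D \<in> bundle_class (subtopology X A) \<alpha> (bundle_restrict E A)"
  then show "D \<in> class_restrict G T X \<alpha> A (bundle_class X \<alpha> E)"
    using E by (auto simp: class_restrict_def bundle_class_def intro: bundle_isomorphic_refl)
qed

text \<open>Restriction commutes with Whitney sums up to isomorphism, and the zero bundle restricts
  to the zero bundle of the subspace on the nose.\<close>

lemma class_restrict_hom:
  fixes X :: "'x topology"
  assumes X: "G_space G T X \<alpha>" and A: "\<And>g x. g \<in> carrier G \<Longrightarrow> x \<in> A \<Longrightarrow> \<alpha> g x \<in> A"
  defines "M \<equiv> vect_monoid G T X \<alpha>" and "N \<equiv> vect_monoid G T (subtopology X A) \<alpha>"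
  shows "class_restrict G T X \<alpha> A \<in> hom M N" "class_restrict G T X \<alpha> A \<one>\<^bsub>M\<^esub> = \<one>\<^bsub>N\<^esub>"
proof -
  let ?c = "class_restrict G T X \<alpha> A"
  have XA: "G_space G T (subtopology X A) \<alpha>" by (rule G_space_subtopology[OF X A])
  note res = class_restrict_eq[OF _ A] and vbr = G_vector_bundle_restrict[OF _ A]
  show "?c \<one>\<^bsub>M\<^esub> = \<one>\<^bsub>N\<^esub>"
    unfolding M_def N_def
    by (simp add: one_vect_monoid[OF X] one_vect_monoid[OF XA] res[OF G_vector_bundle_zero[OF X]] restrict_zero)
  show "?c \<in> hom M N"
    unfolding hom_def
  proof (intro CollectI conjI ballI funcsetI)
    fix x assume "x \<in> carrier M"
    then obtain E where E: "G_vector_bundle G T X \<alpha> E" "x = bundle_class X \<alpha> E"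
      by (auto simp: M_def carrier_vect_monoid)
    then show "?c x \<in> carrier N" using vbr[OF E(1)] by (auto simp: res N_def carrier_vect_monoid)
    fix y assume "y \<in> carrier M"
    then obtain F where F: "G_vector_bundle G T X \<alpha> F" "y = bundle_class X \<alpha> F"
      by (auto simp: M_def carrier_vect_monoid)
    obtain S :: "('a, 'x) std_bundle" where S: "G_vector_bundle G T X \<alpha> S" "bundle_isomorphic G (whitney_sum E F) S"
      using sum_model_exists[OF E(1) F(1)] .
    have "bundle_isomorphic G (bundle_restrict (whitney_sum E F) A) (whitney_sum (bundle_restrict E A) (bundle_restrict F A))"
      by (rule restrict_whitney)
    from bundle_isomorphic_sym[OF this vbr[OF G_vector_bundle_whitney[OF E(1) F(1)]]]
    have "bundle_isomorphic G (whitney_sum (bundle_restrict E A) (bundle_restrict F A)) (bundle_restrict S A)"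
      by (rule bundle_isomorphic_trans[OF _ restrict_cong[OF S(2)]])
    from mult_vect_monoid[OF vbr[OF E(1)] vbr[OF F(1)] this]
    show "?c (x \<otimes>\<^bsub>M\<^esub> y) = ?c x \<otimes>\<^bsub>N\<^esub> ?c y"
      by (simp add: M_def N_def E(2) F(2) mult_vect_monoid[OF E(1) F(1) S(2)] res S(1) E(1) F(1))
  qed
qed

end

section \<open>Kernels of maps of Grothendieck groups\<close>

context comm_monoid
begin

lemma grothendieck_one_mem:
  "(a, b) \<in> grothendieck_rel G `` {(\<one>, \<one>)} \<longleftrightarrow>
     a \<in> carrier G \<and> b \<in> carrier G \<and> (\<exists>k\<in>carrier G. a \<otimes> k = b \<otimes> k)"
  by (auto simp: grothendieck_rel_def) (metis, metis)

lemma grothendieck_class_one: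
  assumes ab: "(a, b) \<in> grothendieck_rel G `` {(\<one>, \<one>)}"
  shows "grothendieck_rel G `` {(a, b)} = grothendieck_rel G `` {(\<one>, \<one>)}"
proof -
  obtain k where k: "a \<in> carrier G" "b \<in> carrier G" "k \<in> carrier G" "a \<otimes> k = b \<otimes> k"
    using ab unfolding grothendieck_one_mem by blast
  have "(c, d) \<in> grothendieck_rel G `` {(a, b)} \<longleftrightarrow> (c, d) \<in> grothendieck_rel G `` {(\<one>, \<one>)}" for c d
    unfolding grothendieck_one_mem
  proof
    assume "(c, d) \<in> grothendieck_rel G `` {(a, b)}"
    then obtain l where l: "c \<in> carrier G" "d \<in> carrier G" "l \<in> carrier G" "a \<otimes> d \<otimes> l = c \<otimes> b \<otimes> l"
      by (auto simp: grothendieck_rel_def)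
    have "c \<otimes> (b \<otimes> l \<otimes> k) = (c \<otimes> b \<otimes> l) \<otimes> k" using k(1-3) l(1-3) by (simp add: m_ac)
    also have "\<dots> = (a \<otimes> d \<otimes> l) \<otimes> k" using l by simp
    also have "\<dots> = d \<otimes> l \<otimes> (a \<otimes> k)" using k(1-3) l(1-3) by (simp add: m_ac)
    also have "\<dots> = d \<otimes> (b \<otimes> l \<otimes> k)" unfolding k(4) using k(1-3) l(1-3) by (simp add: m_ac)
    finally show "c \<in> carrier G \<and> d \<in> carrier G \<and> (\<exists>k\<in>carrier G. c \<otimes> k = d \<otimes> k)"
      using k l by blast
  next
    assume "c \<in> carrier G \<and> d \<in> carrier G \<and> (\<exists>k\<in>carrier G. c \<otimes> k = d \<otimes> k)"
    then obtain l where l: "c \<in> carrier G" "d \<in> carrier G" "l \<in> carrier G" "c \<otimes> l = d \<otimes> l" by blast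
    have "a \<otimes> d \<otimes> (k \<otimes> l) = (a \<otimes> k) \<otimes> (d \<otimes> l)" using k(1-3) l(1-3) by (simp add: m_ac)
    also have "\<dots> = (b \<otimes> k) \<otimes> (c \<otimes> l)" by (simp only: k(4) l(4))
    also have "\<dots> = c \<otimes> b \<otimes> (k \<otimes> l)" using k(1-3) l(1-3) by (simp add: m_ac)
    finally show "(c, d) \<in> grothendieck_rel G `` {(a, b)}"
      using k l by (auto simp: grothendieck_rel_def)
  qed
  then show ?thesis by auto
qed

end

text \<open>A pair represents zero exactly if its components are stably equal. The hypothesis
  \<open>inj\<close> lifts stable equality from \<open>N\<close> back to \<open>M\<close>, so the
  class of zero is alone in the kernel, and the group axioms are those of a one-element set.\<close>

lemma trivial_grothendieck_kernel:
  assumes M: "comm_monoid M" and N: "comm_monoid N" and f: "f \<in> hom M N" "f \<one>\<^bsub>M\<^esub> = \<one>\<^bsub>N\<^esub>"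
    and inj: "\<And>a b k. a \<in> carrier M \<Longrightarrow> b \<in> carrier M \<Longrightarrow> k \<in> carrier N \<Longrightarrow>
        f a \<otimes>\<^bsub>N\<^esub> k = f b \<otimes>\<^bsub>N\<^esub> k \<Longrightarrow> \<exists>l\<in>carrier M. a \<otimes>\<^bsub>M\<^esub> l = b \<otimes>\<^bsub>M\<^esub> l"
  shows "trivial_group (grothendieck_group M
     \<lparr>carrier := kernel (grothendieck_group M) (grothendieck_group N) (grothendieck_map N f)\<rparr>)"
proof -
  interpret M: comm_monoid M by fact
  interpret N: comm_monoid N by fact
  let ?I = "grothendieck_rel M `` {(\<one>\<^bsub>M\<^esub>, \<one>\<^bsub>M\<^esub>)}" and ?J = "grothendieck_rel N `` {(\<one>\<^bsub>N\<^esub>, \<one>\<^bsub>N\<^esub>)}"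
  have closed: "f a \<in> carrier N" if "a \<in> carrier M" for a using f(1) that by (auto simp: hom_def)
  have one_I: "(\<one>\<^bsub>M\<^esub>, \<one>\<^bsub>M\<^esub>) \<in> ?I" unfolding M.grothendieck_one_mem using M.one_closed by blast
  have map_I: "grothendieck_map N f ?I = ?J"
  proof -
    have "grothendieck_rel N `` {(f a, f b)} = ?J" if ab: "(a, b) \<in> ?I" for a b
    proof (rule N.grothendieck_class_one)
      obtain k where k: "a \<in> carrier M" "b \<in> carrier M" "k \<in> carrier M" "a \<otimes>\<^bsub>M\<^esub> k = b \<otimes>\<^bsub>M\<^esub> k"
        using ab unfolding M.grothendieck_one_mem by blast
      then have "f a \<otimes>\<^bsub>N\<^esub> f k = f b \<otimes>\<^bsub>N\<^esub> f k" using f(1) by (metis hom_mult)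
      then show "(f a, f b) \<in> ?J" unfolding N.grothendieck_one_mem using closed k by blast
    qed
    then show ?thesis unfolding grothendieck_map_def using one_I by fastforce
  qed
  have ker: "kernel (grothendieck_group M) (grothendieck_group N) (grothendieck_map N f) = {?I}"
  proof (intro equalityI subsetI)
    fix x assume "x \<in> kernel (grothendieck_group M) (grothendieck_group N) (grothendieck_map N f)"
    then have x: "x \<in> (carrier M \<times> carrier M) // grothendieck_rel M" "grothendieck_map N f x = ?J"
      by (auto simp: kernel_def grothendieck_group_def)
    obtain a b where ab: "a \<in> carrier M" "b \<in> carrier M" "x = grothendieck_rel M `` {(a, b)}"
      using x(1) by (auto simp: quotient_def)
    have "(a, b) \<in> x" unfolding ab(3) using ab by (auto simp: grothendieck_rel_def)
    moreover have "(f a, f b) \<in> grothendieck_rel N `` {(f a, f b)}"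
      using ab closed N.one_closed by (auto simp: grothendieck_rel_def)
    ultimately have "(f a, f b) \<in> ?J" unfolding x(2)[symmetric] grothendieck_map_def by blast
    then obtain k where "k \<in> carrier N" "f a \<otimes>\<^bsub>N\<^esub> k = f b \<otimes>\<^bsub>N\<^esub> k"
      unfolding N.grothendieck_one_mem by blast
    then have "(a, b) \<in> ?I" unfolding M.grothendieck_one_mem using inj ab by blast
    then show "x \<in> {?I}" unfolding ab(3) by (simp add: M.grothendieck_class_one)
  next
    fix x assume "x \<in> {?I}"
    then show "x \<in> kernel (grothendieck_group M) (grothendieck_group N) (grothendieck_map N f)"
      using map_I by (auto simp: kernel_def grothendieck_group_def intro!: quotientI)
  qed
  \<comment> \<open>The product is a union over all representatives, so every pair of
    representatives of the unit has to give the same class.\<close>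
  have mult: "?I \<otimes>\<^bsub>grothendieck_group M\<^esub> ?I = ?I"
  proof -
    have eq: "grothendieck_rel M `` {(a \<otimes>\<^bsub>M\<^esub> c, b \<otimes>\<^bsub>M\<^esub> d)} = ?I" if ab: "(a, b) \<in> ?I" and cd: "(c, d) \<in> ?I" for a b c d
    proof (rule M.grothendieck_class_one)
      obtain k where k: "a \<in> carrier M" "b \<in> carrier M" "k \<in> carrier M" "a \<otimes>\<^bsub>M\<^esub> k = b \<otimes>\<^bsub>M\<^esub> k"
        using ab unfolding M.grothendieck_one_mem by blast
      obtain l where l: "c \<in> carrier M" "d \<in> carrier M" "l \<in> carrier M" "c \<otimes>\<^bsub>M\<^esub> l = d \<otimes>\<^bsub>M\<^esub> l"
        using cd unfolding M.grothendieck_one_mem by blast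
      have "(a \<otimes>\<^bsub>M\<^esub> c) \<otimes>\<^bsub>M\<^esub> (k \<otimes>\<^bsub>M\<^esub> l) = (a \<otimes>\<^bsub>M\<^esub> k) \<otimes>\<^bsub>M\<^esub> (c \<otimes>\<^bsub>M\<^esub> l)" using k(1-3) l(1-3) by (simp add: M.m_ac)
      also have "\<dots> = (b \<otimes>\<^bsub>M\<^esub> d) \<otimes>\<^bsub>M\<^esub> (k \<otimes>\<^bsub>M\<^esub> l)" unfolding k(4) l(4) using k(1-3) l(1-3) by (simp add: M.m_ac)
      finally show "(a \<otimes>\<^bsub>M\<^esub> c, b \<otimes>\<^bsub>M\<^esub> d) \<in> ?I" unfolding M.grothendieck_one_mem using k l by blast
    qed
    have "(\<Union>(a, b)\<in>?I. \<Union>(c, d)\<in>?I. grothendieck_rel M `` {(a \<otimes>\<^bsub>M\<^esub> c, b \<otimes>\<^bsub>M\<^esub> d)}) = (\<Union>p\<in>?I. \<Union>q\<in>?I. ?I)"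
    proof (rule SUP_cong[OF refl])
      fix p assume p: "p \<in> ?I"
      obtain a b where ab: "p = (a, b)" by fastforce
      have "(\<Union>(c, d)\<in>?I. grothendieck_rel M `` {(a \<otimes>\<^bsub>M\<^esub> c, b \<otimes>\<^bsub>M\<^esub> d)}) = (\<Union>q\<in>?I. ?I)"
      proof (rule SUP_cong[OF refl])
        fix q assume q: "q \<in> ?I"
        obtain c d where cd: "q = (c, d)" by fastforce
        show "(case q of (c, d) \<Rightarrow> grothendieck_rel M `` {(a \<otimes>\<^bsub>M\<^esub> c, b \<otimes>\<^bsub>M\<^esub> d)}) = ?I"
          unfolding cd prod.case by (rule eq) (use p q ab cd in simp_all)
      qed
      then show "(case p of (a, b) \<Rightarrow> \<Union>(c, d)\<in>?I. grothendieck_rel M `` {(a \<otimes>\<^bsub>M\<^esub> c, b \<otimes>\<^bsub>M\<^esub> d)}) = (\<Union>q\<in>?I. ?I)"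
        unfolding ab prod.case .
    qed
    also have "\<dots> = ?I" using one_I by blast
    finally show ?thesis by (simp add: grothendieck_group_def)
  qed
  have "group (grothendieck_group M\<lparr>carrier := {?I}\<rparr>)"
    by (rule groupI) (use mult in \<open>auto simp: grothendieck_group_def\<close>)
  then show ?thesis
    unfolding ker trivial_group_def by (simp add: grothendieck_group_def)
qed

section \<open>Frames\<close>

text \<open>
  A frame over \<open>f : Y \<rightarrow> X\<close> is a trivialization of the pullback of the bundle along \<open>f\<close>;
  \<open>b y : C^n \<rightarrow> E_(f y)\<close> has the inverse \<open>d y\<close>.
\<close>

definition frame ::
    "'y topology \<Rightarrow> ('y \<Rightarrow> 'x) \<Rightarrow> ('g, 'x, 'e) gbundle \<Rightarrow> nat \<Rightarrow> ('y \<Rightarrow> (nat \<Rightarrow> complex) \<Rightarrow> 'e)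
      \<Rightarrow> ('y \<Rightarrow> 'e \<Rightarrow> nat \<Rightarrow> complex) \<Rightarrow> bool" where
  "frame Y f E n b d \<longleftrightarrow>
     continuous_map (prod_topology Y (complex_space n)) (total_space E) (\<lambda>(y, v). b y v) \<and>
     continuous_map (subtopology (prod_topology Y (total_space E)) {(y, e). bundle_proj E e = f y})
       (complex_space n) (\<lambda>(y, e). d y e) \<and>
     (\<forall>y\<in>topspace Y. \<forall>v\<in>vecs n. bundle_proj E (b y v) = f y \<and> d y (b y v) = v \<and>
        (\<forall>w\<in>vecs n. b y (\<lambda>i. v i + w i) = fibre_add E (b y v) (b y w)) \<and>
        (\<forall>c. b y (\<lambda>i. c * v i) = fibre_scale E c (b y v))) \<and>
     (\<forall>y\<in>topspace Y. \<forall>e\<in>topspace (total_space E). bundle_proj E e = f y \<longrightarrow> b y (d y e) = e)"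

lemma frameD:
  assumes "frame Y f E n b d"
  shows "continuous_map (prod_topology Y (complex_space n)) (total_space E) (\<lambda>(y, v). b y v)"
    "continuous_map (subtopology (prod_topology Y (total_space E)) {(y, e). bundle_proj E e = f y})
       (complex_space n) (\<lambda>(y, e). d y e)"
    "\<And>y v. y \<in> topspace Y \<Longrightarrow> v \<in> vecs n \<Longrightarrow> bundle_proj E (b y v) = f y"
    "\<And>y v. y \<in> topspace Y \<Longrightarrow> v \<in> vecs n \<Longrightarrow> d y (b y v) = v"
    "\<And>y v w. y \<in> topspace Y \<Longrightarrow> v \<in> vecs n \<Longrightarrow> w \<in> vecs n \<Longrightarrow>
        b y (\<lambda>i. v i + w i) = fibre_add E (b y v) (b y w)"
    "\<And>y v c. y \<in> topspace Y \<Longrightarrow> v \<in> vecs n \<Longrightarrow> b y (\<lambda>i. c * v i) = fibre_scale E c (b y v)"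
    "\<And>y e. y \<in> topspace Y \<Longrightarrow> e \<in> topspace (total_space E) \<Longrightarrow> bundle_proj E e = f y \<Longrightarrow> b y (d y e) = e"
    "\<And>y v. y \<in> topspace Y \<Longrightarrow> v \<in> vecs n \<Longrightarrow> b y v \<in> topspace (total_space E)"
    "\<And>y e. y \<in> topspace Y \<Longrightarrow> e \<in> topspace (total_space E) \<Longrightarrow> bundle_proj E e = f y \<Longrightarrow> d y e \<in> vecs n"
proof -
  show 1: "continuous_map (prod_topology Y (complex_space n)) (total_space E) (\<lambda>(y, v). b y v)"
    and 2: "continuous_map (subtopology (prod_topology Y (total_space E)) {(y, e). bundle_proj E e = f y})
       (complex_space n) (\<lambda>(y, e). d y e)"
    using assms by (simp_all add: frame_def)
  show "b y v \<in> topspace (total_space E)" if "y \<in> topspace Y" "v \<in> vecs n" for y v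
    using continuous_map_in[OF 1, of "(y, v)"] that by simp
  show "d y e \<in> vecs n" if "y \<in> topspace Y" "e \<in> topspace (total_space E)" "bundle_proj E e = f y" for y e
    using continuous_map_in[OF 2, of "(y, e)"] that by simp
qed (use assms in \<open>simp_all add: frame_def\<close>)

lemma continuous_map_frame:
  assumes "frame Y f E n b d" "continuous_map Z Y g" "continuous_map Z (complex_space n) h"
  shows "continuous_map Z (total_space E) (\<lambda>z. b (g z) (h z))"
  using continuous_map_compose[OF continuous_map_pairedI[OF assms(2,3)] frameD(1)[OF assms(1)]]
  by (simp add: o_def)

lemma continuous_map_coframe:
  assumes "frame Y f E n b d" "continuous_map Z Y g" "continuous_map Z (total_space E) h"
    and "\<And>z. z \<in> topspace Z \<Longrightarrow> bundle_proj E (h z) = f (g z)"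
  shows "continuous_map Z (complex_space n) (\<lambda>z. d (g z) (h z))"
proof -
  have "continuous_map Z (subtopology (prod_topology Y (total_space E)) {(y, e). bundle_proj E e = f y})
      (\<lambda>z. (g z, h z))"
    using assms by (auto simp: continuous_map_in_subtopology intro: continuous_map_pairedI)
  from continuous_map_compose[OF this frameD(2)[OF assms(1)]] show ?thesis by (simp add: o_def)
qed

lemma continuous_map_family:
  assumes "continuous_map (prod_topology Y V) W (\<lambda>(y, v). t y v)"
    and "continuous_map Z Y g" "continuous_map Z V h"
  shows "continuous_map Z W (\<lambda>z. t (g z) (h z))"
  using continuous_map_compose[OF continuous_map_pairedI[OF assms(2,3)] assms(1)] by (simp add: o_def)

lemma frame_transition:
  assumes B: "frame Y f E n b d" and B': "frame Y f E m b' d'"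
  shows "continuous_map (prod_topology Y (complex_space n)) (complex_space m) (\<lambda>(y, v). d' y (b y v))"
    and "y \<in> topspace Y \<Longrightarrow> lin_map n m (\<lambda>v. d' y (b y v))"
    and "y \<in> topspace Y \<Longrightarrow> v \<in> vecs n \<Longrightarrow> b' y (d' y (b y v)) = b y v"
    and "y \<in> topspace Y \<Longrightarrow> v \<in> vecs n \<Longrightarrow> d y (b' y (d' y (b y v))) = v"
proof -
  note F = frameD[OF B] and F' = frameD[OF B']
  show "continuous_map (prod_topology Y (complex_space n)) (complex_space m) (\<lambda>(y, v). d' y (b y v))"
    unfolding case_prod_unfold
    by (rule continuous_map_coframe[OF B' continuous_map_fst]) (use F(1,3) in \<open>auto simp: case_prod_unfold\<close>)
  have bt: "b' y (d' y (b y v)) = b y v" if "y \<in> topspace Y" "v \<in> vecs n" for y v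
    using F'(7) F(3,8) that by simp
  show "y \<in> topspace Y \<Longrightarrow> v \<in> vecs n \<Longrightarrow> b' y (d' y (b y v)) = b y v" by (rule bt)
  show "y \<in> topspace Y \<Longrightarrow> v \<in> vecs n \<Longrightarrow> d y (b' y (d' y (b y v))) = v" by (simp add: bt F(4))
  assume y: "y \<in> topspace Y"
  have t: "d' y (b y v) \<in> vecs m" if "v \<in> vecs n" for v using F'(9) F(3,8) y that by simp
  show "lin_map n m (\<lambda>v. d' y (b y v))"
  proof (rule lin_mapI)
    fix v w assume v: "v \<in> vecs n" and w: "w \<in> vecs n"
    have "b y (\<lambda>i. v i + w i) = b' y (\<lambda>i. d' y (b y v) i + d' y (b y w) i)"
      using F(5)[OF y v w] F'(5)[OF y t[OF v] t[OF w]] bt[OF y v] bt[OF y w] by simp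
    then show "d' y (b y (\<lambda>i. v i + w i)) = (\<lambda>i. d' y (b y v) i + d' y (b y w) i)"
      using F'(4)[OF y] t v w by simp
  next
    fix c v assume v: "v \<in> vecs n"
    have "b y (\<lambda>i. c * v i) = b' y (\<lambda>i. c * d' y (b y v) i)"
      using F(6)[OF y v] F'(6)[OF y t[OF v]] bt[OF y v] by simp
    then show "d' y (b y (\<lambda>i. c * v i)) = (\<lambda>i. c * d' y (b y v) i)"
      using F'(4)[OF y] t v by simp
  qed (rule t)
qed

lemma frame_change:
  assumes B: "frame Y f E n b d"
    and t: "continuous_map (prod_topology Y (complex_space m)) (complex_space n) (\<lambda>(y, v). t y v)"
    and s: "continuous_map (prod_topology Y (complex_space n)) (complex_space m) (\<lambda>(y, v). s y v)"
    and lin: "\<And>y. y \<in> topspace Y \<Longrightarrow> lin_map m n (t y)"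
    and st: "\<And>y v. y \<in> topspace Y \<Longrightarrow> v \<in> vecs m \<Longrightarrow> s y (t y v) = v"
    and ts: "\<And>y v. y \<in> topspace Y \<Longrightarrow> v \<in> vecs n \<Longrightarrow> t y (s y v) = v"
  shows "frame Y f E m (\<lambda>y v. b y (t y v)) (\<lambda>y e. s y (d y e))"
  unfolding frame_def
proof (intro conjI ballI allI impI)
  note F = frameD[OF B]
  show "continuous_map (prod_topology Y (complex_space m)) (total_space E) (\<lambda>(y, v). b y (t y v))"
    using continuous_map_frame[OF B continuous_map_fst t] by (simp add: case_prod_unfold)
  have "continuous_map (subtopology (prod_topology Y (total_space E)) {(y, e). bundle_proj E e = f y}) Y fst"
    by (intro continuous_map_from_subtopology continuous_map_fst)
  from continuous_map_family[OF s this F(2)]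
  show "continuous_map (subtopology (prod_topology Y (total_space E)) {(y, e). bundle_proj E e = f y})
      (complex_space m) (\<lambda>(y, e). s y (d y e))"
    by (simp add: case_prod_unfold)
  have tv: "t y v \<in> vecs n" if "y \<in> topspace Y" "v \<in> vecs m" for y v using lin_map_in[OF lin] that by blast
  fix y assume y: "y \<in> topspace Y"
  show "b y (t y (s y (d y e))) = e" if "e \<in> topspace (total_space E)" "bundle_proj E e = f y" for e
    using ts[OF y F(9)[OF y that]] F(7)[OF y that] by simp
  fix v assume v: "v \<in> vecs m"
  show "bundle_proj E (b y (t y v)) = f y" using F(3)[OF y tv[OF y v]] .
  show "s y (d y (b y (t y v))) = v" using F(4)[OF y tv[OF y v]] st[OF y v] by simp
  show "b y (t y (\<lambda>i. v i + w i)) = fibre_add E (b y (t y v)) (b y (t y w))" if "w \<in> vecs m" for w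
    using F(5)[OF y tv[OF y v] tv[OF y that]] lin_map_add[OF lin[OF y] v that] by simp
  show "b y (t y (\<lambda>i. c * v i)) = fibre_scale E c (b y (t y v))" for c
    using F(6)[OF y tv[OF y v]] lin_map_scale[OF lin[OF y] v] by simp
qed

lemma frame_pullback:
  assumes B: "frame Y f E n b d" and g: "continuous_map Z Y g"
    and f': "\<And>z. z \<in> topspace Z \<Longrightarrow> f' z = f (g z)"
  shows "frame Z f' E n (\<lambda>z. b (g z)) (\<lambda>z. d (g z))"
  unfolding frame_def
proof (intro conjI ballI allI impI)
  note F = frameD[OF B]
  have gz: "g z \<in> topspace Y" if "z \<in> topspace Z" for z using continuous_map_in[OF g that] .
  have 1: "continuous_map (prod_topology Z (complex_space n)) Y (\<lambda>p. g (fst p))"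
    using continuous_map_compose[OF continuous_map_fst g] by (simp add: o_def)
  show "continuous_map (prod_topology Z (complex_space n)) (total_space E) (\<lambda>(y, v). b (g y) v)"
    using continuous_map_frame[OF B 1 continuous_map_snd] by (simp add: case_prod_unfold)
  let ?P = "subtopology (prod_topology Z (total_space E)) {(y, e). bundle_proj E e = f' y}"
  have 2: "continuous_map ?P Y (\<lambda>p. g (fst p))"
    using continuous_map_compose[OF continuous_map_from_subtopology[OF continuous_map_fst] g] by (simp add: o_def)
  have 3: "continuous_map ?P (total_space E) snd" by (intro continuous_map_from_subtopology continuous_map_snd)
  show "continuous_map ?P (complex_space n) (\<lambda>(y, e). d (g y) e)"
    using continuous_map_coframe[OF B 2 3] f' by (force simp: case_prod_unfold)
qed (use frameD[OF B] continuous_map_in[OF g] f' in \<open>simp_all\<close>)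

lemma continuous_map_closed_Un:
  assumes P: "closedin Z P" and Q: "closedin Z Q" and PQ: "P \<union> Q = topspace Z"
    and f: "continuous_map (subtopology Z P) W f" and g: "continuous_map (subtopology Z Q) W g"
    and eq: "\<And>z. z \<in> P \<Longrightarrow> z \<in> Q \<Longrightarrow> f z = g z"
  shows "continuous_map Z W (\<lambda>z. if z \<in> P then f z else g z)"
  unfolding continuous_map_closedin
proof (intro conjI allI impI Pi_I)
  have top: "topspace (subtopology Z P) = P" "topspace (subtopology Z Q) = Q" using PQ by auto
  fix z assume "z \<in> topspace Z"
  then show "(if z \<in> P then f z else g z) \<in> topspace W"
    using continuous_map_in[OF f, of z] continuous_map_in[OF g, of z] PQ by (auto simp: top)
next
  have top: "topspace (subtopology Z P) = P" "topspace (subtopology Z Q) = Q" using PQ by auto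
  fix C assume C: "closedin W C"
  have "closedin (subtopology Z P) {z \<in> P. f z \<in> C}"
    using closedin_continuous_map_preimage[OF f C] unfolding top .
  then have 1: "closedin Z {z \<in> P. f z \<in> C}" using P closedin_trans_full by blast
  have "closedin (subtopology Z Q) {z \<in> Q. g z \<in> C}"
    using closedin_continuous_map_preimage[OF g C] unfolding top .
  then have 2: "closedin Z {z \<in> Q. g z \<in> C}" using Q closedin_trans_full by blast
  have "{z \<in> topspace Z. (if z \<in> P then f z else g z) \<in> C} = {z \<in> P. f z \<in> C} \<union> {z \<in> Q. g z \<in> C}"
    using PQ eq by auto
  then show "closedin Z {z \<in> topspace Z. (if z \<in> P then f z else g z) \<in> C}"
    by (simp only: closedin_Un[OF 1 2])
qed

text \<open>Coframes are inverse to frames, so they agree on the overlap as soon as the frames do;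
  this is why \<open>eq\<close> speaks of the frames alone.\<close>

lemma frame_glue:
  assumes P: "closedin Y P" and Q: "closedin Y Q" and PQ: "P \<union> Q = topspace Y"
    and B: "frame (subtopology Y P) f E n b d" and B': "frame (subtopology Y Q) f E n b' d'"
    and eq: "\<And>y v. y \<in> P \<Longrightarrow> y \<in> Q \<Longrightarrow> v \<in> vecs n \<Longrightarrow> b y v = b' y v"
  shows "frame Y f E n (\<lambda>y. if y \<in> P then b y else b' y) (\<lambda>y. if y \<in> P then d y else d' y)"
  unfolding frame_def
proof (intro conjI ballI allI impI)
  note F = frameD[OF B] and F' = frameD[OF B']
  have top: "topspace (subtopology Y P) = P" "topspace (subtopology Y Q) = Q" using PQ by auto
  let ?Z = "prod_topology Y (complex_space n)"
  have "continuous_map ?Z (total_space E) (\<lambda>z. if z \<in> P \<times> vecs n then (case z of (y, v) \<Rightarrow> b y v) else (case z of (y, v) \<Rightarrow> b' y v))"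
  proof (rule continuous_map_closed_Un)
    show "closedin ?Z (P \<times> vecs n)" "closedin ?Z (Q \<times> vecs n)"
      using P Q closedin_topspace[of "complex_space n"] by (simp_all add: closedin_prod_Times_iff)
    show "continuous_map (subtopology ?Z (P \<times> vecs n)) (total_space E) (\<lambda>(y, v). b y v)"
      "continuous_map (subtopology ?Z (Q \<times> vecs n)) (total_space E) (\<lambda>(y, v). b' y v)"
      using F(1) F'(1) by (simp_all add: prod_topology_subtopology(1))
  qed (use PQ eq in auto)
  then show "continuous_map ?Z (total_space E) (\<lambda>(y, v). (if y \<in> P then b y else b' y) v)"
  proof (rule continuous_map_eq)
    fix z assume "z \<in> topspace ?Z"
    then obtain y v where "z = (y, v)" "v \<in> vecs n" by auto
    then show "(if z \<in> P \<times> vecs n then (case z of (y, v) \<Rightarrow> b y v) else (case z of (y, v) \<Rightarrow> b' y v)) =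
        (case z of (y, v) \<Rightarrow> (if y \<in> P then b y else b' y) v)"
      by (cases "y \<in> P") simp_all
  qed
  have eq': "d y e = d' y e" if "y \<in> P" "y \<in> Q" "e \<in> topspace (total_space E)" "bundle_proj E e = f y" for y e
  proof -
    have yT: "y \<in> topspace Y" using that(1) PQ by blast
    have "e = b y (d' y e)" using F'(7,9)[of y e] eq[of y "d' y e"] that top yT by simp
    then have "d y e = d y (b y (d' y e))" by simp
    also have "\<dots> = d' y e" using F(4)[of y "d' y e"] F'(9)[of y e] that top yT by simp
    finally show ?thesis .
  qed
  let ?S = "{(y, e). bundle_proj E e = f y}"
  let ?Z = "subtopology (prod_topology Y (total_space E)) ?S"
  have fst: "continuous_map ?Z Y fst" by (intro continuous_map_from_subtopology continuous_map_fst)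
  have "continuous_map ?Z (complex_space n) (\<lambda>z. if z \<in> {z \<in> topspace ?Z. fst z \<in> P} then (case z of (y, e) \<Rightarrow> d y e) else (case z of (y, e) \<Rightarrow> d' y e))"
  proof (rule continuous_map_closed_Un)
    show "closedin ?Z {z \<in> topspace ?Z. fst z \<in> P}" "closedin ?Z {z \<in> topspace ?Z. fst z \<in> Q}"
      by (rule closedin_continuous_map_preimage[OF fst P], rule closedin_continuous_map_preimage[OF fst Q])
    have sub: "subtopology ?Z {z \<in> topspace ?Z. fst z \<in> R} = subtopology (prod_topology (subtopology Y R) (total_space E)) ?S" for R
    proof -
      have "subtopology ?Z {z \<in> topspace ?Z. fst z \<in> R} = subtopology ?Z (R \<times> topspace (total_space E))"
        by (subst (2) subtopology_restrict[symmetric]) (rule arg_cong[where f = "subtopology ?Z"], auto)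
      then show ?thesis
        by (simp add: prod_topology_subtopology(1) subtopology_subtopology Int_commute)
    qed
    show "continuous_map (subtopology ?Z {z \<in> topspace ?Z. fst z \<in> P}) (complex_space n) (\<lambda>(y, e). d y e)"
      "continuous_map (subtopology ?Z {z \<in> topspace ?Z. fst z \<in> Q}) (complex_space n) (\<lambda>(y, e). d' y e)"
      unfolding sub using F(2) F'(2) by simp_all
    show "{z \<in> topspace ?Z. fst z \<in> P} \<union> {z \<in> topspace ?Z. fst z \<in> Q} = topspace ?Z"
      using PQ by auto
  qed (use eq' in auto)
  then show "continuous_map ?Z (complex_space n) (\<lambda>(y, e). (if y \<in> P then d y else d' y) e)"
  proof (rule continuous_map_eq)
    fix z assume z: "z \<in> topspace ?Z"
    obtain y e where "z = (y, e)" by fastforce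
    with z show "(if z \<in> {z \<in> topspace ?Z. fst z \<in> P} then (case z of (y, e) \<Rightarrow> d y e) else (case z of (y, e) \<Rightarrow> d' y e)) =
        (case z of (y, e) \<Rightarrow> (if y \<in> P then d y else d' y) e)"
      by (cases "y \<in> P") simp_all
  qed
  fix y assume y: "y \<in> topspace Y"
  show "(if y \<in> P then b y else b' y) ((if y \<in> P then d y else d' y) e) = e"
    if "e \<in> topspace (total_space E)" "bundle_proj E e = f y" for e
    using F(7)[of y e] F'(7)[of y e] that y PQ top by auto
  fix v assume v: "v \<in> vecs n"
  show "bundle_proj E ((if y \<in> P then b y else b' y) v) = f y"
    using F(3)[of y v] F'(3)[of y v] v y PQ top by auto
  show "(if y \<in> P then d y else d' y) ((if y \<in> P then b y else b' y) v) = v"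
    using F(4)[of y v] F'(4)[of y v] v y PQ top by auto
  show "(if y \<in> P then b y else b' y) (\<lambda>i. c * v i) = fibre_scale E c ((if y \<in> P then b y else b' y) v)" for c
    using F(6)[of y v] F'(6)[of y v] v y PQ top by auto
  show "(if y \<in> P then b y else b' y) (\<lambda>i. v i + w i) =
      fibre_add E ((if y \<in> P then b y else b' y) v) ((if y \<in> P then b y else b' y) w)" if "w \<in> vecs n" for w
    using F(5)[of y v w] F'(5)[of y v w] v that y PQ top by auto
qed

text \<open>One and the same \<open>r\<close> describes the action at all points of
  \<open>S\<close>, so there the bundle looks like a constant representation and \<open>K\<close>
  preserves its fibres. That \<open>r k v\<close> lies in \<open>vecs n\<close> is included because
  \<open>r\<close> is otherwise arbitrary.\<close>

definition equivariant ::
    "'g set \<Rightarrow> 'y set \<Rightarrow> ('g, 'x, 'e) gbundle \<Rightarrow> nat \<Rightarrow> ('y \<Rightarrow> (nat \<Rightarrow> complex) \<Rightarrow> 'e)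
      \<Rightarrow> ('g \<Rightarrow> (nat \<Rightarrow> complex) \<Rightarrow> nat \<Rightarrow> complex) \<Rightarrow> bool" where
  "equivariant K S E n b r \<longleftrightarrow>
     (\<forall>k\<in>K. \<forall>v\<in>vecs n. r k v \<in> vecs n \<and> (\<forall>y\<in>S. bundle_act E k (b y v) = b y (r k v)))"

lemma equivariant_transition:
  assumes B: "frame Y f E n b d" and B': "frame Y f E m b' d'"
    and eq: "equivariant K S E n b r" "equivariant K S' E m b' r'" and k: "k \<in> K" and v: "v \<in> vecs n"
    and y: "y \<in> S" "y \<in> S'" "y \<in> topspace Y"
  shows "d' y (b y (r k v)) = r' k (d' y (b y v))"
proof -
  note t = lin_map_in[OF frame_transition(2)[OF B B' y(3)] v]
  have "b y (r k v) = bundle_act E k (b' y (d' y (b y v)))"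
    using eq(1) k v y frame_transition(3)[OF B B' y(3) v] by (simp add: equivariant_def)
  also have "\<dots> = b' y (r' k (d' y (b y v)))" using eq(2) k t y by (simp add: equivariant_def)
  finally show ?thesis using frameD(4)[OF B' y(3)] eq(2) k t by (simp add: equivariant_def)
qed

text \<open>Over \<open>S\<close> the two frames differ by a transition map. Composed with the
  retraction \<rho> it is defined on all of \<open>Y\<close>, and correcting \<open>b\<close> by it
  gives a frame that restricts to \<open>b0\<close>. The transition intertwines \<open>r0\<close>
  with \<open>r\<close>, so \<open>r0\<close> takes the place of \<open>r\<close>
  everywhere.\<close>

lemma frame_extend:
  assumes B: "frame Y f E m b d" "equivariant K (topspace Y) E m b r"
    and B0: "frame (subtopology Y S) f E n b0 d0" "equivariant K S E n b0 r0"
    and S: "S \<subseteq> topspace Y" and ret: "continuous_map Y (subtopology Y S) \<rho>" "\<And>y. y \<in> S \<Longrightarrow> \<rho> y = y"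
  obtains b1 d1 where "frame Y f E n b1 d1" "equivariant K (topspace Y) E n b1 r0"
    "\<forall>y\<in>S. \<forall>v\<in>vecs n. b1 y v = b0 y v"
proof -
  let ?S = "subtopology Y S"
  have top: "topspace ?S = S" using S by auto
  have rho: "\<rho> y \<in> S" if "y \<in> topspace Y" for y using continuous_map_in[OF ret(1) that] top by simp
  have "continuous_map ?S Y (\<lambda>y. y)"
    using continuous_map_from_subtopology[OF continuous_map_id] by (simp add: id_def)
  from frame_pullback[OF B(1) this refl] have C: "frame ?S f E m b d" .
  note t = frame_transition[OF B0(1) C, unfolded top] and s = frame_transition[OF C B0(1), unfolded top]
  let ?t = "\<lambda>y v. d (\<rho> y) (b0 (\<rho> y) v)" and ?s = "\<lambda>y v. d0 (\<rho> y) (b (\<rho> y) v)"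
  have F: "frame Y f E n (\<lambda>y v. b y (?t y v)) (\<lambda>y e. ?s y (d y e))"
  proof (rule frame_change[OF B(1)])
    have 1: "continuous_map (prod_topology Y V) ?S (\<lambda>p. \<rho> (fst p))" for V :: "(nat \<Rightarrow> complex) topology"
      using continuous_map_compose[OF continuous_map_fst ret(1)] by (simp add: o_def)
    show "continuous_map (prod_topology Y (complex_space n)) (complex_space m) (\<lambda>(y, v). ?t y v)"
      using continuous_map_family[OF t(1) 1 continuous_map_snd] by (simp add: case_prod_unfold)
    show "continuous_map (prod_topology Y (complex_space m)) (complex_space n) (\<lambda>(y, v). ?s y v)"
      using continuous_map_family[OF s(1) 1 continuous_map_snd] by (simp add: case_prod_unfold)
  qed (use t(2,4) s(4) rho in simp_all)
  moreover have "equivariant K (topspace Y) E n (\<lambda>y v. b y (?t y v)) r0"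
    unfolding equivariant_def
  proof (intro ballI conjI)
    fix k v assume k: "k \<in> K" and v: "v \<in> vecs n"
    then show "r0 k v \<in> vecs n" using B0(2) by (simp add: equivariant_def)
    fix y assume y: "y \<in> topspace Y"
    have "?t y (r0 k v) = r k (?t y v)"
      by (rule equivariant_transition[OF B0(1) C B0(2) B(2) k v]) (use rho[OF y] S top in auto)
    moreover have "?t y v \<in> vecs m" using lin_map_in[OF t(2) v] rho[OF y] by simp
    ultimately show "bundle_act E k (b y (?t y v)) = b y (?t y (r0 k v))"
      using B(2) k y by (simp add: equivariant_def)
  qed
  moreover have "\<forall>y\<in>S. \<forall>v\<in>vecs n. b y (?t y v) = b0 y v"
    using t(3) ret(2) by simp
  ultimately show thesis by (rule that)
qed

text \<open>Rank, frame and representation are hidden, which leaves a property of sets that suits an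
  argument by bisection.\<close>

definition has_frame ::
    "'g set \<Rightarrow> ('y::topological_space \<Rightarrow> 'x) \<Rightarrow> ('g, 'x, 'e) gbundle \<Rightarrow> 'y set \<Rightarrow> bool" where
  "has_frame K f E S \<longleftrightarrow> (\<exists>n b d r. frame (top_of_set S) f E n b d \<and> equivariant K S E n b r)"

lemma has_frame_mono:
  assumes "has_frame K f E S" "S' \<subseteq> S"
  shows "has_frame K f E S'"
proof -
  obtain n b d r where B: "frame (top_of_set S) f E n b d" "equivariant K S E n b r"
    using assms(1) unfolding has_frame_def by blast
  have "continuous_map (top_of_set S') (top_of_set S) (\<lambda>y. y)"
    using assms(2) by (auto intro: continuous_on_id)
  from frame_pullback[OF B(1) this] have "frame (top_of_set S') f E n b d" by simp
  moreover have "equivariant K S' E n b r" using B(2) assms(2) by (auto simp: equivariant_def)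
  ultimately show ?thesis unfolding has_frame_def by blast
qed

text \<open>The frame on \<open>A\<close> is kept. Its restriction to the overlap is extended over
  \<open>B\<close> along the retraction \<rho>, and the two are glued.\<close>

lemma has_frame_Un:
  assumes A: "has_frame K f E A" and B: "has_frame K f E B"
    and cl: "closedin (top_of_set (A \<union> B)) A" "closedin (top_of_set (A \<union> B)) B"
    and ret: "continuous_on B \<rho>" "\<And>y. y \<in> B \<Longrightarrow> \<rho> y \<in> A \<inter> B" "\<And>y. y \<in> A \<Longrightarrow> y \<in> B \<Longrightarrow> \<rho> y = y"
  shows "has_frame K f E (A \<union> B)"
proof -
  obtain n b d r where 1: "frame (top_of_set A) f E n b d" "equivariant K A E n b r"
    using A unfolding has_frame_def by blast
  obtain m b' d' r' where 2: "frame (top_of_set B) f E m b' d'" "equivariant K B E m b' r'"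
    using B unfolding has_frame_def by blast
  have AB: "subtopology (top_of_set B) (A \<inter> B) = top_of_set (A \<inter> B)"
    by (simp add: subtopology_subtopology Int_ac)
  have "continuous_map (top_of_set (A \<inter> B)) (top_of_set A) (\<lambda>y. y)" by (auto intro: continuous_on_id)
  from frame_pullback[OF 1(1) this refl]
  have b0: "frame (subtopology (top_of_set B) (A \<inter> B)) f E n b d" unfolding AB .
  have eq: "equivariant K (A \<inter> B) E n b r" using 1(2) by (auto simp: equivariant_def)
  have rho: "continuous_map (top_of_set B) (subtopology (top_of_set B) (A \<inter> B)) \<rho>"
    unfolding AB using ret(1,2) by auto
  obtain b1 d1 where 3: "frame (top_of_set B) f E n b1 d1" "equivariant K B E n b1 r"
    "\<forall>y\<in>A \<inter> B. \<forall>v\<in>vecs n. b1 y v = b y v"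
    by (rule frame_extend[OF 2(1) _ b0 eq _ rho, unfolded topspace_euclidean_subtopology, OF 2(2)])
       (auto simp: ret(3))
  have sub: "subtopology (top_of_set (A \<union> B)) A = top_of_set A" "subtopology (top_of_set (A \<union> B)) B = top_of_set B"
    by (simp_all add: subtopology_subtopology inf_sup_absorb Int_absorb1)
  have "frame (top_of_set (A \<union> B)) f E n (\<lambda>y. if y \<in> A then b y else b1 y) (\<lambda>y. if y \<in> A then d y else d1 y)"
    by (rule frame_glue[OF cl]) (use 1(1) 3 sub in simp_all)
  moreover have "equivariant K (A \<union> B) E n (\<lambda>y. if y \<in> A then b y else b1 y) r"
    using 1(2) 3(2) by (auto simp: equivariant_def)
  ultimately show ?thesis unfolding has_frame_def by blast
qed

text \<open>Bisection in both directions. For a fixed height \<open>w\<close>, frames on small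
  rectangles are glued along the first coordinate to a frame on a thin strip around
  \<open>w\<close>; the strips are then stacked. Adjacent rectangles meet in an edge, and the second
  one retracts onto it by projection.\<close>

lemma has_frame_rectangle:
  fixes f :: "real \<times> real \<Rightarrow> 'x"
  assumes loc: "\<And>y. \<exists>e>0. has_frame K f E (ball y e)" and ab: "a \<le> b" "c \<le> d"
  shows "has_frame K f E ({a..b} \<times> {c..d})"
proof -
  have strip: "\<exists>e>0. \<forall>c d. c \<le> w \<and> w \<le> d \<and> d - c < e \<longrightarrow> has_frame K f E ({a..b} \<times> {c..d})" for w
    using ab(1)
  proof (induction rule: Bolzano)
    case (trans a b c)
    obtain e1 where e1: "e1 > 0" "\<And>p q. p \<le> w \<Longrightarrow> w \<le> q \<Longrightarrow> q - p < e1 \<Longrightarrow> has_frame K f E ({a..b} \<times> {p..q})"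
      using trans(1) by blast
    obtain e2 where e2: "e2 > 0" "\<And>p q. p \<le> w \<Longrightarrow> w \<le> q \<Longrightarrow> q - p < e2 \<Longrightarrow> has_frame K f E ({b..c} \<times> {p..q})"
      using trans(2) by blast
    have "has_frame K f E ({a..c} \<times> {p..q})" if "p \<le> w" "w \<le> q" "q - p < min e1 e2" for p q
    proof -
      have U: "{a..c} \<times> {p..q} = {a..b} \<times> {p..q} \<union> {b..c} \<times> {p..q}" using trans(3,4) by auto
      show ?thesis unfolding U
      proof (rule has_frame_Un[where \<rho> = "\<lambda>y. (b, snd y)"])
        show "closedin (top_of_set ({a..b} \<times> {p..q} \<union> {b..c} \<times> {p..q})) ({a..b} \<times> {p..q})"
          "closedin (top_of_set ({a..b} \<times> {p..q} \<union> {b..c} \<times> {p..q})) ({b..c} \<times> {p..q})"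
          by (intro closed_subset closed_Times; auto)+
      qed (use e1(2) e2(2) that trans(3,4) in \<open>auto intro!: continuous_intros\<close>)
    qed
    then show ?case using e1(1) e2(1) by (intro exI[of _ "min e1 e2"]) auto
  next
    case (local x)
    obtain e where e: "e > 0" "has_frame K f E (ball (x, w) e)" using loc by blast
    have "has_frame K f E ({a..b} \<times> {c..d})"
      if "a \<le> x" "x \<le> b" "b - a < e / 2" "c \<le> w" "w \<le> d" "d - c < e / 2" for a b c d
    proof (rule has_frame_mono[OF e(2)], rule subsetI)
      fix p assume "p \<in> {a..b} \<times> {c..d}"
      then obtain u t where ut: "p = (u, t)" "a \<le> u" "u \<le> b" "c \<le> t" "t \<le> d" by auto
      then have p: "p = (u, t)" "\<bar>x - u\<bar> < e / 2" "\<bar>w - t\<bar> < e / 2" using that by linarith+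
      have "dist (x, w) (u, t) \<le> dist x u + dist w t"
        by (simp add: dist_Pair_Pair sqrt_sum_squares_le_sum)
      then show "p \<in> ball (x, w) e" using p by (simp add: dist_real_def)
    qed
    then show ?case using e(1) by (intro exI[of _ "e / 2"] conjI allI impI) auto
  qed
  show ?thesis using ab(2)
  proof (induction rule: Bolzano)
    case (trans p q s)
    have U: "{a..b} \<times> {p..s} = {a..b} \<times> {p..q} \<union> {a..b} \<times> {q..s}" using trans(3,4) by auto
    show ?case unfolding U
    proof (rule has_frame_Un[OF trans(1,2), where \<rho> = "\<lambda>y. (fst y, q)"])
      show "closedin (top_of_set ({a..b} \<times> {p..q} \<union> {a..b} \<times> {q..s})) ({a..b} \<times> {p..q})"
        "closedin (top_of_set ({a..b} \<times> {p..q} \<union> {a..b} \<times> {q..s})) ({a..b} \<times> {q..s})"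
        by (intro closed_subset closed_Times; auto)+
    qed (use trans(3,4) in \<open>auto intro!: continuous_intros\<close>)
  next
    case (local w)
    then show ?case using strip[of w] by blast
  qed
qed

section \<open>Equivariant local frames by averaging\<close>

context compact_group
begin

text \<open>Near \<open>y0\<close> the functions of \<open>g\<close> change uniformly little,
  because the group is compact; the mean is linear and respects uniform bounds.\<close>

lemma continuous_map_mean:
  assumes F: "continuous_map (prod_topology T Y) euclideanreal F"
  shows "continuous_map Y euclideanreal (\<lambda>y. mean (\<lambda>g. F (g, y)))"
proof -
  have Fy: "continuous_map T euclideanreal (\<lambda>g. F (g, y))" if "y \<in> topspace Y" for y
    using continuous_map_compose[OF continuous_map_pairedI[OF continuous_map_id] F, of "\<lambda>g. y"] that
    by (simp add: o_def)
  have "continuous_map Y Met_TC.mtopology (\<lambda>y. mean (\<lambda>g. F (g, y)))"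
    unfolding Met_TC.continuous_map_to_metric
  proof (intro ballI allI impI)
    fix y0 e assume y0: "y0 \<in> topspace Y" and "(e::real) > 0"
    then have e: "e / 2 > 0" by simp
    obtain W where W: "openin Y W" "y0 \<in> W"
      "\<And>g y. g \<in> topspace T \<Longrightarrow> y \<in> W \<Longrightarrow> norm (F (g, y) - F (g, y0)) < e / 2"
      using compact_uniform_nbhd[OF F compact y0 e] by blast
    have "mean (\<lambda>g. F (g, y)) \<in> Met_TC.mball (mean (\<lambda>g. F (g, y0))) e" if y: "y \<in> W" for y
    proof -
      have yY: "y \<in> topspace Y" using W(1) y openin_subset by blast
      have c: "continuous_map T euclideanreal (\<lambda>g. - 1 * F (g, y0))"
        by (rule continuous_map_real_mult_left[OF Fy[OF y0]])
      have "\<bar>mean (\<lambda>g. F (g, y) + - 1 * F (g, y0)) - 0\<bar> \<le> e / 2"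
        by (rule mean_near[OF continuous_map_add[OF Fy[OF yY] c]])
           (use W(3)[OF _ y] topspace_eq in \<open>auto intro: less_imp_le\<close>)
      then have "\<bar>mean (\<lambda>g. F (g, y)) - mean (\<lambda>g. F (g, y0))\<bar> \<le> e / 2"
        unfolding mean_add[OF Fy[OF yY] c] mean_scale[OF Fy[OF y0]] by simp
      then show ?thesis using \<open>e > 0\<close> by (simp add: dist_real_def abs_minus_commute)
    qed
    then show "\<exists>U. openin Y U \<and> y0 \<in> U \<and> (\<forall>y\<in>U. mean (\<lambda>g. F (g, y)) \<in> Met_TC.mball (mean (\<lambda>g. F (g, y0))) e)"
      using W(1,2) by blast
  qed
  then show ?thesis by simp
qed

definition cmean :: "('a \<Rightarrow> complex) \<Rightarrow> complex" where
  "cmean f = Complex (mean (\<lambda>g. Re (f g))) (mean (\<lambda>g. Im (f g)))"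

lemma continuous_map_Re: "continuous_map X euclidean f \<Longrightarrow> continuous_map X euclideanreal (\<lambda>x. Re (f x))"
  by (erule continuous_map_unop[rotated]) (intro continuous_intros)

lemma continuous_map_Im: "continuous_map X euclidean f \<Longrightarrow> continuous_map X euclideanreal (\<lambda>x. Im (f x))"
  by (erule continuous_map_unop[rotated]) (intro continuous_intros)

lemma continuous_map_cmean:
  assumes "continuous_map (prod_topology T Y) euclidean F"
  shows "continuous_map Y euclidean (\<lambda>y. cmean (\<lambda>g. F (g, y)))"
  unfolding cmean_def
  by (rule continuous_map_binop[where h = Complex])
     (auto intro!: continuous_map_mean continuous_map_Re continuous_map_Im assms continuous_intros
        simp: Complex_eq)

lemma cmean_add:
  assumes "continuous_map T euclidean f" "continuous_map T euclidean g"
  shows "cmean (\<lambda>x. f x + g x) = cmean f + cmean g"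
  using assms by (simp add: cmean_def mean_add continuous_map_Re continuous_map_Im complex_eq_iff)

lemma cmean_scale:
  assumes f: "continuous_map T euclidean f"
  shows "cmean (\<lambda>x. c * f x) = c * cmean f"
proof -
  note c = continuous_map_Re[OF f] continuous_map_Im[OF f]
  have "mean (\<lambda>x. Re c * Re (f x) + (- Im c) * Im (f x)) = Re c * mean (\<lambda>x. Re (f x)) + (- Im c) * mean (\<lambda>x. Im (f x))"
    "mean (\<lambda>x. Re c * Im (f x) + Im c * Re (f x)) = Re c * mean (\<lambda>x. Im (f x)) + Im c * mean (\<lambda>x. Re (f x))"
    using c by (simp_all only: mean_add mean_scale continuous_map_real_mult_left)
  then show ?thesis by (simp add: cmean_def complex_eq_iff)
qed

lemma cmean_sum:
  assumes "finite I" "\<And>i. i \<in> I \<Longrightarrow> continuous_map T euclidean (\<lambda>g. f g i)"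
  shows "cmean (\<lambda>g. \<Sum>i\<in>I. f g i) = (\<Sum>i\<in>I. cmean (\<lambda>g. f g i))"
  using assms
proof (induction I rule: finite_induct)
  case empty
  show ?case using cmean_scale[of "\<lambda>g. 0" 0] by simp
next
  case (insert i I)
  then show ?case by (simp add: cmean_add continuous_map_sum)
qed

lemma cmean_translate:
  assumes "continuous_map T euclidean f" "a \<in> carrier G"
  shows "cmean (\<lambda>x. f (a \<otimes> x)) = cmean f"
  using mean_translate[OF continuous_map_Re[OF assms(1)] assms(2)] mean_translate[OF continuous_map_Im[OF assms(1)] assms(2)]
  by (simp add: cmean_def)

lemma cmean_const:
  assumes "\<And>g. g \<in> carrier G \<Longrightarrow> f g = c"
  shows "cmean f = c"
proof -
  have cont: "continuous_map T euclidean f"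
    by (rule continuous_map_eq[of _ _ "\<lambda>g. c"]) (use assms topspace_eq in auto)
  have "\<bar>mean (\<lambda>g. Re (f g)) - Re c\<bar> \<le> 0" "\<bar>mean (\<lambda>g. Im (f g)) - Im c\<bar> \<le> 0"
    by (rule mean_near[OF continuous_map_Re[OF cont]] mean_near[OF continuous_map_Im[OF cont]]; simp add: assms)+
  then show ?thesis by (simp add: cmean_def complex_eq_iff)
qed

text \<open>
  In a chart around \<open>f y0\<close> the group acts on the fibre over \<open>f y\<close> by matrices \<open>m g y\<close>; averaging
  \<open>m g y \<circ> m (inv g) y0\<close> over \<open>g\<close> gives an intertwiner that is the identity at \<open>y0\<close>.
\<close>

lemma local_frame:
  fixes E :: "('a, 'x, 'e) gbundle"
  assumes E: "G_vector_bundle G T X \<alpha> E" and f: "continuous_map Y X f" and y0: "y0 \<in> topspace Y"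
    and fixed: "\<And>g y. g \<in> carrier G \<Longrightarrow> y \<in> topspace Y \<Longrightarrow> \<alpha> g (f y) = f y"
  obtains N n b d r where "openin Y N" "y0 \<in> N" "frame (subtopology Y N) f E n b d"
    "equivariant (carrier G) N E n b r"
proof -
  note E' = G_vector_bundleD[OF E]
  note act = G_spaceD[OF E'(2)]
  obtain U n \<tau> \<phi> where U: "f y0 \<in> U" and ch: "vb_chart X E U n \<tau> \<phi>"
    using complex_vector_bundleD(3)[OF E'(1) continuous_map_in[OF f y0]] by blast
  note D = vb_chartD[OF ch]
  define N0 where "N0 = {y \<in> topspace Y. f y \<in> U}"
  have N0: "openin Y N0" unfolding N0_def by (rule openin_continuous_map_preimage[OF f D(1)])
  let ?Y = "subtopology Y N0"
  have topY: "topspace ?Y = N0" by (auto simp: N0_def)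
  have fU: "f y \<in> U" "y \<in> topspace Y" if "y \<in> N0" for y using that by (auto simp: N0_def)
  have fY: "continuous_map ?Y (subtopology X U) f"
    using continuous_map_from_subtopology[OF f] fU topY by (auto simp: continuous_map_in_subtopology)
  define m where "m g y v = \<phi> (bundle_act E g (\<tau> (f y, v)))" for g y v
  have \<tau>in: "\<tau> (f y, v) \<in> topspace (total_space E)" "bundle_proj E (\<tau> (f y, v)) = f y"
    if "y \<in> N0" "v \<in> vecs n" for y v using D(7,8) fU that by auto
  have actin: "bundle_act E g (\<tau> (f y, v)) \<in> topspace (total_space E)" "bundle_proj E (bundle_act E g (\<tau> (f y, v))) = f y"
    if "g \<in> carrier G" "y \<in> N0" "v \<in> vecs n" for g y v
    using act(4) \<tau>in E'(3) fixed fU that topspace_eq by simp_all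
  have m_in: "m g y v \<in> vecs n" if "g \<in> carrier G" "y \<in> N0" "v \<in> vecs n" for g y v
    unfolding m_def using D(6) actin fU that by simp
  have \<tau>m: "\<tau> (f y, m g y v) = bundle_act E g (\<tau> (f y, v))" if "g \<in> carrier G" "y \<in> N0" "v \<in> vecs n" for g y v
    unfolding m_def using D(5)[OF actin(1)[OF that]] actin(2)[OF that] fU(1)[OF that(2)] by simp
  have \<tau>inj: "v = w" if "y \<in> N0" "v \<in> vecs n" "w \<in> vecs n" "\<tau> (f y, v) = \<tau> (f y, w)" for y v w
  proof -
    have "\<phi> (\<tau> (f y, v)) = \<phi> (\<tau> (f y, w))" using that(4) by (rule arg_cong)
    then show ?thesis unfolding D(9)[OF fU(1)[OF that(1)] that(2)] D(9)[OF fU(1)[OF that(1)] that(3)] .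
  qed
  have m_one: "m \<one> y v = v" if "y \<in> N0" "v \<in> vecs n" for y v
    unfolding m_def using act(2)[OF \<tau>in(1)] D(9) fU that by simp
  have m_mult: "m (g \<otimes> h) y v = m g y (m h y v)" if "g \<in> carrier G" "h \<in> carrier G" "y \<in> N0" "v \<in> vecs n" for g h y v
    unfolding m_def[of g] \<tau>m[OF that(2-4)] unfolding m_def using act(3)[OF that(1,2) \<tau>in(1)[OF that(3,4)]] by simp
  have m_lin: "lin_map n n (m g y)" if g: "g \<in> carrier G" and y: "y \<in> N0" for g y
  proof (rule lin_mapI)
    fix v w assume v: "v \<in> vecs n" and w: "w \<in> vecs n"
    have "\<tau> (f y, m g y (\<lambda>i. v i + w i)) = bundle_act E g (fibre_add E (\<tau> (f y, v)) (\<tau> (f y, w)))"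
      using \<tau>m[OF g y vecs_add[OF v w]] D(10)[OF fU(1)[OF y] v w] by simp
    also have "\<dots> = fibre_add E (\<tau> (f y, m g y v)) (\<tau> (f y, m g y w))"
      using E'(4)[OF g \<tau>in(1)[OF y v] \<tau>in(1)[OF y w]] \<tau>in(2)[OF y v] \<tau>in(2)[OF y w] \<tau>m[OF g y v] \<tau>m[OF g y w] by simp
    also have "\<dots> = \<tau> (f y, \<lambda>i. m g y v i + m g y w i)"
      by (rule D(10)[OF fU(1)[OF y] m_in[OF g y v] m_in[OF g y w]])
    finally show "m g y (\<lambda>i. v i + w i) = (\<lambda>i. m g y v i + m g y w i)"
      by (rule \<tau>inj[OF y m_in[OF g y vecs_add[OF v w]] vecs_add[OF m_in[OF g y v] m_in[OF g y w]]])
  next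
    fix c v assume v: "v \<in> vecs n"
    have "\<tau> (f y, m g y (\<lambda>i. c * v i)) = bundle_act E g (fibre_scale E c (\<tau> (f y, v)))"
      using \<tau>m[OF g y vecs_scale[OF v]] D(11)[OF fU(1)[OF y] v] by simp
    also have "\<dots> = fibre_scale E c (\<tau> (f y, m g y v))"
      using E'(5)[OF g \<tau>in(1)[OF y v]] \<tau>m[OF g y v] by simp
    also have "\<dots> = \<tau> (f y, \<lambda>i. c * m g y v i)"
      by (rule D(11)[OF fU(1)[OF y] m_in[OF g y v]])
    finally show "m g y (\<lambda>i. c * v i) = (\<lambda>i. c * m g y v i)"
      by (rule \<tau>inj[OF y m_in[OF g y vecs_scale[OF v]] vecs_scale[OF m_in[OF g y v]]])
  qed (rule m_in[OF g y])
  have m_cont: "continuous_map Z (complex_space n) (\<lambda>z. m (p z) (q z) (h z))"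
    if p: "continuous_map Z T p" and q: "continuous_map Z ?Y q" and h: "continuous_map Z (complex_space n) h"
    for Z :: "'z topology" and p q h
  proof -
    have fq: "continuous_map Z (subtopology X U) (\<lambda>z. f (q z))"
      using continuous_map_compose[OF q fY] by (simp add: o_def)
    have "continuous_map Z (total_space E) (\<lambda>z. \<tau> (f (q z), h z))"
      using continuous_map_compose[OF continuous_map_pairedI[OF fq h] D(3)] by (simp add: o_def)
    from continuous_map_action[OF E'(2) p this]
    have "continuous_map Z (total_space E) (\<lambda>z. bundle_act E (p z) (\<tau> (f (q z), h z)))" .
    moreover have "bundle_act E (p z) (\<tau> (f (q z), h z)) \<in> part_over E U" if "z \<in> topspace Z" for z
      using actin[of "p z" "q z" "h z"] continuous_map_in[OF p that] continuous_map_in[OF q that]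
        continuous_map_in[OF h that] fU(1)[of "q z"] topspace_eq topY by (simp add: part_over_def)
    ultimately have "continuous_map Z (subtopology (total_space E) (part_over E U))
        (\<lambda>z. bundle_act E (p z) (\<tau> (f (q z), h z)))"
      by (auto simp: continuous_map_in_subtopology)
    from continuous_map_compose[OF this D(4)] show ?thesis by (simp add: o_def m_def)
  qed
  define r where "r g = m g y0" for g
  have y0N: "y0 \<in> N0" using y0 U by (simp add: N0_def)
  define k where "k g y v = m g y (r (inv g) v)" for g y v
  have r_in: "r g v \<in> vecs n" if "g \<in> carrier G" "v \<in> vecs n" for g v
    unfolding r_def using m_in y0N that by blast
  have k_cont: "continuous_map Z (complex_space n) (\<lambda>z. k (p z) (q z) v)"
    if p: "continuous_map Z T p" and q: "continuous_map Z ?Y q" and v: "v \<in> vecs n"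
    for Z :: "'z topology" and p q v
  proof -
    have ip: "continuous_map Z T (\<lambda>z. inv (p z))" using continuous_map_compose[OF p cont_inv] by (simp add: o_def)
    have y0c: "continuous_map Z ?Y (\<lambda>z. y0)" and vc: "continuous_map Z (complex_space n) (\<lambda>z. v)"
      using y0N topY v y0 by auto
    show ?thesis unfolding k_def r_def by (intro m_cont p q ip y0c vc)
  qed
  have k_contT: "continuous_map T euclidean (\<lambda>g. k g y v i)" if "y \<in> N0" "v \<in> vecs n" for y v i
    using k_cont[OF continuous_map_id[of T] _ that(2), of "\<lambda>g. y"] that(1) topY fU(2)[OF that(1)]
    by (simp add: continuous_map_complex_space_iff)
  have k_lin: "lin_map n n (k g y)" if "g \<in> carrier G" "y \<in> N0" for g y
    using lin_map_compose[OF m_lin[OF inv_closed[OF that(1)] y0N] m_lin[OF that]] by (simp add: k_def[abs_def] r_def)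
  \<comment> \<open>The action of \<open>h\<close> only translates the averaging variable
    \<open>g\<close>. By invariance of the mean the average is therefore an intertwiner.\<close>
  have k_equi: "m h y (k g y v) = k (h \<otimes> g) y (r h v)"
    if h: "h \<in> carrier G" and g: "g \<in> carrier G" and y: "y \<in> N0" and v: "v \<in> vecs n" for h g y v
  proof -
    have "r (inv (h \<otimes> g)) (r h v) = r (inv (h \<otimes> g) \<otimes> h) v"
      unfolding r_def using m_mult h g y0N v by simp
    also have "inv (h \<otimes> g) \<otimes> h = inv g" using h g by (simp add: inv_mult_group m_assoc)
    finally have "k (h \<otimes> g) y (r h v) = m (h \<otimes> g) y (r (inv g) v)" by (simp add: k_def)
    also have "\<dots> = m h y (k g y v)" unfolding k_def by (rule m_mult[OF h g y r_in[OF inv_closed[OF g] v]])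
    finally show ?thesis ..
  qed
  define B where "B y v = (\<lambda>i. cmean (\<lambda>g. k g y v i))" for y v
  have B_in: "B y v \<in> vecs n" if "y \<in> N0" "v \<in> vecs n" for y v
    using lin_map_in[OF k_lin] that unfolding B_def vecs_def by (auto intro!: cmean_const)
  \<comment> \<open>Only values on the carrier matter: the difference of the two functions is 0
    there, hence has mean 0.\<close>
  have cmean_cong: "cmean F = cmean F'" if "\<And>g. g \<in> carrier G \<Longrightarrow> F g = F' g" "continuous_map T euclidean F'" for F F'
  proof -
    have c: "continuous_map T euclidean F" by (rule continuous_map_eq[OF that(2)]) (use that topspace_eq in simp)
    have "cmean (\<lambda>g. F g + (- 1) * F' g) = 0" by (rule cmean_const) (simp add: that(1))
    moreover have "continuous_map T euclidean (\<lambda>g. (- 1) * F' g)"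
      by (intro continuous_map_mult_algebra that(2)) auto
    ultimately show ?thesis by (simp only: cmean_add[OF c] cmean_scale[OF that(2)]) simp
  qed
  have B_lin: "lin_map n n (B y)" if y: "y \<in> N0" for y
  proof (rule lin_mapI)
    fix v w assume v: "v \<in> vecs n" and w: "w \<in> vecs n"
    have "cmean (\<lambda>g. k g y (\<lambda>i. v i + w i) i) = cmean (\<lambda>g. k g y v i + k g y w i)" for i
      by (rule cmean_cong)
         (use lin_map_add[OF k_lin[OF _ y] v w] k_contT[OF y] v w in \<open>auto intro: continuous_map_add\<close>)
    then show "B y (\<lambda>i. v i + w i) = (\<lambda>i. B y v i + B y w i)"
      unfolding B_def using cmean_add[OF k_contT[OF y v] k_contT[OF y w]] by simp
  next
    fix c v assume v: "v \<in> vecs n"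
    have "cmean (\<lambda>g. k g y (\<lambda>i. c * v i) i) = cmean (\<lambda>g. c * k g y v i)" for i
      by (rule cmean_cong)
         (use lin_map_scale[OF k_lin[OF _ y] v] k_contT[OF y v] in \<open>auto intro: continuous_map_mult_algebra\<close>)
    then show "B y (\<lambda>i. c * v i) = (\<lambda>i. c * B y v i)"
      unfolding B_def using cmean_scale[OF k_contT[OF y v]] by simp
  qed (rule B_in[OF y])
  have B_equi: "m h y (B y v) = B y (r h v)" if h: "h \<in> carrier G" and y: "y \<in> N0" and v: "v \<in> vecs n" for h y v
  proof
    fix i
    have c: "continuous_map T euclidean (\<lambda>g. k g y (r h v) i)" by (rule k_contT[OF y r_in[OF h v]])
    have "m h y (B y v) i = (\<Sum>j<n. B y v j * m h y (basis_vec j) i)"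
      using lin_map_expand[OF m_lin[OF h y] B_in[OF y v]] by simp
    also have "\<dots> = (\<Sum>j<n. cmean (\<lambda>g. m h y (basis_vec j) i * k g y v j))"
      unfolding B_def by (simp add: cmean_scale[OF k_contT[OF y v]] mult.commute[of "cmean _"])
    also have "\<dots> = cmean (\<lambda>g. \<Sum>j<n. m h y (basis_vec j) i * k g y v j)"
      by (rule cmean_sum[symmetric]) (auto intro: continuous_map_mult_algebra k_contT[OF y v])
    also have "\<dots> = cmean (\<lambda>g. k (h \<otimes> g) y (r h v) i)"
    proof (rule cmean_cong)
      fix g assume g: "g \<in> carrier G"
      have "(\<Sum>j<n. m h y (basis_vec j) i * k g y v j) = m h y (k g y v) i"
        using lin_map_expand[OF m_lin[OF h y] lin_map_in[OF k_lin[OF g y] v]] by (simp add: mult.commute)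
      then show "(\<Sum>j<n. m h y (basis_vec j) i * k g y v j) = k (h \<otimes> g) y (r h v) i"
        using k_equi[OF h g y v] by simp
    next
      have "continuous_map T T (\<lambda>g. h \<otimes> g)" using h topspace_eq by (intro continuous_map_mult) auto
      from continuous_map_compose[OF this c] show "continuous_map T euclidean (\<lambda>g. k (h \<otimes> g) y (r h v) i)"
        by (simp add: o_def)
    qed
    also have "\<dots> = B y (r h v) i" unfolding B_def by (rule cmean_translate[OF c h])
    finally show "m h y (B y v) i = B y (r h v) i" .
  qed
  have B_cont: "continuous_map (prod_topology ?Y (complex_space n)) (complex_space n) (\<lambda>(y, v). B y v)"
  proof (rule continuous_map_lin_family)
    show "lin_map n n (B y)" if "y \<in> topspace ?Y" for y using B_lin that topY by simp
    fix i j assume "i < n" "j < n"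
    then have "continuous_map (prod_topology T ?Y) (complex_space n) (\<lambda>p. k (fst p) (snd p) (basis_vec j))"
      by (intro k_cont continuous_map_fst continuous_map_snd) simp
    then have "continuous_map (prod_topology T ?Y) euclidean (\<lambda>p. k (fst p) (snd p) (basis_vec j) i)"
      by (simp add: continuous_map_complex_space_iff)
    from continuous_map_cmean[OF this] show "continuous_map ?Y euclidean (\<lambda>y. B y (basis_vec j) i)"
      by (simp add: B_def)
  qed
  have B_y0: "B y0 v = v" if v: "v \<in> vecs n" for v
  proof
    fix i
    have "k g y0 v i = v i" if g: "g \<in> carrier G" for g
    proof -
      have "k g y0 v = m (g \<otimes> inv g) y0 v"
        unfolding k_def r_def using m_mult[OF g inv_closed[OF g] y0N v] by simp
      then show ?thesis using g m_one[OF y0N v] by simp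
    qed
    then show "B y0 v i = v i" unfolding B_def by (rule cmean_const)
  qed
  let ?det = "\<lambda>y. Determinant.det (lin_mat n (B y))"
  \<comment> \<open>At \<open>y0\<close> the averaged map is the identity, so by continuity of the
    determinant it stays invertible near \<open>y0\<close>.\<close>
  define N where "N = {y \<in> topspace ?Y. ?det y \<in> - {0}}"
  have "openin ?Y N" unfolding N_def
    by (rule openin_continuous_map_preimage[OF continuous_map_det_lin_family[OF B_cont]]) auto
  then have N: "openin Y N" using N0 openin_trans_full by blast
  have NN0: "y \<in> N0" "?det y \<noteq> 0" if "y \<in> N" for y using that topY by (auto simp: N_def)
  have "lin_mat n (B y0) = 1\<^sub>m n" using B_y0 by (simp add: lin_mat_id[symmetric] cong: lin_mat_cong)
  then have y0N': "y0 \<in> N" using y0N y0 topY by (simp add: N_def)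
  let ?b = "\<lambda>y v. \<tau> (f y, B y v)" and ?d = "\<lambda>y e. lin_inv n (B y) (\<phi> e)"
  let ?YN = "subtopology Y N"
  have topN: "topspace ?YN = N" using NN0(1) by (auto simp: N0_def)
  have YN_eq: "?YN = subtopology ?Y N" using NN0(1) by (simp add: subtopology_subtopology Int_absorb1 subsetI)
  have BN: "continuous_map (prod_topology ?YN (complex_space n)) (complex_space n) (\<lambda>(y, v). B y v)"
    unfolding YN_eq prod_topology_subtopology(1)[of ?Y] by (rule continuous_map_from_subtopology[OF B_cont])
  have iN: "continuous_map (prod_topology ?YN (complex_space n)) (complex_space n) (\<lambda>(y, v). lin_inv n (B y) v)"
    by (rule continuous_map_lin_inv_family[OF BN]) (use NN0 topN in simp)
  have fN: "continuous_map ?YN (subtopology X U) f"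
    unfolding YN_eq by (rule continuous_map_from_subtopology[OF fY])
  have "frame ?YN f E n ?b ?d"
    unfolding frame_def
  proof (intro conjI ballI allI impI)
    have 1: "continuous_map (prod_topology ?YN (complex_space n)) (subtopology X U) (\<lambda>p. f (fst p))"
      using continuous_map_compose[OF continuous_map_fst fN] by (simp add: o_def)
    show "continuous_map (prod_topology ?YN (complex_space n)) (total_space E) (\<lambda>(y, v). ?b y v)"
      using continuous_map_compose[OF continuous_map_pairedI[OF 1 BN] D(3)] by (simp add: o_def case_prod_unfold)
    let ?P = "subtopology (prod_topology ?YN (total_space E)) {(y, e). bundle_proj E e = f y}"
    have "continuous_map ?P (subtopology (total_space E) (part_over E U)) snd"
      using continuous_map_from_subtopology[OF continuous_map_snd] fU(1) NN0(1)
      by (auto simp: continuous_map_in_subtopology part_over_def)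
    from continuous_map_compose[OF this D(4)]
    have 2: "continuous_map ?P (complex_space n) (\<lambda>p. \<phi> (snd p))" by (simp add: o_def)
    have 3: "continuous_map ?P ?YN fst" by (intro continuous_map_from_subtopology continuous_map_fst)
    show "continuous_map ?P (complex_space n) (\<lambda>(y, e). ?d y e)"
      using continuous_map_family[OF iN 3 2] by (simp add: case_prod_unfold)
    fix y assume "y \<in> topspace ?YN"
    then have y: "y \<in> N" "y \<in> N0" "f y \<in> U" "?det y \<noteq> 0" using topN NN0 fU(1) by auto
    note Bl = B_lin[OF y(2)]
    show "\<tau> (f y, B y (?d y e)) = e" if e: "e \<in> topspace (total_space E)" "bundle_proj E e = f y" for e
      using lin_inv(2)[OF Bl y(4) D(6)[OF e(1)]] D(5)[OF e(1)] e(2) y(3) by simp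
    fix v assume v: "v \<in> vecs n"
    note Bv = lin_map_in[OF Bl v]
    show "bundle_proj E (?b y v) = f y" by (rule D(8)[OF y(3) Bv])
    show "?d y (?b y v) = v" using D(9)[OF y(3) Bv] lin_inv(1)[OF Bl y(4) v] by simp
    show "?b y (\<lambda>i. c * v i) = fibre_scale E c (?b y v)" for c
      using D(11)[OF y(3) Bv] lin_map_scale[OF Bl v] by simp
    show "?b y (\<lambda>i. v i + w i) = fibre_add E (?b y v) (?b y w)" if w: "w \<in> vecs n" for w
      using D(10)[OF y(3) Bv lin_map_in[OF Bl w]] lin_map_add[OF Bl v w] by simp
  qed
  moreover have "equivariant (carrier G) N E n ?b r"
    unfolding equivariant_def
  proof (intro ballI conjI)
    fix g v assume g: "g \<in> carrier G" and v: "v \<in> vecs n"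
    show "r g v \<in> vecs n" by (rule r_in[OF g v])
    fix y assume "y \<in> N"
    then have y: "y \<in> N0" by (rule NN0)
    show "bundle_act E g (?b y v) = ?b y (r g v)"
      using \<tau>m[OF g y B_in[OF y v]] B_equi[OF g y v] by simp
  qed
  ultimately show thesis using that[OF N y0N'] by blast
qed

lemma has_frame_rectangle_fixed:
  fixes f :: "real \<times> real \<Rightarrow> 'x"
  assumes E: "G_vector_bundle G T X \<alpha> E" and f: "continuous_map euclidean X f"
    and fixed: "\<And>g y. g \<in> carrier G \<Longrightarrow> \<alpha> g (f y) = f y"
    and "a \<le> b" "c \<le> d"
  shows "has_frame (carrier G) f E ({a..b} \<times> {c..d})"
proof (rule has_frame_rectangle[OF _ assms(4,5)])
  fix y :: "real \<times> real"
  obtain N n b d r where N: "openin euclidean N" "y \<in> N" "frame (top_of_set N) f E n b d"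
    "equivariant (carrier G) N E n b r"
    using local_frame[OF E f, of y] fixed by (metis UNIV_I topspace_euclidean)
  then have "has_frame (carrier G) f E N" unfolding has_frame_def by blast
  moreover obtain e where "e > 0" "ball y e \<subseteq> N" using N(1,2) open_contains_ball by (metis open_openin)
  ultimately show "\<exists>e>0. has_frame (carrier G) f E (ball y e)" using has_frame_mono by blast
qed

end

section \<open>The sphere and its reflection\<close>

abbreviation sphere2 :: "(real \<times> real) option topology" where "sphere2 \<equiv> sphere_space"

definition squash :: "real \<Rightarrow> real" where "squash s = s / (1 + \<bar>s\<bar>)"

definition unsquash :: "real \<Rightarrow> real" where "unsquash u = u / (1 - \<bar>u\<bar>)"

text \<open>A presentation of the sphere as a quotient: the open square is stretched over the plane,
  and everything else goes to infinity. Being defined on all of the plane, it can be used on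
  rectangles and on their edges alike.\<close>

definition square_map :: "real \<times> real \<Rightarrow> (real \<times> real) option" where
  "square_map = (\<lambda>(u, w). if \<bar>u\<bar> < 1 \<and> \<bar>w\<bar> < 1 then Some (unsquash u, unsquash w) else None)"

text \<open>A section of \<open>square_map\<close>, discontinuous at infinity, where the corner
  \<open>(1, 1)\<close> is an arbitrary choice among the preimages.\<close>

definition square_point :: "(real \<times> real) option \<Rightarrow> real \<times> real" where
  "square_point x = (case x of None \<Rightarrow> (1, 1) | Some (s, t) \<Rightarrow> (squash s, squash t))"

definition half_sphere :: "(real \<times> real) option set" where
  "half_sphere = insert None (Some ` {p. 0 \<le> snd p})"

definition half_square :: "(real \<times> real) set" where
  "half_square = {-1..1} \<times> {0..1}"

text \<open>The part of the half square that lies over infinity. Of the bottom side only the two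
  ends belong to it; the bottom side itself covers the equator.\<close>

definition half_square_sides :: "(real \<times> real) set" where
  "half_square_sides = {p \<in> half_square. \<bar>fst p\<bar> = 1 \<or> snd p = 1}"

lemma topspace_sphere [simp]: "topspace sphere2 = UNIV"
proof -
  have "x \<in> insert None (range Some)" for x :: "(real \<times> real) option" by (cases x) auto
  then show ?thesis by (auto simp: sphere_space_def)
qed

lemma openin_sphere:
  "openin sphere2 V \<longleftrightarrow> (\<exists>U. open U \<and> V = Some ` U) \<or> (\<exists>C. compact C \<and> V = insert None (Some ` (- C)))"
  unfolding sphere_space_def openin_Alexandroff_compactification
  by (auto simp: Compl_eq_Diff_UNIV compact_imp_closed)

lemma Hausdorff_sphere: "Hausdorff_space sphere2"
  unfolding sphere_space_def
  by (simp add: Hausdorff_space_Alexandroff_compactification locally_compact_space_euclidean)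

section \<open>The square as a model of the sphere\<close>

lemma squash_less [simp]: "\<bar>squash s\<bar> < 1"
  by (simp add: squash_def abs_divide)

lemma unsquash_squash [simp]: "unsquash (squash s) = s"
proof -
  have p: "1 + \<bar>s\<bar> > 0" by linarith
  then have "1 - \<bar>s / (1 + \<bar>s\<bar>)\<bar> = 1 / (1 + \<bar>s\<bar>)" by (simp add: abs_divide field_simps)
  then show ?thesis using p by (simp only: unsquash_def squash_def) simp
qed

lemma squash_unsquash: "\<bar>u\<bar> < 1 \<Longrightarrow> squash (unsquash u) = u"
proof -
  assume "\<bar>u\<bar> < 1"
  then have q: "1 - \<bar>u\<bar> > 0" by simp
  then have "1 + \<bar>u / (1 - \<bar>u\<bar>)\<bar> = 1 / (1 - \<bar>u\<bar>)" by (simp add: abs_divide field_simps)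
  then show ?thesis using q by (simp only: unsquash_def squash_def) simp
qed

lemma squash_nonneg: "0 \<le> s \<Longrightarrow> 0 \<le> squash s"
  and unsquash_minus [simp]: "unsquash (- u) = - unsquash u"
  by (simp_all add: unsquash_def squash_def)

lemma square_map_point [simp]: "square_map (square_point x) = x"
  by (auto simp: square_map_def square_point_def split: option.splits)

lemma square_map_None: "square_map (u, w) = None \<longleftrightarrow> \<bar>u\<bar> \<ge> 1 \<or> \<bar>w\<bar> \<ge> 1"
  by (auto simp: square_map_def)

lemma square_map_inj:
  assumes "square_map p = square_map p'" "square_map p \<noteq> None"
  shows "p = p'"
proof -
  obtain u w u' w' where p: "p = (u, w)" "p' = (u', w')" by fastforce
  with assms have b: "\<bar>u\<bar> < 1" "\<bar>w\<bar> < 1" "\<bar>u'\<bar> < 1" "\<bar>w'\<bar> < 1"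
    and "unsquash u = unsquash u'" "unsquash w = unsquash w'"
    by (auto simp: square_map_def split: if_splits)
  then show ?thesis using squash_unsquash p by metis
qed

text \<open>A neighbourhood of infinity is the complement of a compact set \<open>C\<close> of the
  plane. Its preimage is the complement of the copy of \<open>C\<close> in the open square, and this
  copy is compact, hence closed in the whole plane.\<close>

lemma continuous_square_map: "continuous_map euclidean sphere2 square_map"
  unfolding continuous_map_def
proof (intro conjI allI impI)
  define Q :: "(real \<times> real) set" where "Q = {-1<..<1} \<times> {-1<..<1}"
  define j where "j p = (unsquash (fst p), unsquash (snd p))" for p :: "real \<times> real"
  define i where "i p = (squash (fst p), squash (snd p))" for p :: "real \<times> real"
  have sm: "square_map p = (if p \<in> Q then Some (j p) else None)" for p
    by (cases p) (auto simp: square_map_def Q_def j_def abs_less_iff)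
  have Q: "open Q" unfolding Q_def by (intro open_Times) auto
  have j: "continuous_on Q j"
    unfolding j_def Q_def unsquash_def by (intro continuous_intros) auto
  have i: "continuous_on UNIV i"
    unfolding i_def squash_def by (intro continuous_intros) (auto simp: add_nonneg_eq_0_iff)
  have ij: "i (j p) = p" "j p \<in> UNIV" if "p \<in> Q" for p
    using that squash_unsquash[of "fst p"] squash_unsquash[of "snd p"]
    by (auto simp: i_def j_def Q_def abs_less_iff prod_eq_iff)
  have ji: "j (i p) = p" "i p \<in> Q" for p
    using squash_less[of "fst p"] squash_less[of "snd p"]
    by (auto simp: i_def j_def Q_def prod_eq_iff abs_less_iff simp del: squash_less)
  fix V assume "openin sphere2 V"
  then consider U where "open U" "V = Some ` U" | C where "compact C" "V = insert None (Some ` (- C))"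
    unfolding openin_sphere by blast
  then have "open {p. square_map p \<in> V}"
  proof cases
    case 1
    then have "{p. square_map p \<in> V} = Q \<inter> j -` U" by (auto simp: sm split: if_splits)
    then show ?thesis using continuous_open_preimage[OF j Q 1(1)] by simp
  next
    case 2
    have "{p. square_map p \<in> V} = - (i ` C)"
    proof (intro equalityI subsetI)
      fix p assume "p \<in> {p. square_map p \<in> V}"
      then show "p \<in> - (i ` C)" using 2(2) ji by (auto simp: sm split: if_splits)
    next
      fix p assume "p \<in> - (i ` C)"
      then have "j p \<notin> C" if "p \<in> Q" using ij(1)[OF that] by force
      then show "p \<in> {p. square_map p \<in> V}" using 2(2) by (auto simp: sm)
    qed
    moreover have "closed (i ` C)"
      using compact_continuous_image[OF continuous_on_subset[OF i] 2(1)] compact_imp_closed by blast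
    ultimately show ?thesis by (simp add: open_Compl)
  qed
  then show "openin euclidean {p \<in> topspace euclidean. square_map p \<in> V}" by simp
qed auto

lemma square_point_half: "x \<in> half_sphere \<Longrightarrow> square_point x \<in> half_square"
proof (cases x)
  case (Some p)
  assume "x \<in> half_sphere"
  then have t: "snd p \<ge> 0" using Some by (auto simp: half_sphere_def)
  have b: "-1 \<le> squash s \<and> squash s \<le> 1" for s :: real
    using squash_less[of s] by linarith
  from t b[of "fst p"] b[of "snd p"] show ?thesis
    using Some by (auto simp: square_point_def half_square_def squash_nonneg split: prod.splits)
qed (auto simp: square_point_def half_square_def)

lemma square_map_sides: "p \<in> half_square \<Longrightarrow> square_map p = None \<longleftrightarrow> p \<in> half_square_sides"
  by (cases p) (auto simp: square_map_None half_square_def half_square_sides_def)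

lemma half_square_sidesI:
  "\<bar>u\<bar> \<le> 1 \<Longrightarrow> 0 \<le> w \<Longrightarrow> w \<le> 1 \<Longrightarrow> \<bar>u\<bar> = 1 \<or> w = 1 \<Longrightarrow> (u, w) \<in> half_square_sides"
  by (auto simp: half_square_sides_def half_square_def abs_le_iff)

text \<open>The radial projection from the point \<open>(0, -1)\<close>.\<close>

lemma half_square_retraction:
  obtains \<rho> where "continuous_map (top_of_set half_square) (top_of_set half_square_sides) \<rho>"
    "\<forall>p\<in>half_square_sides. \<rho> p = p"
proof -
  \<comment> \<open>In coordinates centred at \<open>(0, -1)\<close> the sides are part of the
    boundary of the box \<open>[-1, 1] \<times> [0, 2]\<close>, on which \<open>m\<close> is the
    gauge: dividing by it pushes a point out to the boundary. It is at most the height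
    \<open>snd p + 1\<close>, which keeps the image from falling below the bottom side.\<close>
  define m where "m p = max \<bar>fst p\<bar> ((snd p + 1) / 2)" for p :: "real \<times> real"
  define \<rho> where "\<rho> p = (fst p / m p, (snd p + 1) / m p - 1)" for p
  have m: "0 < m p" "m p \<le> 1" if "p \<in> half_square" for p
    using that by (auto simp: m_def half_square_def less_max_iff_disj)
  have "continuous_on half_square m"
    unfolding m_def by (intro continuous_intros) auto
  moreover have "\<forall>p\<in>half_square. m p \<noteq> 0" using m(1) by force
  ultimately have "continuous_on half_square \<rho>"
    unfolding \<rho>_def by (intro continuous_intros)
  moreover have "\<rho> p \<in> half_square_sides" if p: "p \<in> half_square" for p
  proof -
    obtain u w where uw: "p = (u, w)" "-1 \<le> u" "u \<le> 1" "0 \<le> w" "w \<le> 1" using p by (auto simp: half_square_def)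
    have k: "\<bar>u\<bar> \<le> m p" "w + 1 \<le> 2 * m p" "\<bar>u\<bar> = m p \<or> w + 1 = 2 * m p" "m p \<le> w + 1"
      using uw by (auto simp: m_def max_def)
    have "\<bar>u / m p\<bar> \<le> 1" using k(1) m[OF p] by (simp add: abs_divide)
    moreover have "0 \<le> (w + 1) / m p - 1" "(w + 1) / m p - 1 \<le> 1"
      using k m[OF p] by (simp_all add: field_simps)
    moreover have "\<bar>u / m p\<bar> = 1 \<or> (w + 1) / m p - 1 = 1"
      using k(3) m[OF p] by (auto simp: abs_divide field_simps)
    ultimately have "(u / m p, (w + 1) / m p - 1) \<in> half_square_sides" by (rule half_square_sidesI)
    then show ?thesis by (simp add: \<rho>_def uw(1))
  qed
  moreover have "\<rho> p = p" if "p \<in> half_square_sides" for p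
  proof -
    have "m p = 1" using that by (auto simp: m_def half_square_sides_def half_square_def max_def)
    then show ?thesis by (simp add: \<rho>_def)
  qed
  ultimately show thesis by (intro that[of \<rho>]) auto
qed

section \<open>The reflection of the sphere\<close>

lemma sphere_act_simps [simp]:
  "sphere_act (one_plus lam) g None = None"
  "sphere_act (one_plus lam) g (Some (s, t)) = Some (s, lam g * t)"
  by (simp_all add: sphere_act_def one_plus_def rep_sum_def character_rep_def)

lemma continuous_reflection:
  "continuous_map sphere2 sphere2 (map_option (\<lambda>(s, t). (s, - t)))"
  unfolding continuous_map_def
proof (intro conjI allI impI)
  define r :: "real \<times> real \<Rightarrow> real \<times> real" where "r = (\<lambda>(s, t). (s, - t))"
  have r: "continuous_on UNIV r" "\<And>p. r (r p) = p"
    by (auto simp: r_def case_prod_unfold intro!: continuous_intros)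
  fix V assume "openin sphere2 V"
  then consider U where "open U" "V = Some ` U" | C where "compact C" "V = insert None (Some ` (- C))"
    unfolding openin_sphere by blast
  then have "openin sphere2 {x. map_option r x \<in> V}"
  proof cases
    case 1
    then have "{x. map_option r x \<in> V} = Some ` (r -` U)" by (auto simp: image_iff)
    moreover have "open (r -` U)" using open_vimage[OF 1(1) r(1)] .
    ultimately show ?thesis unfolding openin_sphere by blast
  next
    case 2
    have "{x. map_option r x \<in> V} = insert None (Some ` (- (r ` C)))"
    proof (rule Set.set_eqI)
      fix x show "x \<in> {x. map_option r x \<in> V} \<longleftrightarrow> x \<in> insert None (Some ` (- (r ` C)))"
      proof (cases x)
        case (Some p)
        have "r p \<in> C \<longleftrightarrow> p \<in> r ` C" using r(2) by (metis imageI image_iff)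
        moreover have "Some q \<in> insert None (Some ` (- D)) \<longleftrightarrow> q \<notin> D" for q and D :: "(real \<times> real) set"
          by auto
        ultimately show ?thesis unfolding Some 2(2) mem_Collect_eq option.map by blast
      qed (use 2(2) in simp)
    qed
    moreover have "compact (r ` C)" using compact_continuous_image[OF continuous_on_subset[OF r(1)] 2(1)] by blast
    ultimately show ?thesis unfolding openin_sphere by blast
  qed
  then show "openin sphere2 {x \<in> topspace sphere2. map_option (\<lambda>(s, t). (s, - t)) x \<in> V}"
    by (simp add: r_def)
qed auto

lemma closedin_half_sphere: "closedin sphere2 half_sphere"
proof -
  have "UNIV - half_sphere = Some ` {p. snd p < 0}"
  proof (rule Set.set_eqI)
    fix x show "x \<in> UNIV - half_sphere \<longleftrightarrow> x \<in> Some ` {p. snd p < 0}"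
      by (cases x) (auto simp: half_sphere_def inj_image_mem_iff[OF inj_Some])
  qed
  moreover have "open {p :: real \<times> real. snd p < 0}" by (intro open_Collect_less continuous_intros)
  ultimately have "openin sphere2 (UNIV - half_sphere)" unfolding openin_sphere by blast
  then show ?thesis by (simp add: closedin_def)
qed

locale compact_group_character = compact_group +
  fixes lam :: "'a \<Rightarrow> real" and H :: "'a set" and c :: 'a
  assumes lam_hom: "lam \<in> hom G O1" and lam_cont: "continuous_map T (top_of_set (carrier O1)) lam"
    and H_def: "H = kernel G O1 lam" and c: "c \<in> carrier G" "c \<notin> H"
    and c_comm_H: "\<And>h. h \<in> H \<Longrightarrow> c \<otimes> h = h \<otimes> c"
begin

section \<open>The subgroup \<open>H\<close>, the central element \<open>c\<close> and the action on
  the sphere\<close>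

abbreviation refl_act where "refl_act \<equiv> sphere_act (one_plus lam)"

lemma lam_mult: "g \<in> carrier G \<Longrightarrow> h \<in> carrier G \<Longrightarrow> lam (g \<otimes> h) = lam g * lam h"
  using lam_hom by (simp add: hom_def O1_def)

lemma H_iff: "g \<in> H \<longleftrightarrow> g \<in> carrier G \<and> lam g = 1"
  by (simp add: H_def kernel_def O1_def)

lemma lam_not_H: "g \<in> carrier G \<Longrightarrow> g \<notin> H \<Longrightarrow> lam g = -1"
  using lam_hom by (auto simp: H_iff hom_def O1_def Pi_iff)

lemma lam_c [simp]: "lam c = -1" using lam_not_H c by blast

lemma H_carrier: "h \<in> H \<Longrightarrow> h \<in> carrier G" by (simp add: H_iff)

lemma lam_one: "lam \<one> = 1"
proof -
  have "lam \<one> * lam \<one> = lam \<one>" using lam_mult[OF one_closed one_closed] by simp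
  moreover have "lam \<one> \<noteq> 0" using lam_not_H[OF one_closed] by (auto simp: H_iff)
  ultimately show ?thesis by simp
qed

lemma one_H [simp]: "\<one> \<in> H" by (simp add: H_iff lam_one)

lemma mult_H:
  assumes "g \<in> carrier G" "h \<in> carrier G"
  shows "g \<otimes> h \<in> H \<longleftrightarrow> (g \<in> H \<longleftrightarrow> h \<in> H)"
proof -
  have "lam g = 1 \<or> lam g = -1" "lam h = 1 \<or> lam h = -1"
    using lam_not_H assms by (auto simp: H_iff)
  then show ?thesis
    unfolding H_iff lam_mult[OF assms] using assms by (elim disjE) simp_all
qed

lemma inv_H: "g \<in> carrier G \<Longrightarrow> inv g \<in> H \<longleftrightarrow> g \<in> H"
  using mult_H[of g "inv g"] by simp

lemma not_H_decompose:
  assumes "g \<in> carrier G" "g \<notin> H"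
  obtains h where "h \<in> H" "g = c \<otimes> h"
proof (rule that)
  show "inv c \<otimes> g \<in> H" using assms c by (simp add: mult_H inv_H)
  show "g = c \<otimes> (inv c \<otimes> g)" using assms c by (simp add: m_assoc[symmetric])
qed

text \<open>Everything outside \<open>H\<close> has the form \<open>c \<otimes> h\<close>, so
  \<open>c\<close>, which commutes with \<open>H\<close>, is central.\<close>

lemma c_comm:
  assumes "g \<in> carrier G"
  shows "c \<otimes> g = g \<otimes> c"
proof (cases "g \<in> H")
  case False
  then obtain h where h: "h \<in> H" "g = c \<otimes> h" using not_H_decompose assms by blast
  have "c \<otimes> g = c \<otimes> (h \<otimes> c)" unfolding h(2) c_comm_H[OF h(1)] ..
  also have "\<dots> = g \<otimes> c" unfolding h(2) by (rule m_assoc[OF c(1) H_carrier[OF h(1)] c(1), symmetric])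
  finally show ?thesis .
qed (rule c_comm_H)

lemma closedin_H: "closedin T H" "closedin T (carrier G - H)"
proof -
  have "continuous_map T euclideanreal lam" using lam_cont by (simp add: continuous_map_in_subtopology)
  from closedin_continuous_map_preimage[OF this, of "{1}"] closedin_continuous_map_preimage[OF this, of "{-1}"]
  have "closedin T {g \<in> topspace T. lam g \<in> {1}}" "closedin T {g \<in> topspace T. lam g \<in> {-1}}" by auto
  moreover have "{g \<in> topspace T. lam g \<in> {1}} = H" by (auto simp: topspace_eq H_iff)
  moreover have "lam g = -1 \<longleftrightarrow> g \<notin> H" if "g \<in> carrier G" for g
    using lam_not_H[OF that] by (cases "g \<in> H") (simp_all add: H_iff)
  then have "{g \<in> topspace T. lam g \<in> {-1}} = carrier G - H" by (auto simp: topspace_eq)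
  ultimately show "closedin T H" "closedin T (carrier G - H)" by simp_all
qed

text \<open>\<open>H\<close> and its complement are both closed, so a map may be given by different
  formulas on the two cosets.\<close>

lemma continuous_map_H_cases:
  assumes "continuous_map (prod_topology (subtopology T H) Z) W (\<lambda>(g, z). f g z)"
    and "continuous_map (prod_topology (subtopology T (carrier G - H)) Z) W (\<lambda>(g, z). f g z)"
  shows "continuous_map (prod_topology T Z) W (\<lambda>(g, z). f g z)"
proof -
  have "continuous_map (prod_topology T Z) W
      (\<lambda>p. if p \<in> H \<times> topspace Z then (case p of (g, z) \<Rightarrow> f g z) else (case p of (g, z) \<Rightarrow> f g z))"
  proof (rule continuous_map_closed_Un)
    show "closedin (prod_topology T Z) (H \<times> topspace Z)" "closedin (prod_topology T Z) ((carrier G - H) \<times> topspace Z)"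
      using closedin_H by (simp_all add: closedin_prod_Times_iff)
  qed (use assms H_carrier in \<open>auto simp: prod_topology_subtopology(1) topspace_eq\<close>)
  then show ?thesis by simp
qed

lemma G_space_sphere: "G_space G T sphere2 refl_act"
  unfolding G_space_def
proof (intro conjI ballI)
  have H: "refl_act g x = x" if "g \<in> H" for g x using that by (cases x) (auto simp: H_iff)
  have nH: "refl_act g x = map_option (\<lambda>(s, t). (s, - t)) x" if "g \<in> carrier G" "g \<notin> H" for g x
    using lam_not_H[OF that] by (cases x) auto
  show "continuous_map (prod_topology T sphere2) sphere2 (\<lambda>(g, x). refl_act g x)"
  proof (rule continuous_map_H_cases)
    show "continuous_map (prod_topology (subtopology T H) sphere2) sphere2 (\<lambda>(g, x). refl_act g x)"
      by (rule continuous_map_eq[OF continuous_map_snd]) (auto simp: H)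
    show "continuous_map (prod_topology (subtopology T (carrier G - H)) sphere2) sphere2 (\<lambda>(g, x). refl_act g x)"
      by (rule continuous_map_eq[OF continuous_map_compose[OF continuous_map_snd continuous_reflection]]) (auto simp: nH)
  qed
  fix x :: "(real \<times> real) option"
  show "refl_act \<one> x = x" by (cases x) (auto simp: lam_one)
  fix g h assume "g \<in> carrier G" "h \<in> carrier G"
  then show "refl_act (g \<otimes> h) x = refl_act g (refl_act h x)" by (cases x) (auto simp: lam_mult)
qed

lemma refl_act_square_map:
  assumes "g \<in> carrier G"
  shows "refl_act g (square_map (u, w)) = square_map (u, lam g * w)"
proof (cases "g \<in> H")
  case True
  then have "lam g = 1" by (simp add: H_iff)
  then show ?thesis by (simp add: square_map_def)
qed (simp add: square_map_def lam_not_H[OF assms])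

lemma refl_act_H: "h \<in> H \<Longrightarrow> refl_act h x = x"
  by (cases x) (auto simp: H_iff)

text \<open>Closedness of \<open>H\<close> gives its compactness. This makes averaging over
  \<open>H\<close> alone available, for bundles on the hemisphere.\<close>

lemma compact_group_H: "compact_group (G\<lparr>carrier := H\<rparr>) (subtopology T H)"
proof -
  have sub: "subgroup H G"
    by (rule subgroup.intro) (simp_all add: subsetI H_carrier mult_H inv_H)
  interpret H: group "G\<lparr>carrier := H\<rparr>" by (rule subgroup.subgroup_is_group[OF sub is_group])
  have top: "topspace (subtopology T H) = H" using H_carrier topspace_eq by auto
  have "compactin T H" using closedin_compact_space[OF compact closedin_H(1)] .
  then have c: "compact_space (subtopology T H)" by (rule compact_space_subtopology)
  have "continuous_map (prod_topology (subtopology T H) (subtopology T H)) T (\<lambda>(x, y). x \<otimes> y)"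
    unfolding prod_topology_subtopology(1,2)[of T] by (intro continuous_map_from_subtopology cont_mult)
  then have m: "continuous_map (prod_topology (subtopology T H) (subtopology T H)) (subtopology T H) (\<lambda>(x, y). x \<otimes> y)"
    using top H_carrier by (auto simp: continuous_map_in_subtopology mult_H)
  have "continuous_map (subtopology T H) (subtopology T H) (\<lambda>x. inv x)"
    using continuous_map_from_subtopology[OF cont_inv] top H_carrier by (auto simp: continuous_map_in_subtopology inv_H)
  then have "continuous_map (subtopology T H) (subtopology T H) (\<lambda>x. inv\<^bsub>G\<lparr>carrier := H\<rparr>\<^esub> x)"
    by (rule continuous_map_eq) (use top m_inv_consistent[OF sub] in auto)
  with c m top show ?thesis
    by unfold_locales auto
qed

lemma G_vector_bundle_H:
  assumes "G_vector_bundle G T X \<alpha> E"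
  shows "G_vector_bundle (G\<lparr>carrier := H\<rparr>) (subtopology T H) X \<alpha> E"
proof -
  note E = G_vector_bundleD[OF assms]
  have "continuous_map (prod_topology (subtopology T H) (total_space E)) (total_space E) (\<lambda>(g, x). bundle_act E g x)"
    unfolding prod_topology_subtopology(1) by (rule continuous_map_from_subtopology[OF G_spaceD(1)[OF E(2)]])
  then have "G_space (G\<lparr>carrier := H\<rparr>) (subtopology T H) (total_space E) (bundle_act E)"
    using E(2) H_carrier by (auto simp: G_space_def)
  then show ?thesis
    unfolding G_vector_bundle_def using E H_carrier by auto
qed

end

section \<open>Extending isomorphisms from a hemisphere\<close>

text \<open>Descent along a quotient: \<open>f\<close> is tested on the fibre product of
  \<open>Y\<close> and \<open>Z\<close> over \<open>X\<close>. The fibre product is closed because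
  \<open>X\<close> is Hausdorff, and its projection to \<open>Z\<close> is a closed surjection
  because \<open>Y\<close> is compact. With \<open>square_map\<close> for \<open>q\<close>, maps
  built on the half square become maps over the hemisphere.\<close>

lemma continuous_map_descend:
  assumes Y: "compact_space Y" and X: "Hausdorff_space X"
    and q: "continuous_map Y X q" and p: "continuous_map Z X p"
    and surj: "\<And>z. z \<in> topspace Z \<Longrightarrow> \<exists>y\<in>topspace Y. q y = p z"
    and F: "continuous_map (subtopology (prod_topology Y Z) {(y, z). q y = p z}) W F"
    and eq: "\<And>y z. y \<in> topspace Y \<Longrightarrow> z \<in> topspace Z \<Longrightarrow> q y = p z \<Longrightarrow> F (y, z) = f z"
  shows "continuous_map Z W f"
  unfolding continuous_map_closedin
proof (intro conjI allI impI Pi_I)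
  let ?D = "{(y, z). q y = p z}"
  let ?P = "prod_topology Y Z"
  have topD: "topspace (subtopology ?P ?D) = {w \<in> topspace ?P. w \<in> ?D}" by auto
  show "f z \<in> topspace W" if z: "z \<in> topspace Z" for z
  proof -
    obtain y where y: "y \<in> topspace Y" "q y = p z" using surj[OF z] by blast
    have "F (y, z) \<in> topspace W" by (rule continuous_map_in[OF F]) (use y z in simp)
    then show ?thesis using eq y z by simp
  qed
  fix C assume C: "closedin W C"
  have qp: "continuous_map ?P (prod_topology X X) (\<lambda>w. (q (fst w), p (snd w)))"
    using continuous_map_compose[OF continuous_map_fst q] continuous_map_compose[OF continuous_map_snd p]
    by (intro continuous_map_pairedI) (simp_all add: o_def)
  have "closedin ?P {w \<in> topspace ?P. (q (fst w), p (snd w)) \<in> (\<lambda>x. (x, x)) ` topspace X}"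
    using closedin_continuous_map_preimage[OF qp] X by (simp add: Hausdorff_space_closedin_diagonal)
  moreover have "{w \<in> topspace ?P. (q (fst w), p (snd w)) \<in> (\<lambda>x. (x, x)) ` topspace X} = {w \<in> topspace ?P. w \<in> ?D}"
    using continuous_map_in[OF p] by (auto simp: image_iff)
  ultimately have D: "closedin ?P (topspace (subtopology ?P ?D))" by (simp only: topD)
  have eqD: "subtopology ?P (topspace (subtopology ?P ?D)) = subtopology ?P ?D"
    by (metis subtopology_restrict topspace_subtopology)
  have "closedin (subtopology ?P (topspace (subtopology ?P ?D))) {w \<in> topspace (subtopology ?P ?D). F w \<in> C}"
    by (subst eqD) (rule closedin_continuous_map_preimage[OF F C])
  then have "closedin ?P {w \<in> topspace (subtopology ?P ?D). F w \<in> C}"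
    using D by (rule closedin_trans_full)
  then have "closedin Z (snd ` {w \<in> topspace (subtopology ?P ?D). F w \<in> C})"
    using closed_map_snd[OF Y, of Z] by (auto simp: closed_map_def)
  moreover have "snd ` {w \<in> topspace (subtopology ?P ?D). F w \<in> C} = {z \<in> topspace Z. f z \<in> C}"
  proof (intro equalityI subsetI)
    fix z assume "z \<in> snd ` {w \<in> topspace (subtopology ?P ?D). F w \<in> C}"
    then show "z \<in> {z \<in> topspace Z. f z \<in> C}" using eq by force
  next
    fix z assume z: "z \<in> {z \<in> topspace Z. f z \<in> C}"
    then obtain y where y: "y \<in> topspace Y" "q y = p z" using surj by blast
    then have "(y, z) \<in> {w \<in> topspace (subtopology ?P ?D). F w \<in> C}" using z eq by simp
    then show "z \<in> snd ` {w \<in> topspace (subtopology ?P ?D). F w \<in> C}" by force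
  qed
  ultimately show "closedin Z {z \<in> topspace Z. f z \<in> C}" by simp
qed

text \<open>Over a fixed point, an isomorphism with a product bundle identifies the fibre with the
  representation \<open>r\<close>. Taken constant in \<open>y\<close>, it serves as a frame wherever
  \<open>f\<close> is constantly \<open>x0\<close>.\<close>

lemma frame_point:
  assumes iso: "bundle_iso G (product_bundle (subtopology X {x0}) \<alpha> n r) (bundle_restrict E {x0}) \<theta> \<theta>'"
    and x0: "x0 \<in> topspace X" and r: "lin_rep G T n r" and fixed: "\<And>g. g \<in> carrier G \<Longrightarrow> \<alpha> g x0 = x0"
  shows "(\<And>y. y \<in> topspace Y \<Longrightarrow> f y = x0) \<Longrightarrow> frame Y f E n (\<lambda>y v. \<theta> (x0, v)) (\<lambda>y e. snd (\<theta>' e))"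
    and "equivariant (carrier G) S E n (\<lambda>y v. \<theta> (x0, v)) r"
proof -
  note t = bundle_isoD[OF iso, simplified]
  have in0: "\<theta> (x0, v) \<in> topspace (total_space E)" "bundle_proj E (\<theta> (x0, v)) = x0" if "v \<in> vecs n" for v
    using t(5)[of "(x0, v)"] x0 that by (auto simp: part_over_def)
  show "equivariant (carrier G) S E n (\<lambda>y v. \<theta> (x0, v)) r"
    unfolding equivariant_def using t(11) x0 fixed lin_repD(3)[OF r] by fastforce
  assume f: "\<And>y. y \<in> topspace Y \<Longrightarrow> f y = x0"
  show "frame Y f E n (\<lambda>y v. \<theta> (x0, v)) (\<lambda>y e. snd (\<theta>' e))"
    unfolding frame_def
  proof (intro conjI ballI allI impI)
    have t1: "continuous_map (prod_topology (subtopology X {x0}) (complex_space n)) (total_space E) \<theta>"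
      using t(1) by (simp add: continuous_map_in_subtopology)
    have "continuous_map (prod_topology Y (complex_space n)) (prod_topology (subtopology X {x0}) (complex_space n)) (\<lambda>p. (x0, snd p))"
      using x0 by (intro continuous_map_pairedI continuous_map_snd) auto
    from continuous_map_compose[OF this t1]
    show "continuous_map (prod_topology Y (complex_space n)) (total_space E) (\<lambda>(y, v). \<theta> (x0, v))"
      by (simp add: o_def case_prod_unfold)
    let ?P = "subtopology (prod_topology Y (total_space E)) {(y, e). bundle_proj E e = f y}"
    have "continuous_map ?P (subtopology (total_space E) (part_over E {x0})) snd"
      using continuous_map_from_subtopology[OF continuous_map_snd] f
      by (auto simp: continuous_map_in_subtopology part_over_def)
    from continuous_map_compose[OF continuous_map_compose[OF this t(2)] continuous_map_snd]
    show "continuous_map ?P (complex_space n) (\<lambda>(y, e). snd (\<theta>' e))"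
      by (simp add: o_def case_prod_unfold)
    fix y assume y: "y \<in> topspace Y"
    show "\<theta> (x0, snd (\<theta>' e)) = e" if "e \<in> topspace (total_space E)" "bundle_proj E e = f y" for e
    proof -
      have e: "e \<in> topspace (total_space E) \<and> e \<in> part_over E {x0}" using that f[OF y] by (auto simp: part_over_def)
      obtain x v where xv: "\<theta>' e = (x, v)" by fastforce
      then have "x = x0" using t(6)[OF e] by auto
      then show ?thesis using t(4)[OF e] xv by simp
    qed
    fix v assume v: "v \<in> vecs n"
    show "bundle_proj E (\<theta> (x0, v)) = f y" using in0(2)[OF v] f[OF y] by simp
    show "snd (\<theta>' (\<theta> (x0, v))) = v" using t(3)[of "(x0, v)"] x0 v by simp
    show "\<theta> (x0, \<lambda>i. c * v i) = fibre_scale E c (\<theta> (x0, v))" for c using t(10)[of "(x0, v)" c] x0 v by simp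
    show "\<theta> (x0, \<lambda>i. v i + w i) = fibre_add E (\<theta> (x0, v)) (\<theta> (x0, w))" if "w \<in> vecs n" for w
      using t(9)[of "(x0, v)" "(x0, w)"] x0 v that by simp
  qed
qed

context compact_group_character
begin

definition over_half :: "('a, (real \<times> real) option, 'e) gbundle \<Rightarrow> 'e set" where
  "over_half E = {e \<in> topspace (total_space E). bundle_proj E e \<in> half_sphere}"

text \<open>The condition on \<open>c\<close> is confined to the points that \<open>c\<close> fixes,
  since it moves all other points out of the hemisphere.\<close>

definition half_hom ::
    "('a, (real \<times> real) option, 'e) gbundle \<Rightarrow> ('a, (real \<times> real) option, 'f) gbundle \<Rightarrow> ('e \<Rightarrow> 'f) \<Rightarrow> bool" where
  "half_hom E F \<theta> \<longleftrightarrow> continuous_map (subtopology (total_space E) (over_half E)) (total_space F) \<theta> \<and>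
     (\<forall>e\<in>over_half E. bundle_proj F (\<theta> e) = bundle_proj E e) \<and>
     (\<forall>e\<in>over_half E. refl_act c (bundle_proj E e) = bundle_proj E e \<longrightarrow>
        \<theta> (bundle_act E c e) = bundle_act F c (\<theta> e))"

text \<open>Off the hemisphere the value is forced by equivariance under \<open>c\<close>.\<close>

definition extend_half ::
    "('a, (real \<times> real) option, 'e) gbundle \<Rightarrow> ('a, (real \<times> real) option, 'f) gbundle \<Rightarrow> ('e \<Rightarrow> 'f) \<Rightarrow> 'e \<Rightarrow> 'f" where
  "extend_half E F \<theta> e = (if e \<in> over_half E then \<theta> e else bundle_act F (inv c) (\<theta> (bundle_act E c e)))"

lemma half_sphere_cases:
  "x \<in> half_sphere \<or> refl_act c x \<in> half_sphere"
  "x \<in> half_sphere \<Longrightarrow> refl_act c x \<in> half_sphere \<Longrightarrow> refl_act c x = x"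
  by (cases x; auto simp: half_sphere_def inj_image_mem_iff[OF inj_Some])+

lemma refl_act_inv: "refl_act (inv c) (refl_act c x) = x" "refl_act c (refl_act (inv c) x) = x"
  using G_spaceD(3)[OF G_space_sphere, of "inv c" c x] G_spaceD(3)[OF G_space_sphere, of c "inv c" x]
    G_spaceD(2)[OF G_space_sphere, of x] c(1) by simp_all

context
  fixes E :: "('a, (real \<times> real) option, 'e) gbundle"
  assumes E: "G_vector_bundle G T sphere2 refl_act E"
begin

lemma act_in: "g \<in> carrier G \<Longrightarrow> e \<in> topspace (total_space E) \<Longrightarrow> bundle_act E g e \<in> topspace (total_space E)"
  using G_spaceD(4)[OF G_vector_bundleD(2)[OF E]] topspace_eq by simp

lemma act_act: "g \<in> carrier G \<Longrightarrow> h \<in> carrier G \<Longrightarrow> e \<in> topspace (total_space E) \<Longrightarrow>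
    bundle_act E g (bundle_act E h e) = bundle_act E (g \<otimes> h) e"
  using G_spaceD(3)[OF G_vector_bundleD(2)[OF E]] by simp

lemma act_inv: "e \<in> topspace (total_space E) \<Longrightarrow> bundle_act E (inv c) (bundle_act E c e) = e"
    "e \<in> topspace (total_space E) \<Longrightarrow> bundle_act E c (bundle_act E (inv c) e) = e"
  using act_act[of "inv c" c e] act_act[of c "inv c" e] c(1) G_spaceD(2)[OF G_vector_bundleD(2)[OF E]] by simp_all

lemma proj_act: "g \<in> carrier G \<Longrightarrow> e \<in> topspace (total_space E) \<Longrightarrow> bundle_proj E (bundle_act E g e) = refl_act g (bundle_proj E e)"
  by (rule G_vector_bundleD(3)[OF E])

lemma act_over_half:
  assumes "e \<in> topspace (total_space E)" "e \<notin> over_half E"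
  shows "bundle_act E c e \<in> over_half E"
  using assms half_sphere_cases(1)[of "bundle_proj E e"] act_in[OF c(1)] proj_act[OF c(1)] by (auto simp: over_half_def)

lemma act_H_over_half:
  assumes "h \<in> H" "e \<in> topspace (total_space E)"
  shows "bundle_act E h e \<in> over_half E \<longleftrightarrow> e \<in> over_half E"
  using assms act_in proj_act H_carrier by (auto simp: over_half_def refl_act_H)

lemma act_c_over_half:
  assumes "e \<in> over_half E" "bundle_act E c e \<in> over_half E"
  shows "refl_act c (bundle_proj E e) = bundle_proj E e"
  using assms half_sphere_cases(2)[of "bundle_proj E e"] proj_act[OF c(1), of e] by (auto simp: over_half_def)

end

context
  fixes E :: "('a, (real \<times> real) option, 'e) gbundle" and F :: "('a, (real \<times> real) option, 'f) gbundle"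
    and \<theta> :: "'e \<Rightarrow> 'f"
  assumes E: "G_vector_bundle G T sphere2 refl_act E" and F: "G_vector_bundle G T sphere2 refl_act F"
    and hom: "half_hom E F \<theta>"
begin

lemma half_homD:
  shows cont: "continuous_map (subtopology (total_space E) (over_half E)) (total_space F) \<theta>"
    and proj: "e \<in> over_half E \<Longrightarrow> bundle_proj F (\<theta> e) = bundle_proj E e"
    and fix_c: "e \<in> over_half E \<Longrightarrow> refl_act c (bundle_proj E e) = bundle_proj E e \<Longrightarrow>
        \<theta> (bundle_act E c e) = bundle_act F c (\<theta> e)"
  using hom by (simp_all add: half_hom_def)

lemma half_in: "e \<in> over_half E \<Longrightarrow> \<theta> e \<in> topspace (total_space F)"
  using continuous_map_in[OF cont, of e] by (auto simp: over_half_def)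

lemma extend_half_proj:
  assumes e: "e \<in> topspace (total_space E)"
  shows "extend_half E F \<theta> e \<in> topspace (total_space F)" "bundle_proj F (extend_half E F \<theta> e) = bundle_proj E e"
  using e half_in proj act_over_half[OF E e] act_in[OF F, of "inv c"] proj_act[OF F, of "inv c"] proj_act[OF E c(1) e]
    refl_act_inv c(1)
  by (auto simp: extend_half_def)

lemma extend_half_over_half:
  assumes e: "e \<in> topspace (total_space E)"
  shows "extend_half E F \<theta> e \<in> over_half F \<longleftrightarrow> e \<in> over_half E"
  using extend_half_proj[OF e] e by (simp add: over_half_def)

lemma continuous_extend_half: "continuous_map (total_space E) (total_space F) (extend_half E F \<theta>)"
proof -
  let ?TE = "total_space E" and ?Q = "{e \<in> topspace (total_space E). bundle_act E c e \<in> over_half E}"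
  have pr: "continuous_map ?TE sphere2 (bundle_proj E)"
    by (rule complex_vector_bundleD(1)[OF G_vector_bundleD(1)[OF E]])
  have P: "closedin ?TE (over_half E)"
    unfolding over_half_def by (rule closedin_continuous_map_preimage[OF pr closedin_half_sphere])
  have c_const: "continuous_map Z T (\<lambda>z. c)" "continuous_map Z T (\<lambda>z. inv c)" for Z :: "'z topology"
    using c(1) topspace_eq by auto
  have actc: "continuous_map ?TE ?TE (bundle_act E c)"
    using continuous_map_action[OF G_vector_bundleD(2)[OF E] c_const(1) continuous_map_id] by (simp add: o_def)
  have Q: "closedin ?TE ?Q" by (rule closedin_continuous_map_preimage[OF actc P])
  have "continuous_map (subtopology ?TE ?Q) (subtopology ?TE (over_half E)) (bundle_act E c)"
    using continuous_map_from_subtopology[OF actc] by (auto simp: continuous_map_in_subtopology)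
  from continuous_map_compose[OF this cont]
  have cont2: "continuous_map (subtopology ?TE ?Q) (total_space F) (\<lambda>e. bundle_act F (inv c) (\<theta> (bundle_act E c e)))"
    by (intro continuous_map_action[OF G_vector_bundleD(2)[OF F] c_const(2)]) (simp add: o_def)
  have "continuous_map ?TE (total_space F) (\<lambda>e. if e \<in> over_half E then \<theta> e else bundle_act F (inv c) (\<theta> (bundle_act E c e)))"
  proof (rule continuous_map_closed_Un[OF P Q _ cont cont2])
    have "over_half E \<subseteq> topspace ?TE" by (auto simp: over_half_def)
    then show "over_half E \<union> ?Q = topspace ?TE" using act_over_half[OF E] by blast
    \<comment> \<open>If both \<open>e\<close> and its translate by \<open>c\<close> lie over the
      hemisphere, then \<open>c\<close> fixes the base point, and there the two formulas
      agree.\<close>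
    fix e assume e: "e \<in> over_half E" and "e \<in> ?Q"
    then have "refl_act c (bundle_proj E e) = bundle_proj E e" using act_c_over_half[OF E] by blast
    from fix_c[OF e this] show "\<theta> e = bundle_act F (inv c) (\<theta> (bundle_act E c e))"
      using act_inv(1)[OF F half_in[OF e]] by simp
  qed
  then show ?thesis by (simp add: extend_half_def[abs_def])
qed

text \<open>\<open>G\<close> is generated by \<open>H\<close> and \<open>c\<close>. For
  \<open>H\<close> the point is that \<open>c\<close> commutes with it. For \<open>c\<close> the
  point is that a vector moved off the hemisphere comes back under \<open>c \<otimes> c\<close>,
  which lies in \<open>H\<close> and is covered by \<open>equi\<close>.\<close>

lemma extend_half_equivariant:
  assumes equi: "\<forall>h\<in>H. \<forall>e\<in>over_half E. \<theta> (bundle_act E h e) = bundle_act F h (\<theta> e)"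
    and g: "g \<in> carrier G" and e: "e \<in> topspace (total_space E)"
  shows "extend_half E F \<theta> (bundle_act E g e) = bundle_act F g (extend_half E F \<theta> e)"
proof -
  have H_equi: "\<theta> (bundle_act E h e) = bundle_act F h (\<theta> e)" if "h \<in> H" "e \<in> over_half E" for h e
    using equi that by blast
  have H_case: "extend_half E F \<theta> (bundle_act E h e) = bundle_act F h (extend_half E F \<theta> e)"
    if h: "h \<in> H" and e: "e \<in> topspace (total_space E)" for h e
  proof (cases "e \<in> over_half E")
    case True
    then show ?thesis using act_H_over_half[OF E h e] H_equi[OF h] by (simp add: extend_half_def)
  next
    case False
    note hG = H_carrier[OF h]
    have ce: "bundle_act E c e \<in> over_half E" by (rule act_over_half[OF E e False])
    have "bundle_act E c (bundle_act E h e) = bundle_act E h (bundle_act E c e)"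
      using act_act[OF E c(1) hG e] act_act[OF E hG c(1) e] c_comm[OF hG] by simp
    then have "extend_half E F \<theta> (bundle_act E h e) = bundle_act F (inv c) (bundle_act F h (\<theta> (bundle_act E c e)))"
      using False act_H_over_half[OF E h e] H_equi[OF h ce] by (simp add: extend_half_def)
    also have "\<dots> = bundle_act F h (bundle_act F (inv c) (\<theta> (bundle_act E c e)))"
    proof -
      have "inv c \<otimes> h = h \<otimes> inv c"
        using c_comm[OF hG] c(1) hG by (metis inv_closed inv_solve_left inv_solve_right m_assoc m_closed)
      then show ?thesis using act_act[OF F _ _ half_in[OF ce]] hG c(1) by simp
    qed
    finally show ?thesis using False by (simp add: extend_half_def)
  qed
  have c_case: "extend_half E F \<theta> (bundle_act E c e) = bundle_act F c (extend_half E F \<theta> e)"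
    if e: "e \<in> topspace (total_space E)" for e
  proof (cases "e \<in> over_half E")
    case True
    show ?thesis
    proof (cases "bundle_act E c e \<in> over_half E")
      case True
      then show ?thesis using \<open>e \<in> over_half E\<close> fix_c act_c_over_half[OF E] by (simp add: extend_half_def)
    next
      case False
      have cc: "c \<otimes> c \<in> H" using mult_H c(1) by simp
      have "extend_half E F \<theta> (bundle_act E c e) = bundle_act F (inv c) (\<theta> (bundle_act E (c \<otimes> c) e))"
        using False act_act[OF E c(1) c(1) e] by (simp add: extend_half_def)
      also have "\<dots> = bundle_act F (inv c \<otimes> (c \<otimes> c)) (\<theta> e)"
        using H_equi[OF cc True] act_act[OF F _ _ half_in[OF True], of "inv c" "c \<otimes> c"] c(1) by simp
      also have "inv c \<otimes> (c \<otimes> c) = c" using c(1) by (simp add: m_assoc[symmetric])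
      finally show ?thesis using True by (simp add: extend_half_def)
    qed
  next
    case False
    then have ce: "bundle_act E c e \<in> over_half E" by (rule act_over_half[OF E e])
    then show ?thesis using False act_inv(2)[OF F half_in[OF ce]] by (simp add: extend_half_def)
  qed
  show ?thesis
  proof (cases "g \<in> H")
    case False
    then obtain h where h: "h \<in> H" "g = c \<otimes> h" using not_H_decompose g by blast
    note hG = H_carrier[OF h(1)]
    have "extend_half E F \<theta> (bundle_act E g e) = extend_half E F \<theta> (bundle_act E c (bundle_act E h e))"
      unfolding h(2) using act_act[OF E c(1) hG e] by simp
    also have "\<dots> = bundle_act F c (bundle_act F h (extend_half E F \<theta> e))"
      using c_case[OF act_in[OF E hG e]] H_case[OF h(1) e] by simp
    also have "\<dots> = bundle_act F g (extend_half E F \<theta> e)"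
      unfolding h(2) by (rule act_act[OF F c(1) hG extend_half_proj(1)[OF e]])
    finally show ?thesis .
  qed (rule H_case[OF _ e])
qed

end

text \<open>The inverse over the hemisphere satisfies the same conditions, and its extension inverts
  the extension of \<theta>. Linearity off the hemisphere follows by conjugation with
  \<open>c\<close>.\<close>

lemma extend_iso:
  fixes E :: "('a, (real \<times> real) option, 'e) gbundle" and F :: "('a, (real \<times> real) option, 'f) gbundle"
  assumes E: "G_vector_bundle G T sphere2 refl_act E" and F: "G_vector_bundle G T sphere2 refl_act F"
    and cont: "continuous_map (subtopology (total_space E) (over_half E)) (total_space F) \<theta>"
    and cont': "continuous_map (subtopology (total_space F) (over_half F)) (total_space E) \<theta>'"
    and inv1: "\<And>e. e \<in> over_half E \<Longrightarrow> \<theta>' (\<theta> e) = e" and inv2: "\<And>f. f \<in> over_half F \<Longrightarrow> \<theta> (\<theta>' f) = f"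
    and proj: "\<And>e. e \<in> over_half E \<Longrightarrow> bundle_proj F (\<theta> e) = bundle_proj E e"
    and proj': "\<And>f. f \<in> over_half F \<Longrightarrow> bundle_proj E (\<theta>' f) = bundle_proj F f"
    and add: "\<And>e e'. e \<in> over_half E \<Longrightarrow> e' \<in> over_half E \<Longrightarrow> bundle_proj E e' = bundle_proj E e \<Longrightarrow>
        \<theta> (fibre_add E e e') = fibre_add F (\<theta> e) (\<theta> e')"
    and scale: "\<And>k e. e \<in> over_half E \<Longrightarrow> \<theta> (fibre_scale E k e) = fibre_scale F k (\<theta> e)"
    and H_equi: "\<And>h e. h \<in> H \<Longrightarrow> e \<in> over_half E \<Longrightarrow> \<theta> (bundle_act E h e) = bundle_act F h (\<theta> e)"
    and fix_c: "\<And>e. e \<in> over_half E \<Longrightarrow> refl_act c (bundle_proj E e) = bundle_proj E e \<Longrightarrow>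
        \<theta> (bundle_act E c e) = bundle_act F c (\<theta> e)"
  shows "bundle_isomorphic G E F"
proof (rule bundle_isomorphicI, rule bundle_isoI)
  note E' = G_vector_bundleD[OF E] and F' = G_vector_bundleD[OF F]
  have hom: "half_hom E F \<theta>" using cont proj fix_c by (simp add: half_hom_def)
  have half: "\<theta> e \<in> over_half F" if "e \<in> over_half E" for e
    using half_in[OF E F hom that] proj[OF that] that by (simp add: over_half_def)
  have half': "\<theta>' f \<in> over_half E" if "f \<in> over_half F" for f
    using continuous_map_in[OF cont', of f] proj'[OF that] that by (auto simp: over_half_def)
  have fix_c': "\<theta>' (bundle_act F c f) = bundle_act E c (\<theta>' f)"
    if f: "f \<in> over_half F" and fx: "refl_act c (bundle_proj F f) = bundle_proj F f" for f
  proof -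
    have "bundle_act F c f = \<theta> (bundle_act E c (\<theta>' f))"
      using fix_c[OF half'[OF f]] inv2[OF f] proj'[OF f] fx by simp
    moreover have "bundle_act E c (\<theta>' f) \<in> over_half E"
      using half'[OF f] proj_act[OF E c(1)] act_in[OF E c(1)] proj'[OF f] fx by (auto simp: over_half_def)
    ultimately show ?thesis using inv1 by simp
  qed
  have inF: "\<theta> e \<in> topspace (total_space F)" if "e \<in> over_half E" for e
    using half[OF that] by (simp add: over_half_def)
  have hom': "half_hom F E \<theta>'" using cont' proj' fix_c' by (simp add: half_hom_def)
  let ?\<Theta> = "extend_half E F \<theta>" and ?\<Theta>' = "extend_half F E \<theta>'"
  note ext = extend_half_proj[OF E F hom] and ext_half = extend_half_over_half[OF E F hom]
  note ext_half' = extend_half_over_half[OF F E hom']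
  show "continuous_map (total_space E) (total_space F) ?\<Theta>" by (rule continuous_extend_half[OF E F hom])
  show "continuous_map (total_space F) (total_space E) ?\<Theta>'" by (rule continuous_extend_half[OF F E hom'])
  show "?\<Theta>' (?\<Theta> e) = e" if e: "e \<in> topspace (total_space E)" for e
  proof (cases "e \<in> over_half E")
    case True
    then show ?thesis using half inv1 by (simp add: extend_half_def)
  next
    case False
    then have ce: "bundle_act E c e \<in> over_half E" by (rule act_over_half[OF E e])
    have "?\<Theta> e \<notin> over_half F" using ext_half[OF e] False by simp
    then have "?\<Theta>' (?\<Theta> e) = bundle_act E (inv c) (\<theta>' (bundle_act F c (bundle_act F (inv c) (\<theta> (bundle_act E c e)))))"
      using False by (simp add: extend_half_def)
    also have "\<dots> = bundle_act E (inv c) (bundle_act E c e)"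
      using act_inv(2)[OF F] half[OF ce] inv1[OF ce] by (simp add: over_half_def)
    finally show ?thesis using act_inv(1)[OF E e] by simp
  qed
  show "?\<Theta> (?\<Theta>' f) = f" if f: "f \<in> topspace (total_space F)" for f
  proof (cases "f \<in> over_half F")
    case True
    then show ?thesis using half' inv2 by (simp add: extend_half_def)
  next
    case False
    then have cf: "bundle_act F c f \<in> over_half F" by (rule act_over_half[OF F f])
    have "?\<Theta>' f \<notin> over_half E" using ext_half'[OF f] False by simp
    then have "?\<Theta> (?\<Theta>' f) = bundle_act F (inv c) (\<theta> (bundle_act E c (bundle_act E (inv c) (\<theta>' (bundle_act F c f)))))"
      using False by (simp add: extend_half_def)
    also have "\<dots> = bundle_act F (inv c) (bundle_act F c f)"
      using act_inv(2)[OF E] half'[OF cf] inv2[OF cf] by (simp add: over_half_def)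
    finally show ?thesis using act_inv(1)[OF F f] by simp
  qed
  show "bundle_proj F (?\<Theta> e) = bundle_proj E e" if "e \<in> topspace (total_space E)" for e by (rule ext(2)[OF that])
  show "?\<Theta> (bundle_act E g e) = bundle_act F g (?\<Theta> e)" if "e \<in> topspace (total_space E)" "g \<in> carrier G" for e g
    by (rule extend_half_equivariant[OF E F hom _ that(2,1)]) (use H_equi in blast)
  show "?\<Theta> (fibre_scale E k e) = fibre_scale F k (?\<Theta> e)" if e: "e \<in> topspace (total_space E)" for e k
  proof -
    note cl = fibre_ops_closed(2)[OF E'(1) e, of k]
    have same: "fibre_scale E k e \<in> over_half E \<longleftrightarrow> e \<in> over_half E" using cl e by (simp add: over_half_def)
    show ?thesis
    proof (cases "e \<in> over_half E")
      case True
      then show ?thesis using same scale by (simp add: extend_half_def)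
    next
      case False
      then have ce: "bundle_act E c e \<in> over_half E" by (rule act_over_half[OF E e])
      have "?\<Theta> (fibre_scale E k e) = bundle_act F (inv c) (fibre_scale F k (\<theta> (bundle_act E c e)))"
        using False same E'(5)[OF c(1) e] scale[OF ce] by (simp add: extend_half_def)
      also have "\<dots> = fibre_scale F k (?\<Theta> e)"
        using False F'(5)[OF inv_closed[OF c(1)] inF[OF ce]] by (simp add: extend_half_def)
      finally show ?thesis .
    qed
  qed
  show "?\<Theta> (fibre_add E e e') = fibre_add F (?\<Theta> e) (?\<Theta> e')"
    if e: "e \<in> topspace (total_space E)" and e': "e' \<in> topspace (total_space E)" "bundle_proj E e' = bundle_proj E e" for e e'
  proof -
    note cl = fibre_ops_closed(1)[OF E'(1) e e']
    have same: "fibre_add E e e' \<in> over_half E \<longleftrightarrow> e \<in> over_half E" "e' \<in> over_half E \<longleftrightarrow> e \<in> over_half E"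
      using cl e e' by (simp_all add: over_half_def)
    show ?thesis
    proof (cases "e \<in> over_half E")
      case True
      then show ?thesis using same add e'(2) by (simp add: extend_half_def)
    next
      case False
      then have ce: "bundle_act E c e \<in> over_half E" "bundle_act E c e' \<in> over_half E"
        using act_over_half[OF E e] act_over_half[OF E e'(1)] same by auto
      have p: "bundle_proj E (bundle_act E c e') = bundle_proj E (bundle_act E c e)"
        using proj_act[OF E c(1)] e e' by simp
      have "?\<Theta> (fibre_add E e e') = bundle_act F (inv c) (fibre_add F (\<theta> (bundle_act E c e)) (\<theta> (bundle_act E c e')))"
        using False same E'(4)[OF c(1) e e'] add[OF ce p] by (simp add: extend_half_def)
      also have "\<dots> = fibre_add F (?\<Theta> e) (?\<Theta> e')"
        using False same F'(4)[OF inv_closed[OF c(1)] inF[OF ce(1)] inF[OF ce(2)]] proj[OF ce(1)] proj[OF ce(2)] p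
        by (simp add: extend_half_def)
      finally show ?thesis .
    qed
  qed
qed

section \<open>Twisted representations\<close>

text \<open>Let \<open>s\<close> be a polynomial square root of the action of
  \<open>c \<otimes> c\<close>; then \<open>j\<close> is the inverse of \<open>c\<close> followed by
  \<open>s\<close>. It is an involution because \<open>s\<close> squares to
  \<open>c \<otimes> c\<close>, it commutes with the group because \<open>c\<close> is central, and
  \<open>c\<close> followed by \<open>j\<close> is \<open>s\<close> itself, which commutes with
  everything that commutes with \<open>H\<close>.\<close>

lemma rep_involution:
  assumes r: "lin_rep G T n r"
  obtains j where "lin_map n n j" "\<And>v. v \<in> vecs n \<Longrightarrow> j (j v) = v"
    "\<And>g v. g \<in> carrier G \<Longrightarrow> v \<in> vecs n \<Longrightarrow> j (r g v) = r g (j v)"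
    "\<And>t v. lin_map n n t \<Longrightarrow> (\<And>h v. h \<in> H \<Longrightarrow> v \<in> vecs n \<Longrightarrow> t (r h v) = r h (t v)) \<Longrightarrow> v \<in> vecs n \<Longrightarrow>
        t (j (r c v)) = j (r c (t v))"
proof -
  note r' = lin_repD[OF r]
  have cc: "c \<otimes> c \<in> carrier G" "c \<otimes> c \<in> H" using c(1) mult_H by simp_all
  have ic: "inv c \<in> carrier G" using c(1) by simp
  have cancel: "r (inv (c \<otimes> c)) (r (c \<otimes> c) v) = v" "r (inv c) (r c v) = v" if "v \<in> vecs n" for v
    using r'(5)[OF inv_closed[OF cc(1)] cc(1) that] r'(5)[OF ic c(1) that] r'(4)[OF that] cc(1) c(1) by simp_all
  have inj: "inj_on (r (c \<otimes> c)) (vecs n)" by (rule inj_on_inverseI) (rule cancel(1))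
  obtain s where s1: "lin_map n n s" and s2: "\<forall>v\<in>vecs n. s (s v) = r (c \<otimes> c) v"
    and s3: "\<forall>t. lin_map n n t \<longrightarrow> (\<forall>v\<in>vecs n. t (r (c \<otimes> c) v) = r (c \<otimes> c) (t v)) \<longrightarrow>
      (\<forall>v\<in>vecs n. t (s v) = s (t v))"
    using lin_map_sqrt[OF r'(2)[OF cc(1)] inj] by blast
  have s: "lin_map n n s" "\<And>v. v \<in> vecs n \<Longrightarrow> s (s v) = r (c \<otimes> c) v"
    "\<And>t v. lin_map n n t \<Longrightarrow> (\<And>v. v \<in> vecs n \<Longrightarrow> t (r (c \<otimes> c) v) = r (c \<otimes> c) (t v)) \<Longrightarrow> v \<in> vecs n \<Longrightarrow> t (s v) = s (t v)"
    using s1 s2 s3 by simp_all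
  have comm: "c \<otimes> c \<otimes> g = g \<otimes> (c \<otimes> c)" if "g \<in> carrier G" for g
  proof -
    have "c \<otimes> c \<otimes> g = c \<otimes> (g \<otimes> c)" using m_assoc[OF c(1) c(1) that] c_comm[OF that] by simp
    also have "\<dots> = g \<otimes> c \<otimes> c" using m_assoc[OF c(1) that c(1)] c_comm[OF that] by simp
    finally show ?thesis using m_assoc[OF that c(1) c(1)] by simp
  qed
  have rs: "r g (s v) = s (r g v)" if "g \<in> carrier G" "v \<in> vecs n" for g v
  proof (rule s(3)[OF r'(2)[OF that(1)] _ that(2)])
    fix v assume v: "v \<in> vecs n"
    show "r g (r (c \<otimes> c) v) = r (c \<otimes> c) (r g v)"
      using r'(5)[OF that(1) cc(1) v] r'(5)[OF cc(1) that(1) v] comm[OF that(1)] by simp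
  qed
  define j where "j v = s (r (inv c) v)" for v
  show thesis
  proof (rule that)
    show "lin_map n n j" unfolding j_def by (rule lin_map_compose[OF r'(2)[OF ic] s(1)])
    fix v assume v: "v \<in> vecs n"
    note iv = r'(3)[OF ic v]
    have "j (j v) = s (s (r (inv c) (r (inv c) v)))" unfolding j_def using rs[OF ic iv] by simp
    also have "\<dots> = r (c \<otimes> c) (r (inv c) (r (inv c) v))" by (rule s(2)[OF r'(3)[OF ic iv]])
    also have "\<dots> = r (c \<otimes> c \<otimes> (inv c \<otimes> inv c)) v"
      using r'(5)[OF cc(1) m_closed[OF ic ic] v] r'(5)[OF ic ic v] by simp
    also have "c \<otimes> c \<otimes> (inv c \<otimes> inv c) = \<one>"
      using c(1) by (metis cc(1) ic inv_mult_group r_inv)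
    finally show "j (j v) = v" using r'(4)[OF v] by simp
    show "j (r g v) = r g (j v)" if g: "g \<in> carrier G" for g
    proof -
      have "inv c \<otimes> g = g \<otimes> inv c"
        using c_comm[OF g] c(1) g by (metis inv_closed inv_solve_left inv_solve_right m_assoc m_closed)
      then have "r (inv c) (r g v) = r g (r (inv c) v)" using r'(5)[OF ic g v] r'(5)[OF g ic v] by simp
      then show ?thesis unfolding j_def using rs[OF g iv] by simp
    qed
    fix t assume t: "lin_map n n t" "\<And>h v. h \<in> H \<Longrightarrow> v \<in> vecs n \<Longrightarrow> t (r h v) = r h (t v)"
    have "t (j (r c v)) = t (s v)" unfolding j_def using cancel(2)[OF v] by simp
    also have "\<dots> = s (t v)" by (rule s(3)[OF t(1) t(2)[OF cc(2)] v])
    also have "\<dots> = j (r c (t v))" unfolding j_def using cancel(2)[OF lin_map_in[OF t(1) v]] by simp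
    finally show "t (j (r c v)) = j (r c (t v))" .
  qed
qed

text \<open>The action on \<open>V'\<close>: off \<open>H\<close> it is multiplied by an involution,
  as one twists a representation by a sign character. With the \<open>j\<close> of
  \<open>rep_involution\<close>, \<open>c\<close> acts by the polynomial square root.\<close>

definition twist ::
    "((nat \<Rightarrow> complex) \<Rightarrow> nat \<Rightarrow> complex) \<Rightarrow> ('a \<Rightarrow> (nat \<Rightarrow> complex) \<Rightarrow> nat \<Rightarrow> complex)
      \<Rightarrow> 'a \<Rightarrow> (nat \<Rightarrow> complex) \<Rightarrow> nat \<Rightarrow> complex" where
  "twist j r g v = (if g \<in> H then r g v else j (r g v))"

text \<open>For two elements off \<open>H\<close> the factor \<open>j\<close> occurs twice and
  cancels, since it commutes with \<open>r\<close> and squares to the identity. Continuity is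
  checked on the two cosets of \<open>H\<close>.\<close>

lemma lin_rep_twist:
  assumes r: "lin_rep G T n r" and j: "lin_map n n j" "\<And>v. v \<in> vecs n \<Longrightarrow> j (j v) = v"
    "\<And>g v. g \<in> carrier G \<Longrightarrow> v \<in> vecs n \<Longrightarrow> j (r g v) = r g (j v)"
  shows "lin_rep G T n (twist j r)"
proof -
  note r' = lin_repD[OF r] and jin = lin_map_in[OF j(1)]
  have rc: "continuous_map (prod_topology T (complex_space n)) (complex_space n) (\<lambda>(g, v). r g v)"
    by (rule G_spaceD(1)[OF r'(1)])
  have jc: "continuous_map (complex_space n) (complex_space n) j"
  proof -
    have "continuous_map (prod_topology (complex_space n) (complex_space n)) (complex_space n) (\<lambda>(y, v). j v)"
      by (rule continuous_map_lin_family) (use j(1) in auto)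
    from continuous_map_compose[OF continuous_map_pairedI[OF continuous_map_id continuous_map_id] this]
    show ?thesis by (simp add: o_def)
  qed
  have "continuous_map (prod_topology T (complex_space n)) (complex_space n) (\<lambda>(g, v). twist j r g v)"
  proof (rule continuous_map_H_cases)
    show "continuous_map (prod_topology (subtopology T H) (complex_space n)) (complex_space n) (\<lambda>(g, v). twist j r g v)"
      unfolding prod_topology_subtopology(1)
      by (rule continuous_map_eq[OF continuous_map_from_subtopology[OF rc]]) (auto simp: twist_def)
    show "continuous_map (prod_topology (subtopology T (carrier G - H)) (complex_space n)) (complex_space n) (\<lambda>(g, v). twist j r g v)"
      unfolding prod_topology_subtopology(1)
      by (rule continuous_map_eq[OF continuous_map_from_subtopology[OF continuous_map_compose[OF rc jc]]]) (auto simp: twist_def)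
  qed
  moreover have "twist j r (g \<otimes> h) v = twist j r g (twist j r h v)"
    if g: "g \<in> carrier G" and h: "h \<in> carrier G" and v: "v \<in> vecs n" for g h v
    using r'(5)[OF g h v] mult_H[OF g h] j(2)[OF r'(3)[OF g r'(3)[OF h v]]] j(3)[OF g r'(3)[OF h v]]
    by (cases "g \<in> H"; cases "h \<in> H") (simp_all add: twist_def)
  moreover have "lin_map n n (twist j r g)" if g: "g \<in> carrier G" for g
    using r'(2)[OF g] lin_map_compose[OF r'(2)[OF g] j(1)] by (cases "g \<in> H") (simp_all add: twist_def[abs_def])
  moreover have "twist j r \<one> v = v" if "v \<in> vecs n" for v using r'(4)[OF that] by (simp add: twist_def)
  ultimately show ?thesis by (simp add: lin_rep_def G_space_def)
qed

lemma twist_commute: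
  assumes r: "lin_rep G T n r" and t: "lin_map n n t"
    and tH: "\<And>h v. h \<in> H \<Longrightarrow> v \<in> vecs n \<Longrightarrow> t (r h v) = r h (t v)"
    and tc: "\<And>v. v \<in> vecs n \<Longrightarrow> t (j (r c v)) = j (r c (t v))"
    and g: "g \<in> carrier G" and v: "v \<in> vecs n"
  shows "t (twist j r g v) = twist j r g (t v)"
proof (cases "g \<in> H")
  case False
  note r' = lin_repD[OF r]
  obtain h where h: "h \<in> H" "g = c \<otimes> h" using False not_H_decompose g by blast
  note hG = H_carrier[OF h(1)]
  have "t (j (r g v)) = j (r c (r h (t v)))"
    unfolding h(2) r'(5)[OF c(1) hG v] using tc[OF r'(3)[OF hG v]] tH[OF h(1) v] by simp
  also have "\<dots> = j (r g (t v))" unfolding h(2) r'(5)[OF c(1) hG lin_map_in[OF t v]] ..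
  finally show ?thesis using False by (simp add: twist_def)
qed (use tH v in \<open>simp add: twist_def\<close>)

end

section \<open>Frames on the hemisphere and on the equator\<close>

lemma equivariant_mono:
  "equivariant K S E n b r \<Longrightarrow> K' \<subseteq> K \<Longrightarrow> S' \<subseteq> S \<Longrightarrow> equivariant K' S' E n b r"
  unfolding equivariant_def by blast

context compact_group_character
begin

lemma H_subset: "H \<subseteq> carrier G"
  using H_carrier by blast

context
  fixes E :: "('a, (real \<times> real) option, 'e) gbundle" and n :: nat
    and r :: "'a \<Rightarrow> (nat \<Rightarrow> complex) \<Rightarrow> nat \<Rightarrow> complex" and \<theta>0 \<theta>0'
  assumes E: "G_vector_bundle G T sphere2 refl_act E" and r: "lin_rep G T n r"
    and iso: "bundle_iso G (product_bundle (subtopology sphere2 {None}) refl_act n r) (bundle_restrict E {None}) \<theta>0 \<theta>0'"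
begin

definition base_frame :: "(nat \<Rightarrow> complex) \<Rightarrow> 'e" where
  "base_frame v = \<theta>0 (None, v)"

definition base_coframe :: "'e \<Rightarrow> nat \<Rightarrow> complex" where
  "base_coframe e = snd (\<theta>0' e)"

lemma base_frame:
  fixes Y :: "'y topology"
  shows "(\<And>y. y \<in> topspace Y \<Longrightarrow> f y = None) \<Longrightarrow> frame Y f E n (\<lambda>y. base_frame) (\<lambda>y. base_coframe)"
    and "equivariant (carrier G) S E n (\<lambda>y. base_frame) r"
proof -
  have d: "base_frame = (\<lambda>v. \<theta>0 (None, v))" "base_coframe = (\<lambda>e. snd (\<theta>0' e))"
    by (simp_all add: base_frame_def[abs_def] base_coframe_def[abs_def])
  show "equivariant (carrier G) S E n (\<lambda>y. base_frame) r"
    unfolding d by (rule frame_point(2)[OF iso _ r]) simp_all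
  assume f: "\<And>y. y \<in> topspace Y \<Longrightarrow> f y = None"
  show "frame Y f E n (\<lambda>y. base_frame) (\<lambda>y. base_coframe)"
    unfolding d by (rule frame_point(1)[OF iso _ r]) (simp_all add: f)
qed

text \<open>\<open>H\<close> fixes every point of the sphere, so averaging gives local
  \<open>H\<close>-frames and bisection one on the rectangle. The rectangle retracts onto the sides
  over infinity, where the base frame is at hand, so the frame can be made equal to it
  there.\<close>

lemma hemisphere_frame:
  obtains b d where "frame (top_of_set half_square) square_map E n b d"
    "equivariant H half_square E n b r"
    "\<forall>y\<in>half_square_sides. \<forall>v\<in>vecs n. b y v = base_frame v"
proof -
  interpret Hg: compact_group "G\<lparr>carrier := H\<rparr>" "subtopology T H" by (rule compact_group_H)
  have "has_frame H square_map E ({-1..1} \<times> {0..1})"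
    using Hg.has_frame_rectangle_fixed[OF G_vector_bundle_H[OF E] continuous_square_map, of "-1" 1 0 1]
    by (simp add: refl_act_H)
  then obtain m b d r' where b: "frame (top_of_set half_square) square_map E m b d"
    "equivariant H half_square E m b r'"
    unfolding has_frame_def half_square_def by blast
  have sides: "half_square_sides \<subseteq> half_square" by (auto simp: half_square_sides_def)
  have sub: "subtopology (top_of_set half_square) half_square_sides = top_of_set half_square_sides"
    using sides by (simp add: subtopology_subtopology Int_absorb1)
  have none: "square_map y = None" if "y \<in> half_square_sides" for y
    using square_map_sides that sides by blast
  have b0: "frame (subtopology (top_of_set half_square) half_square_sides) square_map E n (\<lambda>y. base_frame) (\<lambda>y. base_coframe)"
    unfolding sub by (rule base_frame(1)) (simp add: none)
  have eq: "equivariant H half_square_sides E n (\<lambda>y. base_frame) r"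
    by (rule equivariant_mono[OF base_frame(2) H_subset subset_refl])
  obtain \<rho> where \<rho>: "continuous_map (top_of_set half_square) (top_of_set half_square_sides) \<rho>"
    "\<forall>p\<in>half_square_sides. \<rho> p = p"
    by (rule half_square_retraction)
  have \<rho>': "continuous_map (top_of_set half_square) (subtopology (top_of_set half_square) half_square_sides) \<rho>"
    unfolding sub by (rule \<rho>(1))
  show thesis
    by (rule frame_extend[OF b(1) _ b0 eq _ \<rho>', unfolded topspace_euclidean_subtopology, OF b(2) sides])
       (use \<rho>(2) in blast, rule that)
qed

text \<open>All of \<open>G\<close> fixes the equator, here an interval with both ends at infinity.
  At the left end the base frame can be imposed, a point being a retract of the interval; at the
  right end the frame so obtained may still differ from the base frame by an automorphism of
  \<open>r\<close>.\<close>

lemma equator_frame: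
  obtains a d where "frame (top_of_set {-1..1}) (\<lambda>u. square_map (u, 0)) E n a d"
    "equivariant (carrier G) {-1..1} E n a r"
    "\<forall>u v. \<bar>u\<bar> = 1 \<longrightarrow> v \<in> vecs n \<longrightarrow> a u v = base_frame v"
proof -
  let ?I = "top_of_set {-1..1::real}" and ?q = "\<lambda>u. square_map (u, 0)"
  \<comment> \<open>Constant in the second coordinate, so that the result on rectangles applies to
    an interval.\<close>
  let ?f = "\<lambda>p::real \<times> real. square_map (fst p, 0)"
  note r' = lin_repD[OF r]
  have "continuous_map euclidean euclidean (\<lambda>p::real \<times> real. (fst p, 0::real))"
    by (simp add: continuous_intros)
  from continuous_map_compose[OF this continuous_square_map]
  have f: "continuous_map euclidean sphere2 ?f" by (simp add: o_def)
  have "has_frame (carrier G) ?f E ({-1..1} \<times> {0..1})"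
    by (rule has_frame_rectangle_fixed[OF E f]) (simp_all add: refl_act_square_map)
  then obtain m a0 d0 r0 where a0: "frame (top_of_set ({-1..1} \<times> {0..1})) ?f E m a0 d0"
    "equivariant (carrier G) ({-1..1} \<times> {0..1}) E m a0 r0"
    unfolding has_frame_def by blast
  have "continuous_map ?I (top_of_set ({-1..1} \<times> {0..1})) (\<lambda>u. (u, 0::real))"
    by (auto intro!: continuous_intros)
  from frame_pullback[OF a0(1) this, of ?q]
  have a: "frame ?I ?q E m (\<lambda>u. a0 (u, 0)) (\<lambda>u. d0 (u, 0))" by simp
  have a_eq: "equivariant (carrier G) (topspace ?I) E m (\<lambda>u. a0 (u, 0)) r0"
    using a0(2) by (simp add: equivariant_def)
  have q1: "?q u = None" if "\<bar>u\<bar> = 1" for u using that by (simp add: square_map_None)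
  have sub: "subtopology ?I {-1} = top_of_set {-1}" by (simp add: subtopology_subtopology)
  have b0: "frame (subtopology ?I {-1}) ?q E n (\<lambda>y. base_frame) (\<lambda>y. base_coframe)"
    unfolding sub by (rule base_frame(1)) (simp add: q1)
  have ret: "continuous_map ?I (subtopology ?I {-1}) (\<lambda>u. -1)" unfolding sub by simp
  obtain a1 d1 where a1: "frame ?I ?q E n a1 d1" "equivariant (carrier G) {-1..1} E n a1 r"
    "\<forall>y\<in>{-1}. \<forall>v\<in>vecs n. a1 y v = base_frame v"
    by (rule frame_extend[OF a a_eq b0 base_frame(2) _ ret, unfolded topspace_euclidean_subtopology]) simp_all
  \<comment> \<open>The monodromy \<open>a1 1\<close> against \<open>base_frame\<close> is killed along a path in the commutant of \<open>r\<close>.\<close>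
  let ?P = "top_of_set {1::real}"
  have "continuous_map ?P ?I (\<lambda>u. u)" by (auto intro: continuous_on_id)
  from frame_pullback[OF a1(1) this refl] have aP: "frame ?P ?q E n a1 d1" .
  have bP: "frame ?P ?q E n (\<lambda>y. base_frame) (\<lambda>y. base_coframe)" by (rule base_frame(1)) (simp add: q1)
  let ?A = "\<lambda>v. d1 1 (base_frame v)" and ?B = "\<lambda>v. base_coframe (a1 1 v)"
  have one: "(1::real) \<in> topspace ?P" by simp
  note tA = frame_transition(2-4)[OF bP aP one] and tB = frame_transition(2-4)[OF aP bP one]
  have AB: "?A (?B v) = v" if "v \<in> vecs n" for v using tB(3)[OF that] .
  have Ar: "?A (r g v) = r g (?A v)" if "g \<in> carrier G" "v \<in> vecs n" for g v
    by (rule equivariant_transition[OF bP aP base_frame(2)[of "{1}"] a1(2) that]) simp_all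
  obtain z :: "real \<Rightarrow> complex" where z: "continuous_on {0..1} z" "z 0 = 0" "z 1 = 1"
    "\<forall>s\<in>{0..1}. Determinant.det (lin_mat n (\<lambda>v i. (1 - z s) * v i + z s * ?A v i)) \<noteq> 0"
    by (rule invertible_path[OF tA(1) tB(1) AB])
  \<comment> \<open>On the interval these are automorphisms of \<open>r\<close>: combinations of the
    identity and \<open>?A\<close>, equal to the identity at \<open>u = -1\<close> and to
    \<open>?A\<close> at \<open>u = 1\<close>, where \<open>?A\<close> turns \<open>a1\<close> into
    the base frame. The argument \<open>(u + 1) / 2\<close> rescales the interval to the domain of
    the path \<open>z\<close>.\<close>
  define t where "t u v = (\<lambda>i. (1 - z ((u + 1) / 2)) * v i + z ((u + 1) / 2) * ?A v i)" for u v
  have t_lin: "lin_map n n (t u)" for u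
    unfolding t_def[abs_def] by (rule lin_map_affine[OF _ tA(1)]) (simp add: lin_map_def)
  have zc: "continuous_map ?I euclidean (\<lambda>u. z ((u + 1) / 2))"
  proof -
    have "continuous_on {-1..1} (\<lambda>u::real. (u + 1) / 2)" by (intro continuous_intros) simp
    moreover have "(\<lambda>u::real. (u + 1) / 2) ` {-1..1} \<subseteq> {0..1}" by auto
    ultimately show ?thesis using continuous_on_compose2[OF z(1)] by simp
  qed
  have t_cont: "continuous_map (prod_topology ?I (complex_space n)) (complex_space n) (\<lambda>(u, v). t u v)"
  proof (rule continuous_map_lin_family)
    show "continuous_map ?I euclidean (\<lambda>u. t u (basis_vec j) i)" for i j
      unfolding t_def
      by (intro continuous_map_add continuous_map_mult_algebra continuous_map_diff zc) auto
  qed (rule t_lin)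
  have t_det: "Determinant.det (lin_mat n (t u)) \<noteq> 0" if "u \<in> {-1..1}" for u
    using bspec[OF z(4), of "(u + 1) / 2"] that unfolding t_def[abs_def] by simp
  have s_cont: "continuous_map (prod_topology ?I (complex_space n)) (complex_space n) (\<lambda>(u, v). lin_inv n (t u) v)"
    by (rule continuous_map_lin_inv_family[OF t_cont]) (simp add: t_det)
  have F: "frame ?I ?q E n (\<lambda>u v. a1 u (t u v)) (\<lambda>u e. lin_inv n (t u) (d1 u e))"
    by (rule frame_change[OF a1(1) t_cont s_cont t_lin]) (use lin_inv[OF t_lin] t_det in simp_all)
  have t_r: "t u (r g v) = r g (t u v)" if g: "g \<in> carrier G" and v: "v \<in> vecs n" for u g v
  proof -
    have Av: "?A v \<in> vecs n" by (rule lin_map_in[OF tA(1) v])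
    have "r g (t u v) = (\<lambda>i. r g (\<lambda>i. (1 - z ((u + 1) / 2)) * v i) i + r g (\<lambda>i. z ((u + 1) / 2) * ?A v i) i)"
      unfolding t_def by (rule lin_map_add[OF r'(2)[OF g] vecs_scale[OF v] vecs_scale[OF Av]])
    then show ?thesis
      unfolding t_def Ar[OF g v] lin_map_scale[OF r'(2)[OF g] v] lin_map_scale[OF r'(2)[OF g] Av] by simp
  qed
  show thesis
  proof (rule that[OF F])
    show "equivariant (carrier G) {-1..1} E n (\<lambda>u v. a1 u (t u v)) r"
      using a1(2) t_r lin_map_in[OF t_lin] r'(3) by (simp add: equivariant_def)
    have "a1 u (t u v) = base_frame v" if u: "\<bar>u\<bar> = 1" and v: "v \<in> vecs n" for u v
    proof -
      consider "u = -1" | "u = 1" using u by linarith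
      then show ?thesis
      proof cases
        case 1
        have "t u v = v" unfolding t_def 1 by (simp add: z)
        then show ?thesis using a1(3) v 1 by simp
      next
        case 2
        have "t u v = ?A v" unfolding t_def 2 by (simp add: z)
        then show ?thesis using tA(2)[OF v] 2 by simp
      qed
    qed
    then show "\<forall>u v. \<bar>u\<bar> = 1 \<longrightarrow> v \<in> vecs n \<longrightarrow> a1 u (t u v) = base_frame v" by blast
  qed
qed

text \<open>
  \<open>b\<close> is a frame on the hemisphere for \<open>H\<close>, \<open>a\<close> a frame on the equator for \<open>G\<close>, both equal to the
  base frame at infinity, and \<open>\<psi>\<close> is the clutching function between them.
\<close>

definition clutched where
  "clutched b d a \<psi> \<psi>' \<longleftrightarrow> frame (top_of_set half_square) square_map E n b d \<and>
    equivariant H half_square E n b r \<and>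
    (\<forall>y\<in>half_square_sides. \<forall>v\<in>vecs n. b y v = base_frame v) \<and>
    equivariant (carrier G) {-1..1} E n a r \<and>
    (\<forall>u\<in>{-1..1}. \<forall>v\<in>vecs n. b (u, 0) (\<psi> u v) = a u v) \<and>
    continuous_map (prod_topology (top_of_set {-1..1}) (complex_space n)) (complex_space n) (\<lambda>(u, v). \<psi> u v) \<and>
    continuous_map (prod_topology (top_of_set {-1..1}) (complex_space n)) (complex_space n) (\<lambda>(u, v). \<psi>' u v) \<and>
    (\<forall>u\<in>{-1..1::real}. lin_map n n (\<psi> u) \<and> lin_map n n (\<psi>' u) \<and>
      (\<forall>v\<in>vecs n. \<psi> u (\<psi>' u v) = v \<and> \<psi>' u (\<psi> u v) = v \<and>
        (\<forall>h\<in>H. \<psi> u (r h v) = r h (\<psi> u v) \<and> \<psi>' u (r h v) = r h (\<psi>' u v)))) \<and>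
    (\<forall>u v. \<bar>u\<bar> = 1 \<longrightarrow> v \<in> vecs n \<longrightarrow> \<psi> u v = v \<and> \<psi>' u v = v)"

lemma clutched_exists: "\<exists>b d a \<psi> \<psi>'. clutched b d a \<psi> \<psi>'"
proof -
  let ?I = "top_of_set {-1..1::real}" and ?q = "\<lambda>u. square_map (u, 0)"
  obtain b d where b: "frame (top_of_set half_square) square_map E n b d" "equivariant H half_square E n b r"
    "\<forall>y\<in>half_square_sides. \<forall>v\<in>vecs n. b y v = base_frame v"
    by (rule hemisphere_frame)
  obtain a d' where a: "frame ?I ?q E n a d'" "equivariant (carrier G) {-1..1} E n a r"
    "\<forall>u v. \<bar>u\<bar> = 1 \<longrightarrow> v \<in> vecs n \<longrightarrow> a u v = base_frame v"
    by (rule equator_frame)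
  have "continuous_map ?I (top_of_set half_square) (\<lambda>u. (u, 0::real))"
    by (auto simp: half_square_def intro!: continuous_intros)
  from frame_pullback[OF b(1) this refl] have bI: "frame ?I ?q E n (\<lambda>u. b (u, 0)) (\<lambda>u. d (u, 0))" .
  have bI_eq: "equivariant H {-1..1} E n (\<lambda>u. b (u, 0)) r"
    using b(2) by (simp add: equivariant_def half_square_def)
  have a_eq: "equivariant H {-1..1} E n a r"
    by (rule equivariant_mono[OF a(2) H_subset subset_refl])
  note t = frame_transition[OF a(1) bI] and s = frame_transition[OF bI a(1)]
  let ?\<psi> = "\<lambda>u v. d (u, 0) (a u v)" and ?\<psi>' = "\<lambda>u v. d' u (b (u, 0) v)"
  have ends: "?\<psi> u v = v \<and> ?\<psi>' u v = v" if u: "\<bar>u\<bar> = 1" and v: "v \<in> vecs n" for u v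
  proof -
    have I: "u \<in> {-1..1}" using u by auto
    have "(u, 0) \<in> half_square_sides" using u by (intro half_square_sidesI) auto
    then have "a u v = b (u, 0) v" using a(3) b(3) u v by simp
    then show ?thesis using frameD(4)[OF bI, of u v] frameD(4)[OF a(1), of u v] I v by simp
  qed
  have mid: "lin_map n n (?\<psi> u) \<and> lin_map n n (?\<psi>' u) \<and>
      (\<forall>v\<in>vecs n. ?\<psi> u (?\<psi>' u v) = v \<and> ?\<psi>' u (?\<psi> u v) = v \<and>
        (\<forall>h\<in>H. ?\<psi> u (r h v) = r h (?\<psi> u v) \<and> ?\<psi>' u (r h v) = r h (?\<psi>' u v)))" if u: "u \<in> {-1..1}" for u
  proof (intro conjI ballI)
    have uI: "u \<in> topspace ?I" using u by simp
    show "lin_map n n (?\<psi> u)" by (rule t(2)[OF uI])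
    show "lin_map n n (?\<psi>' u)" by (rule s(2)[OF uI])
    fix v assume v: "v \<in> vecs n"
    show "?\<psi> u (?\<psi>' u v) = v" by (rule s(4)[OF uI v])
    show "?\<psi>' u (?\<psi> u v) = v" by (rule t(4)[OF uI v])
    fix h assume h: "h \<in> H"
    show "?\<psi> u (r h v) = r h (?\<psi> u v)"
      by (rule equivariant_transition[OF a(1) bI a_eq bI_eq h v u u uI])
    show "?\<psi>' u (r h v) = r h (?\<psi>' u v)"
      by (rule equivariant_transition[OF bI a(1) bI_eq a_eq h v u u uI])
  qed
  have "\<forall>u\<in>{-1..1}. \<forall>v\<in>vecs n. b (u, 0) (?\<psi> u v) = a u v" using t(3) by simp
  then have "clutched b d a ?\<psi> ?\<psi>'"
    unfolding clutched_def using b a(2) t(1) s(1) mid ends by blast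
  then show ?thesis by blast
qed

end

section \<open>Rotating the clutching function\<close>

definition rotate :: "real \<Rightarrow> (nat \<Rightarrow> complex) \<times> (nat \<Rightarrow> complex) \<Rightarrow> (nat \<Rightarrow> complex) \<times> (nat \<Rightarrow> complex)" where
  "rotate t p = (\<lambda>i. of_real (cos t) * fst p i - of_real (sin t) * snd p i,
                 \<lambda>i. of_real (sin t) * fst p i + of_real (cos t) * snd p i)"

lemma rotate_rotate: "rotate s (rotate t p) = rotate (s + t) p"
  by (simp add: rotate_def prod_eq_iff fun_eq_iff cos_add sin_add algebra_simps)

lemma rotate_0 [simp]: "rotate 0 p = p"
  by (simp add: rotate_def prod_eq_iff)

text \<open>Continuous families of \<open>H\<close>-equivariant endomorphisms of the double of
  \<open>C^n\<close>, written on pairs rather than on \<open>C^(2n)\<close> to match the fibres of a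
  Whitney sum.\<close>

definition pair_family ::
    "nat \<Rightarrow> ('a \<Rightarrow> (nat \<Rightarrow> complex) \<Rightarrow> nat \<Rightarrow> complex)
      \<Rightarrow> (real \<times> real \<Rightarrow> (nat \<Rightarrow> complex) \<times> (nat \<Rightarrow> complex) \<Rightarrow> (nat \<Rightarrow> complex) \<times> (nat \<Rightarrow> complex)) \<Rightarrow> bool" where
  "pair_family n r \<Phi> \<longleftrightarrow>
     continuous_map (prod_topology (top_of_set half_square) (prod_topology (complex_space n) (complex_space n)))
       (prod_topology (complex_space n) (complex_space n)) (\<lambda>(y, p). \<Phi> y p) \<and>
     (\<forall>y\<in>half_square. \<forall>p\<in>vecs n \<times> vecs n.
        (\<forall>q\<in>vecs n \<times> vecs n. \<Phi> y (\<lambda>i. fst p i + fst q i, \<lambda>i. snd p i + snd q i) =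
           (\<lambda>i. fst (\<Phi> y p) i + fst (\<Phi> y q) i, \<lambda>i. snd (\<Phi> y p) i + snd (\<Phi> y q) i)) \<and>
        (\<forall>k. \<Phi> y (\<lambda>i. k * fst p i, \<lambda>i. k * snd p i) = (\<lambda>i. k * fst (\<Phi> y p) i, \<lambda>i. k * snd (\<Phi> y p) i)) \<and>
        (\<forall>h\<in>H. \<Phi> y (r h (fst p), r h (snd p)) = (r h (fst (\<Phi> y p)), r h (snd (\<Phi> y p)))))"

lemma pair_familyD:
  assumes "pair_family n r \<Phi>"
  shows "continuous_map (prod_topology (top_of_set half_square) (prod_topology (complex_space n) (complex_space n)))
       (prod_topology (complex_space n) (complex_space n)) (\<lambda>(y, p). \<Phi> y p)"
    and "\<And>y p. y \<in> half_square \<Longrightarrow> p \<in> vecs n \<times> vecs n \<Longrightarrow> \<Phi> y p \<in> vecs n \<times> vecs n"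
    and "\<And>y p q. y \<in> half_square \<Longrightarrow> p \<in> vecs n \<times> vecs n \<Longrightarrow> q \<in> vecs n \<times> vecs n \<Longrightarrow>
        \<Phi> y (\<lambda>i. fst p i + fst q i, \<lambda>i. snd p i + snd q i) =
           (\<lambda>i. fst (\<Phi> y p) i + fst (\<Phi> y q) i, \<lambda>i. snd (\<Phi> y p) i + snd (\<Phi> y q) i)"
    and "\<And>y p k. y \<in> half_square \<Longrightarrow> p \<in> vecs n \<times> vecs n \<Longrightarrow>
        \<Phi> y (\<lambda>i. k * fst p i, \<lambda>i. k * snd p i) = (\<lambda>i. k * fst (\<Phi> y p) i, \<lambda>i. k * snd (\<Phi> y p) i)"
    and "\<And>y p h. y \<in> half_square \<Longrightarrow> p \<in> vecs n \<times> vecs n \<Longrightarrow> h \<in> H \<Longrightarrow>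
        \<Phi> y (r h (fst p), r h (snd p)) = (r h (fst (\<Phi> y p)), r h (snd (\<Phi> y p)))"
proof -
  show c: "continuous_map (prod_topology (top_of_set half_square) (prod_topology (complex_space n) (complex_space n)))
       (prod_topology (complex_space n) (complex_space n)) (\<lambda>(y, p). \<Phi> y p)"
    using assms by (simp only: pair_family_def)
  show "\<Phi> y p \<in> vecs n \<times> vecs n" if "y \<in> half_square" "p \<in> vecs n \<times> vecs n" for y p
    using continuous_map_in[OF c, of "(y, p)"] that by simp
qed (use assms in \<open>simp_all only: pair_family_def\<close>)

lemma pair_family_compose:
  assumes "pair_family n r \<Phi>" "pair_family n r \<Psi>"
  shows "pair_family n r (\<lambda>y p. \<Phi> y (\<Psi> y p))"
proof -
  note F = pair_familyD[OF assms(1)] and P = pair_familyD[OF assms(2)]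
  have c: "continuous_map (prod_topology (top_of_set half_square) (prod_topology (complex_space n) (complex_space n)))
       (prod_topology (complex_space n) (complex_space n)) (\<lambda>(y, p). \<Phi> y (\<Psi> y p))"
    using continuous_map_family[OF F(1) continuous_map_fst P(1)] by (simp add: case_prod_unfold)
  show ?thesis
    unfolding pair_family_def
    by (intro conjI c ballI allI) (simp_all only: P(3) F(3) P(4) F(4) P(5) F(5) P(2))
qed

text \<open>The rotation mixes the two factors with scalar coefficients, so it commutes with the
  diagonal linear action of \<open>H\<close>.\<close>

lemma pair_family_rotate:
  assumes r: "lin_rep G T n r" and t: "continuous_on half_square t"
  shows "pair_family n r (\<lambda>y. rotate (t y))"
  unfolding pair_family_def
proof (intro conjI ballI allI)
  let ?Z = "prod_topology (top_of_set half_square) (prod_topology (complex_space n) (complex_space n))"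
  have base: "continuous_map ?Z euclidean (\<lambda>z. g (fst z))" if "continuous_on half_square g"
    for g :: "real \<times> real \<Rightarrow> complex"
  proof -
    have "continuous_map (top_of_set half_square) euclidean g" using that by simp
    from continuous_map_compose[OF continuous_map_fst this] show ?thesis by (simp only: o_def)
  qed
  have c: "continuous_map ?Z euclidean (\<lambda>z. complex_of_real (cos (t (fst z))))"
    "continuous_map ?Z euclidean (\<lambda>z. complex_of_real (sin (t (fst z))))"
    by (rule base, intro continuous_intros t)+
  have f: "continuous_map ?Z (complex_space n) (\<lambda>z. fst (snd z))"
    and s: "continuous_map ?Z (complex_space n) (\<lambda>z. snd (snd z))"
    using continuous_map_compose[OF continuous_map_snd continuous_map_fst]
      continuous_map_compose[OF continuous_map_snd continuous_map_snd] by (simp_all add: o_def)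
  have fi: "continuous_map ?Z euclidean (\<lambda>z. fst (snd z) i)" and si: "continuous_map ?Z euclidean (\<lambda>z. snd (snd z) i)" for i
    using f s by (simp_all add: continuous_map_complex_space_iff)
  have "continuous_map ?Z (complex_space n) (\<lambda>z i. complex_of_real (cos (t (fst z))) * fst (snd z) i - complex_of_real (sin (t (fst z))) * snd (snd z) i)"
    unfolding continuous_map_complex_space_iff
    by (intro conjI allI continuous_map_diff continuous_map_mult_algebra c fi si) auto
  moreover have "continuous_map ?Z (complex_space n) (\<lambda>z i. complex_of_real (sin (t (fst z))) * fst (snd z) i + complex_of_real (cos (t (fst z))) * snd (snd z) i)"
    unfolding continuous_map_complex_space_iff
    by (intro conjI allI continuous_map_add continuous_map_mult_algebra c fi si) auto
  ultimately show "continuous_map ?Z (prod_topology (complex_space n) (complex_space n)) (\<lambda>(y, p). rotate (t y) p)"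
    by (simp add: rotate_def case_prod_unfold continuous_map_pairedI)
  fix y p assume p: "p \<in> vecs n \<times> vecs n"
  show "rotate (t y) (r h (fst p), r h (snd p)) = (r h (fst (rotate (t y) p)), r h (snd (rotate (t y) p)))" if h: "h \<in> H" for h
  proof -
    note rl = lin_repD(2)[OF r H_carrier[OF h]]
    obtain v w where vw: "p = (v, w)" "v \<in> vecs n" "w \<in> vecs n" using p by auto
    have sum: "r h (\<lambda>i. a * v i + b * w i) = (\<lambda>i. a * r h v i + b * r h w i)" for a b
      using lin_map_add[OF rl vecs_scale[OF vw(2)] vecs_scale[OF vw(3)]] lin_map_scale[OF rl vw(2)] lin_map_scale[OF rl vw(3)]
      by simp
    show ?thesis
      using sum[of "of_real (cos (t y))" "- of_real (sin (t y))"] sum[of "of_real (sin (t y))" "of_real (cos (t y))"]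
      by (simp add: rotate_def vw(1))
  qed
qed (simp_all add: rotate_def fun_eq_iff algebra_simps)

lemma pair_family_fst:
  assumes lin: "\<forall>u\<in>{-1..1}. lin_map n n (\<psi> u)"
    and c: "continuous_map (prod_topology (top_of_set {-1..1}) (complex_space n)) (complex_space n) (\<lambda>(u, v). \<psi> u v)"
    and H: "\<forall>u\<in>{-1..1}. \<forall>h\<in>H. \<forall>v\<in>vecs n. \<psi> u (r h v) = r h (\<psi> u v)"
  shows "pair_family n r (\<lambda>y p. (\<psi> (fst y) (fst p), snd p))"
  unfolding pair_family_def
proof (intro conjI ballI allI)
  let ?Z = "prod_topology (top_of_set half_square) (prod_topology (complex_space n) (complex_space n))"
  have "continuous_map (top_of_set half_square) (top_of_set {-1..1}) fst"
    by (auto simp: half_square_def intro: continuous_on_fst continuous_on_id)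
  from continuous_map_compose[OF continuous_map_fst this]
  have 1: "continuous_map ?Z (top_of_set {-1..1}) (\<lambda>z. fst (fst z))" by (simp only: o_def)
  have f: "continuous_map ?Z (complex_space n) (\<lambda>z. fst (snd z))"
    and s: "continuous_map ?Z (complex_space n) (\<lambda>z. snd (snd z))"
    using continuous_map_compose[OF continuous_map_snd continuous_map_fst]
      continuous_map_compose[OF continuous_map_snd continuous_map_snd] by (simp_all add: o_def)
  show "continuous_map ?Z (prod_topology (complex_space n) (complex_space n)) (\<lambda>(y, p). (\<psi> (fst y) (fst p), snd p))"
    using continuous_map_pairedI[OF continuous_map_family[OF c 1 f] s] by (simp add: case_prod_unfold)
  fix y :: "real \<times> real" and p :: "(nat \<Rightarrow> complex) \<times> (nat \<Rightarrow> complex)"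
  assume "y \<in> half_square" and p: "p \<in> vecs n \<times> vecs n"
  then have y: "fst y \<in> {-1..1}" by (auto simp: half_square_def)
  note l = bspec[OF lin y]
  show "(\<psi> (fst y) (fst (\<lambda>i. k * fst p i, \<lambda>i. k * snd p i)), snd (\<lambda>i. k * fst p i, \<lambda>i. k * snd p i)) =
      (\<lambda>i. k * fst (\<psi> (fst y) (fst p), snd p) i, \<lambda>i. k * snd (\<psi> (fst y) (fst p), snd p) i)" for k
    using lin_map_scale[OF l, of "fst p" k] p by auto
  show "(\<psi> (fst y) (fst (\<lambda>i. fst p i + fst q i, \<lambda>i. snd p i + snd q i)), snd (\<lambda>i. fst p i + fst q i, \<lambda>i. snd p i + snd q i)) =
      (\<lambda>i. fst (\<psi> (fst y) (fst p), snd p) i + fst (\<psi> (fst y) (fst q), snd q) i,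
       \<lambda>i. snd (\<psi> (fst y) (fst p), snd p) i + snd (\<psi> (fst y) (fst q), snd q) i)" if "q \<in> vecs n \<times> vecs n" for q
    using lin_map_add[OF l, of "fst p" "fst q"] p that by auto
  show "(\<psi> (fst y) (fst (r h (fst p), r h (snd p))), snd (r h (fst p), r h (snd p))) =
      (r h (fst (\<psi> (fst y) (fst p), snd p)), r h (snd (\<psi> (fst y) (fst p), snd p)))" if "h \<in> H" for h
    using bspec[OF bspec[OF H y] that] p by auto
qed

end

context compact_group_character
begin

text \<open>
  Under the twisted representation \<open>c\<close> acts by a polynomial in \<open>r (c c)\<close>, and \<open>c c\<close> lies in \<open>H\<close>.
\<close>

lemma twisted_rep:
  assumes r: "lin_rep G T n r"
  shows "\<exists>r'. lin_rep G T n r' \<and> (\<forall>h\<in>H. r' h = r h) \<and>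
    (\<forall>t. lin_map n n t \<longrightarrow> (\<forall>h\<in>H. \<forall>v\<in>vecs n. t (r h v) = r h (t v)) \<longrightarrow>
      (\<forall>g\<in>carrier G. \<forall>v\<in>vecs n. t (r' g v) = r' g (t v)))"
proof (rule rep_involution[OF r])
  fix j assume j: "lin_map n n j" "\<And>v. v \<in> vecs n \<Longrightarrow> j (j v) = v"
    "\<And>g v. g \<in> carrier G \<Longrightarrow> v \<in> vecs n \<Longrightarrow> j (r g v) = r g (j v)"
    and comm: "\<And>t v. lin_map n n t \<Longrightarrow> (\<And>h v. h \<in> H \<Longrightarrow> v \<in> vecs n \<Longrightarrow> t (r h v) = r h (t v)) \<Longrightarrow> v \<in> vecs n \<Longrightarrow>
        t (j (r c v)) = j (r c (t v))"
  have "t (twist j r g v) = twist j r g (t v)"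
    if t: "lin_map n n t" "\<forall>h\<in>H. \<forall>v\<in>vecs n. t (r h v) = r h (t v)" and gv: "g \<in> carrier G" "v \<in> vecs n" for t g v
  proof (rule twist_commute[OF r t(1) _ _ gv])
    show tH: "t (r h v) = r h (t v)" if "h \<in> H" "v \<in> vecs n" for h v using t(2) that by simp
    show "t (j (r c v)) = j (r c (t v))" if "v \<in> vecs n" for v by (rule comm[OF t(1) tH that])
  qed
  moreover have "\<forall>h\<in>H. twist j r h = r h" by (simp add: twist_def fun_eq_iff)
  ultimately show ?thesis using lin_rep_twist[OF r j] by blast
qed

text \<open>
  Whitehead's trick: conjugating \<open>diag \<psi>' 1\<close> by a rotation deforms \<open>diag \<psi> \<psi>'\<close> on the bottom side
  to the identity on the top side.
\<close>

lemma clutching_rotation: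
  assumes r: "lin_rep G T n r"
    and c: "continuous_map (prod_topology (top_of_set {-1..1}) (complex_space n)) (complex_space n) (\<lambda>(u, v). \<psi> u v)"
    and c': "continuous_map (prod_topology (top_of_set {-1..1}) (complex_space n)) (complex_space n) (\<lambda>(u, v). \<psi>' u v)"
    and \<psi>: "\<forall>u\<in>{-1..1::real}. lin_map n n (\<psi> u) \<and> lin_map n n (\<psi>' u) \<and>
      (\<forall>v\<in>vecs n. \<psi> u (\<psi>' u v) = v \<and> \<psi>' u (\<psi> u v) = v \<and>
        (\<forall>h\<in>H. \<psi> u (r h v) = r h (\<psi> u v) \<and> \<psi>' u (r h v) = r h (\<psi>' u v)))"
    and ends: "\<forall>u v. \<bar>u\<bar> = 1 \<longrightarrow> v \<in> vecs n \<longrightarrow> \<psi> u v = v \<and> \<psi>' u v = v"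
  shows "\<exists>X Xi. pair_family n r X \<and> pair_family n r Xi \<and>
    (\<forall>y\<in>half_square. \<forall>p\<in>vecs n \<times> vecs n. X y (Xi y p) = p \<and> Xi y (X y p) = p) \<and>
    (\<forall>y\<in>half_square_sides. \<forall>p\<in>vecs n \<times> vecs n. X y p = p) \<and>
    (\<forall>u\<in>{-1..1}. \<forall>v\<in>vecs n. \<forall>w\<in>vecs n. X (u, 0) (v, w) = (\<psi> u v, \<psi>' u w))"
proof -
  \<comment> \<open>The angle is a right angle on the bottom side and 0 on the top side. At the
    right angle the rotation exchanges the factors up to sign, and conjugation by it moves \<psi>'
    to the second factor. At angle 0 the maps \<open>P\<close> and \<open>Pi\<close> cancel; on the
    vertical sides both are the identity.\<close>
  define t where "t y = pi / 2 * (1 - snd y)" for y :: "real \<times> real"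
  define P where "P y p = (\<psi> (fst y) (fst p), snd p)" for y :: "real \<times> real" and p :: "(nat \<Rightarrow> complex) \<times> (nat \<Rightarrow> complex)"
  define Pi where "Pi y p = (\<psi>' (fst y) (fst p), snd p)" for y :: "real \<times> real" and p :: "(nat \<Rightarrow> complex) \<times> (nat \<Rightarrow> complex)"
  have t: "continuous_on half_square t" "continuous_on half_square (\<lambda>y. - t y)"
    unfolding t_def by (intro continuous_intros)+
  note R = pair_family_rotate[OF r t(1)] and R' = pair_family_rotate[OF r t(2)]
  have lin: "\<forall>u\<in>{-1..1}. lin_map n n (\<psi> u)" "\<forall>u\<in>{-1..1}. lin_map n n (\<psi>' u)"
    and equi: "\<forall>u\<in>{-1..1}. \<forall>h\<in>H. \<forall>v\<in>vecs n. \<psi> u (r h v) = r h (\<psi> u v)"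
      "\<forall>u\<in>{-1..1}. \<forall>h\<in>H. \<forall>v\<in>vecs n. \<psi>' u (r h v) = r h (\<psi>' u v)"
    using \<psi> by blast+
  have P: "pair_family n r P" unfolding P_def[abs_def]
    by (rule pair_family_fst) (fact lin(1), fact c, fact equi(1))
  have Pi: "pair_family n r Pi" unfolding Pi_def[abs_def]
    by (rule pair_family_fst) (fact lin(2), fact c', fact equi(2))
  let ?X = "\<lambda>y p. P y (rotate (t y) (Pi y (rotate (- t y) p)))"
  \<comment> \<open>The inverses of the four factors of \<open>?X\<close>, in the opposite
    order.\<close>
  let ?Xi = "\<lambda>y p. rotate (t y) (P y (rotate (- t y) (Pi y p)))"
  note X = pair_family_compose[OF P pair_family_compose[OF R pair_family_compose[OF Pi R']]]
    and Xi = pair_family_compose[OF R pair_family_compose[OF P pair_family_compose[OF R' Pi]]]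
  note mem = pair_familyD(2)
  have inv: "P y (Pi y p) = p" "Pi y (P y p) = p" if "y \<in> half_square" "p \<in> vecs n \<times> vecs n" for y p
  proof -
    have "fst y \<in> {-1..1}" using that(1) by (auto simp: half_square_def)
    moreover have "fst p \<in> vecs n" using that(2) by auto
    ultimately have "\<psi> (fst y) (\<psi>' (fst y) (fst p)) = fst p \<and> \<psi>' (fst y) (\<psi> (fst y) (fst p)) = fst p"
      using \<psi> by blast
    then show "P y (Pi y p) = p" "Pi y (P y p) = p" by (simp_all add: P_def Pi_def)
  qed
  have "?X y (?Xi y p) = p \<and> ?Xi y (?X y p) = p" if y: "y \<in> half_square" and p: "p \<in> vecs n \<times> vecs n" for y p
  proof
    have 1: "rotate (- t y) (Pi y p) \<in> vecs n \<times> vecs n"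
      by (rule mem[OF R' y mem[OF Pi y p]])
    show "?X y (?Xi y p) = p"
      using inv(2)[OF y 1] inv(1)[OF y p] by (simp add: rotate_rotate)
    have 2: "rotate (- t y) p \<in> vecs n \<times> vecs n" by (rule mem[OF R' y p])
    have 3: "rotate (t y) (Pi y (rotate (- t y) p)) \<in> vecs n \<times> vecs n" by (rule mem[OF R y mem[OF Pi y 2]])
    show "?Xi y (?X y p) = p"
      using inv(2)[OF y 3] inv(1)[OF y 2] by (simp add: rotate_rotate)
  qed
  moreover have "?X y p = p" if y: "y \<in> half_square_sides" and p: "p \<in> vecs n \<times> vecs n" for y p
  proof -
    have y': "y \<in> half_square" and s: "\<bar>fst y\<bar> = 1 \<or> snd y = 1" using y by (simp_all add: half_square_sides_def)
    show ?thesis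
    proof (cases "snd y = 1")
      case True
      then have "t y = 0" by (simp add: t_def)
      then show ?thesis using inv(1)[OF y' p] by simp
    next
      case False
      then have "\<bar>fst y\<bar> = 1" using s by blast
      then have id: "P y q = q" "Pi y q = q" if "q \<in> vecs n \<times> vecs n" for q
        using ends that by (auto simp: P_def Pi_def)
      have "rotate (- t y) p \<in> vecs n \<times> vecs n" by (rule mem[OF R' y' p])
      then show ?thesis using id(2) id(1)[OF p] by (simp add: rotate_rotate)
    qed
  qed
  moreover have "?X (u, 0) (v, w) = (\<psi> u v, \<psi>' u w)" for u v w
    by (simp add: P_def Pi_def t_def rotate_def)
  ultimately show ?thesis using X Xi by (intro exI[of _ ?X] exI[of _ ?Xi] conjI) simp_all
qed

text \<open>The fibre isomorphisms \<open>B\<close> on the half square pass to the hemisphere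
  because they agree wherever \<open>square_map\<close> identifies points, that is, on the sides;
  from the hemisphere \<open>extend_iso\<close> carries them to the sphere. The condition on
  \<open>c\<close> is imposed on the bottom side and on the sides, which is exactly where
  \<open>c\<close> fixes the point of the sphere.\<close>

lemma half_pair_iso:
  fixes F :: "('a, (real \<times> real) option, 'f) gbundle"
  assumes F: "G_vector_bundle G T sphere2 refl_act F" and r: "lin_rep G T n r" and r': "lin_rep G T n r'"
    and r'_H: "\<forall>h\<in>H. r' h = r h"
    and B: "continuous_map (prod_topology (top_of_set half_square) (prod_topology (complex_space n) (complex_space n)))
        (total_space F) (\<lambda>(y, p). B y p)"
    and D: "continuous_map (subtopology (prod_topology (top_of_set half_square) (total_space F)) {(y, f). square_map y = bundle_proj F f})
        (prod_topology (complex_space n) (complex_space n)) (\<lambda>(y, f). D y f)"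
    and proj: "\<forall>y\<in>half_square. \<forall>p\<in>vecs n \<times> vecs n. bundle_proj F (B y p) = square_map y"
    and DB: "\<forall>y\<in>half_square. \<forall>p\<in>vecs n \<times> vecs n. D y (B y p) = p"
    and BD: "\<forall>y\<in>half_square. \<forall>f\<in>topspace (total_space F). bundle_proj F f = square_map y \<longrightarrow> B y (D y f) = f"
    and sides: "\<forall>y\<in>half_square_sides. \<forall>y'\<in>half_square_sides. \<forall>p\<in>vecs n \<times> vecs n. B y p = B y' p"
    and add: "\<forall>y\<in>half_square. \<forall>p\<in>vecs n \<times> vecs n. \<forall>q\<in>vecs n \<times> vecs n.
        B y (\<lambda>i. fst p i + fst q i, \<lambda>i. snd p i + snd q i) = fibre_add F (B y p) (B y q)"
    and scale: "\<forall>y\<in>half_square. \<forall>p\<in>vecs n \<times> vecs n. \<forall>k.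
        B y (\<lambda>i. k * fst p i, \<lambda>i. k * snd p i) = fibre_scale F k (B y p)"
    and H_equi: "\<forall>y\<in>half_square. \<forall>p\<in>vecs n \<times> vecs n. \<forall>h\<in>H. B y (r h (fst p), r h (snd p)) = bundle_act F h (B y p)"
    and c_equi: "\<forall>y\<in>half_square. \<forall>p\<in>vecs n \<times> vecs n. snd y = 0 \<or> y \<in> half_square_sides \<longrightarrow>
        B y (r c (fst p), r' c (snd p)) = bundle_act F c (B y p)"
  shows "bundle_isomorphic G (whitney_sum (product_bundle sphere2 refl_act n r) (product_bundle sphere2 refl_act n r')) F"
proof -
  let ?P = "product_bundle sphere2 refl_act n r" and ?P' = "product_bundle sphere2 refl_act n r'"
  let ?E = "whitney_sum ?P ?P'" and ?V = "prod_topology (complex_space n) (complex_space n)"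
  let ?hs = "top_of_set half_square"
  \<comment> \<open>\<open>square_point\<close> picks one preimage of the base point; by
    \<open>wd\<close> and \<open>wd'\<close> below every other preimage in the half square gives the
    same value.\<close>
  define \<theta> where "\<theta> e = B (square_point (fst (fst e))) (snd (fst e), snd (snd e))"
    for e :: "((real \<times> real) option \<times> (nat \<Rightarrow> complex)) \<times> (real \<times> real) option \<times> (nat \<Rightarrow> complex)"
  define \<theta>' where "\<theta>' f = ((bundle_proj F f, fst (D (square_point (bundle_proj F f)) f)),
     (bundle_proj F f, snd (D (square_point (bundle_proj F f)) f)))" for f
  have E: "G_vector_bundle G T sphere2 refl_act ?E"
    by (intro G_vector_bundle_whitney G_vector_bundle_product G_space_sphere r r')
  have topE: "topspace (total_space ?E) = {((x, v), (x', w)). x = x' \<and> v \<in> vecs n \<and> w \<in> vecs n}"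
    by (auto simp: topspace_whitney)
  have half_E: "\<exists>x v w. e = ((x, v), (x, w)) \<and> x \<in> half_sphere \<and> v \<in> vecs n \<and> w \<in> vecs n" if "e \<in> over_half ?E" for e
    using that unfolding over_half_def topE by auto
  have half_F: "f \<in> topspace (total_space F) \<and> bundle_proj F f \<in> half_sphere" if "f \<in> over_half F" for f
    using that by (simp add: over_half_def)
  note sp = square_point_half
  have inD: "D y f \<in> vecs n \<times> vecs n" if "y \<in> half_square" "f \<in> topspace (total_space F)" "bundle_proj F f = square_map y" for y f
    using continuous_map_in[OF D, of "(y, f)"] that by simp
  have wd: "B y p = B y' p" if "y \<in> half_square" "y' \<in> half_square" "square_map y = square_map y'" "p \<in> vecs n \<times> vecs n" for y y' p
  proof (cases "square_map y = None")
    case True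
    then have "y \<in> half_square_sides" "y' \<in> half_square_sides" using True square_map_sides[OF that(1)] square_map_sides[OF that(2)] that(3) by simp_all
    then show ?thesis using sides that(4) by blast
  next
    case False
    then show ?thesis using square_map_inj[OF that(3)] by simp
  qed
  have wd': "D y f = D y' f" if y: "y \<in> half_square" "y' \<in> half_square" "square_map y = square_map y'"
    and f: "f \<in> topspace (total_space F)" "bundle_proj F f = square_map y" for y y' f
  proof -
    have p: "D y f \<in> vecs n \<times> vecs n" by (rule inD[OF y(1) f])
    have "B y' (D y f) = f" using wd[OF y p] BD y(1) f by simp
    then show ?thesis using DB y(2) p by metis
  qed
  show ?thesis
  proof (rule extend_iso[OF E F])
    have surj: "\<exists>y\<in>topspace ?hs. square_map y = x" if "x \<in> half_sphere" for x
      using sp[OF that] square_map_point by (intro bexI[of _ "square_point x"]) simp_all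
    have pE: "continuous_map (total_space ?E) sphere2 (bundle_proj ?E)" and pF: "continuous_map (total_space F) sphere2 (bundle_proj F)"
      by (rule complex_vector_bundleD(1)[OF G_vector_bundleD(1)[OF E]], rule complex_vector_bundleD(1)[OF G_vector_bundleD(1)[OF F]])
    have comp: "compact_space ?hs"
      by (simp add: compact_space_subtopology half_square_def compact_Times)
    have q: "continuous_map ?hs sphere2 square_map"
      by (rule continuous_map_from_subtopology[OF continuous_square_map])
    show "continuous_map (subtopology (total_space ?E) (over_half ?E)) (total_space F) \<theta>"
    proof (rule continuous_map_descend[OF comp Hausdorff_sphere q continuous_map_from_subtopology[OF pE]])
      show "\<exists>y\<in>topspace ?hs. square_map y = bundle_proj ?E z" if "z \<in> topspace (subtopology (total_space ?E) (over_half ?E))" for z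
        by (rule surj) (use that in \<open>simp add: over_half_def\<close>)
      let ?Z = "subtopology (prod_topology ?hs (subtopology (total_space ?E) (over_half ?E))) {(y, z). square_map y = bundle_proj ?E z}"
      have 1: "continuous_map ?Z ?hs fst" by (rule continuous_map_from_subtopology[OF continuous_map_fst])
      have "continuous_map ?Z (subtopology (total_space ?E) (over_half ?E)) snd"
        by (rule continuous_map_from_subtopology[OF continuous_map_snd])
      then have 2: "continuous_map ?Z (total_space ?E) snd" by (simp add: continuous_map_in_subtopology)
      have 3: "continuous_map (total_space ?E) (complex_space n) (\<lambda>e. snd (fst e))"
        and 4: "continuous_map (total_space ?E) (complex_space n) (\<lambda>e. snd (snd e))"
        using continuous_map_compose[OF continuous_map_whitney_fst[of ?P ?P'], of "complex_space n" snd]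
          continuous_map_compose[OF continuous_map_whitney_snd[of ?P ?P'], of "complex_space n" snd]
        by (simp_all add: o_def continuous_map_snd)
      have "continuous_map ?Z ?V (\<lambda>z. (snd (fst (snd z)), snd (snd (snd z))))"
        using continuous_map_compose[OF 2 3] continuous_map_compose[OF 2 4] by (intro continuous_map_pairedI) (simp_all add: o_def)
      from continuous_map_family[OF B 1 this]
      show "continuous_map ?Z (total_space F) (\<lambda>z. B (fst z) (snd (fst (snd z)), snd (snd (snd z))))" .
      fix y z assume y: "y \<in> topspace ?hs" and z: "z \<in> topspace (subtopology (total_space ?E) (over_half ?E))"
        and yz: "square_map y = bundle_proj ?E z"
      have "z \<in> over_half ?E" using z by simp
      then obtain x v w where x: "z = ((x, v), (x, w))" "x \<in> half_sphere" "v \<in> vecs n" "w \<in> vecs n"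
        using half_E by blast
      have "B y (v, w) = B (square_point x) (v, w)"
        by (rule wd) (use y yz x sp in simp_all)
      then show "B (fst (y, z)) (snd (fst (snd (y, z))), snd (snd (snd (y, z)))) = \<theta> z"
        by (simp add: \<theta>_def x(1))
    qed
    show "continuous_map (subtopology (total_space F) (over_half F)) (total_space ?E) \<theta>'"
    proof (rule continuous_map_descend[OF comp Hausdorff_sphere q continuous_map_from_subtopology[OF pF]])
      show "\<exists>y\<in>topspace ?hs. square_map y = bundle_proj F z" if "z \<in> topspace (subtopology (total_space F) (over_half F))" for z
        by (rule surj) (use that in \<open>simp add: over_half_def\<close>)
      let ?Z = "subtopology (prod_topology ?hs (subtopology (total_space F) (over_half F))) {(y, z). square_map y = bundle_proj F z}"
      have 1: "continuous_map ?Z ?hs fst" by (rule continuous_map_from_subtopology[OF continuous_map_fst])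
      have "continuous_map ?Z (subtopology (total_space F) (over_half F)) snd"
        by (rule continuous_map_from_subtopology[OF continuous_map_snd])
      then have 2: "continuous_map ?Z (total_space F) snd" by (simp add: continuous_map_in_subtopology)
      have "continuous_map ?Z (subtopology (prod_topology ?hs (total_space F)) {(y, f). square_map y = bundle_proj F f}) (\<lambda>z. (fst z, snd z))"
        unfolding continuous_map_in_subtopology by (intro conjI continuous_map_pairedI 1 2) auto
      from continuous_map_compose[OF this D]
      have 3: "continuous_map ?Z ?V (\<lambda>z. D (fst z) (snd z))" by (simp add: o_def case_prod_unfold)
      from continuous_map_compose[OF 2 pF] have 4: "continuous_map ?Z sphere2 (\<lambda>z. bundle_proj F (snd z))"
        by (simp add: o_def)
      have 5: "continuous_map ?Z (complex_space n) (\<lambda>z. fst (D (fst z) (snd z)))"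
        "continuous_map ?Z (complex_space n) (\<lambda>z. snd (D (fst z) (snd z)))"
        using continuous_map_compose[OF 3 continuous_map_fst] continuous_map_compose[OF 3 continuous_map_snd]
        by (simp_all add: o_def)
      show "continuous_map ?Z (total_space ?E) (\<lambda>z. ((bundle_proj F (snd z), fst (D (fst z) (snd z))),
         (bundle_proj F (snd z), snd (D (fst z) (snd z)))))"
        by (rule continuous_map_into_whitney) (simp_all only: product_bundle_simps fst_conv continuous_map_pairedI 4 5)
      fix y z assume y: "y \<in> topspace ?hs" and z: "z \<in> topspace (subtopology (total_space F) (over_half F))"
        and yz: "square_map y = bundle_proj F z"
      have zF: "z \<in> topspace (total_space F)" "bundle_proj F z \<in> half_sphere" using z half_F by simp_all
      have "D y z = D (square_point (bundle_proj F z)) z"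
        by (rule wd') (use y yz zF sp in simp_all)
      then show "((bundle_proj F (snd (y, z)), fst (D (fst (y, z)) (snd (y, z)))),
         (bundle_proj F (snd (y, z)), snd (D (fst (y, z)) (snd (y, z))))) = \<theta>' z"
        by (simp add: \<theta>'_def)
    qed
    show "\<theta>' (\<theta> e) = e" "bundle_proj F (\<theta> e) = bundle_proj ?E e" if e: "e \<in> over_half ?E" for e
    proof -
      obtain x v w where x: "e = ((x, v), (x, w))" "x \<in> half_sphere" "v \<in> vecs n" "w \<in> vecs n"
        using half_E[OF e] by blast
      have y: "square_point x \<in> half_square" by (rule sp[OF x(2)])
      have p: "(v, w) \<in> vecs n \<times> vecs n" using x by simp
      have pr: "bundle_proj F (B (square_point x) (v, w)) = x" using proj y p by simp
      show "bundle_proj F (\<theta> e) = bundle_proj ?E e" using pr by (simp add: \<theta>_def x(1))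
      show "\<theta>' (\<theta> e) = e" using pr DB y p by (simp add: \<theta>_def \<theta>'_def x(1))
    qed
    show "\<theta> (\<theta>' f) = f" if f: "f \<in> over_half F" for f
      using half_F[OF f] BD sp by (simp add: \<theta>_def \<theta>'_def)
    show "bundle_proj ?E (\<theta>' f) = bundle_proj F f" for f by (simp add: \<theta>'_def)
    show "\<theta> (fibre_add ?E e e') = fibre_add F (\<theta> e) (\<theta> e')"
      if e: "e \<in> over_half ?E" and e': "e' \<in> over_half ?E" and ee: "bundle_proj ?E e' = bundle_proj ?E e" for e e'
    proof -
      obtain x v w where x: "e = ((x, v), (x, w))" "x \<in> half_sphere" "v \<in> vecs n" "w \<in> vecs n"
        using half_E[OF e] by blast
      obtain x' v' w' where x': "e' = ((x', v'), (x', w'))" "v' \<in> vecs n" "w' \<in> vecs n"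
        using half_E[OF e'] by blast
      have "x' = x" using ee by (simp add: x(1) x'(1))
      moreover have "B (square_point x) (\<lambda>i. v i + v' i, \<lambda>i. w i + w' i) = fibre_add F (B (square_point x) (v, w)) (B (square_point x) (v', w'))"
        using bspec[OF bspec[OF bspec[OF add sp[OF x(2)]], of "(v, w)"], of "(v', w')"] x x' by simp
      ultimately show ?thesis by (simp add: \<theta>_def x(1) x'(1))
    qed
    show "\<theta> (fibre_scale ?E k e) = fibre_scale F k (\<theta> e)" if e: "e \<in> over_half ?E" for k e
    proof -
      obtain x v w where x: "e = ((x, v), (x, w))" "x \<in> half_sphere" "v \<in> vecs n" "w \<in> vecs n"
        using half_E[OF e] by blast
      show ?thesis
        using bspec[OF bspec[OF scale sp[OF x(2)]], of "(v, w)"] x by (simp add: \<theta>_def)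
    qed
    show "\<theta> (bundle_act ?E h e) = bundle_act F h (\<theta> e)" if h: "h \<in> H" and e: "e \<in> over_half ?E" for h e
    proof -
      obtain x v w where x: "e = ((x, v), (x, w))" "x \<in> half_sphere" "v \<in> vecs n" "w \<in> vecs n"
        using half_E[OF e] by blast
      show ?thesis
        using bspec[OF bspec[OF bspec[OF H_equi sp[OF x(2)]], of "(v, w)"] h] x r'_H h
        by (simp add: \<theta>_def refl_act_H)
    qed
    show "\<theta> (bundle_act ?E c e) = bundle_act F c (\<theta> e)"
      if e: "e \<in> over_half ?E" and fx: "refl_act c (bundle_proj ?E e) = bundle_proj ?E e" for e
    proof -
      obtain x v w where x: "e = ((x, v), (x, w))" "x \<in> half_sphere" "v \<in> vecs n" "w \<in> vecs n"
        using half_E[OF e] by blast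
      have y: "square_point x \<in> half_square" by (rule sp[OF x(2)])
      have fix_x: "refl_act c x = x" using fx by (simp add: x(1))
      \<comment> \<open>The fixed points of \<open>c\<close> are infinity and the points whose
        second coordinate is 0.\<close>
      have "snd (square_point x) = 0 \<or> square_point x \<in> half_square_sides"
      proof (cases x)
        case None
        then show ?thesis by (auto simp: square_point_def intro: half_square_sidesI)
      next
        case (Some p)
        then show ?thesis using fix_x c(1) by (cases p) (simp add: square_point_def squash_def)
      qed
      then show ?thesis
        using bspec[OF bspec[OF c_equi y], of "(v, w)"] x fix_x by (simp add: \<theta>_def)
    qed
  qed
qed

text \<open>The isomorphism \<open>B\<close> applies the rotated family \<open>X\<close> first, then
  the frame \<open>b\<close> in the summand \<open>E\<close>. On the bottom side this is the
  \<open>G\<close>-frame \<open>a\<close> of \<open>E\<close> next to \<psi>' on the other summand,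
  and \<psi>' commutes with \<open>r'\<close>; so both parts are compatible with \<open>c\<close>.
  On the remaining sides \<open>X\<close> is the identity and \<open>b\<close> is the base frame, so
  \<open>B\<close> is constant there.\<close>

lemma stable_trivial:
  fixes E :: "('a, (real \<times> real) option, 'e) gbundle"
  assumes E: "G_vector_bundle G T sphere2 refl_act E" and r: "lin_rep G T n r"
    and iso: "bundle_iso G (product_bundle (subtopology sphere2 {None}) refl_act n r) (bundle_restrict E {None}) \<theta>0 \<theta>0'"
    and r': "lin_rep G T n r'" and r'_H: "\<forall>h\<in>H. r' h = r h"
    and r'_comm: "\<forall>t. lin_map n n t \<longrightarrow> (\<forall>h\<in>H. \<forall>v\<in>vecs n. t (r h v) = r h (t v)) \<longrightarrow>
      (\<forall>g\<in>carrier G. \<forall>v\<in>vecs n. t (r' g v) = r' g (t v))"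
  shows "bundle_isomorphic G (whitney_sum (product_bundle sphere2 refl_act n r) (product_bundle sphere2 refl_act n r'))
     (whitney_sum E (product_bundle sphere2 refl_act n r'))"
proof -
  let ?P' = "product_bundle sphere2 refl_act n r'"
  let ?F = "whitney_sum E ?P'" and ?V = "prod_topology (complex_space n) (complex_space n)"
  let ?hs = "top_of_set half_square" and ?base = "base_frame \<theta>0"
  obtain b d a \<psi> \<psi>' where cl: "clutched E n r \<theta>0 b d a \<psi> \<psi>'"
    using clutched_exists[OF E r iso] by blast
  have b: "frame ?hs square_map E n b d" and b_equi: "equivariant H half_square E n b r"
    and b_sides: "\<forall>y\<in>half_square_sides. \<forall>v\<in>vecs n. b y v = ?base v"
    and a_equi: "equivariant (carrier G) {-1..1} E n a r"
    and ba: "\<forall>u\<in>{-1..1}. \<forall>v\<in>vecs n. b (u, 0) (\<psi> u v) = a u v"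
    and c\<psi>: "continuous_map (prod_topology (top_of_set {-1..1}) (complex_space n)) (complex_space n) (\<lambda>(u, v). \<psi> u v)"
      "continuous_map (prod_topology (top_of_set {-1..1}) (complex_space n)) (complex_space n) (\<lambda>(u, v). \<psi>' u v)"
    and \<psi>: "\<forall>u\<in>{-1..1::real}. lin_map n n (\<psi> u) \<and> lin_map n n (\<psi>' u) \<and>
      (\<forall>v\<in>vecs n. \<psi> u (\<psi>' u v) = v \<and> \<psi>' u (\<psi> u v) = v \<and>
        (\<forall>h\<in>H. \<psi> u (r h v) = r h (\<psi> u v) \<and> \<psi>' u (r h v) = r h (\<psi>' u v)))"
    and ends: "\<forall>u v. \<bar>u\<bar> = 1 \<longrightarrow> v \<in> vecs n \<longrightarrow> \<psi> u v = v \<and> \<psi>' u v = v"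
    using cl unfolding clutched_def[OF E r iso] by blast+
  obtain X Xi where X: "pair_family n r X" and Xi: "pair_family n r Xi"
    and inv: "\<forall>y\<in>half_square. \<forall>p\<in>vecs n \<times> vecs n. X y (Xi y p) = p \<and> Xi y (X y p) = p"
    and X_sides: "\<forall>y\<in>half_square_sides. \<forall>p\<in>vecs n \<times> vecs n. X y p = p"
    and X_0: "\<forall>u\<in>{-1..1}. \<forall>v\<in>vecs n. \<forall>w\<in>vecs n. X (u, 0) (v, w) = (\<psi> u v, \<psi>' u w)"
    using clutching_rotation[OF r c\<psi> \<psi> ends] by blast
  note X' = pair_familyD[OF X] and Xi' = pair_familyD[OF Xi] and fb = frameD[OF b, simplified]
  define B where "B y p = (b y (fst (X y p)), (square_map y, snd (X y p)))" for y p
  define D where "D y f = Xi y (d y (fst f), snd (snd f))" for y and f :: "'e \<times> (real \<times> real) option \<times> (nat \<Rightarrow> complex)"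
  have base_equi: "bundle_act E g (?base v) = ?base (r g v)" if "g \<in> carrier G" "v \<in> vecs n" for g v
    using base_frame(2)[OF E r iso, of UNIV] that by (simp add: equivariant_def)
  have Xfs: "fst (X y p) \<in> vecs n" "snd (X y p) \<in> vecs n" if "y \<in> half_square" "p \<in> vecs n \<times> vecs n" for y p
    using X'(2)[OF that] by auto
  have sides: "y \<in> half_square \<and> square_map y = None" if "y \<in> half_square_sides" for y
    using that square_map_sides[of y] by (auto simp: half_square_sides_def)
  have F: "G_vector_bundle G T sphere2 refl_act ?F"
    by (intro G_vector_bundle_whitney G_vector_bundle_product G_space_sphere E r')
  have topF: "\<exists>e x v. f = (e, (x, v)) \<and> e \<in> topspace (total_space E) \<and> v \<in> vecs n \<and> bundle_proj E e = x"
    if "f \<in> topspace (total_space ?F)" for f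
    using that by (auto simp: topspace_whitney)
  show ?thesis
  proof (rule half_pair_iso[OF F r r' r'_H, of B D])
    let ?Z = "prod_topology ?hs ?V"
    have q: "continuous_map ?hs sphere2 square_map"
      by (rule continuous_map_from_subtopology[OF continuous_square_map])
    have Xz: "continuous_map ?Z ?V (\<lambda>z. X (fst z) (snd z))"
      using X'(1) by (simp add: case_prod_unfold)
    have Xf: "continuous_map ?Z (complex_space n) (\<lambda>z. fst (X (fst z) (snd z)))"
      and Xs: "continuous_map ?Z (complex_space n) (\<lambda>z. snd (X (fst z) (snd z)))"
      using continuous_map_compose[OF Xz continuous_map_fst] continuous_map_compose[OF Xz continuous_map_snd]
      by (simp_all add: o_def)
    have qz: "continuous_map ?Z sphere2 (\<lambda>z. square_map (fst z))"
      using continuous_map_compose[OF continuous_map_fst q] by (simp add: o_def)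
    have "continuous_map ?Z (total_space ?F)
        (\<lambda>z. (b (fst z) (fst (X (fst z) (snd z))), (square_map (fst z), snd (X (fst z) (snd z)))))"
    proof (rule continuous_map_into_whitney)
      show "continuous_map ?Z (total_space E) (\<lambda>z. b (fst z) (fst (X (fst z) (snd z))))"
        by (rule continuous_map_frame[OF b continuous_map_fst Xf])
      show "continuous_map ?Z (total_space ?P') (\<lambda>z. (square_map (fst z), snd (X (fst z) (snd z))))"
        unfolding product_bundle_simps by (rule continuous_map_pairedI[OF qz Xs])
      show "bundle_proj E (b (fst z) (fst (X (fst z) (snd z)))) = bundle_proj ?P' (square_map (fst z), snd (X (fst z) (snd z)))"
        if z: "z \<in> topspace ?Z" for z
      proof -
        have "fst z \<in> half_square" "snd z \<in> vecs n \<times> vecs n" using z by auto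
        then show ?thesis using fb(3) Xfs(1) by simp
      qed
    qed
    then show "continuous_map ?Z (total_space ?F) (\<lambda>(y, p). B y p)"
      by (simp add: B_def case_prod_unfold)
    let ?W = "subtopology (prod_topology ?hs (total_space ?F)) {(y, f). square_map y = bundle_proj ?F f}"
    have 1: "continuous_map ?W ?hs fst" by (rule continuous_map_from_subtopology[OF continuous_map_fst])
    have 2: "continuous_map ?W (total_space ?F) snd" by (rule continuous_map_from_subtopology[OF continuous_map_snd])
    have 3: "continuous_map ?W (total_space E) (\<lambda>w. fst (snd w))"
      using continuous_map_compose[OF 2 continuous_map_whitney_fst] by (simp add: o_def)
    have "continuous_map ?W (prod_topology sphere2 (complex_space n)) (\<lambda>w. snd (snd w))"
      using continuous_map_compose[OF 2 continuous_map_whitney_snd] by (simp add: o_def)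
    from continuous_map_compose[OF this continuous_map_snd]
    have 4: "continuous_map ?W (complex_space n) (\<lambda>w. snd (snd (snd w)))" by (simp add: o_def)
    have 5: "continuous_map ?W (complex_space n) (\<lambda>w. d (fst w) (fst (snd w)))"
      by (rule continuous_map_coframe[OF b 1 3]) auto
    have "continuous_map ?W ?V (\<lambda>w. Xi (fst w) (d (fst w) (fst (snd w)), snd (snd (snd w))))"
      by (rule continuous_map_family[OF Xi'(1) 1 continuous_map_pairedI[OF 5 4]])
    then show "continuous_map ?W ?V (\<lambda>(y, f). D y f)"
      by (simp add: D_def case_prod_unfold)
    show "\<forall>y\<in>half_square. \<forall>p\<in>vecs n \<times> vecs n. bundle_proj ?F (B y p) = square_map y"
      using fb(3) Xfs(1) by (simp add: B_def)
    show "\<forall>y\<in>half_square. \<forall>p\<in>vecs n \<times> vecs n. D y (B y p) = p"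
      using fb(4) Xfs(1) inv by (simp add: B_def D_def)
    show "\<forall>y\<in>half_square. \<forall>f\<in>topspace (total_space ?F). bundle_proj ?F f = square_map y \<longrightarrow> B y (D y f) = f"
    proof (intro ballI impI)
      fix y f assume y: "y \<in> half_square" and f: "f \<in> topspace (total_space ?F)" and fy: "bundle_proj ?F f = square_map y"
      obtain e x v where x: "f = (e, (x, v))" "e \<in> topspace (total_space E)" "v \<in> vecs n" "bundle_proj E e = x"
        using topF[OF f] by blast
      have pe: "bundle_proj E e = square_map y" using fy by (simp add: x(1))
      have "(d y e, v) \<in> vecs n \<times> vecs n" using fb(9)[OF y x(2) pe] x(3) by simp
      then have "X y (D y f) = (d y e, v)" using inv y by (simp add: D_def x(1))
      then show "B y (D y f) = f" using fb(7)[OF y x(2) pe] pe x(4) by (simp add: B_def x(1))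
    qed
    show "\<forall>y\<in>half_square_sides. \<forall>y'\<in>half_square_sides. \<forall>p\<in>vecs n \<times> vecs n. B y p = B y' p"
      using X_sides b_sides sides by (auto simp: B_def)
    show "\<forall>y\<in>half_square. \<forall>p\<in>vecs n \<times> vecs n. \<forall>q\<in>vecs n \<times> vecs n.
        B y (\<lambda>i. fst p i + fst q i, \<lambda>i. snd p i + snd q i) = fibre_add ?F (B y p) (B y q)"
      by (simp add: B_def X'(3) fb(5) Xfs)
    show "\<forall>y\<in>half_square. \<forall>p\<in>vecs n \<times> vecs n. \<forall>k.
        B y (\<lambda>i. k * fst p i, \<lambda>i. k * snd p i) = fibre_scale ?F k (B y p)"
      by (simp add: B_def X'(4) fb(6) Xfs)
    show "\<forall>y\<in>half_square. \<forall>p\<in>vecs n \<times> vecs n. \<forall>h\<in>H. B y (r h (fst p), r h (snd p)) = bundle_act ?F h (B y p)"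
    proof (intro ballI)
      fix y p h assume y: "y \<in> half_square" and p: "p \<in> vecs n \<times> vecs n" and h: "h \<in> H"
      have "bundle_act E h (b y (fst (X y p))) = b y (r h (fst (X y p)))"
        using b_equi h y Xfs(1)[OF y p] unfolding equivariant_def by blast
      then show "B y (r h (fst p), r h (snd p)) = bundle_act ?F h (B y p)"
        using X'(5)[OF y p h] r'_H h by (simp add: B_def refl_act_H)
    qed
    show "\<forall>y\<in>half_square. \<forall>p\<in>vecs n \<times> vecs n. snd y = 0 \<or> y \<in> half_square_sides \<longrightarrow>
        B y (r c (fst p), r' c (snd p)) = bundle_act ?F c (B y p)"
    proof (intro ballI impI)
      fix y p assume y: "y \<in> half_square" and p: "p \<in> vecs n \<times> vecs n" and s: "snd y = 0 \<or> y \<in> half_square_sides"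
      obtain v w where vw: "p = (v, w)" "v \<in> vecs n" "w \<in> vecs n" using p by blast
      have rv: "r c v \<in> vecs n" "r' c w \<in> vecs n"
        using lin_repD(3)[OF r c(1) vw(2)] lin_repD(3)[OF r' c(1) vw(3)] by simp_all
      show "B y (r c (fst p), r' c (snd p)) = bundle_act ?F c (B y p)"
      proof (cases "y \<in> half_square_sides")
        case True
        then show ?thesis
          using X_sides b_sides sides[OF True] rv vw base_equi[OF c(1) vw(2)] by (simp add: B_def)
      next
        case False
        then obtain u where u: "y = (u, 0)" "u \<in> {-1..1}" using s y by (cases y) (auto simp: half_square_def)
        \<comment> \<open>\<psi>' commutes with \<open>H\<close>, hence under \<open>r'\<close> with
          all of \<open>G\<close>: this is the purpose of the twisted representation.\<close>
        have comm: "\<psi>' u (r' c w) = r' c (\<psi>' u w)"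
        proof -
          have "lin_map n n (\<psi>' u)" "\<forall>h\<in>H. \<forall>v\<in>vecs n. \<psi>' u (r h v) = r h (\<psi>' u v)" using \<psi> u(2) by blast+
          then show ?thesis using r'_comm c(1) vw(3) by blast
        qed
        have "bundle_act E c (a u v) = a u (r c v)"
          using a_equi c(1) vw(2) u(2) unfolding equivariant_def by blast
        moreover have "b y (\<psi> u v) = a u v" "b y (\<psi> u (r c v)) = a u (r c v)"
          using ba u vw(2) rv(1) by simp_all
        moreover have "X y (v, w) = (\<psi> u v, \<psi>' u w)" "X y (r c v, r' c w) = (\<psi> u (r c v), \<psi>' u (r' c w))"
          using X_0 u vw rv by simp_all
        moreover have "refl_act c (square_map y) = square_map y"
          using refl_act_square_map[OF c(1), of u 0] by (simp add: u(1))
        ultimately show ?thesis by (simp add: B_def vw(1) comm)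
      qed
    qed
  qed
qed

end

section \<open>Cancellation\<close>

text \<open>One chart covers the whole point; the action of \<open>G\<close> read in it is the
  representation.\<close>

lemma (in group_with_topology) point_bundle:
  assumes E: "G_vector_bundle G T (subtopology X {x0}) \<alpha> E" and x0: "x0 \<in> topspace X"
    and fixed: "\<And>g. g \<in> carrier G \<Longrightarrow> \<alpha> g x0 = x0"
  shows "\<exists>n r. lin_rep G T n r \<and> bundle_isomorphic G (product_bundle (subtopology X {x0}) \<alpha> n r) E"
proof -
  let ?pt = "subtopology X {x0}"
  note E' = G_vector_bundleD[OF E]
  have top: "topspace ?pt = {x0}" using x0 by auto
  obtain U n \<tau> \<phi> where U: "x0 \<in> U" "vb_chart ?pt E U n \<tau> \<phi>"
    using complex_vector_bundleD(3)[OF E'(1), of x0] x0 by auto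
  note ch = vb_chartD[OF U(2)]
  have U_eq: "U = {x0}" using U(1) ch(2) top by blast
  have pr: "bundle_proj E e = x0" if "e \<in> topspace (total_space E)" for e
    using complex_vector_bundleD(2)[OF E'(1) that] top by simp
  have all: "part_over E U = topspace (total_space E)" using pr U_eq by (auto simp: part_over_def)
  have \<tau>: "continuous_map (prod_topology ?pt (complex_space n)) (total_space E) \<tau>"
    using ch(3) by (simp add: U_eq subtopology_subtopology)
  have \<phi>: "continuous_map (total_space E) (complex_space n) \<phi>"
    using ch(4) by (simp add: all)
  define f where "f v = \<tau> (x0, v)" for v
  have f: "f v \<in> topspace (total_space E)" "\<phi> (f v) = v" if "v \<in> vecs n" for v
    using ch(7,9)[OF U(1) that] by (simp_all add: f_def)
  have f_add: "f (\<lambda>i. v i + w i) = fibre_add E (f v) (f w)" if "v \<in> vecs n" "w \<in> vecs n" for v w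
    using ch(10)[OF U(1) that] by (simp add: f_def)
  have f_scale: "f (\<lambda>i. k * v i) = fibre_scale E k (f v)" if "v \<in> vecs n" for k v
    using ch(11)[OF U(1) that] by (simp add: f_def)
  have \<phi>_f: "f (\<phi> e) = e" "\<phi> e \<in> vecs n" if "e \<in> topspace (total_space E)" for e
    using ch(5,6)[OF that] pr[OF that] U(1) by (simp_all add: f_def)
  have cf: "continuous_map (complex_space n) (total_space E) f"
  proof -
    have "continuous_map (complex_space n) (prod_topology ?pt (complex_space n)) (\<lambda>v. (x0, v))"
      using x0 by (intro continuous_map_pairedI) (auto simp: continuous_map_id[unfolded id_def])
    from continuous_map_compose[OF this \<tau>] show ?thesis by (simp add: o_def f_def[abs_def])
  qed
  define r where "r g v = \<phi> (bundle_act E g (f v))" for g v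
  have act: "bundle_act E g e \<in> topspace (total_space E)" if "g \<in> carrier G" "e \<in> topspace (total_space E)" for g e
    using G_spaceD(4)[OF E'(2)] that topspace_eq by simp
  have fr: "f (r g v) = bundle_act E g (f v)" if "g \<in> carrier G" "v \<in> vecs n" for g v
    using \<phi>_f(1) act f(1) that by (simp add: r_def)
  have r_in: "r g v \<in> vecs n" if "g \<in> carrier G" "v \<in> vecs n" for g v
    using \<phi>_f(2) act f(1) that by (simp add: r_def)
  have rep: "lin_rep G T n r"
    unfolding lin_rep_def G_space_def
  proof (intro conjI ballI)
    let ?Z = "prod_topology T (complex_space n)"
    have "continuous_map ?Z (total_space E) (\<lambda>z. f (snd z))"
      using continuous_map_compose[OF continuous_map_snd cf] by (simp add: o_def)
    from continuous_map_compose[OF continuous_map_action[OF E'(2) continuous_map_fst this] \<phi>]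
    show "continuous_map ?Z (complex_space n) (\<lambda>(g, v). r g v)"
      by (simp add: o_def case_prod_unfold r_def)
    show "r \<one> v = v" if "v \<in> topspace (complex_space n)" for v
      using that f G_spaceD(2)[OF E'(2)] by (simp add: r_def)
    show "r (g \<otimes> h) v = r g (r h v)" if g: "g \<in> carrier G" and h: "h \<in> carrier G" and v: "v \<in> topspace (complex_space n)" for g h v
    proof -
      have v': "v \<in> vecs n" using v by simp
      have "r g (r h v) = \<phi> (bundle_act E g (bundle_act E h (f v)))"
        by (simp only: r_def[of g "r h v"] fr[OF h v'])
      then show ?thesis using G_spaceD(3)[OF E'(2) g h f(1)[OF v']] by (simp add: r_def)
    qed
    fix g assume g: "g \<in> carrier G"
    show "lin_map n n (r g)"
      unfolding lin_map_def
    proof (intro ballI conjI allI)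
      fix v assume v: "v \<in> vecs n"
      show "r g v \<in> vecs n" by (rule r_in[OF g v])
      show "r g (\<lambda>i. v i + w i) = (\<lambda>i. r g v i + r g w i)" if w: "w \<in> vecs n" for w
      proof -
        have "bundle_act E g (f (\<lambda>i. v i + w i)) = fibre_add E (f (r g v)) (f (r g w))"
          using E'(4)[OF g f(1)[OF v] f(1)[OF w]] pr f(1) v w by (simp add: f_add fr g)
        also have "\<dots> = f (\<lambda>i. r g v i + r g w i)" by (rule f_add[symmetric]) (use r_in g v w in auto)
        finally have "r g (\<lambda>i. v i + w i) = \<phi> (f (\<lambda>i. r g v i + r g w i))" by (simp add: r_def[of g "\<lambda>i. v i + w i"])
        then show ?thesis using f(2)[of "\<lambda>i. r g v i + r g w i"] r_in g v w by simp
      qed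
      show "r g (\<lambda>i. k * v i) = (\<lambda>i. k * r g v i)" for k
      proof -
        have "bundle_act E g (f (\<lambda>i. k * v i)) = fibre_scale E k (f (r g v))"
          using E'(5)[OF g f(1)[OF v]] v by (simp add: f_scale fr g)
        also have "\<dots> = f (\<lambda>i. k * r g v i)" by (rule f_scale[symmetric]) (use r_in g v in auto)
        finally have "r g (\<lambda>i. k * v i) = \<phi> (f (\<lambda>i. k * r g v i))" by (simp add: r_def[of g "\<lambda>i. k * v i"])
        then show ?thesis using f(2)[of "\<lambda>i. k * r g v i"] r_in g v by simp
      qed
    qed
  qed
  have "bundle_iso G (product_bundle ?pt \<alpha> n r) E (\<lambda>p. f (snd p)) (\<lambda>e. (x0, \<phi> e))"
  proof (rule bundle_isoI)
    show "continuous_map (total_space (product_bundle ?pt \<alpha> n r)) (total_space E) (\<lambda>p. f (snd p))"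
      using continuous_map_compose[OF continuous_map_snd cf] by (simp add: o_def)
    show "continuous_map (total_space E) (total_space (product_bundle ?pt \<alpha> n r)) (\<lambda>e. (x0, \<phi> e))"
      unfolding product_bundle_simps using x0 by (intro continuous_map_pairedI \<phi>) auto
  qed (auto simp: f \<phi>_f pr f_add f_scale fr fixed)
  then show ?thesis using rep bundle_isomorphicI by blast
qed

lemma restrict_product:
  "bundle_isomorphic G (bundle_restrict (product_bundle X \<alpha> n r) A) (product_bundle (subtopology X A) \<alpha> n r)"
proof (rule bundle_isomorphicI, rule bundle_isoI)
  have eq: "subtopology (prod_topology X (complex_space n)) (part_over (product_bundle X \<alpha> n r) A) =
      prod_topology (subtopology X A) (complex_space n)"
  proof -
    have "part_over (product_bundle X \<alpha> n r) A = topspace (prod_topology X (complex_space n)) \<inter> A \<times> vecs n"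
      by (auto simp: part_over_def)
    then show ?thesis by (simp only: subtopology_restrict prod_topology_subtopology(1) topspace_complex_space)
  qed
  show "continuous_map (total_space (bundle_restrict (product_bundle X \<alpha> n r) A)) (total_space (product_bundle (subtopology X A) \<alpha> n r)) (\<lambda>p. p)"
    "continuous_map (total_space (product_bundle (subtopology X A) \<alpha> n r)) (total_space (bundle_restrict (product_bundle X \<alpha> n r) A)) (\<lambda>p. p)"
    by (simp_all add: eq continuous_map_id[unfolded id_def])
qed (auto simp: part_over_def)

context compact_group_character
begin

text \<open>The bundle \<open>k\<close> over the point at infinity is a representation and therefore
  extends to a product bundle \<open>?S\<close> on the sphere. After adding \<open>?S\<close> the
  two bundles have isomorphic fibres at infinity, so one representation \<open>r\<close> serves
  both, and \<open>stable_trivial\<close> compares each of them with the same product bundle. The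
  complement \<kappa> is a copy of the sum of \<open>?S\<close> and \<open>?P'\<close>.\<close>

lemma stable_iso:
  fixes E F :: "('a, (real \<times> real) option) std_bundle"
  assumes E: "G_vector_bundle G T sphere2 refl_act E" and F: "G_vector_bundle G T sphere2 refl_act F"
    and k: "G_vector_bundle G T (subtopology sphere2 {None}) refl_act k"
    and iso: "bundle_isomorphic G (whitney_sum (bundle_restrict E {None}) k) (whitney_sum (bundle_restrict F {None}) k)"
  shows "\<exists>\<kappa> :: ('a, (real \<times> real) option) std_bundle. G_vector_bundle G T sphere2 refl_act \<kappa> \<and> bundle_isomorphic G (whitney_sum E \<kappa>) (whitney_sum F \<kappa>)"
proof -
  let ?pt = "subtopology sphere2 {None}"
  note trans = bundle_isomorphic_trans and sym = bundle_isomorphic_sym and refl = bundle_isomorphic_refl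
  have inv: "refl_act g x \<in> {None}" if "g \<in> carrier G" "x \<in> {None}" for g x using that by simp
  obtain m \<sigma> where \<sigma>: "lin_rep G T m \<sigma>" "bundle_isomorphic G (product_bundle ?pt refl_act m \<sigma>) k"
    using point_bundle[OF k] by auto
  let ?S = "product_bundle sphere2 refl_act m \<sigma>"
  have S: "G_vector_bundle G T sphere2 refl_act ?S" by (rule G_vector_bundle_product[OF G_space_sphere \<sigma>(1)])
  have Sk: "bundle_isomorphic G (bundle_restrict ?S {None}) k" by (rule trans[OF restrict_product \<sigma>(2)])
  have rest: "bundle_isomorphic G (bundle_restrict (whitney_sum D ?S) {None}) (whitney_sum (bundle_restrict D {None}) k)"
    for D :: "('a, (real \<times> real) option) std_bundle"
    by (rule trans[OF restrict_whitney whitney_cong[OF refl Sk]])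
  note E1 = G_vector_bundle_whitney[OF E S] and F1 = G_vector_bundle_whitney[OF F S]
  have E1r: "G_vector_bundle G T ?pt refl_act (bundle_restrict (whitney_sum E ?S) {None})"
    and F1r: "G_vector_bundle G T ?pt refl_act (bundle_restrict (whitney_sum F ?S) {None})"
    by (rule G_vector_bundle_restrict[OF E1 inv], assumption+, rule G_vector_bundle_restrict[OF F1 inv], assumption+)
  have EF: "bundle_isomorphic G (bundle_restrict (whitney_sum E ?S) {None}) (bundle_restrict (whitney_sum F ?S) {None})"
    by (rule trans[OF trans[OF rest iso] sym[OF rest F1r]])
  obtain n r where r: "lin_rep G T n r"
    "bundle_isomorphic G (product_bundle ?pt refl_act n r) (bundle_restrict (whitney_sum E ?S) {None})"
    using point_bundle[OF E1r] by auto
  obtain \<theta> \<theta>' where \<theta>: "bundle_iso G (product_bundle ?pt refl_act n r) (bundle_restrict (whitney_sum E ?S) {None}) \<theta> \<theta>'"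
    using r(2) unfolding bundle_isomorphic_iff by blast
  obtain \<eta> \<eta>' where \<eta>: "bundle_iso G (product_bundle ?pt refl_act n r) (bundle_restrict (whitney_sum F ?S) {None}) \<eta> \<eta>'"
    using trans[OF r(2) EF] unfolding bundle_isomorphic_iff by blast
  obtain r' where twist: "lin_rep G T n r' \<and> (\<forall>h\<in>H. r' h = r h) \<and>
    (\<forall>t. lin_map n n t \<longrightarrow> (\<forall>h\<in>H. \<forall>v\<in>vecs n. t (r h v) = r h (t v)) \<longrightarrow>
      (\<forall>g\<in>carrier G. \<forall>v\<in>vecs n. t (r' g v) = r' g (t v)))"
    by (rule exE[OF twisted_rep[OF r(1)]])
  note r' = conjunct1[OF twist] conjunct1[OF conjunct2[OF twist]] conjunct2[OF conjunct2[OF twist]]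
  let ?P' = "product_bundle sphere2 refl_act n r'"
  have P: "G_vector_bundle G T sphere2 refl_act (product_bundle sphere2 refl_act n r)"
    and P': "G_vector_bundle G T sphere2 refl_act ?P'"
    by (rule G_vector_bundle_product[OF G_space_sphere r(1)], rule G_vector_bundle_product[OF G_space_sphere r'(1)])
  have st: "bundle_isomorphic G (whitney_sum (whitney_sum E ?S) ?P') (whitney_sum (whitney_sum F ?S) ?P')"
    by (rule trans[OF sym[OF stable_trivial[OF E1 r(1) \<theta> r'] G_vector_bundle_whitney[OF P P']] stable_trivial[OF F1 r(1) \<eta> r']])
  obtain \<kappa> :: "('a, (real \<times> real) option) std_bundle" where \<kappa>: "G_vector_bundle G T sphere2 refl_act \<kappa>"
    "bundle_isomorphic G (whitney_sum ?S ?P') \<kappa>"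
    by (rule sum_model_exists[OF S P'])
  have to_\<kappa>: "bundle_isomorphic G (whitney_sum (whitney_sum D ?S) ?P') (whitney_sum D \<kappa>)"
    for D :: "('a, (real \<times> real) option) std_bundle"
    by (rule trans[OF whitney_assoc whitney_cong[OF refl \<kappa>(2)]])
  have "bundle_isomorphic G (whitney_sum E \<kappa>) (whitney_sum (whitney_sum E ?S) ?P')"
    by (rule sym[OF to_\<kappa> G_vector_bundle_whitney[OF E1 P']])
  from trans[OF trans[OF this st] to_\<kappa>] show ?thesis using \<kappa>(1) by blast
qed

text \<open>In terms of classes, \<open>stable_iso\<close> is the hypothesis \<open>inj\<close> of
  \<open>trivial_grothendieck_kernel\<close>; the rest is the passage from bundles to their classes,
  where sums are replaced by copies over the fixed type.\<close>

lemma trivial_reduced_K_group: "trivial_group (reduced_K_group G T sphere2 refl_act None)"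
proof -
  let ?pt = "subtopology sphere2 {None}"
  let ?M = "vect_monoid G T sphere2 refl_act" and ?N = "vect_monoid G T ?pt refl_act"
  let ?f = "class_restrict G T sphere2 refl_act {None}"
  have inv: "refl_act g x \<in> {None}" if "g \<in> carrier G" "x \<in> {None}" for g x using that by simp
  have pt: "G_space G T ?pt refl_act" by (rule G_space_subtopology[OF G_space_sphere]) auto
  have "trivial_group (grothendieck_group ?M
     \<lparr>carrier := kernel (grothendieck_group ?M) (grothendieck_group ?N) (grothendieck_map ?N ?f)\<rparr>)"
  proof (rule trivial_grothendieck_kernel)
    show "comm_monoid ?M" by (rule comm_monoid_vect_monoid[OF G_space_sphere])
    show "comm_monoid ?N" by (rule comm_monoid_vect_monoid[OF pt])
    show "?f \<in> hom ?M ?N" by (rule class_restrict_hom(1)[OF G_space_sphere inv])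
    show "?f \<one>\<^bsub>?M\<^esub> = \<one>\<^bsub>?N\<^esub>" by (rule class_restrict_hom(2)[OF G_space_sphere inv])
    fix a b k' assume "a \<in> carrier ?M" "b \<in> carrier ?M" "k' \<in> carrier ?N" and eq: "?f a \<otimes>\<^bsub>?N\<^esub> k' = ?f b \<otimes>\<^bsub>?N\<^esub> k'"
    then obtain E F k where E: "G_vector_bundle G T sphere2 refl_act E" "a = bundle_class sphere2 refl_act E"
      and F: "G_vector_bundle G T sphere2 refl_act F" "b = bundle_class sphere2 refl_act F"
      and k: "G_vector_bundle G T ?pt refl_act k" "k' = bundle_class ?pt refl_act k"
      by (auto simp: carrier_vect_monoid)
    have Er: "G_vector_bundle G T ?pt refl_act (bundle_restrict E {None})"
      by (rule G_vector_bundle_restrict[OF E(1) inv])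
    have Fr: "G_vector_bundle G T ?pt refl_act (bundle_restrict F {None})"
      by (rule G_vector_bundle_restrict[OF F(1) inv])
    obtain A :: "('a, (real \<times> real) option) std_bundle" where A: "G_vector_bundle G T ?pt refl_act A"
      "bundle_isomorphic G (whitney_sum (bundle_restrict E {None}) k) A"
      by (rule sum_model_exists[OF Er k(1)])
    obtain B :: "('a, (real \<times> real) option) std_bundle" where B: "G_vector_bundle G T ?pt refl_act B"
      "bundle_isomorphic G (whitney_sum (bundle_restrict F {None}) k) B"
      by (rule sum_model_exists[OF Fr k(1)])
    have fa: "?f a = bundle_class ?pt refl_act (bundle_restrict E {None})"
      unfolding E(2) by (rule class_restrict_eq[OF E(1) inv])
    have fb: "?f b = bundle_class ?pt refl_act (bundle_restrict F {None})"
      unfolding F(2) by (rule class_restrict_eq[OF F(1) inv])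
    have "bundle_class ?pt refl_act A = bundle_class ?pt refl_act B"
      using eq unfolding fa fb k(2) mult_vect_monoid[OF Er k(1) A(2)] mult_vect_monoid[OF Fr k(1) B(2)] .
    then have "bundle_isomorphic G A B" using bundle_class_eq_iff[OF A(1) B(1)] by blast
    from bundle_isomorphic_trans[OF bundle_isomorphic_trans[OF A(2) this]
        bundle_isomorphic_sym[OF B(2) G_vector_bundle_whitney[OF Fr k(1)]]]
    obtain \<kappa> :: "('a, (real \<times> real) option) std_bundle" where \<kappa>: "G_vector_bundle G T sphere2 refl_act \<kappa>" "bundle_isomorphic G (whitney_sum E \<kappa>) (whitney_sum F \<kappa>)"
      using stable_iso[OF E(1) F(1) k(1)] by blast
    obtain D :: "('a, (real \<times> real) option) std_bundle" where D: "G_vector_bundle G T sphere2 refl_act D"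
      "bundle_isomorphic G (whitney_sum F \<kappa>) D"
      by (rule sum_model_exists[OF F(1) \<kappa>(1)])
    have "a \<otimes>\<^bsub>?M\<^esub> bundle_class sphere2 refl_act \<kappa> = bundle_class sphere2 refl_act D"
      unfolding E(2) by (rule mult_vect_monoid[OF E(1) \<kappa>(1) bundle_isomorphic_trans[OF \<kappa>(2) D(2)]])
    moreover have "b \<otimes>\<^bsub>?M\<^esub> bundle_class sphere2 refl_act \<kappa> = bundle_class sphere2 refl_act D"
      unfolding F(2) by (rule mult_vect_monoid[OF F(1) \<kappa>(1) D(2)])
    moreover have "bundle_class sphere2 refl_act \<kappa> \<in> carrier ?M"
      using \<kappa>(1) by (auto simp: carrier_vect_monoid)
    ultimately show "\<exists>l\<in>carrier ?M. a \<otimes>\<^bsub>?M\<^esub> l = b \<otimes>\<^bsub>?M\<^esub> l" by (intro bexI) simp_all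
  qed
  then show ?thesis by (simp only: reduced_K_group_def K_group_def K_restrict_def)
qed

end

theorem corollary1p2:
  fixes G :: "('g, 'r) monoid_scheme"
    and T :: "'g topology"
    and n :: nat
    and A :: "'g chart set"
    and lam :: "'g \<Rightarrow> real"
    and H :: "'g set"
  assumes "lie_group G T n A"
    and "compact_space T"
    and "lam \<in> hom G O1"
    and "continuous_map T (top_of_set (carrier O1)) lam"
    and "lam ` carrier G = carrier O1"
    and "H = kernel G O1 lam"
    and "\<exists>c \<in> carrier G - H. \<forall>h\<in>H. c \<otimes>\<^bsub>G\<^esub> h = h \<otimes>\<^bsub>G\<^esub> c"
  shows "trivial_group
           (reduced_K_group G T (sphere_space :: (real \<times> real) option topology)
              (sphere_act (one_plus lam)) None)"
proof -
  interpret group G using assms(1) by (simp add: lie_group_def)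
  obtain c where c: "c \<in> carrier G" "c \<notin> H" "\<forall>h\<in>H. c \<otimes>\<^bsub>G\<^esub> h = h \<otimes>\<^bsub>G\<^esub> c"
    using assms(7) by blast
  interpret compact_group_character G T lam H c
    by unfold_locales (use assms(1-4,6) c in \<open>simp_all add: lie_group_def smooth_map_def\<close>)
  show ?thesis by (rule trivial_reduced_K_group)
qed


end
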